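(* Fix $r>0$ and let $f\in \mathbf{L}^2(\Omega)$, $g\in L^2(\Omega)$, $u_\Gamma\in\mathbf{H}^{1/2}(\Gamma)$, $r_\Gamma\in H^{-1/2}(\Gamma)$ be such that $$\frac{\tilde\gamma_1^*}{r}\max\{\tilde\gamma_1^*\kappa_2 r,1\}\,\big(\|g\|_{0,\Omega}+\|r_\Gamma\|_{-1/2,\Gamma}+\|u_\Gamma\|_{1/2,\Gamma}+\|f\|_{0,\Omega}\big)<1 .$$ Then the operator $\widetilde{\mathcal{J}}_h$ has a unique fixed point $\underline{d}_h\in\widetilde{\mathbf{W}}_h$. Equivalently, the discrete problem ($\widetilde{\mathrm P}_h$) has a unique solution $((\underline{d}_h,\sigma_h),\underline{u}_h)\in(\widetilde{\mathbf{X}}_h\times\widetilde{\mathbf{Y}}_h)\times\widetilde{\mathbf{Z}}_h$ with $\underline{d}_h\in\widetilde{\mathbf{W}}_h$. In addition, there exists $\widetilde C^*>0$ such that $$\|((\underline{d}_h,\sigma_h),\underline{u}_h)\|\le \widetilde C^*\big(\|g\|_{0,\Omega}+\|r_\Gamma\|_{-1/2,\Gamma}+\|u_\Gamma\|_{1/2,\Gamma}+\|f\|_{0,\Omega}\big).$$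
   Context: Setting. $\Omega\subset\mathbb{R}^n$, $n\in\{2,3\}$, is an open bounded domain with Lipschitz boundary $\Gamma$ and unit outward normal $\boldsymbol{n}$, such that $\overline\Omega$ admits a regular partition $\mathcal{T}_h$ into triangles ($n=2$) or tetrahedra ($n=3$) $K$ of diameter $h_K$, $h:=\max_K h_K$. Bold spaces $\mathbf{L}^2,\mathbf{H}^m$ are vector-valued, blackboard ones tensor-valued ($n\times n$); $\|\cdot\|_{m,\Omega}$ is the $H^m(\Omega)$ norm ($H^0=L^2$). $\mathbb{I}$ is the identity tensor; $\mathbf{div}$ of a tensor is the row-wise divergence; $\langle\cdot,\cdot\rangle_\Gamma$ is the duality between $H^{-1/2}(\Gamma)$ and $H^{1/2}(\Gamma)$ (also vector-valued). Parameters: constants $\lambda,\mu>0$, $0\le\alpha\le1$, $c_0>0$; $\mathcal{C}d:=\lambda(\operatorname{tr}d)\mathbb{I}+2\mu d$. Spaces: $\widetilde{\mathbf{X}}:=\mathbb{L}^2(\Omega)\times H^1(\Omega)$, $\widetilde{\mathbf{Y}}:=\mathbb{H}(\mathbf{div};\Omega)=\{\tau\in\mathbb{L}^2(\Omega):\mathbf{div}\,\tau\in\mathbf{L}^2(\Omega)\}$, $\widetilde{\mathbf{Z}}:=\mathbf{L}^2(\Omega)\times\mathbb{L}^2_{\rm skew}(\Omega)$, with $\mathbb{L}^2_{\rm skew}(\Omega)$ the skew-symmetric tensors in $\mathbb{L}^2(\Omega)$. Elements are written $\underline{d}=(d,p)$, $\underline{e}=(e,q)$, $\underline{w}=(w,s)\in\widetilde{\mathbf{X}}$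 and $\underline{u}=(u,\gamma)$, $\underline{v}=(v,\eta)\in\widetilde{\mathbf{Z}}$. Norms: $\|\underline{e}\|_{\widetilde{\mathbf{X}}}^2=\|e\|_{0,\Omega}^2+\|q\|_{1,\Omega}^2$, $\|\tau\|_{\widetilde{\mathbf{Y}}}^2=\|\tau\|_{0,\Omega}^2+\|\mathbf{div}\,\tau\|_{0,\Omega}^2$, $\|\underline{v}\|_{\widetilde{\mathbf{Z}}}^2=\|v\|_{0,\Omega}^2+\|\eta\|_{0,\Omega}^2$; product spaces carry the Euclidean combination of norms. Permeability: $\kappa$ assigns to each $(d,p)$ an $n\times n$ tensor $\kappa(d,p)\in\mathbb{L}^\infty(\Omega)$, and there are constants $\kappa_1,\kappa_2>0$ with $\kappa_1|v|^2\le v^{t}\kappa(\cdot,\cdot)v$ for all $v\in\mathbb{R}^n\setminus\{0\}$ (for all arguments, a.e. in $\Omega$) and $\|\kappa(\cdot,p_1)-\kappa(\cdot,p_2)\|_{\mathbb{L}^\infty(\Omega)}\le\kappa_2\|p_1-p_2\|_{1,\Omega}$ for all $p_1,p_2\in H^1(\Omega)$, where each dot stands for an arbitrary (possibly different) first argument. Forms: for $\underline{w}\in\widetilde{\mathbf{X}}$, $$\tilde a_{\underline{w}}(\underline{d},\underline{e}):=\int_\Omega\mathcal{C}d:e+\int_\Omega\kappa(\underline{w})\nabla p\cdot\nabla q+c_0\int_\Omega pq+\alpha\int_\Omega q\operatorname{tr}d-\alpha\int_\Omega p\operatorname{tr}e,$$ $\tilde a(\underline{d},\underline{e}):=\tilde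 a_{\underline{d}}(\underline{d},\underline{e})$, $\tilde b_1(\underline{e},\tau):=-\int_\Omega\tau:e$, $\tilde b_2((\underline{e},\tau),\underline{v}):=-\int_\Omega v\cdot\mathbf{div}\,\tau-\int_\Omega\tau:\eta$. Functionals: $\widetilde G(\underline{e}):=\int_\Omega gq+\langle r_\Gamma,q\rangle_\Gamma$, $\widetilde H(\tau):=-\langle\tau\boldsymbol{n},u_\Gamma\rangle_\Gamma$, $\widetilde F(\underline{v}):=\int_\Omega f\cdot v$. Discrete spaces (PEERS-based), for an integer $k\ge0$ ($\mathrm{P}_\ell(K)$, $\mathbf{P}_\ell(K)$, $\mathbb{P}_\ell(K)$: scalar, vector, tensor polynomials of degree $\le\ell$ on $K$). $\mathbf{RT}_k(K):=\mathbf{P}_k(K)\oplus\mathrm{P}_k(K)\boldsymbol{x}$, and $\mathbb{RT}_k(K)$ are the tensors with rows in $\mathbf{RT}_k(K)$. $b_K$ is the (suitably normalised) polynomial bubble on $K$ vanishing on $\partial K$ (product of the barycentric coordinates); $\mathbf{B}_k(K):=\mathbf{curl}^{t}(b_K\mathrm{P}_k(K))$ if $n=2$, and $\nabla\times(b_K\mathbf{P}_k(K))$ if $n=3$; $[\mathbf{B}_k(K)]^n$ are the tensors with rows in $\mathbf{B}_k(K)$. $\widetilde{\mathbf{X}}_{1,h}:=\{e_h\in\mathbb{L}^2(\Omega):e_h|_K\in\mathbb{P}_k(K)\oplus[\mathbf{B}_k(K)]^n\ \forall K\in\mathcal{T}_h\}$; $\mathbf{X}_{2,h}:=\{q_h\in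 C(\overline\Omega):q_h|_K\in\mathrm{P}_{k+1}(K)\ \forall K\}$; $\widetilde{\mathbf{X}}_h:=\widetilde{\mathbf{X}}_{1,h}\times\mathbf{X}_{2,h}$; $\widetilde{\mathbf{Y}}_h:=\{\tau_h\in\mathbb{H}(\mathbf{div};\Omega):\tau_h|_K\in\mathbb{RT}_k(K)\oplus[\mathbf{B}_k(K)]^n\ \forall K\}$; $\widetilde{\mathbf{Z}}_{1,h}:=\{v_h\in\mathbf{L}^2(\Omega):v_h|_K\in\mathbf{P}_k(K)\ \forall K\}$; $\widetilde{\mathbf{Z}}_{2,h}:=\{\eta_h\in\mathbb{L}^2_{\rm skew}(\Omega):\eta_h \text{ continuous on }\overline\Omega,\ \eta_h|_K\in\mathbb{P}_{k+1}(K)\ \forall K\}$; $\widetilde{\mathbf{Z}}_h:=\widetilde{\mathbf{Z}}_{1,h}\times\widetilde{\mathbf{Z}}_{2,h}$. Problem ($\widetilde{\mathrm P}_h$): find $((\underline{d}_h,\sigma_h),\underline{u}_h)\in(\widetilde{\mathbf{X}}_h\times\widetilde{\mathbf{Y}}_h)\times\widetilde{\mathbf{Z}}_h$ such that for all $((\underline{e}_h,\tau_h),\underline{v}_h)\in(\widetilde{\mathbf{X}}_h\times\widetilde{\mathbf{Y}}_h)\times\widetilde{\mathbf{Z}}_h$: $\tilde a(\underline{d}_h,\underline{e}_h)+\tilde b_1(\underline{e}_h,\sigma_h)=\widetilde G(\underline{e}_h)$, $\;\tilde b_1(\underline{d}_h,\tau_h)+\tilde b_2((\underline{e}_h,\tau_h),\underline{u}_h)=\widetilde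 H(\tau_h)$, $\;\tilde b_2((\underline{d}_h,\sigma_h),\underline{v}_h)=\widetilde F(\underline{v}_h)$. Linearised discrete problem ($\widetilde{\mathrm P}_{h,\underline{w}_h}$): the same with $\tilde a$ replaced by $\tilde a_{\underline{w}_h}$. $\widetilde{\mathbf{W}}_h:=\{\underline{w}_h\in\widetilde{\mathbf{X}}_h:\|\underline{w}_h\|_{\widetilde{\mathbf{X}}}\le r\}$, and $\widetilde{\mathcal{J}}_h:\widetilde{\mathbf{W}}_h\to\widetilde{\mathbf{X}}_h$ maps $\underline{w}_h$ to the first component $\underline{d}_h$ of the solution of ($\widetilde{\mathrm P}_{h,\underline{w}_h}$). Constants: $\tilde\beta_2^*>0$ is a constant such that $\sup_{0\ne(\underline{e}_h,\tau_h)\in\widetilde{\mathbf{X}}_h\times\widetilde{\mathbf{Y}}_h}\frac{\tilde b_2((\underline{e}_h,\tau_h),\underline{v}_h)}{\|(\underline{e}_h,\tau_h)\|_{\widetilde{\mathbf{X}}\times\widetilde{\mathbf{Y}}}}\ge\tilde\beta_2^*\|\underline{v}_h\|_{\widetilde{\mathbf{Z}}}$ for all $\underline{v}_h\in\widetilde{\mathbf{Z}}_h$; $C_a:=\max\{2\mu+n\lambda,c_0,n\alpha,\kappa_2r\}$, $c_a:=\min\{\kappa_1,2\mu,c_0\}$, $$\gamma_2:=\frac{(C_a+2)(c_a+1+C_a)}{c_a},\qquad\tilde\gamma_1^*:=\frac{(C_a+1+\tilde\beta_2^*+\gamma_2)^2}{(\tilde\beta_2^* )^2\gamma_2}.$$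 *)

theory Defs
  imports "HOL-Analysis.Analysis" "HOL-Probability.Essential_Supremum"
begin

text \<open>
  Elements of Lebesgue and Sobolev spaces are represented by functions on the whole of
  \<open>real ^ 'n\<close>; only their values on the domain matter, and elements of the spaces are identified
  when they agree almost everywhere there. Tensors are matrices \<open>real ^ 'n ^ 'n\<close>; the library
  inner product and norm on them are the Frobenius ones.
  The order on the index type \<open>'n\<close> serves only to number the coordinate axes for the curl;
  the library types \<open>2\<close> and \<open>3\<close> are instances.
\<close>

type_synonym 'n scal = "real ^ 'n \<Rightarrow> real"
type_synonym 'n vect = "real ^ 'n \<Rightarrow> real ^ 'n"
type_synonym 'n tens = "real ^ 'n \<Rightarrow> real ^ 'n ^ 'n"
type_synonym 'n xel = "'n tens \<times> 'n scal"
type_synonym 'n zel = "'n vect \<times> 'n tens"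


section \<open>Domain and mesh\<close>

definition lipschitz_domain :: "(real ^ 'n) set \<Rightarrow> bool" where
  "lipschitz_domain Om \<longleftrightarrow>
     open Om \<and> connected Om \<and> bounded Om \<and> Om \<noteq> {} \<and>
     (\<forall>x\<in>frontier Om. \<exists>\<nu> \<rho> L \<psi>. norm \<nu> = 1 \<and> 0 < \<rho> \<and> L-lipschitz_on {z. z \<bullet> \<nu> = 0} \<psi> \<and>
        Om \<inter> ball x \<rho> = {y \<in> ball x \<rho>. \<psi> (y - (y \<bullet> \<nu>) *\<^sub>R \<nu>) < y \<bullet> \<nu>})"

definition is_mesh :: "(real ^ 'n) set \<Rightarrow> (real ^ 'n) set set \<Rightarrow> bool" where
  "is_mesh Om T \<longleftrightarrow>
     triangulation T \<and> (\<forall>K\<in>T. int CARD('n) simplex K) \<and> \<Union>T = closure Om"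


section \<open>Function spaces on the domain\<close>

definition L2 :: "(real ^ 'n) set \<Rightarrow> (real ^ 'n \<Rightarrow> 'b::euclidean_space) set" where
  "L2 Om = {f. f \<in> borel_measurable (lebesgue_on Om) \<and>
               integrable (lebesgue_on Om) (\<lambda>x. (norm (f x))\<^sup>2)}"

definition norm_L2 :: "(real ^ 'n) set \<Rightarrow> (real ^ 'n \<Rightarrow> 'b::euclidean_space) \<Rightarrow> real" where
  "norm_L2 Om f = sqrt (LINT x|lebesgue_on Om. (norm (f x))\<^sup>2)"

definition norm_Linf :: "(real ^ 'n) set \<Rightarrow> (real ^ 'n \<Rightarrow> 'b::euclidean_space) \<Rightarrow> ereal" where
  "norm_Linf Om f = esssup (lebesgue_on Om) (\<lambda>x. ereal (norm (f x)))"

definition Linf :: "(real ^ 'n) set \<Rightarrow> (real ^ 'n \<Rightarrow> 'b::euclidean_space) set" where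
  "Linf Om = {f. f \<in> borel_measurable (lebesgue_on Om) \<and> norm_Linf Om f < \<infinity>}"

definition pd :: "'n::finite \<Rightarrow> 'n scal \<Rightarrow> 'n scal" where
  "pd i \<phi> x = frechet_derivative \<phi> (at x) (axis i 1)"

primrec Cn :: "nat \<Rightarrow> 'n::finite scal \<Rightarrow> bool" where
  "Cn 0 \<phi> = continuous_on UNIV \<phi>"
| "Cn (Suc m) \<phi> = ((\<forall>x. \<phi> differentiable (at x)) \<and> (\<forall>i. Cn m (pd i \<phi>)))"

definition test_fun :: "(real ^ 'n) set \<Rightarrow> 'n scal \<Rightarrow> bool" where
  "test_fun Om \<phi> \<longleftrightarrow> (\<forall>m. Cn m \<phi>) \<and>
     compact (closure {x. \<phi> x \<noteq> 0}) \<and> closure {x. \<phi> x \<noteq> 0} \<subseteq> Om"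

definition is_weak_grad :: "(real ^ 'n) set \<Rightarrow> 'n scal \<Rightarrow> 'n vect \<Rightarrow> bool" where
  "is_weak_grad Om p G \<longleftrightarrow> (\<forall>\<phi> i. test_fun Om \<phi> \<longrightarrow>
     (LINT x|lebesgue_on Om. p x * pd i \<phi> x) = - (LINT x|lebesgue_on Om. G x $ i * \<phi> x))"

definition H1 :: "(real ^ 'n) set \<Rightarrow> 'n scal set" where
  "H1 Om = {p \<in> L2 Om. \<exists>G\<in>L2 Om. is_weak_grad Om p G}"

definition wgrad :: "(real ^ 'n) set \<Rightarrow> 'n scal \<Rightarrow> 'n vect" where
  "wgrad Om p = (SOME G. G \<in> L2 Om \<and> is_weak_grad Om p G)"

definition norm_H1 :: "(real ^ 'n) set \<Rightarrow> 'n scal \<Rightarrow> real" where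
  "norm_H1 Om p = sqrt ((norm_L2 Om p)\<^sup>2 + (norm_L2 Om (wgrad Om p))\<^sup>2)"

definition is_weak_div :: "(real ^ 'n) set \<Rightarrow> 'n vect \<Rightarrow> 'n scal \<Rightarrow> bool" where
  "is_weak_div Om s D \<longleftrightarrow> (\<forall>\<phi>. test_fun Om \<phi> \<longrightarrow>
     (LINT x|lebesgue_on Om. (\<Sum>j\<in>UNIV. s x $ j * pd j \<phi> x)) =
     - (LINT x|lebesgue_on Om. D x * \<phi> x))"

definition wdiv :: "(real ^ 'n) set \<Rightarrow> 'n vect \<Rightarrow> 'n scal" where
  "wdiv Om s = (SOME D. D \<in> L2 Om \<and> is_weak_div Om s D)"

abbreviation trow :: "'n::finite tens \<Rightarrow> 'n \<Rightarrow> 'n vect" where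
  "trow \<tau> i \<equiv> \<lambda>x. \<tau> x $ i"

definition tdiv :: "(real ^ 'n) set \<Rightarrow> 'n tens \<Rightarrow> 'n vect" where
  "tdiv Om \<tau> x = (\<chi> i. wdiv Om (trow \<tau> i) x)"

definition Hdiv :: "(real ^ 'n) set \<Rightarrow> 'n tens set" where
  "Hdiv Om = {\<tau> \<in> L2 Om. \<forall>i. \<exists>D\<in>L2 Om. is_weak_div Om (trow \<tau> i) D}"

definition L2skew :: "(real ^ 'n) set \<Rightarrow> 'n tens set" where
  "L2skew Om = {\<eta> \<in> L2 Om. AE x in lebesgue_on Om. transpose (\<eta> x) = - \<eta> x}"


section \<open>Boundary spaces\<close>

text \<open>
  The surface measure is the Hausdorff measure of dimension \<open>n - 1\<close>, normalised so that it
  agrees with the Lebesgue measure on flat pieces, restricted to the boundary. Covers are by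
  bounded sets because the library \<open>diameter\<close> of an unbounded set is meaningless.
\<close>

definition hausdorff_outer :: "nat \<Rightarrow> 'a::euclidean_space set \<Rightarrow> ennreal" where
  "hausdorff_outer s A =
     (SUP \<delta>\<in>{0::real<..}. INF U\<in>{U :: nat \<Rightarrow> 'a set.
          A \<subseteq> (\<Union>i. U i) \<and> (\<forall>i. bounded (U i) \<and> diameter (U i) \<le> \<delta>)}.
        (\<Sum>i. ennreal (unit_ball_vol (real s) * (diameter (U i) / 2) ^ s)))"

definition surface :: "(real ^ 'n) set \<Rightarrow> (real ^ 'n) measure" where
  "surface Om =
     restrict_space (measure_of UNIV (sets borel) (hausdorff_outer (CARD('n) - 1))) (frontier Om)"

text \<open>
  \<open>is_trace Om v g\<close>: the boundary function \<open>g\<close> is the trace of \<open>v \<in> H1 Om\<close>. The trace operator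
  is the continuous extension, from \<open>H1\<close> to \<open>L2\<close> of the boundary, of the restriction map
  on functions in \<open>H1\<close> that are continuous up to the boundary.
\<close>

definition is_trace :: "(real ^ 'n) set \<Rightarrow> 'n scal \<Rightarrow> 'n scal \<Rightarrow> bool" where
  "is_trace Om v g \<longleftrightarrow> v \<in> H1 Om \<and> g \<in> borel_measurable (surface Om) \<and>
     (\<exists>\<phi>. (\<forall>m. \<phi> m \<in> H1 Om \<and> continuous_on (closure Om) (\<phi> m)) \<and>
          (\<lambda>m. norm_H1 Om (\<lambda>x. \<phi> m x - v x)) \<longlonglongrightarrow> 0 \<and>
          (\<lambda>m. \<integral>\<^sup>+x. ennreal ((\<phi> m x - g x)\<^sup>2) \<partial>surface Om) \<longlonglongrightarrow> 0)"

definition btrace :: "(real ^ 'n) set \<Rightarrow> 'n scal \<Rightarrow> 'n scal" where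
  "btrace Om v = (SOME g. is_trace Om v g)"

text \<open>The space of traces of \<open>H1\<close> functions, with the quotient norm.\<close>

definition H12 :: "(real ^ 'n) set \<Rightarrow> 'n scal set" where
  "H12 Om = {g. \<exists>v. is_trace Om v g}"

definition norm_H12 :: "(real ^ 'n) set \<Rightarrow> 'n scal \<Rightarrow> real" where
  "norm_H12 Om g = Inf {norm_H1 Om v | v. is_trace Om v g}"

definition H12v :: "(real ^ 'n) set \<Rightarrow> 'n vect set" where
  "H12v Om = {g. \<forall>i. (\<lambda>x. g x $ i) \<in> H12 Om}"

definition norm_H12v :: "(real ^ 'n) set \<Rightarrow> 'n vect \<Rightarrow> real" where
  "norm_H12v Om g = sqrt (\<Sum>i\<in>UNIV. (norm_H12 Om (\<lambda>x. g x $ i))\<^sup>2)"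

text \<open>Its dual space, with the operator norm; the duality pairing is application.\<close>

definition Hm12 :: "(real ^ 'n) set \<Rightarrow> ('n scal \<Rightarrow> real) set" where
  "Hm12 Om = {r. (\<forall>g\<in>H12 Om. \<forall>h\<in>H12 Om. r (\<lambda>x. g x + h x) = r g + r h) \<and>
                 (\<forall>c. \<forall>g\<in>H12 Om. r (\<lambda>x. c * g x) = c * r g) \<and>
                 (\<exists>C. \<forall>g\<in>H12 Om. \<bar>r g\<bar> \<le> C * norm_H12 Om g)}"

definition norm_Hm12 :: "(real ^ 'n) set \<Rightarrow> ('n scal \<Rightarrow> real) \<Rightarrow> real" where
  "norm_Hm12 Om r = Inf {C. 0 \<le> C \<and> (\<forall>g\<in>H12 Om. \<bar>r g\<bar> \<le> C * norm_H12 Om g)}"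

text \<open>
  The normal trace of a field \<open>s\<close> with square integrable divergence is the functional defined by
  Green's formula, \<open>g \<mapsto> \<integral> s \<bullet> \<nabla>v + \<integral> v div s\<close> with \<open>v\<close> any function in \<open>H1\<close> of trace \<open>g\<close>.
  On a Lipschitz domain the value does not depend on \<open>v\<close>; for definiteness the (existing and
  unique) lifting of least \<open>H1\<close> norm is taken.
\<close>

definition lifting :: "(real ^ 'n) set \<Rightarrow> 'n scal \<Rightarrow> 'n scal" where
  "lifting Om g = arg_min (norm_H1 Om) (\<lambda>v. is_trace Om v g)"

definition normal_dual :: "(real ^ 'n) set \<Rightarrow> 'n vect \<Rightarrow> 'n scal \<Rightarrow> real" where
  "normal_dual Om s g =
     (LINT x|lebesgue_on Om. s x \<bullet> wgrad Om (lifting Om g) x) +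
     (LINT x|lebesgue_on Om. lifting Om g x * wdiv Om s x)"

definition normal_dualv :: "(real ^ 'n) set \<Rightarrow> 'n tens \<Rightarrow> 'n vect \<Rightarrow> real" where
  "normal_dualv Om \<tau> g = (\<Sum>i\<in>UNIV. normal_dual Om (trow \<tau> i) (\<lambda>x. g x $ i))"


section \<open>Norms of the product spaces\<close>

definition Xsp :: "(real ^ 'n) set \<Rightarrow> 'n xel set" where
  "Xsp Om = L2 Om \<times> H1 Om"

definition norm_X :: "(real ^ 'n) set \<Rightarrow> 'n xel \<Rightarrow> real" where
  "norm_X Om = (\<lambda>(e, q). sqrt ((norm_L2 Om e)\<^sup>2 + (norm_H1 Om q)\<^sup>2))"

definition norm_Y :: "(real ^ 'n) set \<Rightarrow> 'n tens \<Rightarrow> real" where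
  "norm_Y Om \<tau> = sqrt ((norm_L2 Om \<tau>)\<^sup>2 + (norm_L2 Om (tdiv Om \<tau>))\<^sup>2)"

definition norm_Z :: "(real ^ 'n) set \<Rightarrow> 'n zel \<Rightarrow> real" where
  "norm_Z Om = (\<lambda>(v, \<eta>). sqrt ((norm_L2 Om v)\<^sup>2 + (norm_L2 Om \<eta>)\<^sup>2))"

definition norm_XY :: "(real ^ 'n) set \<Rightarrow> 'n xel \<times> 'n tens \<Rightarrow> real" where
  "norm_XY Om = (\<lambda>(e, \<tau>). sqrt ((norm_X Om e)\<^sup>2 + (norm_Y Om \<tau>)\<^sup>2))"

definition norm_XYZ :: "(real ^ 'n) set \<Rightarrow> ('n xel \<times> 'n tens) \<times> 'n zel \<Rightarrow> real" where
  "norm_XYZ Om = (\<lambda>(y, v). sqrt ((norm_XY Om y)\<^sup>2 + (norm_Z Om v)\<^sup>2))"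

definition eq_on :: "(real ^ 'n) set \<Rightarrow> (real ^ 'n \<Rightarrow> 'b) \<Rightarrow> (real ^ 'n \<Rightarrow> 'b) \<Rightarrow> bool" where
  "eq_on Om f g \<longleftrightarrow> (AE x in lebesgue_on Om. f x = g x)"

definition eq_pair :: "(real ^ 'n) set \<Rightarrow> (real ^ 'n \<Rightarrow> 'b) \<times> (real ^ 'n \<Rightarrow> 'c)
    \<Rightarrow> (real ^ 'n \<Rightarrow> 'b) \<times> (real ^ 'n \<Rightarrow> 'c) \<Rightarrow> bool" where
  "eq_pair Om a b \<longleftrightarrow> eq_on Om (fst a) (fst b) \<and> eq_on Om (snd a) (snd b)"


section \<open>Permeability, forms and functionals\<close>

definition permeability ::
  "(real ^ 'n) set \<Rightarrow> ('n xel \<Rightarrow> 'n tens) \<Rightarrow> real \<Rightarrow> real \<Rightarrow> bool" where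
  "permeability Om kap k1 k2 \<longleftrightarrow>
     (\<forall>w\<in>Xsp Om. kap w \<in> Linf Om) \<and>
     (\<forall>w\<in>Xsp Om. AE x in lebesgue_on Om.
        \<forall>v. v \<noteq> 0 \<longrightarrow> k1 * (norm v)\<^sup>2 \<le> v \<bullet> (kap w x *v v)) \<and>
     (\<forall>d1\<in>L2 Om. \<forall>d2\<in>L2 Om. \<forall>p1\<in>H1 Om. \<forall>p2\<in>H1 Om.
        norm_Linf Om (\<lambda>x. kap (d1, p1) x - kap (d2, p2) x)
          \<le> ereal (k2 * norm_H1 Om (\<lambda>x. p1 x - p2 x)))"

definition hooke :: "real \<Rightarrow> real \<Rightarrow> real ^ 'n ^ 'n \<Rightarrow> real ^ 'n ^ 'n" where
  "hooke lam mu d = (lam * trace d) *\<^sub>R mat 1 + (2 * mu) *\<^sub>R d"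

definition a_form :: "(real ^ 'n) set \<Rightarrow> real \<Rightarrow> real \<Rightarrow> real \<Rightarrow> real \<Rightarrow> ('n xel \<Rightarrow> 'n tens)
    \<Rightarrow> 'n xel \<Rightarrow> 'n xel \<Rightarrow> 'n xel \<Rightarrow> real" where
  "a_form Om lam mu alpha c0 kap w = (\<lambda>(d, p) (e, q).
     (LINT x|lebesgue_on Om. hooke lam mu (d x) \<bullet> e x) +
     (LINT x|lebesgue_on Om. (kap w x *v wgrad Om p x) \<bullet> wgrad Om q x) +
     c0 * (LINT x|lebesgue_on Om. p x * q x) +
     alpha * (LINT x|lebesgue_on Om. q x * trace (d x)) -
     alpha * (LINT x|lebesgue_on Om. p x * trace (e x)))"

definition b1_form :: "(real ^ 'n) set \<Rightarrow> 'n xel \<Rightarrow> 'n tens \<Rightarrow> real" where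
  "b1_form Om = (\<lambda>(e, q) \<tau>. - (LINT x|lebesgue_on Om. \<tau> x \<bullet> e x))"

definition b2_form :: "(real ^ 'n) set \<Rightarrow> 'n xel \<times> 'n tens \<Rightarrow> 'n zel \<Rightarrow> real" where
  "b2_form Om = (\<lambda>(e, \<tau>) (v, \<eta>).
     - (LINT x|lebesgue_on Om. v x \<bullet> tdiv Om \<tau> x) - (LINT x|lebesgue_on Om. \<tau> x \<bullet> \<eta> x))"

definition G_fun :: "(real ^ 'n) set \<Rightarrow> 'n scal \<Rightarrow> ('n scal \<Rightarrow> real) \<Rightarrow> 'n xel \<Rightarrow> real" where
  "G_fun Om g rG = (\<lambda>(e, q). (LINT x|lebesgue_on Om. g x * q x) + rG (btrace Om q))"

definition H_fun :: "(real ^ 'n) set \<Rightarrow> 'n vect \<Rightarrow> 'n tens \<Rightarrow> real" where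
  "H_fun Om uG \<tau> = - normal_dualv Om \<tau> uG"

definition F_fun :: "(real ^ 'n) set \<Rightarrow> 'n vect \<Rightarrow> 'n zel \<Rightarrow> real" where
  "F_fun Om f = (\<lambda>(v, \<eta>). LINT x|lebesgue_on Om. f x \<bullet> v x)"


section \<open>Finite element spaces\<close>

text \<open>
  Polynomials are polynomial functions on the whole space. Direct sums are rendered
  as plain sums of spaces (the sums of polynomial and bubble spaces need not be direct for large
  degree, e.g. \<open>k \<ge> 2\<close> in the plane).
\<close>

definition polys :: "nat \<Rightarrow> 'n::finite scal set" where
  "polys k = {p. \<exists>c :: ('n \<Rightarrow> nat) \<Rightarrow> real. \<forall>x.
     p x = (\<Sum>m | (\<Sum>i\<in>UNIV. m i) \<le> k. c m * (\<Prod>i\<in>UNIV. (x $ i) ^ m i))}"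

definition vpolys :: "nat \<Rightarrow> 'n::finite vect set" where
  "vpolys k = {v. \<forall>i. (\<lambda>x. v x $ i) \<in> polys k}"

definition rows_in :: "'n::finite vect set \<Rightarrow> 'n tens set" where
  "rows_in V = {\<tau>. \<forall>i. trow \<tau> i \<in> V}"

definition fsum :: "(real ^ 'n \<Rightarrow> 'b::plus) set \<Rightarrow> (real ^ 'n \<Rightarrow> 'b) set \<Rightarrow> (real ^ 'n \<Rightarrow> 'b) set"
  where "fsum A B = {\<lambda>x. a x + b x | a b. a \<in> A \<and> b \<in> B}"

definition RT :: "nat \<Rightarrow> 'n::finite vect set" where
  "RT k = fsum (vpolys k) {\<lambda>x. q x *\<^sub>R x | q. q \<in> polys k}"

definition vertices :: "(real ^ 'n) set \<Rightarrow> (real ^ 'n) set" where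
  "vertices K = {v. v extreme_point_of K}"

text \<open>The barycentric coordinate of the simplex \<open>K\<close> belonging to its vertex \<open>v\<close>.\<close>

definition bary :: "(real ^ 'n) set \<Rightarrow> real ^ 'n \<Rightarrow> 'n scal" where
  "bary K v = (THE l. (\<exists>a c. l = (\<lambda>x. a \<bullet> x + c)) \<and>
                      (\<forall>w\<in>vertices K. l w = (if w = v then 1 else 0)))"

definition bubble :: "(real ^ 'n) set \<Rightarrow> 'n scal" where
  "bubble K x = (\<Prod>v\<in>vertices K. bary K v x)"

text \<open>The \<open>m\<close>-th coordinate axis, counted from \<open>0\<close>.\<close>

definition ax :: "nat \<Rightarrow> 'n::{finite,linorder}" where
  "ax m = sorted_list_of_set (UNIV :: 'n set) ! m"

definition curl2 :: "'n::{finite,linorder} scal \<Rightarrow> 'n vect" where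
  "curl2 \<phi> x = (\<chi> i. if i = ax 0 then pd (ax 1) \<phi> x else - pd (ax 0) \<phi> x)"

definition curl3 :: "'n::{finite,linorder} vect \<Rightarrow> 'n vect" where
  "curl3 w x = (\<chi> i.
     if i = ax 0 then pd (ax 1) (\<lambda>y. w y $ ax 2) x - pd (ax 2) (\<lambda>y. w y $ ax 1) x
     else if i = ax 1 then pd (ax 2) (\<lambda>y. w y $ ax 0) x - pd (ax 0) (\<lambda>y. w y $ ax 2) x
     else pd (ax 0) (\<lambda>y. w y $ ax 1) x - pd (ax 1) (\<lambda>y. w y $ ax 0) x)"

text \<open>Used only for \<open>n = 2\<close> and \<open>n = 3\<close>.\<close>

definition Bub :: "nat \<Rightarrow> (real ^ 'n::{finite,linorder}) set \<Rightarrow> 'n vect set" where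
  "Bub k K = (if CARD('n) = 2 then {curl2 (\<lambda>x. bubble K x * q x) | q. q \<in> polys k}
              else {curl3 (\<lambda>x. bubble K x *\<^sub>R w x) | w. w \<in> vpolys k})"

definition restr_in :: "(real ^ 'n) set \<Rightarrow> (real ^ 'n \<Rightarrow> 'b) set \<Rightarrow> (real ^ 'n \<Rightarrow> 'b) \<Rightarrow> bool" where
  "restr_in K S f \<longleftrightarrow> (\<exists>s\<in>S. AE x in lebesgue_on K. f x = s x)"

definition X1h :: "(real ^ 'n::{finite,linorder}) set \<Rightarrow> (real ^ 'n::{finite,linorder}) set set \<Rightarrow> nat \<Rightarrow> 'n tens set"
  where "X1h Om T k = {e \<in> L2 Om.
           \<forall>K\<in>T. restr_in K (fsum (rows_in (vpolys k)) (rows_in (Bub k K))) e}"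

definition X2h :: "(real ^ 'n) set \<Rightarrow> (real ^ 'n) set set \<Rightarrow> nat \<Rightarrow> 'n scal set" where
  "X2h Om T k = {q. continuous_on (closure Om) q \<and> (\<forall>K\<in>T. restr_in K (polys (k + 1)) q)}"

definition Xh :: "(real ^ 'n::{finite,linorder}) set \<Rightarrow> (real ^ 'n::{finite,linorder}) set set \<Rightarrow> nat \<Rightarrow> 'n xel set"
  where "Xh Om T k = X1h Om T k \<times> X2h Om T k"

definition Yh :: "(real ^ 'n::{finite,linorder}) set \<Rightarrow> (real ^ 'n::{finite,linorder}) set set \<Rightarrow> nat \<Rightarrow> 'n tens set"
  where "Yh Om T k = {\<tau> \<in> Hdiv Om.
           \<forall>K\<in>T. restr_in K (fsum (rows_in (RT k)) (rows_in (Bub k K))) \<tau>}"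

definition Zh :: "(real ^ 'n) set \<Rightarrow> (real ^ 'n) set set \<Rightarrow> nat \<Rightarrow> 'n zel set" where
  "Zh Om T k =
     {v \<in> L2 Om. \<forall>K\<in>T. restr_in K (vpolys k) v} \<times>
     {\<eta> \<in> L2skew Om. continuous_on (closure Om) \<eta> \<and>
                     (\<forall>K\<in>T. restr_in K (rows_in (vpolys (k + 1))) \<eta>)}"

definition Wh :: "(real ^ 'n::{finite,linorder}) set \<Rightarrow> (real ^ 'n::{finite,linorder}) set set \<Rightarrow> nat \<Rightarrow> real
    \<Rightarrow> 'n xel set" where
  "Wh Om T k r = {w \<in> Xh Om T k. norm_X Om w \<le> r}"

definition inf_sup_b2 :: "(real ^ 'n::{finite,linorder}) set \<Rightarrow> (real ^ 'n::{finite,linorder}) set set \<Rightarrow> nat \<Rightarrow> real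
    \<Rightarrow> bool" where
  "inf_sup_b2 Om T k beta \<longleftrightarrow> (\<forall>v\<in>Zh Om T k. beta * norm_Z Om v \<le>
     (SUP y\<in>{y \<in> Xh Om T k \<times> Yh Om T k. norm_XY Om y \<noteq> 0}. b2_form Om y v / norm_XY Om y))"


section \<open>The discrete problems\<close>

text \<open>
  \<open>discr_sol\<close> is the discrete problem with a generic first form \<open>A\<close>: the linearised
  and the nonlinear problem differ only in that form.
\<close>

definition discr_sol :: "(real ^ 'n::{finite,linorder}) set \<Rightarrow> (real ^ 'n::{finite,linorder}) set set \<Rightarrow> nat
    \<Rightarrow> ('n xel \<Rightarrow> 'n xel \<Rightarrow> real) \<Rightarrow> 'n vect \<Rightarrow> 'n scal \<Rightarrow> 'n vect \<Rightarrow> ('n scal \<Rightarrow> real)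
    \<Rightarrow> ('n xel \<times> 'n tens) \<times> 'n zel \<Rightarrow> bool" where
  "discr_sol Om T k A f g uG rG = (\<lambda>((d, s), u).
     d \<in> Xh Om T k \<and> s \<in> Yh Om T k \<and> u \<in> Zh Om T k \<and>
     (\<forall>e\<in>Xh Om T k. \<forall>\<tau>\<in>Yh Om T k. \<forall>v\<in>Zh Om T k.
        A d e + b1_form Om e s = G_fun Om g rG e \<and>
        b1_form Om d \<tau> + b2_form Om (e, \<tau>) u = H_fun Om uG \<tau> \<and>
        b2_form Om (d, s) v = F_fun Om f v))"

definition eq_sol :: "(real ^ 'n) set \<Rightarrow> ('n xel \<times> 'n tens) \<times> 'n zel
    \<Rightarrow> ('n xel \<times> 'n tens) \<times> 'n zel \<Rightarrow> bool" where
  "eq_sol Om = (\<lambda>((d, s), u) ((d', s'), u'). eq_pair Om d d' \<and> eq_on Om s s' \<and> eq_pair Om u u')"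

definition lin_sol where
  "lin_sol Om T k lam mu alpha c0 kap f g uG rG w =
     discr_sol Om T k (a_form Om lam mu alpha c0 kap w) f g uG rG"

definition nonlin_sol where
  "nonlin_sol Om T k lam mu alpha c0 kap f g uG rG =
     discr_sol Om T k (\<lambda>d e. a_form Om lam mu alpha c0 kap d d e) f g uG rG"

text \<open>
  The fixed-point operator. Its value is one representative of a solution component that is
  unique up to null sets, so fixed points are to be understood modulo \<open>eq_pair\<close>.
\<close>

definition Jh where
  "Jh Om T k lam mu alpha c0 kap f g uG rG w =
     (SOME d. \<exists>s u. lin_sol Om T k lam mu alpha c0 kap f g uG rG w ((d, s), u))"

definition data_norm where
  "data_norm Om f g uG rG =
     norm_L2 Om g + norm_Hm12 Om rG + norm_H12v Om uG + norm_L2 Om f"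


section \<open>Constants\<close>

definition Cbig :: "nat \<Rightarrow> real \<Rightarrow> real \<Rightarrow> real \<Rightarrow> real \<Rightarrow> real \<Rightarrow> real \<Rightarrow> real" where
  "Cbig n lam mu alpha c0 k2 r = Max {2 * mu + real n * lam, c0, real n * alpha, k2 * r}"

definition Csmall :: "real \<Rightarrow> real \<Rightarrow> real \<Rightarrow> real" where
  "Csmall mu c0 k1 = Min {k1, 2 * mu, c0}"

definition gam2 :: "real \<Rightarrow> real \<Rightarrow> real" where
  "gam2 Ca ca = (Ca + 2) * (ca + 1 + Ca) / ca"

definition gam1 :: "real \<Rightarrow> real \<Rightarrow> real \<Rightarrow> real" where
  "gam1 Ca ca beta = (Ca + 1 + beta + gam2 Ca ca)\<^sup>2 / (beta\<^sup>2 * gam2 Ca ca)"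

end

theory Submission
  imports Defs
begin

text \<open>
  The linearised problem is a twofold saddle point problem whose structure is
  isolated in the locale \<open>saddle\<close>: a coercive form on the strains and pressures, coupled by \<open>b1\<close>
  to the stresses, which are coupled by \<open>b2\<close> to displacements and rotations. The inf-sup condition
  of \<open>b2\<close> is a hypothesis. That of \<open>b1\<close> on the kernel of \<open>b2\<close> is the point at which the choice of
  the finite elements enters: a stress in the kernel is divergence free
  (\<open>tdiv_Yh_in_Z1h\<close>), and a divergence free stress is itself a discrete strain
  (\<open>divergence_free_Yh_in_X1h\<close>), so it can be used as a test function. Behind this is
  a fact on Euler's operator for polynomials (\<open>RT_divergence_free\<close>).

  On the embedded kernel the permeability does not act. Therefore the a priori bound (\<open>a_priori\<close>)
  depends only on the elastic and coupling constants, on the coercivity constant and on the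
  inf-sup constant, all of which are dominated by \<open>gam1\<close> (\<open>gam1_bounds\<close>, \<open>beta_le_1\<close>).
  Two linearised solutions differ by a quantity that coercivity alone controls (\<open>sol_stability\<close>),
  so the solution operator is Lipschitz with constant proportional to the size of the data, and
  the smallness condition makes it a contraction of the ball \<open>Wh\<close> into itself. Banach's theorem
  gives the fixed point. Existence for the linearised problem follows from uniqueness for the
  transposed problem, since the spaces are finite-dimensional (\<open>bilinear_solve\<close>,
  \<open>fin_dim_piecewise\<close>).

  The remaining work is to verify that the concrete spaces and functionals fit this frame. The
  continuous pressures are shown to lie in \<open>H1\<close> by difference quotients (\<open>X2h_H1\<close>); the divergence
  of a discrete stress is identified on each element by testing with functions supported there
  (\<open>tdiv_on_cell\<close>); weak derivatives are unique because test functions separate integrable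
  functions (\<open>AE_zero_if_test_integrals_zero\<close>); and the boundary functionals are bounded because
  the lifting of least norm exists (\<open>lifting\<close>). Functions are identified when they agree
  almost everywhere, which is why all spaces carry semidefinite inner products.
\<close>

section \<open>Finite-dimensional semi-inner product spaces\<close>

text \<open>Functions that agree almost everywhere are not identified here, and the spaces are subsets of a
  function type. Hence the inner product is only semidefinite, and \<open>lin c x y\<close> stands for
  \<open>x + c y\<close>, the one operation from which all linear algebra below is done. Vectors \<open>x\<close> with
  \<open>ip x x = 0\<close> play the part of zero.\<close>

locale semi_inner =
  fixes U :: "'v set" and lin :: "real \<Rightarrow> 'v \<Rightarrow> 'v \<Rightarrow> 'v" and ip :: "'v \<Rightarrow> 'v \<Rightarrow> real"
  assumes nonempty: "U \<noteq> {}"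
    and closed: "x \<in> U \<Longrightarrow> y \<in> U \<Longrightarrow> lin c x y \<in> U"
    and ip_sym: "x \<in> U \<Longrightarrow> y \<in> U \<Longrightarrow> ip x y = ip y x"
    and ip_lin: "x \<in> U \<Longrightarrow> y \<in> U \<Longrightarrow> z \<in> U \<Longrightarrow> ip (lin c x y) z = ip x z + c * ip y z"
    and ip_pos: "x \<in> U \<Longrightarrow> 0 \<le> ip x x"

definition linear_on :: "'v set \<Rightarrow> (real \<Rightarrow> 'v \<Rightarrow> 'v \<Rightarrow> 'v) \<Rightarrow> ('v \<Rightarrow> real) \<Rightarrow> bool" where
  "linear_on U lin f \<longleftrightarrow> (\<forall>x\<in>U. \<forall>y\<in>U. \<forall>c. f (lin c x y) = f x + c * f y)"

lemma linear_onD: "linear_on U lin f \<Longrightarrow> x \<in> U \<Longrightarrow> y \<in> U \<Longrightarrow> f (lin c x y) = f x + c * f y"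
  by (simp add: linear_on_def)

definition separating :: "'v set \<Rightarrow> (real \<Rightarrow> 'v \<Rightarrow> 'v \<Rightarrow> 'v) \<Rightarrow> ('v \<Rightarrow> 'v \<Rightarrow> real) \<Rightarrow> ('v \<Rightarrow> real) set \<Rightarrow> bool"
  where "separating U lin ip F \<longleftrightarrow> finite F \<and> (\<forall>l\<in>F. linear_on U lin l) \<and>
           (\<forall>x\<in>U. (\<forall>l\<in>F. l x = 0) \<longrightarrow> ip x x = 0)"

text \<open>Finite dimension modulo null vectors, through finitely many separating functionals: such
  functionals are easy to write down for piecewise polynomials, whereas bases are not.\<close>

definition fin_dim where
  "fin_dim U lin ip \<longleftrightarrow> (\<exists>F. separating U lin ip F)"

text \<open>The linear algebra behind every existence result below: a functional that vanishes on the
  common kernel of finitely many functionals is a combination of them.\<close>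

lemma functional_in_span:
  fixes l :: "'i \<Rightarrow> 'v \<Rightarrow> real"
  assumes "finite I" "\<And>x y c. x \<in> U \<Longrightarrow> y \<in> U \<Longrightarrow> lin c x y \<in> U"
    and "\<And>i. i \<in> I \<Longrightarrow> linear_on U lin (l i)" "linear_on U lin f"
    and "\<And>y. y \<in> U \<Longrightarrow> (\<forall>i\<in>I. l i y = 0) \<Longrightarrow> f y = 0"
  shows "\<exists>c. \<forall>y\<in>U. f y = (\<Sum>i\<in>I. c i * l i y)"
  using assms
proof (induction I arbitrary: U rule: finite_induct)
  case empty
  then show ?case by auto
next
  case (insert a I)
  let ?V = "{y \<in> U. l a y = 0}"
  have la: "linear_on U lin (l a)" using insert.prems(2) by blast
  have "\<exists>c. \<forall>y\<in>?V. f y = (\<Sum>i\<in>I. c i * l i y)"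
  proof (rule insert.IH)
    show "lin c x y \<in> ?V" if "x \<in> ?V" "y \<in> ?V" for x y c
      using that insert.prems(1) linear_onD[OF la] by auto
    show "linear_on ?V lin (l i)" if "i \<in> I" for i
      using insert.prems(2)[of i] that by (auto simp: linear_on_def)
    show "linear_on ?V lin f" using insert.prems(3) by (auto simp: linear_on_def)
    show "f y = 0" if "y \<in> ?V" "\<forall>i\<in>I. l i y = 0" for y
      using that insert.prems(4) by auto
  qed
  then obtain c where c: "\<And>y. y \<in> U \<Longrightarrow> l a y = 0 \<Longrightarrow> f y = (\<Sum>i\<in>I. c i * l i y)" by auto
  show ?case
  proof (cases "\<exists>b\<in>U. l a b \<noteq> 0")
    case False
    then show ?thesis
      using c insert.hyps by (intro exI[of _ c]) (auto intro!: sum.cong)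
  next
    case True
    then obtain b where b: "b \<in> U" "l a b \<noteq> 0" by blast
    define d where "d = (f b - (\<Sum>i\<in>I. c i * l i b)) / l a b"
    have "f y = (\<Sum>i\<in>insert a I. (c(a := d)) i * l i y)" if y: "y \<in> U" for y
    proof -
      define t where "t = l a y / l a b"
      have *: "g (lin (- t) y b) = g y - t * g b" if "linear_on U lin g" for g
        using linear_onD[OF that y b(1), of "-t"] by simp
      have "f (lin (- t) y b) = (\<Sum>i\<in>I. c i * l i (lin (- t) y b))"
        using * [OF la] b insert.prems(1)[OF y b(1)] by (intro c) (auto simp: t_def)
      also have "\<dots> = (\<Sum>i\<in>I. c i * l i y) - t * (\<Sum>i\<in>I. c i * l i b)"
        using insert.prems(2)
        by (simp add: * sum_subtractf sum_distrib_left algebra_simps)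
      finally have "f y = (\<Sum>i\<in>I. c i * l i y) + t * (f b - (\<Sum>i\<in>I. c i * l i b))"
        using *[OF insert.prems(3)] by (simp add: algebra_simps)
      moreover have "t * (f b - (\<Sum>i\<in>I. c i * l i b)) = d * l a y"
        using b by (simp add: t_def d_def)
      moreover have "(\<Sum>i\<in>I. (c(a := d)) i * l i y) = (\<Sum>i\<in>I. c i * l i y)"
        using insert.hyps by (intro sum.cong) auto
      ultimately show ?thesis using insert.hyps by simp
    qed
    then show ?thesis by blast
  qed
qed

context semi_inner
begin

definition nrm :: "'v \<Rightarrow> real" where "nrm x = sqrt (ip x x)"

lemma nrm_nonneg [simp]: "x \<in> U \<Longrightarrow> 0 \<le> nrm x"
  by (simp add: nrm_def ip_pos)

lemma nrm_sq: "x \<in> U \<Longrightarrow> (nrm x)\<^sup>2 = ip x x"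
  by (simp add: nrm_def ip_pos)

lemma ip_lin_right: "x \<in> U \<Longrightarrow> y \<in> U \<Longrightarrow> z \<in> U \<Longrightarrow> ip z (lin c x y) = ip z x + c * ip z y"
  using ip_lin closed ip_sym by metis

lemma linear_ip: "x \<in> U \<Longrightarrow> linear_on U lin (ip x)"
  by (simp add: linear_on_def ip_lin_right)

lemma ip_lin_lin: "x \<in> U \<Longrightarrow> y \<in> U \<Longrightarrow>
    ip (lin c x y) (lin c x y) = ip x x + 2 * c * ip x y + c\<^sup>2 * ip y y"
  by (simp add: ip_lin ip_lin_right closed ip_sym[of y x] power2_eq_square algebra_simps)

lemma cauchy_schwarz:
  assumes "x \<in> U" "y \<in> U" shows "\<bar>ip x y\<bar> \<le> nrm x * nrm y"
proof -
  have pos: "0 \<le> ip x x + 2 * c * ip x y + c\<^sup>2 * ip y y" for c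
    using ip_pos[OF closed[OF assms, of c]] ip_lin_lin[OF assms, of c] by simp
  have "(ip x y)\<^sup>2 \<le> ip x x * ip y y"
  proof (cases "ip y y = 0")
    case True
    have "ip x y = 0"
    proof (rule ccontr)
      assume "ip x y \<noteq> 0"
      with pos[of "- (ip x x + 1) / (2 * ip x y)"] True show False
        by (simp add: field_simps)
    qed
    with True show ?thesis by simp
  next
    case False
    with ip_pos[OF assms(2)] have y: "0 < ip y y" by simp
    from pos[of "- ip x y / ip y y"] y show ?thesis
      by (simp add: field_simps power2_eq_square)
  qed
  then have "sqrt ((ip x y)\<^sup>2) \<le> sqrt (ip x x * ip y y)" by (rule real_sqrt_le_mono)
  then show ?thesis by (simp add: nrm_def real_sqrt_mult)
qed

lemma ip_null: "x \<in> U \<Longrightarrow> y \<in> U \<Longrightarrow> nrm x = 0 \<Longrightarrow> ip x y = 0"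
  using cauchy_schwarz[of x y] by simp

lemma nrm_lin:
  assumes "x \<in> U" "y \<in> U" shows "nrm (lin c x y) \<le> nrm x + \<bar>c\<bar> * nrm y"
proof (rule power2_le_imp_le)
  have "c * ip x y \<le> \<bar>c\<bar> * \<bar>ip x y\<bar>" using abs_ge_self[of "c * ip x y"] by (simp add: abs_mult)
  also have "\<dots> \<le> \<bar>c\<bar> * (nrm x * nrm y)"
    using cauchy_schwarz[OF assms] by (intro mult_left_mono) auto
  finally have "c * ip x y \<le> \<bar>c\<bar> * (nrm x * nrm y)" .
  moreover have "(nrm (lin c x y))\<^sup>2 = (nrm x)\<^sup>2 + 2 * (c * ip x y) + c\<^sup>2 * (nrm y)\<^sup>2"
    using assms by (simp add: nrm_sq closed ip_lin_lin)
  moreover have "(nrm x + \<bar>c\<bar> * nrm y)\<^sup>2 = (nrm x)\<^sup>2 + 2 * (\<bar>c\<bar> * (nrm x * nrm y)) + c\<^sup>2 * (nrm y)\<^sup>2"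
    by (simp add: power2_sum power_mult_distrib)
  ultimately show "(nrm (lin c x y))\<^sup>2 \<le> (nrm x + \<bar>c\<bar> * nrm y)\<^sup>2" by linarith
qed (use assms in simp)

abbreviation dst :: "'v \<Rightarrow> 'v \<Rightarrow> real" where "dst x y \<equiv> nrm (lin (- 1) x y)"

lemma dst_sq: "x \<in> U \<Longrightarrow> y \<in> U \<Longrightarrow> (dst x y)\<^sup>2 = ip x x - 2 * ip x y + ip y y"
  using ip_lin_lin[of x y "-1"] by (simp add: nrm_sq closed)

lemma dst_commute: "x \<in> U \<Longrightarrow> y \<in> U \<Longrightarrow> dst x y = dst y x"
  using dst_sq[of x y] dst_sq[of y x] ip_sym[of x y]
  by (simp add: nrm_def closed ip_lin_lin)

lemma dst_triangle:
  assumes "x \<in> U" "y \<in> U" "z \<in> U" shows "dst x z \<le> dst x y + dst y z"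
proof -
  let ?s = "lin 1 (lin (-1) x y) (lin (-1) y z)"
  have "ip ?s ?s = ip (lin (-1) x z) (lin (-1) x z)"
    using assms by (simp add: ip_lin ip_lin_right closed ip_sym[of y x] ip_sym[of z x] ip_sym[of z y])
  then show ?thesis
    using nrm_lin[of "lin (-1) x y" "lin (-1) y z" 1] assms by (simp add: nrm_def closed)
qed

lemma nrm_le_dst: "x \<in> U \<Longrightarrow> y \<in> U \<Longrightarrow> nrm x \<le> nrm y + dst x y"
proof -
  assume xy: "x \<in> U" "y \<in> U"
  let ?s = "lin 1 (lin (-1) x y) y"
  have "ip ?s ?s = ip x x"
    using xy by (simp add: ip_lin ip_lin_right closed ip_sym[of y x])
  then show ?thesis using nrm_lin[of "lin (-1) x y" y 1] xy by (simp add: nrm_def closed)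
qed

lemma linear_on_dst_null:
  assumes "linear_on U lin f" "\<And>x. x \<in> U \<Longrightarrow> nrm x = 0 \<Longrightarrow> f x = 0" "x \<in> U" "y \<in> U" "dst x y = 0"
  shows "f x = f y"
  using assms(2)[of "lin (-1) x y"] linear_onD[OF assms(1), of x y "-1"] assms(3-5) by (simp add: closed)

lemma ex_zero: "\<exists>z\<in>U. \<forall>f. linear_on U lin f \<longrightarrow> f z = 0"
proof -
  obtain x where "x \<in> U" using nonempty by blast
  then show ?thesis by (intro bexI[of _ "lin (-1) x x"]) (auto simp: linear_on_def closed)
qed

lemma ex_combination:
  assumes "finite B" "B \<subseteq> U"
  shows "\<exists>x\<in>U. \<forall>f. linear_on U lin f \<longrightarrow> f x = (\<Sum>b\<in>B. c b * f b)"
  using assms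
proof (induction B rule: finite_induct)
  case empty
  then show ?case using ex_zero by simp
next
  case (insert b B)
  then obtain x where x: "x \<in> U" "\<forall>f. linear_on U lin f \<longrightarrow> f x = (\<Sum>b\<in>B. c b * f b)" by auto
  then have "f (lin (c b) x b) = (\<Sum>b\<in>insert b B. c b * f b)" if "linear_on U lin f" for f
    using that insert linear_onD[OF that x(1), of b "c b"] by simp
  moreover have "lin (c b) x b \<in> U" using x insert.prems closed by simp
  ultimately show ?case by blast
qed

text \<open>A determining set is the substitute for a generating set of \<open>V\<close> modulo null vectors, seen
  through the functionals that respect null vectors.\<close>

definition determines :: "'v set \<Rightarrow> 'v set \<Rightarrow> bool" where
  "determines B V \<longleftrightarrow> (\<forall>g. linear_on U lin g \<longrightarrow> (\<forall>x\<in>U. nrm x = 0 \<longrightarrow> g x = 0) \<longrightarrow>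
     (\<forall>b\<in>B. g b = 0) \<longrightarrow> (\<forall>x\<in>V. g x = 0))"

lemma determinesI:
  assumes "\<And>g x. linear_on U lin g \<Longrightarrow> (\<And>x. x \<in> U \<Longrightarrow> nrm x = 0 \<Longrightarrow> g x = 0) \<Longrightarrow>
     (\<And>b. b \<in> B \<Longrightarrow> g b = 0) \<Longrightarrow> x \<in> V \<Longrightarrow> g x = 0"
  shows "determines B V"
  unfolding determines_def by (intro allI impI ballI) (rule assms; blast)

lemma determinesD:
  assumes "determines B V" "linear_on U lin g" "\<And>x. x \<in> U \<Longrightarrow> nrm x = 0 \<Longrightarrow> g x = 0"
    "\<And>b. b \<in> B \<Longrightarrow> g b = 0" "x \<in> V"
  shows "g x = 0"
proof -
  have "\<forall>x\<in>U. nrm x = 0 \<longrightarrow> g x = 0" "\<forall>b\<in>B. g b = 0" using assms(3,4) by auto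
  with assms(1,2,5) show ?thesis unfolding determines_def by metis
qed

lemma ex_determining:
  assumes "finite F" "V \<subseteq> U" "\<And>x y c. x \<in> V \<Longrightarrow> y \<in> V \<Longrightarrow> lin c x y \<in> V"
    and "\<And>l. l \<in> F \<Longrightarrow> linear_on U lin l"
    and "\<And>x. x \<in> V \<Longrightarrow> (\<forall>l\<in>F. l x = 0) \<Longrightarrow> ip x x = 0"
  shows "\<exists>B. finite B \<and> B \<subseteq> V \<and> determines B V"
  using assms
proof (induction F arbitrary: V rule: finite_induct)
  case empty
  have "determines {} V"
  proof (rule determinesI)
    fix g x assume "\<And>x. x \<in> U \<Longrightarrow> nrm x = 0 \<Longrightarrow> g x = 0" "x \<in> V"
    then show "g x = 0" using empty.prems(1,4) by (auto simp: nrm_def)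
  qed
  then show ?case by blast
next
  case (insert a F)
  let ?V = "{y \<in> V. a y = 0}"
  have la: "linear_on U lin a" using insert.prems(3) by blast
  have "\<exists>B. finite B \<and> B \<subseteq> ?V \<and> determines B ?V"
  proof (rule insert.IH)
    show "?V \<subseteq> U" using insert.prems(1) by blast
    show "lin c x y \<in> ?V" if "x \<in> ?V" "y \<in> ?V" for x y c
      using that insert.prems(1) insert.prems(2)[of x y c] linear_onD[OF la, of x y c] by auto
    show "linear_on U lin l" if "l \<in> F" for l using insert.prems(3)[of l] that by simp
    show "ip x x = 0" if "x \<in> ?V" "\<forall>l\<in>F. l x = 0" for x
      using insert.prems(4)[of x] that by simp
  qed
  then obtain B where B: "finite B" "B \<subseteq> ?V" "determines B ?V" by blast
  show "\<exists>B. finite B \<and> B \<subseteq> V \<and> determines B V"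
  proof (cases "\<exists>b\<in>V. a b \<noteq> 0")
    case False
    then have "?V = V" by blast
    with B show ?thesis by metis
  next
    case True
    then obtain b where b: "b \<in> V" "a b \<noteq> 0" by blast
    have "determines (insert b B) V"
    proof (rule determinesI)
      fix g x
      assume g: "linear_on U lin g" "\<And>x. x \<in> U \<Longrightarrow> nrm x = 0 \<Longrightarrow> g x = 0"
        "\<And>c. c \<in> insert b B \<Longrightarrow> g c = 0" and x: "x \<in> V"
      let ?y = "lin (- (a x / a b)) x b"
      have U: "x \<in> U" "b \<in> U" using x b insert.prems(1) by auto
      have "?y \<in> ?V"
        using insert.prems(2)[OF x b(1)] linear_onD[OF la U] b by simp
      have "g ?y = 0"
      proof (rule determinesD[OF B(3) g(1)])
        show "g x = 0" if "x \<in> U" "nrm x = 0" for x by (rule g(2)[OF that])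
        show "g c = 0" if "c \<in> B" for c using that by (intro g(3)) simp
      qed fact
      moreover have "g b = 0" using g(3) by simp
      ultimately show "g x = 0" using linear_onD[OF g(1) U] by simp
    qed
    moreover have "finite (insert b B)" "insert b B \<subseteq> V" using B(1,2) b(1) by auto
    ultimately show ?thesis by metis
  qed
qed

text \<open>The Fredholm alternative for a finite system: it is solvable as soon as the right-hand side
  annihilates the kernel of the transposed system.\<close>

lemma bilinear_solve:
  fixes A :: "'v \<Rightarrow> 'w \<Rightarrow> real"
  assumes fd: "fin_dim U lin ip"
    and V: "\<And>x y c. x \<in> V \<Longrightarrow> y \<in> V \<Longrightarrow> lin' c x y \<in> V"
    and A1: "\<And>y. y \<in> V \<Longrightarrow> linear_on U lin (\<lambda>x. A x y)"
    and A2: "\<And>x. x \<in> U \<Longrightarrow> linear_on V lin' (A x)"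
    and A0: "\<And>x y. x \<in> U \<Longrightarrow> y \<in> V \<Longrightarrow> nrm x = 0 \<Longrightarrow> A x y = 0"
    and f: "linear_on V lin' f"
    and ker: "\<And>y. y \<in> V \<Longrightarrow> (\<forall>x\<in>U. A x y = 0) \<Longrightarrow> f y = 0"
  shows "\<exists>x\<in>U. \<forall>y\<in>V. A x y = f y"
proof -
  obtain F where F: "finite F" "\<And>l. l \<in> F \<Longrightarrow> linear_on U lin l"
      "\<And>x. x \<in> U \<Longrightarrow> (\<forall>l\<in>F. l x = 0) \<Longrightarrow> ip x x = 0"
    using fd unfolding fin_dim_def separating_def by metis
  have "\<exists>B. finite B \<and> B \<subseteq> U \<and> determines B U"
    by (rule ex_determining[OF F(1) order.refl]) (use closed F(2,3) in simp_all)
  then obtain B where B: "finite B" "B \<subseteq> U" "determines B U" by blast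
  have "\<exists>c. \<forall>y\<in>V. f y = (\<Sum>b\<in>B. c b * A b y)"
  proof (rule functional_in_span[OF B(1) V _ f])
    show "linear_on V lin' (A b)" if "b \<in> B" for b using A2 B that by blast
    show "f y = 0" if "y \<in> V" "\<forall>b\<in>B. A b y = 0" for y
    proof (rule ker[OF that(1)], rule ballI)
      show "A x y = 0" if "x \<in> U" for x
        by (rule determinesD[OF B(3) A1[OF \<open>y \<in> V\<close>]])
          (use A0 \<open>y \<in> V\<close> \<open>\<forall>b\<in>B. A b y = 0\<close> that in auto)
    qed
  qed
  then obtain c where c: "\<And>y. y \<in> V \<Longrightarrow> f y = (\<Sum>b\<in>B. c b * A b y)" by blast
  obtain x where "x \<in> U" "\<forall>g. linear_on U lin g \<longrightarrow> g x = (\<Sum>b\<in>B. c b * g b)"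
    using ex_combination[OF B(1,2)] by metis
  with c A1 show ?thesis by (intro bexI[of _ x]) auto
qed

lemma riesz:
  assumes "fin_dim U lin ip" "linear_on U lin f" "\<And>x. x \<in> U \<Longrightarrow> nrm x = 0 \<Longrightarrow> f x = 0"
  shows "\<exists>x\<in>U. \<forall>y\<in>U. ip x y = f y"
proof (rule bilinear_solve[OF assms(1) closed _ linear_ip ip_null assms(2)])
  show "linear_on U lin (\<lambda>x. ip x y)" if "y \<in> U" for y
    using that by (simp add: linear_on_def ip_lin)
  show "f y = 0" if "y \<in> U" "\<forall>x\<in>U. ip x y = 0" for y
    using that by (intro assms(3)) (auto simp: nrm_def)
qed

lemma complete:
  assumes fd: "fin_dim U lin ip" and s: "\<And>m. s m \<in> U"
    and cauchy: "\<And>e. 0 < e \<Longrightarrow> \<exists>M. \<forall>m\<ge>M. \<forall>l\<ge>M. dst (s m) (s l) < e"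
  shows "\<exists>x\<in>U. (\<lambda>m. dst (s m) x) \<longlonglongrightarrow> 0"
proof -
  have diff: "\<bar>ip (s m) y - ip (s l) y\<bar> \<le> dst (s m) (s l) * nrm y" if "y \<in> U" for m l y
    using cauchy_schwarz[of "lin (-1) (s m) (s l)" y] that s by (simp add: ip_lin closed)
  have conv: "convergent (\<lambda>m. ip (s m) y)" if y: "y \<in> U" for y
  proof (rule Cauchy_convergent, rule metric_CauchyI)
    fix e :: real assume e: "0 < e"
    have p: "0 < nrm y + 1" using nrm_nonneg[OF y] by linarith
    obtain M where M: "\<forall>m\<ge>M. \<forall>l\<ge>M. dst (s m) (s l) < e / (nrm y + 1)"
      using cauchy[of "e / (nrm y + 1)"] e p by auto
    have "\<bar>ip (s m) y - ip (s l) y\<bar> < e" if "m \<ge> M" "l \<ge> M" for m l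
    proof -
      have "dst (s m) (s l) * nrm y \<le> e / (nrm y + 1) * nrm y"
        using M that y by (intro mult_right_mono) (auto intro: less_imp_le)
      also have "\<dots> < e" using p e by (simp add: field_simps)
      finally show ?thesis using diff[OF y, of m l] by linarith
    qed
    then show "\<exists>M. \<forall>m\<ge>M. \<forall>n\<ge>M. dist (ip (s m) y) (ip (s n) y) < e"
      by (auto simp: dist_real_def)
  qed
  define f where "f y = lim (\<lambda>m. ip (s m) y)" for y
  have f: "(\<lambda>m. ip (s m) y) \<longlonglongrightarrow> f y" if "y \<in> U" for y
    using conv[OF that] by (simp add: f_def convergent_LIMSEQ_iff)
  have "linear_on U lin f"
    unfolding linear_on_def
  proof (intro ballI allI)
    fix x y c assume xy: "x \<in> U" "y \<in> U"
    have "(\<lambda>m. ip (s m) (lin c x y)) \<longlonglongrightarrow> f x + c * f y"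
      using xy s by (simp add: ip_lin_right) (intro tendsto_intros f)
    then show "f (lin c x y) = f x + c * f y"
      using LIMSEQ_unique f[OF closed[OF xy]] by blast
  qed
  moreover have "f y = 0" if "y \<in> U" "nrm y = 0" for y
  proof -
    have "ip (s m) y = 0" for m using ip_null[OF that(1) s that(2)] ip_sym[OF that(1) s] by simp
    then show ?thesis using f[OF that(1)] by (simp add: LIMSEQ_const_iff)
  qed
  ultimately obtain x where x: "x \<in> U" "\<And>y. y \<in> U \<Longrightarrow> ip x y = f y" using riesz[OF fd] by metis
  have "(\<lambda>m. dst (s m) x) \<longlonglongrightarrow> 0"
  proof (rule LIMSEQ_I)
    fix e :: real assume e: "0 < e"
    obtain M where M: "\<forall>m\<ge>M. \<forall>l\<ge>M. dst (s m) (s l) < e / 2" using cauchy[of "e / 2"] e by auto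
    have "dst (s m) x \<le> e / 2" if m: "m \<ge> M" for m
    proof -
      let ?y = "lin (-1) (s m) x"
      have y: "?y \<in> U" using s x closed by blast
      have "(\<lambda>l. ip (s m) ?y - ip (s l) ?y) \<longlonglongrightarrow> ip (s m) ?y - f ?y"
        by (intro tendsto_intros f y)
      moreover have "ip (s m) ?y - ip (s l) ?y \<le> e / 2 * nrm ?y" if "l \<ge> M" for l
      proof -
        have "dst (s m) (s l) * nrm ?y \<le> e / 2 * nrm ?y"
          using M m that y by (intro mult_right_mono) (auto intro: less_imp_le)
        then show ?thesis using diff[OF y, of m l] by linarith
      qed
      ultimately have "ip (s m) ?y - f ?y \<le> e / 2 * nrm ?y"
        by (intro LIMSEQ_le_const2[where X="\<lambda>l. ip (s m) ?y - ip (s l) ?y"]) auto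
      then have "nrm ?y * nrm ?y \<le> e / 2 * nrm ?y"
        using x y s nrm_sq[OF y] by (simp add: ip_lin power2_eq_square)
      then show ?thesis using e nrm_nonneg[OF y] by (cases "nrm ?y = 0") auto
    qed
    with e show "\<exists>M. \<forall>m\<ge>M. norm (dst (s m) x - 0) < e"
      using s x closed by (intro exI[of _ M]) fastforce
  qed
  with x show ?thesis by blast
qed

text \<open>Banach's theorem in a space where limits are determined only up to distance zero, so that the
  fixed point is one up to distance zero as well.\<close>

lemma contraction_fixed_point:
  assumes fd: "fin_dim U lin ip" and W: "W \<noteq> {}" "W \<subseteq> U"
    and Wc: "\<And>s x. (\<And>m. s m \<in> W) \<Longrightarrow> x \<in> U \<Longrightarrow> (\<lambda>m. dst (s m) x) \<longlonglongrightarrow> 0 \<Longrightarrow> x \<in> W"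
    and J: "\<And>x. x \<in> W \<Longrightarrow> J x \<in> W"
    and q: "0 \<le> q" "q < 1" "\<And>x y. x \<in> W \<Longrightarrow> y \<in> W \<Longrightarrow> dst (J x) (J y) \<le> q * dst x y"
  shows "\<exists>x\<in>W. dst (J x) x = 0"
proof -
  obtain x0 where x0: "x0 \<in> W" using W by blast
  define s where "s m = (J ^^ m) x0" for m
  have sW: "s m \<in> W" for m by (induction m) (auto simp: s_def x0 J)
  then have sU: "s m \<in> U" for m using W by blast
  have sJ: "s (Suc m) = J (s m)" for m by (simp add: s_def)
  define D where "D = dst (s 1) (s 0)"
  have D: "0 \<le> D" using sU closed by (simp add: D_def)
  have step: "dst (s (Suc m)) (s m) \<le> q ^ m * D" for m
  proof (induction m)
    case (Suc m)
    have "dst (s (Suc (Suc m))) (s (Suc m)) \<le> q * dst (s (Suc m)) (s m)"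
      using q(3)[OF sW sW] sJ by metis
    also have "\<dots> \<le> q * (q ^ m * D)" using Suc q by (intro mult_left_mono) auto
    finally show ?case by (simp add: mult_ac)
  qed (simp add: D_def)
  have far: "dst (s (m + l)) (s m) \<le> q ^ m * D / (1 - q)" for m l
  proof -
    have "dst (s (m + l)) (s m) \<le> (\<Sum>i<l. q ^ (m + i) * D)"
    proof (induction l)
      case 0
      have "dst (s m) (s m) = 0" using dst_sq[OF sU sU, of m m] by simp
      then show ?case by simp
    next
      case (Suc l)
      have "dst (s (m + Suc l)) (s m) \<le> dst (s (Suc (m + l))) (s (m + l)) + dst (s (m + l)) (s m)"
        using dst_triangle sU by simp
      with Suc step[of "m + l"] show ?case by simp
    qed
    also have "\<dots> = q ^ m * D * (\<Sum>i<l. q ^ i)"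
      by (simp add: sum_distrib_left power_add mult_ac)
    also have "\<dots> \<le> q ^ m * D * (1 / (1 - q))"
    proof (rule mult_left_mono)
      show "(\<Sum>i<l. q ^ i) \<le> 1 / (1 - q)"
        using q by (simp add: sum_gp_strict divide_right_mono)
    qed (use q D in auto)
    finally show ?thesis by simp
  qed
  have lim: "(\<lambda>m. q ^ m * D / (1 - q)) \<longlonglongrightarrow> 0"
    using LIMSEQ_realpow_zero[of q] q by (auto intro!: tendsto_eq_intros)
  have "\<exists>M. \<forall>m\<ge>M. \<forall>l\<ge>M. dst (s m) (s l) < e" if e: "0 < e" for e
  proof -
    obtain M where "\<forall>m\<ge>M. norm (q ^ m * D / (1 - q) - 0) < e"
      using LIMSEQ_D[OF lim e] by blast
    then have M: "q ^ m * D / (1 - q) < e" if "m \<ge> M" for m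
      using that q D by (metis abs_ge_self diff_zero le_less_trans real_norm_def)
    have "dst (s m) (s l) < e" if "m \<ge> M" "l \<ge> M" for m l
    proof (cases "m \<le> l")
      case True
      then have "dst (s m) (s l) \<le> q ^ m * D / (1 - q)"
        using far[of m "l - m"] dst_commute[OF sU sU, of m l] by simp
      then show ?thesis using M[OF that(1)] by simp
    next
      case False
      then have "dst (s m) (s l) \<le> q ^ l * D / (1 - q)" using far[of l "m - l"] by simp
      then show ?thesis using M[OF that(2)] by simp
    qed
    then show ?thesis by blast
  qed
  from complete[OF fd sU this] obtain x where x: "x \<in> U" and sx: "(\<lambda>m. dst (s m) x) \<longlonglongrightarrow> 0" by blast
  have xW: "x \<in> W" by (rule Wc[OF sW x sx])
  have JU: "J x \<in> U" using J[OF xW] W by blast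
  have "dst (J x) x \<le> q * dst (s m) x + dst (s (Suc m)) x" for m
  proof -
    have "dst (J x) x \<le> dst (J x) (s (Suc m)) + dst (s (Suc m)) x"
      using dst_triangle JU sU x by blast
    moreover have "dst (J x) (s (Suc m)) \<le> q * dst (s m) x"
      using q(3)[OF xW sW] sJ dst_commute[OF x sU] by metis
    ultimately show ?thesis by linarith
  qed
  moreover have "(\<lambda>m. q * dst (s m) x + dst (s (Suc m)) x) \<longlonglongrightarrow> q * 0 + 0"
    by (intro tendsto_intros sx LIMSEQ_Suc)
  ultimately have "dst (J x) x \<le> 0" by (intro LIMSEQ_le_const) auto
  with nrm_nonneg[OF closed[OF JU x, of "-1"]] have "dst (J x) x = 0" by linarith
  then show ?thesis using xW by blast
qed

end

section \<open>The twofold saddle point problem\<close>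

definition prod_lin :: "(real \<Rightarrow> 'a \<Rightarrow> 'a \<Rightarrow> 'a) \<Rightarrow> (real \<Rightarrow> 'b \<Rightarrow> 'b \<Rightarrow> 'b) \<Rightarrow>
    real \<Rightarrow> 'a \<times> 'b \<Rightarrow> 'a \<times> 'b \<Rightarrow> 'a \<times> 'b" where
  "prod_lin l1 l2 c x y = (l1 c (fst x) (fst y), l2 c (snd x) (snd y))"

definition prod_ip :: "('a \<Rightarrow> 'a \<Rightarrow> real) \<Rightarrow> ('b \<Rightarrow> 'b \<Rightarrow> real) \<Rightarrow> 'a \<times> 'b \<Rightarrow> 'a \<times> 'b \<Rightarrow> real" where
  "prod_ip i1 i2 x y = i1 (fst x) (fst y) + i2 (snd x) (snd y)"

lemma semi_inner_prod:
  assumes "semi_inner U1 l1 i1" "semi_inner U2 l2 i2"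
  shows "semi_inner (U1 \<times> U2) (prod_lin l1 l2) (prod_ip i1 i2)"
proof -
  interpret S1: semi_inner U1 l1 i1 by fact
  interpret S2: semi_inner U2 l2 i2 by fact
  show ?thesis
  proof
    show "U1 \<times> U2 \<noteq> {}" using S1.nonempty S2.nonempty by auto
  next
    fix x y c assume "x \<in> U1 \<times> U2" "y \<in> U1 \<times> U2"
    then show "prod_lin l1 l2 c x y \<in> U1 \<times> U2" "prod_ip i1 i2 x y = prod_ip i1 i2 y x"
      by (auto simp: prod_lin_def prod_ip_def S1.closed S2.closed S1.ip_sym S2.ip_sym)
  next
    fix x y z c assume "x \<in> U1 \<times> U2" "y \<in> U1 \<times> U2" "z \<in> U1 \<times> U2"
    then show "prod_ip i1 i2 (prod_lin l1 l2 c x y) z = prod_ip i1 i2 x z + c * prod_ip i1 i2 y z"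
      by (auto simp: prod_lin_def prod_ip_def S1.ip_lin S2.ip_lin distrib_left)
  next
    fix x assume "x \<in> U1 \<times> U2"
    then show "0 \<le> prod_ip i1 i2 x x" by (auto simp: prod_ip_def S1.ip_pos S2.ip_pos)
  qed
qed

lemma fin_dim_prod:
  assumes "semi_inner U1 l1 i1" "semi_inner U2 l2 i2" "fin_dim U1 l1 i1" "fin_dim U2 l2 i2"
  shows "fin_dim (U1 \<times> U2) (prod_lin l1 l2) (prod_ip i1 i2)"
proof -
  obtain F1 where F1: "finite F1" "\<And>l. l \<in> F1 \<Longrightarrow> linear_on U1 l1 l"
      "\<And>x. x \<in> U1 \<Longrightarrow> (\<forall>l\<in>F1. l x = 0) \<Longrightarrow> i1 x x = 0"
    using assms(3) unfolding fin_dim_def separating_def by metis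
  obtain F2 where F2: "finite F2" "\<And>l. l \<in> F2 \<Longrightarrow> linear_on U2 l2 l"
      "\<And>x. x \<in> U2 \<Longrightarrow> (\<forall>l\<in>F2. l x = 0) \<Longrightarrow> i2 x x = 0"
    using assms(4) unfolding fin_dim_def separating_def by metis
  let ?F = "(\<lambda>l x. l (fst x)) ` F1 \<union> (\<lambda>l x. l (snd x)) ` F2"
  have "separating (U1 \<times> U2) (prod_lin l1 l2) (prod_ip i1 i2) ?F"
    unfolding separating_def
  proof (intro conjI ballI impI)
    show "finite ?F" using F1 F2 by simp
    show "linear_on (U1 \<times> U2) (prod_lin l1 l2) l" if "l \<in> ?F" for l
      using that F1(2) F2(2) by (auto simp: linear_on_def prod_lin_def)
    show "prod_ip i1 i2 x x = 0" if x: "x \<in> U1 \<times> U2" and l: "\<forall>l\<in>?F. l x = 0" for x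
    proof -
      have "i1 (fst x) (fst x) = 0" using x l by (intro F1(3)) auto
      moreover have "i2 (snd x) (snd x) = 0" using x l by (intro F2(3)) auto
      ultimately show ?thesis by (simp add: prod_ip_def)
    qed
  qed
  then show ?thesis unfolding fin_dim_def by blast
qed

lemma semi_inner_subspace:
  assumes "semi_inner U lin ip" "V \<subseteq> U" "V \<noteq> {}" "\<And>x y c. x \<in> V \<Longrightarrow> y \<in> V \<Longrightarrow> lin c x y \<in> V"
  shows "semi_inner V lin ip"
proof -
  interpret S: semi_inner U lin ip by fact
  have V: "x \<in> U" if "x \<in> V" for x using that assms(2) by blast
  show ?thesis
  proof
    show "ip x y = ip y x" if "x \<in> V" "y \<in> V" for x y using S.ip_sym V that by blast
  qed (simp_all add: assms(3,4) V S.ip_lin S.ip_pos)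
qed

lemma fin_dim_subspace:
  assumes "fin_dim U lin ip" "V \<subseteq> U" shows "fin_dim V lin ip"
proof -
  obtain F where F: "finite F" "\<And>l. l \<in> F \<Longrightarrow> linear_on U lin l"
      "\<And>x. x \<in> U \<Longrightarrow> (\<forall>l\<in>F. l x = 0) \<Longrightarrow> ip x x = 0"
    using assms(1) unfolding fin_dim_def separating_def by metis
  have "\<And>l. l \<in> F \<Longrightarrow> linear_on V lin l"
    using F(2) assms(2) unfolding linear_on_def by (simp add: subset_iff)
  moreover have "\<And>x. x \<in> V \<Longrightarrow> (\<forall>l\<in>F. l x = 0) \<Longrightarrow> ip x x = 0"
    using F(3) assms(2) by blast
  ultimately have "separating V lin ip F" using F(1) by (auto simp: separating_def)
  then show ?thesis unfolding fin_dim_def by blast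
qed

lemma le_of_square_le:
  fixes x c :: real assumes "x * x \<le> c * x" "0 \<le> x" "0 \<le> c" shows "x \<le> c"
  using assms by (cases "x = 0") auto

text \<open>The abstract twofold saddle point structure. The form \<open>b2\<close> satisfies an inf-sup condition, written
  without quotients as a statement about upper bounds \<open>m\<close>. The kernel of \<open>b2\<close> embeds into \<open>X\<close>
  in such a way that \<open>b1\<close> is minus the inner product with the embedded element; this makes the
  embedding isometric and gives the inf-sup condition of \<open>b1\<close> on the kernel with constant one.\<close>

locale saddle =
  X: semi_inner X lX iX + Y: semi_inner Y lY iY + Z: semi_inner Z lZ iZ
  for X :: "'x set" and lX iX and Y :: "'y set" and lY iY and Z :: "'z set" and lZ iZ +
  fixes b1 :: "'x \<Rightarrow> 'y \<Rightarrow> real" and b2 :: "'y \<Rightarrow> 'z \<Rightarrow> real" and emb :: "'y \<Rightarrow> 'x" and beta :: real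
  assumes fdX: "fin_dim X lX iX" and fdY: "fin_dim Y lY iY" and fdZ: "fin_dim Z lZ iZ"
    and b1_left: "t \<in> Y \<Longrightarrow> linear_on X lX (\<lambda>e. b1 e t)"
    and b1_right: "e \<in> X \<Longrightarrow> linear_on Y lY (b1 e)"
    and b1_bound: "e \<in> X \<Longrightarrow> t \<in> Y \<Longrightarrow> \<bar>b1 e t\<bar> \<le> X.nrm e * Y.nrm t"
    and b2_left: "v \<in> Z \<Longrightarrow> linear_on Y lY (\<lambda>t. b2 t v)"
    and b2_right: "t \<in> Y \<Longrightarrow> linear_on Z lZ (b2 t)"
    and b2_bound: "t \<in> Y \<Longrightarrow> v \<in> Z \<Longrightarrow> \<bar>b2 t v\<bar> \<le> Y.nrm t * Z.nrm v"
    and beta_pos: "0 < beta"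
    and inf_sup: "v \<in> Z \<Longrightarrow> 0 \<le> m \<Longrightarrow> (\<And>t. t \<in> Y \<Longrightarrow> b2 t v \<le> m * Y.nrm t) \<Longrightarrow>
                  beta * Z.nrm v \<le> m"
    and emb_in: "t \<in> Y \<Longrightarrow> (\<And>v. v \<in> Z \<Longrightarrow> b2 t v = 0) \<Longrightarrow> emb t \<in> X"
    and emb_b1: "t \<in> Y \<Longrightarrow> (\<And>v. v \<in> Z \<Longrightarrow> b2 t v = 0) \<Longrightarrow> t' \<in> Y \<Longrightarrow> b1 (emb t) t' = - iY t t'"
    and emb_ip: "t \<in> Y \<Longrightarrow> (\<And>v. v \<in> Z \<Longrightarrow> b2 t v = 0) \<Longrightarrow> e \<in> X \<Longrightarrow> b1 e t = - iX e (emb t)"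
begin

definition ker :: "'y set" where "ker = {t \<in> Y. \<forall>v\<in>Z. b2 t v = 0}"

lemma ker_Y: "t \<in> ker \<Longrightarrow> t \<in> Y" by (simp add: ker_def)

lemma ker_b2: "t \<in> ker \<Longrightarrow> v \<in> Z \<Longrightarrow> b2 t v = 0" by (simp add: ker_def)

lemma ker_emb:
  assumes "t \<in> ker"
  shows "emb t \<in> X" "t' \<in> Y \<Longrightarrow> b1 (emb t) t' = - iY t t'" "e \<in> X \<Longrightarrow> b1 e t = - iX e (emb t)"
  using assms emb_in emb_b1 emb_ip by (simp_all add: ker_def)

lemma ker_semi_inner: "semi_inner ker lY iY"
proof (rule semi_inner_subspace[OF Y.semi_inner_axioms])
  obtain z where "z \<in> Y" "\<forall>f. linear_on Y lY f \<longrightarrow> f z = 0" using Y.ex_zero by blast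
  then show "ker \<noteq> {}" using b2_left by (auto simp: ker_def)
  show "lY c x y \<in> ker" if "x \<in> ker" "y \<in> ker" for x y c
    using that linear_onD[OF b2_left] Y.closed by (simp add: ker_def)
qed (auto simp: ker_def)

sublocale K: semi_inner ker lY iY by (rule ker_semi_inner)

lemma fd_ker: "fin_dim ker lY iY"
  by (rule fin_dim_subspace[OF fdY]) (auto simp: ker_def)

lemma emb_nrm: "t \<in> ker \<Longrightarrow> X.nrm (emb t) = Y.nrm t"
  using ker_emb(2)[of t t] ker_emb(3)[of t "emb t"] ker_emb(1) ker_Y
  by (simp add: X.nrm_def Y.nrm_def)

text \<open>The constant \<open>M\<close> controls the form only when one argument lies in the embedded kernel.
  In the application the permeability term vanishes there, so \<open>M\<close> does not see any bound of the
  permeability; of \<open>B\<close> only the existence matters.\<close>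

definition form :: "('x \<Rightarrow> 'x \<Rightarrow> real) \<Rightarrow> real \<Rightarrow> real \<Rightarrow> bool" where
  "form a ca M \<longleftrightarrow> 0 < ca \<and> 0 \<le> M \<and>
     (\<forall>e\<in>X. linear_on X lX (\<lambda>d. a d e) \<and> linear_on X lX (a e) \<and> ca * iX e e \<le> a e e) \<and>
     (\<forall>t\<in>ker. \<forall>e\<in>X. \<bar>a (emb t) e\<bar> \<le> M * Y.nrm t * X.nrm e \<and> \<bar>a e (emb t)\<bar> \<le> M * Y.nrm t * X.nrm e) \<and>
     (\<exists>B. \<forall>d\<in>X. \<forall>e\<in>X. \<bar>a d e\<bar> \<le> B * X.nrm d * X.nrm e)"

definition sol where
  "sol a G H F d s u \<longleftrightarrow> d \<in> X \<and> s \<in> Y \<and> u \<in> Z \<and> (\<forall>e\<in>X. a d e + b1 e s = G e) \<and>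
     (\<forall>t\<in>Y. b1 d t + b2 t u = H t) \<and> (\<forall>v\<in>Z. b2 s v = F v)"

text \<open>Split \<open>d\<close> and \<open>s\<close> along the kernel of \<open>b2\<close>. The second equation determines the kernel part of
  \<open>d\<close>, and the third bounds the complementary part of \<open>s\<close> by the inf-sup condition. Testing the
  first equation with the complementary part of \<open>d\<close> removes the kernel part of \<open>s\<close>, so that
  coercivity applies; testing it with the embedded kernel part of \<open>s\<close> bounds this part.\<close>

lemma a_priori:
  assumes a: "form a ca M" and s: "sol a G H F d s u"
    and g: "0 \<le> g" "\<And>e. e \<in> X \<Longrightarrow> \<bar>G e\<bar> \<le> g * X.nrm e"
    and h: "0 \<le> h" "\<And>t. t \<in> Y \<Longrightarrow> \<bar>H t\<bar> \<le> h * Y.nrm t"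
    and f: "0 \<le> f" "\<And>v. v \<in> Z \<Longrightarrow> \<bar>F v\<bar> \<le> f * Z.nrm v"
    and H_lin: "linear_on Y lY H"
  shows "X.nrm d \<le> (g + f / beta + M * h) / ca + h"
    and "Y.nrm s \<le> M * X.nrm d + g + f / beta"
    and "Z.nrm u \<le> (h + X.nrm d) / beta"
proof -
  note sD = s[unfolded sol_def]
  have d: "d \<in> X" and sY: "s \<in> Y" and u: "u \<in> Z" using sD by auto
  have eq1: "a d e + b1 e s = G e" if "e \<in> X" for e using sD that by blast
  have eq2: "b1 d t + b2 t u = H t" if "t \<in> Y" for t using sD that by blast
  have eq3: "b2 s v = F v" if "v \<in> Z" for v using sD that by blast
  have ca: "0 < ca" and M: "0 \<le> M" using a by (auto simp: form_def)
  have a_left: "linear_on X lX (\<lambda>d. a d e)" and a_right: "linear_on X lX (a e)"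
    and coer: "ca * iX e e \<le> a e e" if "e \<in> X" for e using a that by (auto simp: form_def)
  have aM: "\<bar>a (emb t) e\<bar> \<le> M * Y.nrm t * X.nrm e" "\<bar>a e (emb t)\<bar> \<le> M * Y.nrm t * X.nrm e"
    if "t \<in> ker" "e \<in> X" for t e using a that by (auto simp: form_def)
  \<comment> \<open>the part of \<open>d\<close> in the embedded kernel is determined by the second equation\<close>
  have "\<exists>t\<in>ker. \<forall>t'\<in>ker. iY t t' = - H t'"
  proof (rule K.riesz[OF fd_ker])
    show "linear_on ker lY (\<lambda>t. - H t)" using H_lin ker_Y by (simp add: linear_on_def)
    show "- H x = 0" if "x \<in> ker" "K.nrm x = 0" for x
      using h(2)[of x] that ker_Y by (simp add: K.nrm_def Y.nrm_def)
  qed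
  then obtain td where td: "td \<in> ker" "\<And>t. t \<in> ker \<Longrightarrow> iY td t = - H t" by blast
  have tdY: "td \<in> Y" and etd: "emb td \<in> X" using td(1) ker_Y ker_emb(1) by auto
  have "Y.nrm td * Y.nrm td \<le> h * Y.nrm td"
    using td(2)[OF td(1)] h(2)[OF tdY] Y.nrm_sq[OF tdY] by (simp add: power2_eq_square)
  then have ntd: "Y.nrm td \<le> h" by (rule le_of_square_le) (use tdY h in auto)
  define d0 where "d0 = lX (-1) d (emb td)"
  have d0: "d0 \<in> X" using d etd by (simp add: d0_def X.closed)
  have d0_orth: "b1 d0 t = 0" if t: "t \<in> ker" for t
  proof -
    have "b1 d0 t = b1 d t - b1 (emb td) t"
      using linear_onD[OF b1_left[OF ker_Y[OF t]] d etd, of "-1"] by (simp add: d0_def)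
    also have "b1 d t = H t" using eq2[OF ker_Y[OF t]] ker_b2[OF t u] by simp
    also have "b1 (emb td) t = H t" using ker_emb(2)[OF td(1) ker_Y[OF t]] td(2)[OF t] by simp
    finally show ?thesis by simp
  qed
  have "\<exists>t\<in>ker. \<forall>t'\<in>ker. iY t t' = iY s t'"
  proof (rule K.riesz[OF fd_ker])
    show "linear_on ker lY (iY s)" using Y.linear_ip[OF sY] ker_Y by (simp add: linear_on_def)
    show "iY s x = 0" if "x \<in> ker" "K.nrm x = 0" for x
      using Y.ip_null[of x s] that ker_Y sY Y.ip_sym[of x s] by (simp add: K.nrm_def Y.nrm_def)
  qed
  then obtain s0 where s0: "s0 \<in> ker" "\<And>t. t \<in> ker \<Longrightarrow> iY s0 t = iY s t" by blast
  have s0Y: "s0 \<in> Y" using s0(1) ker_Y by auto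
  define s1 where "s1 = lY (-1) s s0"
  have s1: "s1 \<in> Y" using sY s0Y by (simp add: s1_def Y.closed)
  have s1_orth: "iY s1 t = 0" if "t \<in> ker" for t
    using Y.ip_lin[OF sY s0Y ker_Y[OF that], of "-1"] s0(2)[OF that] by (simp add: s1_def)
  \<comment> \<open>the inf-sup condition, transposed: the complement of the kernel is controlled by \<open>F\<close>\<close>
  have "\<exists>v\<in>Z. \<forall>t\<in>Y. b2 t v = iY s1 t"
  proof (rule Z.bilinear_solve[OF fdZ Y.closed b2_right b2_left _ Y.linear_ip[OF s1]])
    show "b2 t v = 0" if "v \<in> Z" "t \<in> Y" "Z.nrm v = 0" for v t
      using b2_bound[OF that(2,1)] that(3) by simp
    show "iY s1 t = 0" if "t \<in> Y" "\<forall>v\<in>Z. b2 t v = 0" for t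
      using that by (intro s1_orth) (auto simp: ker_def)
  qed
  then obtain v where v: "v \<in> Z" "\<And>t. t \<in> Y \<Longrightarrow> b2 t v = iY s1 t" by blast
  have "beta * Z.nrm v \<le> Y.nrm s1"
  proof (rule inf_sup[OF v(1)])
    show "b2 t v \<le> Y.nrm s1 * Y.nrm t" if "t \<in> Y" for t
      using Y.cauchy_schwarz[OF s1 that] v(2)[OF that] by simp
  qed (use s1 in simp)
  then have nv: "Z.nrm v \<le> Y.nrm s1 / beta" using beta_pos by (simp add: field_simps)
  have "Y.nrm s1 * Y.nrm s1 = b2 s1 v"
    using v(2)[OF s1] Y.nrm_sq[OF s1] by (simp add: power2_eq_square)
  also have "\<dots> = F v"
    using linear_onD[OF b2_left[OF v(1)] sY s0Y, of "-1"] eq3[OF v(1)] ker_b2[OF s0(1) v(1)]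
    by (simp add: s1_def)
  also have "\<dots> \<le> f * Z.nrm v" using f(2)[OF v(1)] by simp
  also have "\<dots> \<le> f * (Y.nrm s1 / beta)" using nv f(1) by (rule mult_left_mono)
  finally have "Y.nrm s1 * Y.nrm s1 \<le> f / beta * Y.nrm s1" by simp
  then have ns1: "Y.nrm s1 \<le> f / beta"
    by (rule le_of_square_le) (use s1 f beta_pos in auto)
  \<comment> \<open>testing with the complementary part of \<open>d\<close>\<close>
  have ad0: "a d0 d0 = G d0 - b1 d0 s1 - a (emb td) d0"
  proof -
    have "b1 d0 s1 = b1 d0 s"
      using linear_onD[OF b1_right[OF d0] sY s0Y, of "-1"] d0_orth[OF s0(1)] by (simp add: s1_def)
    moreover have "a d0 d0 = a d d0 - a (emb td) d0"
      using linear_onD[OF a_left[OF d0] d etd, of "-1"] by (simp add: d0_def)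
    ultimately show ?thesis using eq1[OF d0] by simp
  qed
  have "ca * (X.nrm d0 * X.nrm d0) \<le> a d0 d0"
    using coer[OF d0] X.nrm_sq[OF d0] by (simp add: power2_eq_square)
  also have "\<dots> \<le> g * X.nrm d0 + X.nrm d0 * Y.nrm s1 + M * Y.nrm td * X.nrm d0"
    using ad0 g(2)[OF d0] b1_bound[OF d0 s1] aM(1)[OF td(1) d0] by linarith
  also have "\<dots> \<le> (g + f / beta + M * h) * X.nrm d0"
  proof -
    have "X.nrm d0 * Y.nrm s1 \<le> X.nrm d0 * (f / beta)"
      using ns1 d0 by (intro mult_left_mono) auto
    moreover have "M * Y.nrm td * X.nrm d0 \<le> M * h * X.nrm d0"
      using ntd d0 M by (intro mult_right_mono mult_left_mono) auto
    ultimately show ?thesis by (simp add: algebra_simps)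
  qed
  finally have "X.nrm d0 * X.nrm d0 \<le> (g + f / beta + M * h) / ca * X.nrm d0"
    using ca by (simp add: field_simps)
  then have nd0: "X.nrm d0 \<le> (g + f / beta + M * h) / ca"
    by (rule le_of_square_le) (use d0 g(1) f(1) h(1) M ca beta_pos in auto)
  have "X.nrm d \<le> X.nrm (emb td) + X.nrm d0"
    using X.nrm_le_dst[OF d etd] by (simp add: d0_def)
  then show "X.nrm d \<le> (g + f / beta + M * h) / ca + h"
    using nd0 ntd emb_nrm[OF td(1)] by simp
  \<comment> \<open>testing with the embedded kernel part of \<open>s\<close>\<close>
  have es0: "emb s0 \<in> X" by (rule ker_emb(1)[OF s0(1)])
  have "b1 (emb s0) s = - iY s0 s" using ker_emb(2)[OF s0(1) sY] .
  also have "iY s0 s = Y.nrm s0 * Y.nrm s0"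
    using s0(2)[OF s0(1)] Y.ip_sym[OF s0Y sY] Y.nrm_sq[OF s0Y] by (simp add: power2_eq_square)
  finally have "Y.nrm s0 * Y.nrm s0 = a d (emb s0) - G (emb s0)" using eq1[OF es0] by simp
  also have "\<dots> \<le> (M * X.nrm d + g) * Y.nrm s0"
    using aM(2)[OF s0(1) d] g(2)[OF es0] emb_nrm[OF s0(1)] by (simp add: algebra_simps)
  finally have "Y.nrm s0 \<le> M * X.nrm d + g"
    by (rule le_of_square_le) (use s0Y M d g(1) in auto)
  moreover have "Y.nrm s \<le> Y.nrm s0 + Y.nrm s1"
    using Y.nrm_le_dst[OF sY s0Y] by (simp add: s1_def)
  ultimately show "Y.nrm s \<le> M * X.nrm d + g + f / beta" using ns1 by simp
  have "beta * Z.nrm u \<le> h + X.nrm d"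
  proof (rule inf_sup[OF u])
    show "b2 t u \<le> (h + X.nrm d) * Y.nrm t" if t: "t \<in> Y" for t
      using eq2[OF t] h(2)[OF t] b1_bound[OF d t] by (simp add: algebra_simps)
  qed (use h(1) d in simp)
  then show "Z.nrm u \<le> (h + X.nrm d) / beta" using beta_pos by (simp add: field_simps)
qed

lemma sol_diff:
  assumes a: "form a ca M" and a': "form a' ca M" and s: "sol a G H F d s u" and s': "sol a' G H F d' s' u'"
  shows "sol a (\<lambda>e. a' d' e - a d' e) (\<lambda>t. 0) (\<lambda>v. 0) (lX (-1) d d') (lY (-1) s s') (lZ (-1) u u')"
proof -
  have m: "d \<in> X" "s \<in> Y" "u \<in> Z" "d' \<in> X" "s' \<in> Y" "u' \<in> Z" using s s' by (auto simp: sol_def)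
  show ?thesis
    unfolding sol_def
  proof (intro conjI ballI)
    fix e assume e: "e \<in> X"
    have "linear_on X lX (\<lambda>d. a d e)" using a e by (simp add: form_def)
    from linear_onD[OF this m(1,4), of "-1"] linear_onD[OF b1_right[OF e] m(2,5), of "-1"]
    show "a (lX (-1) d d') e + b1 e (lY (-1) s s') = a' d' e - a d' e"
      using s s' e by (simp add: sol_def) (smt (verit))
  next
    fix t assume t: "t \<in> Y"
    from linear_onD[OF b1_left[OF t] m(1,4), of "-1"] linear_onD[OF b2_right[OF t] m(3,6), of "-1"]
    show "b1 (lX (-1) d d') t + b2 t (lZ (-1) u u') = 0"
      using s s' t by (simp add: sol_def) (smt (verit))
  next
    fix v assume v: "v \<in> Z"
    from linear_onD[OF b2_left[OF v] m(2,5), of "-1"]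
    show "b2 (lY (-1) s s') v = 0" using s s' v by (simp add: sol_def)
  qed (use m in \<open>simp_all add: X.closed Y.closed Z.closed\<close>)
qed

text \<open>The difference of two solutions that belong to two forms solves the problem of the first form
  with the second and third data zero. Of the a priori bound only the coercivity part \<open>g / ca\<close>
  is left, which keeps the Lipschitz constant of the solution operator small.\<close>

lemma sol_stability:
  assumes a: "form a ca M" and a': "form a' ca M" and s: "sol a G H F d s u" and s': "sol a' G H F d' s' u'"
    and g: "0 \<le> g" "\<And>e. e \<in> X \<Longrightarrow> \<bar>a' d' e - a d' e\<bar> \<le> g * X.nrm e"
  shows "X.dst d d' \<le> g / ca" and "g = 0 \<Longrightarrow> Y.dst s s' = 0" and "g = 0 \<Longrightarrow> Z.dst u u' = 0"
proof -
  note b = a_priori[OF a sol_diff[OF a a' s s'] g, of 0 0]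
  have m: "d \<in> X" "s \<in> Y" "u \<in> Z" "d' \<in> X" "s' \<in> Y" "u' \<in> Z" using s s' by (auto simp: sol_def)
  show d: "X.dst d d' \<le> g / ca" using b(1) by (simp add: linear_on_def)
  show "Y.dst s s' = 0" if "g = 0"
    using b(2) d that X.nrm_nonneg[OF X.closed[OF m(1,4)], of "-1"] Y.nrm_nonneg[OF Y.closed[OF m(2,5)], of "-1"]
    by (simp add: linear_on_def)
  show "Z.dst u u' = 0" if "g = 0"
    using b(3) d that X.nrm_nonneg[OF X.closed[OF m(1,4)], of "-1"] Z.nrm_nonneg[OF Z.closed[OF m(3,6)], of "-1"]
    by (simp add: linear_on_def)
qed

lemma sol_unique:
  assumes "form a ca M" "sol a G H F d s u" "sol a G H F d' s' u'"
  shows "X.dst d d' = 0" "Y.dst s s' = 0" "Z.dst u u' = 0"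
proof -
  note b = sol_stability[OF assms(1,1,2,3), of 0]
  have "d \<in> X" "d' \<in> X" using assms by (auto simp: sol_def)
  then show "X.dst d d' = 0" using b(1) X.nrm_nonneg[OF X.closed, of d d' "-1"] by simp
  show "Y.dst s s' = 0" "Z.dst u u' = 0" using b(2,3) by simp_all
qed

text \<open>Existence is reduced to uniqueness for the adjoint problem, which holds because the
  total form is symmetric up to the transposition of \<open>a\<close>.\<close>

lemma sol_exists:
  assumes a: "form a ca M" and "linear_on X lX G" "linear_on Y lY H" "linear_on Z lZ F"
    and G0: "\<And>e. e \<in> X \<Longrightarrow> X.nrm e = 0 \<Longrightarrow> G e = 0"
    and H0: "\<And>t. t \<in> Y \<Longrightarrow> Y.nrm t = 0 \<Longrightarrow> H t = 0"
    and F0: "\<And>v. v \<in> Z \<Longrightarrow> Z.nrm v = 0 \<Longrightarrow> F v = 0"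
  shows "\<exists>d s u. sol a G H F d s u"
proof -
  define U where "U = X \<times> Y \<times> Z"
  define lU where "lU = prod_lin lX (prod_lin lY lZ)"
  define iU where "iU = prod_ip iX (prod_ip iY iZ)"
  interpret U: semi_inner U lU iU
    unfolding U_def lU_def iU_def
    by (intro semi_inner_prod X.semi_inner_axioms Y.semi_inner_axioms Z.semi_inner_axioms)
  have fdU: "fin_dim U lU iU"
    unfolding U_def lU_def iU_def
    by (intro fin_dim_prod semi_inner_prod X.semi_inner_axioms Y.semi_inner_axioms
          Z.semi_inner_axioms fdX fdY fdZ)
  obtain B where B: "\<And>d e. d \<in> X \<Longrightarrow> e \<in> X \<Longrightarrow> \<bar>a d e\<bar> \<le> B * X.nrm d * X.nrm e"
    using a unfolding form_def by blast
  have a_left: "linear_on X lX (\<lambda>d. a d e)" and a_right: "linear_on X lX (a e)"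
    and coer: "ca * iX e e \<le> a e e" if "e \<in> X" for e using a that by (auto simp: form_def)
  have ca: "0 < ca" using a by (simp add: form_def)
  define A where "A = (\<lambda>(d, s, u) (e, t, v). a d e + b1 e s + b1 d t + b2 t u + b2 s v)"
  define R where "R = (\<lambda>(e, t, v). G e + H t + F v)"
  obtain x0 where x0: "x0 \<in> X" "\<And>f. linear_on X lX f \<Longrightarrow> f x0 = 0" using X.ex_zero by blast
  obtain y0 where y0: "y0 \<in> Y" "\<And>f. linear_on Y lY f \<Longrightarrow> f y0 = 0" using Y.ex_zero by blast
  obtain z0 where z0: "z0 \<in> Z" "\<And>f. linear_on Z lZ f \<Longrightarrow> f z0 = 0" using Z.ex_zero by blast
  note z = x0(2)[OF a_left] x0(2)[OF a_right] x0(2)[OF b1_left] y0(2)[OF b1_right]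
      y0(2)[OF b2_left] z0(2)[OF b2_right] x0(2)[OF assms(2)] y0(2)[OF assms(3)] z0(2)[OF assms(4)]
  have "\<exists>x\<in>U. \<forall>y\<in>U. A x y = R y"
  proof (rule U.bilinear_solve[OF fdU U.closed])
    fix y assume y: "y \<in> U"
    then obtain e t v where [simp]: "y = (e, t, v)" and m: "e \<in> X" "t \<in> Y" "v \<in> Z"
      by (auto simp: U_def)
    show "linear_on U lU (\<lambda>x. A x y)"
      unfolding linear_on_def U_def lU_def
      using linear_onD[OF a_left[OF m(1)]] linear_onD[OF b1_right[OF m(1)]]
        linear_onD[OF b1_left[OF m(2)]] linear_onD[OF b2_right[OF m(2)]] linear_onD[OF b2_left[OF m(3)]]
      by (auto simp: A_def prod_lin_def algebra_simps)
    show "linear_on U lU (A y)"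
      unfolding linear_on_def U_def lU_def
      using linear_onD[OF a_right[OF m(1)]] linear_onD[OF b1_right[OF m(1)]]
        linear_onD[OF b1_left[OF m(2)]] linear_onD[OF b2_right[OF m(2)]] linear_onD[OF b2_left[OF m(3)]]
      by (auto simp: A_def prod_lin_def algebra_simps)
  next
    fix x y assume x: "x \<in> U" and y: "y \<in> U" and n: "U.nrm x = 0"
    obtain e t v where [simp]: "y = (e, t, v)" and m: "e \<in> X" "t \<in> Y" "v \<in> Z"
      using y by (auto simp: U_def)
    obtain d s u where [simp]: "x = (d, s, u)" and m': "d \<in> X" "s \<in> Y" "u \<in> Z"
      using x by (auto simp: U_def)
    have "iX d d + (iY s s + iZ u u) = 0" using n unfolding U.nrm_def by (simp add: iU_def prod_ip_def)
    then have "iX d d = 0" "iY s s = 0" "iZ u u = 0"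
      using X.ip_pos[OF m'(1)] Y.ip_pos[OF m'(2)] Z.ip_pos[OF m'(3)] by linarith+
    then have "X.nrm d = 0" "Y.nrm s = 0" "Z.nrm u = 0"
      by (simp_all add: X.nrm_def Y.nrm_def Z.nrm_def)
    then show "A x y = 0"
      using B[OF m'(1) m(1)] b1_bound[OF m(1) m'(2)] b1_bound[OF m'(1) m(2)]
        b2_bound[OF m(2) m'(3)] b2_bound[OF m'(2) m(3)] by (simp add: A_def)
  next
    show "linear_on U lU R"
      unfolding linear_on_def U_def lU_def
      using linear_onD[OF assms(2)] linear_onD[OF assms(3)] linear_onD[OF assms(4)]
      by (auto simp: R_def prod_lin_def algebra_simps)
  next
    fix y assume y: "y \<in> U" and 0: "\<forall>x\<in>U. A x y = 0"
    obtain e t v where [simp]: "y = (e, t, v)" and m: "e \<in> X" "t \<in> Y" "v \<in> Z"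
      using y by (auto simp: U_def)
    have c1: "a d e + b1 d t = 0" if d: "d \<in> X" for d
      using 0[rule_format, of "(d, y0, z0)"] d y0(1) z0(1) m z by (simp add: A_def U_def)
    have c2: "b1 e s + b2 s v = 0" if s: "s \<in> Y" for s
      using 0[rule_format, of "(x0, s, z0)"] s x0(1) z0(1) m z by (simp add: A_def U_def)
    have c3: "b2 t u = 0" if u: "u \<in> Z" for u
      using 0[rule_format, of "(x0, y0, u)"] u x0(1) y0(1) m z by (simp add: A_def U_def)
    have tk: "t \<in> ker" using m(2) c3 by (simp add: ker_def)
    have "a e e = 0" using c1[OF m(1)] c2[OF m(2)] c3[OF m(3)] by simp
    then have "iX e e = 0" using coer[OF m(1)] X.ip_pos[OF m(1)] ca
      by (simp add: mult_le_0_iff)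
    then have ne: "X.nrm e = 0" by (simp add: X.nrm_def)
    have "b1 (emb t) t = 0"
      using c1[OF ker_emb(1)[OF tk]] B[OF ker_emb(1)[OF tk] m(1)] ne by simp
    then have nt: "Y.nrm t = 0" using ker_emb(2)[OF tk m(2)] by (simp add: Y.nrm_def)
    have "beta * Z.nrm v \<le> 0"
    proof (rule inf_sup[OF m(3)])
      show "b2 s v \<le> 0 * Y.nrm s" if "s \<in> Y" for s
        using c2[OF that] b1_bound[OF m(1) that] ne by simp
    qed simp
    then have "Z.nrm v = 0" using beta_pos Z.nrm_nonneg[OF m(3)] by (simp add: mult_le_0_iff)
    then show "R y = 0" using G0[OF m(1) ne] H0[OF m(2) nt] F0[OF m(3)] by (simp add: R_def)
  qed
  then obtain x where x: "x \<in> U" and Ax: "\<And>y. y \<in> U \<Longrightarrow> A x y = R y" by blast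
  obtain d s u where x_eq: "x = (d, s, u)" and m: "d \<in> X" "s \<in> Y" "u \<in> Z"
    using x by (auto simp: U_def)
  have eq: "a d e + b1 e s + b1 d t + b2 t u + b2 s v = G e + H t + F v"
    if "e \<in> X" "t \<in> Y" "v \<in> Z" for e t v
    using Ax[of "(e, t, v)"] that by (simp add: U_def A_def R_def x_eq)
  have "sol a G H F d s u"
    unfolding sol_def
  proof (intro conjI ballI m)
    show "a d e + b1 e s = G e" if "e \<in> X" for e
      using eq[OF that y0(1) z0(1)] that m z by simp
    show "b1 d t + b2 t u = H t" if "t \<in> Y" for t
      using eq[OF x0(1) that z0(1)] that m z by simp
    show "b2 s v = F v" if "v \<in> Z" for v
      using eq[OF x0(1) y0(1) that] that m z by simp
  qed
  then show ?thesis by blast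
qed

end

text \<open>The form now depends on a parameter \<open>w\<close>, in a Lipschitz way. The a priori bound \<open>r\<close> of the
  linearised solutions is also the factor that multiplies the Lipschitz constant, so that the
  solution operator is a contraction when the data are small.\<close>

locale nonlinear_saddle = saddle +
  fixes a :: "'a \<Rightarrow> 'a \<Rightarrow> 'a \<Rightarrow> real" and ca M k g h f r :: real and G H F
  assumes form: "w \<in> X \<Longrightarrow> form (a w) ca M"
    and k: "0 \<le> k"
    and lip: "w \<in> X \<Longrightarrow> w' \<in> X \<Longrightarrow> d \<in> X \<Longrightarrow> e \<in> X \<Longrightarrow>
      \<bar>a w d e - a w' d e\<bar> \<le> k * X.dst w w' * X.nrm d * X.nrm e"
    and G: "linear_on X lX G" "0 \<le> g" "\<And>e. e \<in> X \<Longrightarrow> \<bar>G e\<bar> \<le> g * X.nrm e"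
    and H: "linear_on Y lY H" "0 \<le> h" "\<And>t. t \<in> Y \<Longrightarrow> \<bar>H t\<bar> \<le> h * Y.nrm t"
    and F: "linear_on Z lZ F" "0 \<le> f" "\<And>v. v \<in> Z \<Longrightarrow> \<bar>F v\<bar> \<le> f * Z.nrm v"
    and r: "0 \<le> r" "(g + f / beta + M * h) / ca + h \<le> r"
    and small: "k / ca * r < 1"
begin

lemma lin_exists: "w \<in> X \<Longrightarrow> \<exists>d s u. sol (a w) G H F d s u"
  using sol_exists[OF form G(1) H(1) F(1)] G(3) H(3) F(3) by (metis abs_le_zero_iff mult_zero_right)

lemma lin_bound:
  assumes "w \<in> X" "sol (a w) G H F d s u" shows "X.nrm d \<le> r"
  using a_priori(1)[OF form[OF assms(1)] assms(2) G(2,3) H(2,3) F(2,3) H(1)] r by linarith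

lemma lin_lipschitz:
  assumes w: "w \<in> X" "w' \<in> X" and s: "sol (a w) G H F d s u" "sol (a w') G H F d' s' u'"
  shows "X.dst d d' \<le> k / ca * r * X.dst w w'"
    and "X.dst w w' = 0 \<Longrightarrow> Y.dst s s' = 0" and "X.dst w w' = 0 \<Longrightarrow> Z.dst u u' = 0"
proof -
  have ca: "0 < ca" using form[OF w(1)] by (simp add: form_def)
  have n: "0 \<le> X.dst w w'" using w X.closed by simp
  have d': "d' \<in> X" using s(2) by (simp add: sol_def)
  have "\<bar>a w' d' e - a w d' e\<bar> \<le> k * X.dst w w' * r * X.nrm e" if e: "e \<in> X" for e
  proof -
    have "\<bar>a w' d' e - a w d' e\<bar> \<le> k * X.dst w w' * X.nrm d' * X.nrm e"
      using lip[OF w(1,2) d' e] by linarith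
    also have "\<dots> \<le> k * X.dst w w' * r * X.nrm e"
      using lin_bound[OF w(2) s(2)] k n e by (intro mult_right_mono mult_left_mono) auto
    finally show ?thesis .
  qed
  moreover have "0 \<le> k * X.dst w w' * r" using k n r(1) by simp
  ultimately have *: "X.dst d d' \<le> k * X.dst w w' * r / ca"
    "k * X.dst w w' * r = 0 \<Longrightarrow> Y.dst s s' = 0" "k * X.dst w w' * r = 0 \<Longrightarrow> Z.dst u u' = 0"
    using sol_stability[OF form[OF w(1)] form[OF w(2)] s] by blast+
  show "X.dst d d' \<le> k / ca * r * X.dst w w'" using *(1) by (simp add: mult_ac)
  show "Y.dst s s' = 0" "Z.dst u u' = 0" if "X.dst w w' = 0" using *(2,3) that by simp_all
qed

lemma nonlinear_unique:
  assumes "sol (a d) G H F d s u" "sol (a d') G H F d' s' u'"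
  shows "X.dst d d' = 0" "Y.dst s s' = 0" "Z.dst u u' = 0"
proof -
  have m: "d \<in> X" "d' \<in> X" using assms by (auto simp: sol_def)
  have n: "0 \<le> X.dst d d'" using m X.closed by simp
  show "X.dst d d' = 0"
  proof (rule ccontr)
    assume "X.dst d d' \<noteq> 0"
    with n have "k / ca * r * X.dst d d' < 1 * X.dst d d'"
      using small by (intro mult_strict_right_mono) auto
    with lin_lipschitz(1)[OF m assms] show False by simp
  qed
  then show "Y.dst s s' = 0" "Z.dst u u' = 0" using lin_lipschitz(2,3)[OF m assms] by simp_all
qed

lemma nonlinear_exists: "\<exists>d s u. sol (a d) G H F d s u"
proof -
  define J where "J w = (SOME d. \<exists>s u. sol (a w) G H F d s u)" for w
  have J: "\<exists>s u. sol (a w) G H F (J w) s u" if "w \<in> X" for w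
    unfolding J_def by (rule someI_ex[OF lin_exists[OF that]])
  define W where "W = {w \<in> X. X.nrm w \<le> r}"
  obtain z where z: "z \<in> X" "\<And>f. linear_on X lX f \<Longrightarrow> f z = 0" using X.ex_zero by blast
  have "X.nrm z = 0" using z(2)[OF X.linear_ip[OF z(1)]] by (simp add: X.nrm_def)
  then have zW: "z \<in> W" using z(1) r(1) by (simp add: W_def)
  have ca: "0 < ca" using form[OF z(1)] by (simp add: form_def)
  have "\<exists>d\<in>W. X.dst (J d) d = 0"
  proof (rule X.contraction_fixed_point[OF fdX, of W J "k / ca * r"])
    show "W \<noteq> {}" "W \<subseteq> X" using zW by (auto simp: W_def)
    show "x \<in> W" if s: "\<And>m. s m \<in> W" and x: "x \<in> X" and l: "(\<lambda>m. X.dst (s m) x) \<longlonglongrightarrow> 0" for s x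
    proof -
      have "X.nrm x \<le> r + X.dst (s m) x" for m
        using X.nrm_le_dst[OF x, of "s m"] X.dst_commute[OF x, of "s m"] s[of m] by (simp add: W_def)
      moreover have "(\<lambda>m. r + X.dst (s m) x) \<longlonglongrightarrow> r + 0" by (intro tendsto_intros l)
      ultimately have "X.nrm x \<le> r + 0" by (intro LIMSEQ_le_const) auto
      then show ?thesis using x by (simp add: W_def)
    qed
    show "J x \<in> W" if "x \<in> W" for x
    proof -
      have x: "x \<in> X" using that by (simp add: W_def)
      obtain s u where s: "sol (a x) G H F (J x) s u" using J[OF x] by blast
      then show ?thesis using lin_bound[OF x s] by (simp add: W_def sol_def)
    qed
    show "0 \<le> k / ca * r" using k ca r by simp
    show "k / ca * r < 1" by (rule small)
    show "X.dst (J x) (J y) \<le> k / ca * r * X.dst x y" if "x \<in> W" "y \<in> W" for x y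
    proof -
      have xy: "x \<in> X" "y \<in> X" using that by (auto simp: W_def)
      obtain s u where s: "sol (a x) G H F (J x) s u" using J[OF xy(1)] by blast
      obtain s' u' where s': "sol (a y) G H F (J y) s' u'" using J[OF xy(2)] by blast
      show ?thesis by (rule lin_lipschitz(1)[OF xy s s'])
    qed
  qed
  then obtain d where d: "d \<in> X" "X.dst (J d) d = 0" by (auto simp: W_def)
  obtain s u where s: "sol (a d) G H F (J d) s u" using J[OF d(1)] by blast
  have Jd: "J d \<in> X" using s by (simp add: sol_def)
  have eq: "X.dst (J d) d = 0 \<Longrightarrow> f (J d) = f d"
    if "linear_on X lX f" "\<And>x. x \<in> X \<Longrightarrow> X.nrm x = 0 \<Longrightarrow> f x = 0" for f
    using X.linear_on_dst_null[OF that Jd d(1)] .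
  obtain B where B: "\<And>w e. w \<in> X \<Longrightarrow> e \<in> X \<Longrightarrow> \<bar>a d w e\<bar> \<le> B * X.nrm w * X.nrm e"
    using form[OF d(1)] unfolding form_def by blast
  have "sol (a d) G H F d s u"
  proof -
    have "a d (J d) e = a d d e" if e: "e \<in> X" for e
    proof (rule eq[OF _ _ d(2)])
      show "linear_on X lX (\<lambda>x. a d x e)" using form[OF d(1)] e by (simp add: form_def)
      show "a d x e = 0" if "x \<in> X" "X.nrm x = 0" for x using B[OF that(1) e] that(2) by simp
    qed
    moreover have "b1 (J d) t = b1 d t" if t: "t \<in> Y" for t
    proof (rule eq[OF b1_left[OF t] _ d(2)])
      show "b1 x t = 0" if "x \<in> X" "X.nrm x = 0" for x using b1_bound[OF that(1) t] that(2) by simp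
    qed
    ultimately show ?thesis using s d(1) by (simp add: sol_def)
  qed
  then show ?thesis by blast
qed

end

section \<open>Square integrable functions\<close>

definition fun_lin :: "real \<Rightarrow> ('a \<Rightarrow> 'b::real_vector) \<Rightarrow> ('a \<Rightarrow> 'b) \<Rightarrow> 'a \<Rightarrow> 'b" where
  "fun_lin c f g = (\<lambda>x. f x + c *\<^sub>R g x)"

definition ip2 :: "(real ^ 'n) set \<Rightarrow> (real ^ 'n \<Rightarrow> 'b::euclidean_space) \<Rightarrow> (real ^ 'n \<Rightarrow> 'b) \<Rightarrow> real" where
  "ip2 Om f g = (LINT x|lebesgue_on Om. f x \<bullet> g x)"

lemma norm_L2_eq: "norm_L2 Om f = sqrt (ip2 Om f f)"
  by (simp add: norm_L2_def ip2_def power2_norm_eq_inner)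

lemma L2_measurable: "f \<in> L2 Om \<Longrightarrow> f \<in> borel_measurable (lebesgue_on Om)"
  by (simp add: L2_def)

lemma L2_integrable_norm_mult:
  assumes "f \<in> L2 Om" "g \<in> L2 Om"
  shows "integrable (lebesgue_on Om) (\<lambda>x. norm (f x) * norm (g x))"
proof (rule Bochner_Integration.integrable_bound)
  show "integrable (lebesgue_on Om) (\<lambda>x. (norm (f x))\<^sup>2 + (norm (g x))\<^sup>2)"
    using assms by (simp add: L2_def)
  show "(\<lambda>x. norm (f x) * norm (g x)) \<in> borel_measurable (lebesgue_on Om)"
    using assms[THEN L2_measurable] by measurable
  have "a * b \<le> a\<^sup>2 + b\<^sup>2" if "0 \<le> a" "0 \<le> b" for a b :: real
    using sum_squares_bound[of a b] mult_nonneg_nonneg[OF that] by linarith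
  then show "AE x in lebesgue_on Om. norm (norm (f x) * norm (g x)) \<le> norm ((norm (f x))\<^sup>2 + (norm (g x))\<^sup>2)"
    by (intro AE_I2) simp
qed

lemma L2_integrable_bilinear:
  fixes f :: "real ^ 'n \<Rightarrow> 'b::euclidean_space" and g :: "real ^ 'n \<Rightarrow> 'c::euclidean_space"
    and h :: "real ^ 'n \<Rightarrow> 'd::euclidean_space"
  assumes "f \<in> L2 Om" "g \<in> L2 Om" "h \<in> borel_measurable (lebesgue_on Om)"
    and "AE x in lebesgue_on Om. norm (h x) \<le> C * (norm (f x) * norm (g x))"
  shows "integrable (lebesgue_on Om) h"
proof (rule Bochner_Integration.integrable_bound)
  show "integrable (lebesgue_on Om) (\<lambda>x. \<bar>C\<bar> * (norm (f x) * norm (g x)))"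
    using L2_integrable_norm_mult[OF assms(1,2)] by simp
  show "AE x in lebesgue_on Om. norm (h x) \<le> norm (\<bar>C\<bar> * (norm (f x) * norm (g x)))"
    using assms(4)
  proof eventually_elim
    case (elim x)
    have "C * (norm (f x) * norm (g x)) \<le> \<bar>C\<bar> * (norm (f x) * norm (g x))"
      by (intro mult_right_mono) auto
    with elim show ?case by (simp add: abs_mult)
  qed
qed (use assms in auto)

lemma L2_integrable_inner:
  assumes "f \<in> L2 Om" "g \<in> L2 Om"
  shows "integrable (lebesgue_on Om) (\<lambda>x. f x \<bullet> g x)"
proof (rule L2_integrable_bilinear[OF assms, of _ 1])
  show "(\<lambda>x. f x \<bullet> g x) \<in> borel_measurable (lebesgue_on Om)"
    using assms[THEN L2_measurable] by measurable
qed (simp add: Cauchy_Schwarz_ineq2)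

lemma L2_integrable_mult:
  fixes f g :: "real ^ 'n \<Rightarrow> real"
  assumes "f \<in> L2 Om" "g \<in> L2 Om"
  shows "integrable (lebesgue_on Om) (\<lambda>x. f x * g x)"
  using L2_integrable_inner[OF assms] by simp

lemma L2_lin:
  assumes "f \<in> L2 Om" "g \<in> L2 Om"
  shows "fun_lin c f g \<in> L2 Om"
proof -
  have "integrable (lebesgue_on Om) (\<lambda>x. f x \<bullet> f x + 2 * c * (f x \<bullet> g x) + c\<^sup>2 * (g x \<bullet> g x))"
    using L2_integrable_inner assms by (intro Bochner_Integration.integrable_add integrable_mult_right) auto
  moreover have "(norm (f x + c *\<^sub>R g x))\<^sup>2 = f x \<bullet> f x + 2 * c * (f x \<bullet> g x) + c\<^sup>2 * (g x \<bullet> g x)" for x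
    unfolding power2_norm_eq_inner
    by (simp add: inner_add_left inner_add_right inner_commute power2_eq_square algebra_simps)
  moreover have "(\<lambda>x. f x + c *\<^sub>R g x) \<in> borel_measurable (lebesgue_on Om)"
    using assms[THEN L2_measurable] by measurable
  ultimately show ?thesis by (simp add: L2_def fun_lin_def)
qed

lemma L2_zero: "(\<lambda>x. 0) \<in> L2 Om"
  by (simp add: L2_def)

lemma L2_bounded_linear:
  assumes f: "f \<in> L2 Om" and h: "bounded_linear h"
  shows "(\<lambda>x. h (f x)) \<in> L2 Om"
proof -
  obtain K where K: "\<And>x. norm (h x) \<le> norm x * K" using h bounded_linear.bounded by blast
  have m: "(\<lambda>x. h (f x)) \<in> borel_measurable (lebesgue_on Om)"
    using measurable_compose[OF L2_measurable[OF f], of h borel]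
      borel_measurable_continuous_onI[OF linear_continuous_on[OF h]] by simp
  have "integrable (lebesgue_on Om) (\<lambda>x. (norm (h (f x)))\<^sup>2)"
  proof (rule L2_integrable_bilinear[OF f f, of _ "K\<^sup>2"])
    show "AE x in lebesgue_on Om. norm ((norm (h (f x)))\<^sup>2) \<le> K\<^sup>2 * (norm (f x) * norm (f x))"
    proof (intro AE_I2)
      fix x
      have "(norm (h (f x)))\<^sup>2 \<le> (norm (f x) * K)\<^sup>2" using K by (intro power_mono) auto
      then show "norm ((norm (h (f x)))\<^sup>2) \<le> K\<^sup>2 * (norm (f x) * norm (f x))"
        by (simp add: power_mult_distrib power2_eq_square mult_ac)
    qed
  qed (use m in measurable)
  with m show ?thesis by (simp add: L2_def)
qed

lemma L2_nth: "f \<in> L2 Om \<Longrightarrow> (\<lambda>x. f x $ i) \<in> L2 Om"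
  by (rule L2_bounded_linear[OF _ bounded_linear_vec_nth])

lemma L2_vec:
  fixes f :: "real ^ 'n \<Rightarrow> 'b::euclidean_space ^ 'm"
  assumes "\<And>i. (\<lambda>x. f x $ i) \<in> L2 Om" shows "f \<in> L2 Om"
proof -
  have "(norm (f x))\<^sup>2 = (\<Sum>i\<in>UNIV. (norm (f x $ i))\<^sup>2)" for x
    by (simp add: norm_vec_def L2_set_def sum_nonneg)
  moreover have "f \<in> borel_measurable (lebesgue_on Om)"
  proof (subst borel_measurable_euclidean_space, rule ballI)
    fix b :: "'b ^ 'm" assume "b \<in> Basis"
    then obtain i c where b: "b = axis i c" by (auto simp: Basis_vec_def)
    have "(\<lambda>x. f x $ i \<bullet> c) \<in> borel_measurable (lebesgue_on Om)"
      using L2_measurable[OF assms[of i]] by measurable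
    then show "(\<lambda>x. f x \<bullet> b) \<in> borel_measurable (lebesgue_on Om)"
      by (simp add: b inner_axis)
  qed
  ultimately show ?thesis using assms by (simp add: L2_def)
qed

lemma ip2_lin_left:
  assumes "f \<in> L2 Om" "g \<in> L2 Om" "h \<in> L2 Om"
  shows "ip2 Om (fun_lin c f g) h = ip2 Om f h + c * ip2 Om g h"
  using L2_integrable_inner[OF assms(1,3)] L2_integrable_inner[OF assms(2,3)]
  by (simp add: ip2_def fun_lin_def inner_add_left)

lemma ip2_commute: "ip2 Om f g = ip2 Om g f"
  by (simp add: ip2_def inner_commute)

lemma semi_inner_L2: "semi_inner (L2 Om) fun_lin (ip2 Om)"
proof
  show "L2 Om \<noteq> {}" using L2_zero by blast
  show "0 \<le> ip2 Om f f" if "f \<in> L2 Om" for f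
    unfolding ip2_def by (rule Bochner_Integration.integral_nonneg) simp
  show "ip2 Om f g = ip2 Om g f" for f g by (rule ip2_commute)
qed (simp_all add: L2_lin ip2_lin_left)

interpretation L2: semi_inner "L2 Om" fun_lin "ip2 Om" for Om
  by (rule semi_inner_L2)

lemma norm_L2_nrm: "L2.nrm Om f = norm_L2 Om f"
  by (simp add: L2.nrm_def norm_L2_eq)

lemma norm_L2_nonneg [simp]: "0 \<le> norm_L2 Om f"
  unfolding norm_L2_def by simp

lemma norm_L2_sq: "(norm_L2 Om f)\<^sup>2 = ip2 Om f f"
  by (simp add: norm_L2_eq ip2_def)

lemma ip2_le: "f \<in> L2 Om \<Longrightarrow> g \<in> L2 Om \<Longrightarrow> \<bar>ip2 Om f g\<bar> \<le> norm_L2 Om f * norm_L2 Om g"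
  using L2.cauchy_schwarz by (simp add: norm_L2_nrm)

lemma ip2_cong_AE:
  assumes "AE x in lebesgue_on Om. f x = f' x" "AE x in lebesgue_on Om. g x = g' x"
    and "f \<in> L2 Om" "f' \<in> L2 Om" "g \<in> L2 Om" "g' \<in> L2 Om"
  shows "ip2 Om f g = ip2 Om f' g'"
  unfolding ip2_def
proof (rule integral_cong_AE)
  show "AE x in lebesgue_on Om. f x \<bullet> g x = f' x \<bullet> g' x" using assms(1,2) by eventually_elim simp
  show "(\<lambda>x. f x \<bullet> g x) \<in> borel_measurable (lebesgue_on Om)"
    "(\<lambda>x. f' x \<bullet> g' x) \<in> borel_measurable (lebesgue_on Om)"
    using assms(3-6)[THEN L2_measurable] by measurable
qed

lemma ip2_null_iff:
  assumes "f \<in> L2 Om" shows "ip2 Om f f = 0 \<longleftrightarrow> (AE x in lebesgue_on Om. f x = 0)"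
proof -
  have "ip2 Om f f = 0 \<longleftrightarrow> (AE x in lebesgue_on Om. f x \<bullet> f x = 0)"
    unfolding ip2_def using L2_integrable_inner[OF assms assms]
    by (intro integral_nonneg_eq_0_iff_AE) auto
  then show ?thesis by simp
qed

lemma norm_L2_null_iff:
  "f \<in> L2 Om \<Longrightarrow> norm_L2 Om f = 0 \<longleftrightarrow> (AE x in lebesgue_on Om. f x = 0)"
  by (simp add: norm_L2_eq ip2_null_iff)

lemma finite_measure_lebesgue_on_bounded:
  "open Om \<Longrightarrow> bounded Om \<Longrightarrow> finite_measure (lebesgue_on (Om :: (real ^ 'n) set))"
  by (rule finite_measure_lebesgue_on) (simp add: lmeasurable_open)

lemma L2_bounded:
  fixes f :: "real ^ 'n \<Rightarrow> 'b::euclidean_space"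
  assumes "open Om" "bounded Om" "f \<in> borel_measurable (lebesgue_on Om)"
    and "\<And>x. x \<in> Om \<Longrightarrow> norm (f x) \<le> B"
  shows "f \<in> L2 Om"
proof -
  interpret finite_measure "lebesgue_on Om"
    by (rule finite_measure_lebesgue_on_bounded) fact+
  have "integrable (lebesgue_on Om) (\<lambda>x. (norm (f x))\<^sup>2)"
  proof (rule integrable_const_bound[of _ "B\<^sup>2"])
    show "AE x in lebesgue_on Om. norm ((norm (f x))\<^sup>2) \<le> B\<^sup>2"
      using assms(4) by (intro AE_I2) (simp add: power_mono)
  qed (use assms(3) in measurable)
  with assms(3) show ?thesis by (simp add: L2_def)
qed

lemma L2_integrable:
  assumes "open Om" "bounded Om" "(f :: real ^ 'n \<Rightarrow> real) \<in> L2 Om" shows "integrable (lebesgue_on Om) f"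
proof -
  have "(\<lambda>x. 1 :: real) \<in> L2 Om" using assms by (intro L2_bounded[of _ _ 1]) auto
  from L2_integrable_mult[OF assms(3) this] show ?thesis by simp
qed

section \<open>Test functions separate integrable functions\<close>

lemma Cn_Suc_D: "Cn (Suc m) \<phi> \<Longrightarrow> Cn m \<phi>"
proof (induction m arbitrary: \<phi>)
  case 0
  then show ?case
    by (auto intro!: continuous_at_imp_continuous_on differentiable_imp_continuous_within)
qed simp

lemma pd_eq: "(\<phi> has_derivative D) (at x) \<Longrightarrow> pd i \<phi> x = D (axis i 1)"
  by (simp add: pd_def frechet_derivative_at[symmetric])

lemma pd_add:
  "\<phi> differentiable at x \<Longrightarrow> \<psi> differentiable at x \<Longrightarrow> pd i (\<lambda>x. \<phi> x + \<psi> x) x = pd i \<phi> x + pd i \<psi> x"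
  by (subst pd_eq[OF has_derivative_add[OF frechet_derivative_works[THEN iffD1] frechet_derivative_works[THEN iffD1]]])
    (auto simp: pd_def)

lemma pd_mult:
  "\<phi> differentiable at x \<Longrightarrow> \<psi> differentiable at x \<Longrightarrow>
    pd i (\<lambda>x. \<phi> x * \<psi> x) x = \<phi> x * pd i \<psi> x + pd i \<phi> x * \<psi> x"
  by (subst pd_eq[OF has_derivative_mult[OF frechet_derivative_works[THEN iffD1] frechet_derivative_works[THEN iffD1]]])
    (auto simp: pd_def)

lemma pd_const [simp]: "pd i (\<lambda>x. c) x = 0"
  by (subst pd_eq[OF has_derivative_const]) simp

lemma Cn_const: "Cn m (\<lambda>x :: real ^ 'n. c)"
proof (induction m arbitrary: c)
  case (Suc m)
  have "pd i (\<lambda>x. c) = (\<lambda>x. 0)" for i :: 'n by (rule ext) simp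
  then show ?case using Suc.IH[of 0] by (simp del: pd_const)
qed simp

lemma Cn_add: "Cn m \<phi> \<Longrightarrow> Cn m \<psi> \<Longrightarrow> Cn m (\<lambda>x. \<phi> x + \<psi> x)"
proof (induction m arbitrary: \<phi> \<psi>)
  case (Suc m)
  have "pd i (\<lambda>x. \<phi> x + \<psi> x) = (\<lambda>x. pd i \<phi> x + pd i \<psi> x)" for i
    using Suc.prems by (intro ext pd_add) auto
  with Suc show ?case by auto
qed (auto intro: continuous_intros)

lemma Cn_mult: "Cn m \<phi> \<Longrightarrow> Cn m \<psi> \<Longrightarrow> Cn m (\<lambda>x. \<phi> x * \<psi> x)"
proof (induction m arbitrary: \<phi> \<psi>)
  case (Suc m)
  have "pd i (\<lambda>x. \<phi> x * \<psi> x) = (\<lambda>x. \<phi> x * pd i \<psi> x + pd i \<phi> x * \<psi> x)" for i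
    using Suc.prems by (intro ext pd_mult) auto
  moreover have "Cn m \<phi>" "Cn m \<psi>" using Suc.prems Cn_Suc_D by blast+
  ultimately show ?case using Suc by (auto intro!: Cn_add)
qed (auto intro: continuous_intros)

lemma Cn_prod: "(\<And>j. j \<in> J \<Longrightarrow> Cn m (\<phi> j)) \<Longrightarrow> Cn m (\<lambda>x. \<Prod>j\<in>J. \<phi> j x)"
  by (induction J rule: infinite_finite_induct) (auto intro: Cn_const Cn_mult)

lemma Cn_ridge:
  assumes "\<And>j t. (D j has_real_derivative D (Suc j) t) (at t)"
  shows "Cn m (\<lambda>x. c * D j (x \<bullet> a + b))"
proof (induction m arbitrary: j c)
  case 0
  have "isCont (D j) t" for t using assms DERIV_isCont by blast
  then have "continuous_on UNIV (D j)" by (simp add: continuous_at_imp_continuous_on)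
  then have "continuous_on UNIV (\<lambda>x. D j (x \<bullet> a + b))"
    by (rule continuous_on_compose2) (auto intro!: continuous_intros)
  then show ?case by (simp add: continuous_on_mult_left)
next
  case (Suc m)
  have d: "((\<lambda>x. c * D j (x \<bullet> a + b)) has_derivative (\<lambda>h. c * (D (Suc j) (x \<bullet> a + b) * (h \<bullet> a)))) (at x)" for x
  proof (rule has_derivative_mult_right)
    have "((\<lambda>x. x \<bullet> a + b) has_derivative (\<lambda>h. h \<bullet> a)) (at x)"
      by (auto intro!: derivative_eq_intros)
    moreover have "(D j has_derivative (*) (D (Suc j) (x \<bullet> a + b))) (at (x \<bullet> a + b))"
      using assms[of j "x \<bullet> a + b"] by (simp add: has_field_derivative_def)
    ultimately show "((\<lambda>x. D j (x \<bullet> a + b)) has_derivative (\<lambda>h. D (Suc j) (x \<bullet> a + b) * (h \<bullet> a))) (at x)"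
      by (rule has_derivative_compose)
  qed
  have "pd i (\<lambda>x. c * D j (x \<bullet> a + b)) = (\<lambda>x. c * (axis i 1 \<bullet> a) * D (Suc j) (x \<bullet> a + b))" for i
    by (rule ext) (simp add: pd_eq[OF d])
  with Suc d show ?case by (auto simp: differentiable_def simp del: mult.assoc)
qed

text \<open>\<open>flat P t\<close> is \<open>P (1 / t) exp (- 1 / t)\<close> for positive \<open>t\<close> and \<open>0\<close> otherwise. The derivative
  of such a function is again of this form, which gives smoothness by induction.\<close>

definition flat :: "real poly \<Rightarrow> real \<Rightarrow> real" where
  "flat P t = (if 0 < t then poly P (inverse t) * exp (- inverse t) else 0)"

definition flat_deriv :: "real poly \<Rightarrow> real poly" where
  "flat_deriv P = [:0, 0, 1:] * (P - pderiv P)"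

lemma poly_exp_tendsto_0: "((\<lambda>s. poly P s * exp (- s)) \<longlongrightarrow> (0::real)) at_top"
proof -
  have "((\<lambda>s. \<Sum>i\<le>degree P. coeff P i * (s ^ i / exp s)) \<longlongrightarrow> (\<Sum>i\<le>degree P. coeff P i * 0)) at_top"
    by (intro tendsto_intros tendsto_power_div_exp_0)
  moreover have "poly P s * exp (- s) = (\<Sum>i\<le>degree P. coeff P i * (s ^ i / exp s))" for s
    by (simp add: poly_altdef exp_minus sum_distrib_right divide_inverse mult.assoc)
  ultimately show ?thesis by simp
qed

lemma flat_DERIV: "(flat P has_real_derivative flat (flat_deriv P) t) (at t)"
proof -
  consider "0 < t" | "t < 0" | "t = 0" by linarith
  then show ?thesis
  proof cases
    case 1
    have "((\<lambda>t. poly P (inverse t) * exp (- inverse t)) has_real_derivative flat (flat_deriv P) t) (at t)"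
      using 1 by (auto intro!: derivative_eq_intros poly_DERIV[THEN DERIV_chain2]
          simp: flat_def flat_deriv_def algebra_simps power2_eq_square)
    then show ?thesis
      by (rule has_field_derivative_transform_within_open[of _ _ _ "{0<..}"]) (use 1 in \<open>auto simp: flat_def\<close>)
  next
    case 2
    have "((\<lambda>t. 0) has_real_derivative flat (flat_deriv P) t) (at t)"
      using 2 by (simp add: flat_def)
    then show ?thesis
      by (rule has_field_derivative_transform_within_open[of _ _ _ "{..<0}"]) (use 2 in \<open>auto simp: flat_def\<close>)
  next
    case 3
    have "((\<lambda>y. flat P y / y) \<longlongrightarrow> 0) (at 0)"
      proof (rule filterlim_split_at)
      have "\<forall>\<^sub>F y in at_left (0::real). flat P y / y = 0"
        by (auto simp: eventually_at_filter flat_def)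
      then show "((\<lambda>y. flat P y / y) \<longlongrightarrow> 0) (at_left 0)" by (rule tendsto_eventually)
      have "((\<lambda>y. poly ([:0, 1:] * P) (inverse y) * exp (- inverse y)) \<longlongrightarrow> 0) (at_right 0)"
        by (rule filterlim_compose[OF poly_exp_tendsto_0 filterlim_inverse_at_top_right])
      moreover have "\<forall>\<^sub>F y in at_right 0. poly ([:0, 1:] * P) (inverse y) * exp (- inverse y) = flat P y / y"
        by (auto simp: eventually_at_filter flat_def field_simps)
      ultimately show "((\<lambda>y. flat P y / y) \<longlongrightarrow> 0) (at_right 0)" by (rule Lim_transform_eventually)
    qed
    then show ?thesis using 3 by (simp add: has_field_derivative_iff flat_def)
  qed
qed

definition box_bump :: "real \<Rightarrow> real ^ 'n \<Rightarrow> real ^ 'n \<Rightarrow> real ^ 'n \<Rightarrow> real" where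
  "box_bump s l u x = (\<Prod>i\<in>UNIV. flat 1 (s * (x $ i - l $ i)) * flat 1 (s * (u $ i - x $ i)))"

lemma Cn_flat_ridge: "Cn m (\<lambda>x. flat 1 (x \<bullet> a + b))"
  using Cn_ridge[of "\<lambda>j. flat ((flat_deriv ^^ j) 1)" m 1 0 a b] flat_DERIV by simp

lemma Cn_box_bump: "Cn m (box_bump s l u)"
proof -
  have "Cn m (\<lambda>x. flat 1 (s * (x $ i - l $ i)))" for i
    using Cn_flat_ridge[of m "s *\<^sub>R axis i 1" "- s * l $ i"]
    by (simp add: inner_axis algebra_simps)
  moreover have "Cn m (\<lambda>x. flat 1 (s * (u $ i - x $ i)))" for i
    using Cn_flat_ridge[of m "- s *\<^sub>R axis i 1" "s * u $ i"]
    by (simp add: inner_axis algebra_simps)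
  ultimately show ?thesis
    unfolding box_bump_def[abs_def] by (intro Cn_prod Cn_mult)
qed

lemma flat_1_bounds: "0 \<le> flat 1 t" "flat 1 t \<le> 1"
  by (auto simp: flat_def)

lemma box_bump_bounds: "0 \<le> box_bump s l u x" "box_bump s l u x \<le> 1"
  unfolding box_bump_def
  by (auto intro!: prod_nonneg prod_le_1 mult_nonneg_nonneg mult_le_one flat_1_bounds)

lemma box_bump_nonzero:
  assumes "0 < s" "box_bump s l u x \<noteq> 0" shows "x \<in> box l u"
proof -
  have "l $ i < x $ i \<and> x $ i < u $ i" for i
  proof -
    have "flat 1 (s * (x $ i - l $ i)) \<noteq> 0" "flat 1 (s * (u $ i - x $ i)) \<noteq> 0"
      using assms(2) by (auto simp: box_bump_def)
    then have "0 < s * (x $ i - l $ i)" "0 < s * (u $ i - x $ i)" by (auto simp: flat_def split: if_splits)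
    then show ?thesis using assms(1) by (simp add: zero_less_mult_iff)
  qed
  then show ?thesis by (simp add: mem_box_cart)
qed

lemma box_bump_tendsto:
  assumes "x \<in> box l u"
  shows "(\<lambda>m. box_bump (real (Suc m)) l u x) \<longlonglongrightarrow> 1"
proof -
  have *: "(\<lambda>m. flat 1 (real (Suc m) * c)) \<longlonglongrightarrow> 1" if c: "0 < c" for c
  proof -
    have "(\<lambda>m. exp (- (inverse (real (Suc m)) * inverse c))) \<longlonglongrightarrow> exp (- (0 * inverse c))"
      by (intro tendsto_intros LIMSEQ_inverse_real_of_nat)
    moreover have "flat 1 (real (Suc m) * c) = exp (- (inverse (real (Suc m)) * inverse c))" for m
      using c by (simp add: flat_def)
    ultimately show ?thesis by simp
  qed
  have "(\<lambda>m. box_bump (real (Suc m)) l u x) \<longlonglongrightarrow> (\<Prod>i\<in>(UNIV::'a set). 1 * 1)"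
    unfolding box_bump_def
  proof (rule tendsto_prod, rule tendsto_mult)
    fix i
    have "0 < x $ i - l $ i" "0 < u $ i - x $ i" using assms by (auto simp: mem_box_cart)
    then show "(\<lambda>m. flat 1 (real (Suc m) * (x $ i - l $ i))) \<longlonglongrightarrow> 1"
      "(\<lambda>m. flat 1 (real (Suc m) * (u $ i - x $ i))) \<longlonglongrightarrow> 1" using * by blast+
  qed
  then show ?thesis by simp
qed

lemma open_eq_Union_boxes:
  assumes "open (S :: (real ^ 'n) set)"
  obtains l u :: "nat \<Rightarrow> real ^ 'n"
  where "S = (\<Union>j. box (l j) (u j))" "\<And>j. cbox (l j) (u j) \<subseteq> S"
proof -
  define F where "F = {box a b | a b. cbox a b \<subseteq> S}"
  have "x \<in> \<Union>F" if "x \<in> S" for x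
  proof -
    obtain a b where "cbox a b \<subseteq> S" "x \<in> box a b" by (rule open_contains_cbox[OF assms \<open>x \<in> S\<close>])
    then show ?thesis unfolding F_def by blast
  qed
  moreover have "\<Union>F \<subseteq> S" using box_subset_cbox unfolding F_def by blast
  ultimately have F: "\<Union>F = S" by blast
  have "\<And>X. X \<in> F \<Longrightarrow> open X" by (auto simp: F_def)
  then obtain F' where F': "F' \<subseteq> F" "countable F'" "\<Union>F' = \<Union>F" by (rule Lindelof)
  have "(1 :: real ^ 'n) $ i > (0 :: real ^ 'n) $ i" for i by simp
  then have "cbox 1 (0 :: real ^ 'n) = {}" "box 1 (0 :: real ^ 'n) = {}"
    unfolding interval_eq_empty_cart by (auto intro: less_imp_le)
  then have e: "{} \<in> F" unfolding F_def by (intro CollectI exI[of _ 1] exI[of _ 0]) auto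
  define X where "X = from_nat_into (insert {} F')"
  have X: "range X = insert {} F'" unfolding X_def by (rule range_from_nat_into) (use F'(2) in simp_all)
  have XF: "X j \<in> F" for j
  proof -
    have "X j \<in> insert {} F'" using rangeI[of X j] by (simp only: X)
    then show ?thesis using F'(1) e by auto
  qed
  have "\<exists>p. X j = box (fst p) (snd p) \<and> cbox (fst p) (snd p) \<subseteq> S" for j
  proof -
    obtain a b where "X j = box a b" "cbox a b \<subseteq> S" using XF[of j] unfolding F_def by blast
    then show ?thesis by (intro exI[of _ "(a, b)"]) simp
  qed
  then obtain p where "\<And>j. X j = box (fst (p j)) (snd (p j))" "\<And>j. cbox (fst (p j)) (snd (p j)) \<subseteq> S"
    by metis
  moreover have "S = (\<Union>j. X j)" using X F'(3) F by simp
  ultimately show ?thesis using that[of "\<lambda>j. fst (p j)" "\<lambda>j. snd (p j)"] by simp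
qed

lemma test_fun_D:
  assumes "test_fun Om \<phi>"
  shows "continuous_on UNIV \<phi>" "\<phi> differentiable (at x)" "continuous_on UNIV (pd i \<phi>)"
    "compact (closure {x. \<phi> x \<noteq> 0})" "closure {x. \<phi> x \<noteq> 0} \<subseteq> Om"
proof -
  have *: "\<forall>m. Cn m \<phi>" using assms by (simp add: test_fun_def)
  then have "Cn 0 \<phi>" "Cn (Suc 0) \<phi>" by blast+
  then show "continuous_on UNIV \<phi>" "\<phi> differentiable (at x)" "continuous_on UNIV (pd i \<phi>)" by auto
qed (use assms in \<open>simp_all add: test_fun_def\<close>)

text \<open>Write the open set as a countable union of boxes and take
  \<open>1 - \<Prod>j<m. (1 - \<beta> j)\<close> with bumps \<open>\<beta> j\<close> that tend to the indicators of the boxes.\<close>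

lemma test_fun_exhaust:
  fixes S Om :: "(real ^ 'n) set"
  assumes "open S" "S \<subseteq> Om"
  obtains \<psi> where "\<And>m. test_fun Om (\<psi> m)" "\<And>m x. 0 \<le> \<psi> m x" "\<And>m x. \<psi> m x \<le> (1::real)"
    "\<And>x. (\<lambda>m. \<psi> m x) \<longlonglongrightarrow> indicator S x"
proof -
  obtain l u :: "nat \<Rightarrow> real ^ 'n"
    where S: "S = (\<Union>j. box (l j) (u j))" and c: "\<And>j. cbox (l j) (u j) \<subseteq> S"
    by (rule open_eq_Union_boxes[OF assms(1)]) (rule that)
  have S_iff: "x \<in> S \<longleftrightarrow> (\<exists>j. x \<in> box (l j) (u j))" for x by (subst S) simp
  define P where "P m x = (\<Prod>j<m. 1 - box_bump (real (Suc m)) (l j) (u j) x)" for m x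
  define \<psi> where "\<psi> m x = 1 + (-1) * P m x" for m x
  have P: "0 \<le> P m x" "P m x \<le> 1" for m x
    unfolding P_def using box_bump_bounds by (auto intro!: prod_nonneg prod_le_1)
  show ?thesis
  proof
    show "0 \<le> \<psi> m x" "\<psi> m x \<le> 1" for m x using P[of m x] by (auto simp: \<psi>_def)
    show "test_fun Om (\<psi> m)" for m
      unfolding test_fun_def
    proof (intro conjI allI)
      have "Cn n (\<lambda>x. 1 + (-1) * box_bump s a b x)" for n s and a b :: "real ^ 'n"
        by (intro Cn_add Cn_mult Cn_const Cn_box_bump)
      then show "Cn n (\<psi> m)" for n
        unfolding \<psi>_def[abs_def] P_def by (intro Cn_add Cn_mult Cn_const Cn_prod) simp
      have "{x. \<psi> m x \<noteq> 0} \<subseteq> (\<Union>j<m. cbox (l j) (u j))"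
      proof
        fix x assume "x \<in> {x. \<psi> m x \<noteq> 0}"
        then have "P m x \<noteq> 1" by (simp add: \<psi>_def)
        moreover have "P m x = 1" if "\<forall>j<m. box_bump (real (Suc m)) (l j) (u j) x = 0"
          unfolding P_def using that by (intro prod.neutral) simp
        ultimately obtain j where "j < m" "box_bump (real (Suc m)) (l j) (u j) x \<noteq> 0" by blast
        then show "x \<in> (\<Union>j<m. cbox (l j) (u j))"
          using box_bump_nonzero[of "real (Suc m)" "l j" "u j" x] box_subset_cbox[of "l j" "u j"] by auto
      qed
      moreover have K: "compact (\<Union>j<m. cbox (l j) (u j))" by (intro compact_UN) auto
      ultimately have cl: "closure {x. \<psi> m x \<noteq> 0} \<subseteq> (\<Union>j<m. cbox (l j) (u j))"
        by (intro closure_minimal compact_imp_closed)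
      show "compact (closure {x. \<psi> m x \<noteq> 0})"
        using compact_Int_closed[OF K closed_closure, of "{x. \<psi> m x \<noteq> 0}"] cl by (simp only: Int_absorb1)
      have "(\<Union>j<m. cbox (l j) (u j)) \<subseteq> S" using c by (rule UN_least)
      then show "closure {x. \<psi> m x \<noteq> 0} \<subseteq> Om" using cl assms(2) by (meson subset_trans)
    qed
    show "(\<lambda>m. \<psi> m x) \<longlonglongrightarrow> indicator S x" for x
    proof (cases "x \<in> S")
      case True
      then obtain j where j: "x \<in> box (l j) (u j)" using S_iff by blast
      have "P m x \<le> 1 - box_bump (real (Suc m)) (l j) (u j) x" if "j < m" for m
      proof -
        have "P m x = (1 - box_bump (real (Suc m)) (l j) (u j) x) *
            (\<Prod>i\<in>{..<m} - {j}. 1 - box_bump (real (Suc m)) (l i) (u i) x)"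
          unfolding P_def using that by (subst prod.remove[of _ j]) auto
        also have "\<dots> \<le> (1 - box_bump (real (Suc m)) (l j) (u j) x) * 1"
          using box_bump_bounds by (intro mult_left_mono prod_le_1) auto
        finally show ?thesis by simp
      qed
      then have ev: "\<forall>\<^sub>F m in sequentially. P m x \<le> 1 - box_bump (real (Suc m)) (l j) (u j) x"
        by (auto simp: eventually_sequentially intro: exI[of _ "Suc j"])
      have "(\<lambda>m. 1 - box_bump (real (Suc m)) (l j) (u j) x) \<longlonglongrightarrow> 1 - 1"
        by (intro tendsto_intros box_bump_tendsto j)
      then have "(\<lambda>m. P m x) \<longlonglongrightarrow> 0"
        by (intro tendsto_sandwich[OF _ ev tendsto_const]) (auto simp: P)
      then have "(\<lambda>m. \<psi> m x) \<longlonglongrightarrow> 1 + (-1) * 0" unfolding \<psi>_def by (intro tendsto_intros)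
      with True show ?thesis by simp
    next
      case False
      have "box_bump (real (Suc m)) (l j) (u j) x = 0" for m j
        using box_bump_nonzero[of "real (Suc m)" "l j" "u j" x] False S_iff[of x] by auto
      then have "\<psi> m x = 0" for m by (simp add: \<psi>_def P_def)
      with False show ?thesis by simp
    qed
  qed
qed

text \<open>Bounded sequences of test functions converge to the indicator of any open subset, so the
  integrals over open sets vanish, and these determine an integrable function.\<close>

lemma AE_zero_if_test_integrals_zero:
  fixes D :: "real ^ 'n \<Rightarrow> real"
  assumes Om: "open Om" "bounded Om" and D: "integrable (lebesgue_on Om) D"
    and 0: "\<And>\<phi>. test_fun Om \<phi> \<Longrightarrow> (LINT x|lebesgue_on Om. D x * \<phi> x) = 0"
  shows "AE x in lebesgue_on Om. D x = 0"
proof -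
  let ?M = "lebesgue_on Om"
  have Oml: "Om \<in> sets lebesgue" using Om(1) by simp
  have D_meas [measurable]: "D \<in> borel_measurable ?M" using D by simp
  have op: "(LINT x:S|?M. D x) = 0" if S: "open S" for S
  proof -
    have "open (S \<inter> Om)" "S \<inter> Om \<subseteq> Om" using S Om(1) by auto
    then obtain \<psi> where \<psi>: "\<And>m. test_fun Om (\<psi> m)" "\<And>m x. 0 \<le> \<psi> m x" "\<And>m x. \<psi> m x \<le> (1::real)"
      "\<And>x. (\<lambda>m. \<psi> m x) \<longlonglongrightarrow> indicator (S \<inter> Om) x" using test_fun_exhaust by blast
    have m: "\<psi> m \<in> borel_measurable ?M" for m
      using continuous_on_subset[OF test_fun_D(1)[OF \<psi>(1)]] Oml
      by (intro continuous_imp_measurable_on_sets_lebesgue) auto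
    have "(\<lambda>m. LINT x|?M. D x * \<psi> m x) \<longlonglongrightarrow> (LINT x|?M. indicator S x * D x)"
    proof (rule integral_dominated_convergence[where w="\<lambda>x. \<bar>D x\<bar>"])
      have "S \<in> sets lebesgue" using S by simp
      then show "(\<lambda>x. indicator S x * D x) \<in> borel_measurable ?M"
        by (intro borel_measurable_times borel_measurable_indicator' D_meas) (auto simp: sets_restrict_space)
      show "(\<lambda>x. D x * \<psi> m x) \<in> borel_measurable ?M" for m using m by measurable
      show "integrable ?M (\<lambda>x. \<bar>D x\<bar>)" using D by simp
      show "AE x in ?M. (\<lambda>m. D x * \<psi> m x) \<longlonglongrightarrow> indicator S x * D x"
      proof (intro AE_I2)
        fix x assume "x \<in> space ?M"
        then have "indicator (S \<inter> Om) x = (indicator S x :: real)" by (simp add: indicator_def)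
        then show "(\<lambda>m. D x * \<psi> m x) \<longlonglongrightarrow> indicator S x * D x"
          using tendsto_mult[OF tendsto_const[of "D x"] \<psi>(4)[of x]] by (simp add: mult.commute)
      qed
      show "AE x in ?M. norm (D x * \<psi> m x) \<le> \<bar>D x\<bar>" for m
        using \<psi>(2,3) by (intro AE_I2) (simp add: abs_mult mult_left_le)
    qed
    then have "(LINT x|?M. indicator S x * D x) = 0"
      using 0[OF \<psi>(1)] by (simp add: LIMSEQ_const_iff)
    then show ?thesis by (simp add: set_lebesgue_integral_def)
  qed
  have ind: "(\<lambda>x. indicator A x :: real) \<in> borel_measurable ?M" if "A \<in> sets lebesgue" for A
    using that by (intro borel_measurable_indicator') (auto simp: sets_restrict_space)
  have int: "set_integrable ?M A D" if "A \<in> sets lebesgue" for A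
    unfolding set_integrable_def
    by (rule Bochner_Integration.integrable_bound[OF D])
      (use ind[OF that] in \<open>auto simp: indicator_def intro!: borel_measurable_scaleR\<close>)
  have borel: "(LINT x:A|?M. D x) = 0" if A: "A \<in> sets borel" for A
  proof -
    have "Int_stable {S :: (real ^ 'n) set. open S}" by (auto simp: Int_stable_def)
    moreover have "{S :: (real ^ 'n) set. open S} \<subseteq> Pow UNIV" by simp
    moreover have "A \<in> sigma_sets UNIV {S. open S}" using A by (simp add: borel_def)
    ultimately show ?thesis
    proof (induction rule: sigma_sets_induct_disjoint)
      case (basic S)
      then show ?case using op by simp
    next
      case empty
      show ?case by (simp add: set_lebesgue_integral_def)
    next
      case (compl A)
      have "A \<in> sets borel" using compl(1) by (simp add: borel_def)
      then have A: "A \<in> sets lebesgue" by simp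
      have "(LINT x:UNIV|?M. D x) = (LINT x:UNIV - A|?M. D x) + (LINT x:A|?M. D x)"
      proof -
        have "(UNIV - A) \<inter> A = {}" "(UNIV - A) \<union> A = UNIV" by auto
        moreover have "UNIV - A \<in> sets lebesgue" using sets.compl_sets[OF A] by simp
        ultimately show ?thesis using set_integral_Un[OF _ int int, of "UNIV - A" A] A by metis
      qed
      with compl op[OF open_UNIV] show ?case by simp
    next
      case (union A)
      have "A i \<in> sets borel" for i using union(2) by (simp add: borel_def image_subset_iff)
      then have A: "A i \<in> sets lebesgue" for i by simp
      have cut: "(LINT x:B|?M. D x) = (LINT x:B \<inter> Om|?M. D x)" for B
        unfolding set_lebesgue_integral_def
        by (intro Bochner_Integration.integral_cong) (auto simp: indicator_def)
      have "(LINT x:(\<Union>i. A i)|?M. D x) = (LINT x:(\<Union>i. A i \<inter> Om)|?M. D x)"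
        using cut[of "\<Union>i. A i"] by (simp add: Int_commute)
      also have "\<dots> = (\<Sum>i. LINT x:(A i \<inter> Om)|?M. D x)"
      proof (rule lebesgue_integral_countable_add)
        show "A i \<inter> Om \<in> sets ?M" for i using A by (auto simp: sets_restrict_space)
        show "(A i \<inter> Om) \<inter> (A j \<inter> Om) = {}" if "i \<noteq> j" for i j
          using union(1) that by (auto simp: disjoint_family_on_def)
        show "set_integrable ?M (\<Union>i. A i \<inter> Om) D" using A Oml by (intro int) auto
      qed
      also have "\<dots> = (\<Sum>i. LINT x:A i|?M. D x)" by (simp only: cut[symmetric])
      finally have "(LINT x:(\<Union>i. A i)|?M. D x) = (\<Sum>i. LINT x:A i|?M. D x)" .
      with union show ?case by simp
    qed
  qed
  interpret finite_measure ?M by (rule finite_measure_lebesgue_on_bounded) fact+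
  show ?thesis
  proof (rule density_zero[OF D])
    fix A assume "A \<in> sets ?M"
    then have A: "A \<in> sets lebesgue" using Oml by (auto simp: sets_restrict_space)
    then obtain S N N' where S: "A = S \<union> N" "N \<subseteq> N'" "N' \<in> null_sets lborel" "S \<in> sets lborel"
      using sets_completionE by blast
    have Sb: "S \<in> sets borel" using S(4) by simp
    have "AE x in lebesgue. x \<notin> N'" using S(3) by (intro AE_completion AE_not_in)
    then have "AE x in lebesgue. x \<in> Om \<longrightarrow> x \<notin> N'" by eventually_elim simp
    then have "AE x in ?M. x \<notin> N'" using Oml by (simp add: AE_restrict_space_iff)
    then have "AE x in ?M. indicator A x *\<^sub>R D x = indicator S x *\<^sub>R D x"
      by eventually_elim (use S in \<open>auto simp: indicator_def\<close>)
    then have "(LINT x:A|?M. D x) = (LINT x:S|?M. D x)"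
      unfolding set_lebesgue_integral_def
    proof (intro integral_cong_AE borel_measurable_scaleR D_meas)
      show "(\<lambda>x. indicat_real A x) \<in> borel_measurable ?M" by (rule ind[OF A])
      show "(\<lambda>x. indicat_real S x) \<in> borel_measurable ?M" using Sb by (intro ind) simp
    qed
    with borel[OF Sb] show "(LINT x:A|?M. D x) = 0" by simp
  qed
qed

section \<open>Weak gradient and weak divergence\<close>

lemma continuous_L2:
  fixes f :: "real ^ 'n \<Rightarrow> 'b::euclidean_space"
  assumes "open Om" "bounded Om" "continuous_on (closure Om) f" shows "f \<in> L2 Om"
proof -
  have "compact (closure Om)" using assms(2) by simp
  then have "bounded (f ` closure Om)" using assms(3) compact_continuous_image compact_imp_bounded by blast
  then obtain B where "\<And>x. x \<in> closure Om \<Longrightarrow> norm (f x) \<le> B" by (auto simp: bounded_iff)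
  moreover have "f \<in> borel_measurable (lebesgue_on Om)"
    using assms continuous_on_subset[OF assms(3) closure_subset]
    by (intro continuous_imp_measurable_on_sets_lebesgue) auto
  ultimately show ?thesis
    using assms(1,2) closure_subset by (intro L2_bounded[of _ _ B]) auto
qed

lemma test_fun_L2:
  assumes "open Om" "bounded Om" "test_fun Om \<phi>"
  shows "\<phi> \<in> L2 Om" "pd i \<phi> \<in> L2 Om"
  using test_fun_D(1,3)[OF assms(3)]
  by (auto intro!: continuous_L2 assms(1,2) intro: continuous_on_subset[OF _ subset_UNIV])

text \<open>The weak gradient and the weak divergence share their theory: both are linear relations \<open>R\<close>
  that determine the image up to null sets, and \<open>T\<close> picks a representative of it. The graph inner
  product makes their domains the spaces \<open>H1\<close> and \<open>Hdiv\<close>.\<close>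

locale weak_operator =
  fixes Om :: "(real ^ 'n) set"
    and R :: "(real ^ 'n \<Rightarrow> 'b::euclidean_space) \<Rightarrow> (real ^ 'n \<Rightarrow> 'c::euclidean_space) \<Rightarrow> bool"
    and T :: "(real ^ 'n \<Rightarrow> 'b) \<Rightarrow> real ^ 'n \<Rightarrow> 'c"
  assumes R_zero: "R (\<lambda>x. 0) (\<lambda>x. 0)"
    and R_lin: "f \<in> L2 Om \<Longrightarrow> f' \<in> L2 Om \<Longrightarrow> g \<in> L2 Om \<Longrightarrow> g' \<in> L2 Om \<Longrightarrow> R f g \<Longrightarrow> R f' g' \<Longrightarrow>
      R (fun_lin c f f') (fun_lin c g g')"
    and R_unique: "f \<in> L2 Om \<Longrightarrow> f' \<in> L2 Om \<Longrightarrow> AE x in lebesgue_on Om. f x = f' x \<Longrightarrow>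
      g \<in> L2 Om \<Longrightarrow> g' \<in> L2 Om \<Longrightarrow> R f g \<Longrightarrow> R f' g' \<Longrightarrow> AE x in lebesgue_on Om. g x = g' x"
    and T_R: "f \<in> L2 Om \<Longrightarrow> g \<in> L2 Om \<Longrightarrow> R f g \<Longrightarrow> T f \<in> L2 Om \<and> R f (T f)"
begin

definition dom where "dom = {f \<in> L2 Om. \<exists>g\<in>L2 Om. R f g}"

definition ipT where "ipT f f' = ip2 Om f f' + ip2 Om (T f) (T f')"

lemma dom_D: assumes "f \<in> dom" shows "f \<in> L2 Om" "T f \<in> L2 Om" "R f (T f)"
  using assms T_R by (auto simp: dom_def)

lemma dom_I: "f \<in> L2 Om \<Longrightarrow> g \<in> L2 Om \<Longrightarrow> R f g \<Longrightarrow> f \<in> dom"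
  by (auto simp: dom_def)

lemma dom_lin: "f \<in> dom \<Longrightarrow> f' \<in> dom \<Longrightarrow> fun_lin c f f' \<in> dom"
  by (rule dom_I[OF L2_lin L2_lin R_lin[of f f' "T f" "T f'"]]) (simp_all add: dom_D)

lemma T_eq: "f \<in> L2 Om \<Longrightarrow> g \<in> L2 Om \<Longrightarrow> R f g \<Longrightarrow> AE x in lebesgue_on Om. T f x = g x"
  using R_unique[of f f "T f" g] T_R[of f g] by simp

lemma T_lin: "f \<in> dom \<Longrightarrow> f' \<in> dom \<Longrightarrow>
    AE x in lebesgue_on Om. T (fun_lin c f f') x = fun_lin c (T f) (T f') x"
  by (rule T_eq[OF L2_lin L2_lin R_lin]) (simp_all add: dom_D)

lemma T_null: "f \<in> dom \<Longrightarrow> AE x in lebesgue_on Om. f x = 0 \<Longrightarrow> AE x in lebesgue_on Om. T f x = 0"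
  by (rule R_unique[of f "\<lambda>x. 0" "T f" "\<lambda>x. 0"]) (simp_all add: dom_D L2_zero R_zero)

lemma ipT_lin: "f \<in> dom \<Longrightarrow> f' \<in> dom \<Longrightarrow> h \<in> L2 Om \<Longrightarrow>
    ip2 Om (T (fun_lin c f f')) h = ip2 Om (T f) h + c * ip2 Om (T f') h"
  using ip2_cong_AE[OF T_lin[of f f' c], of h h] ip2_lin_left[of "T f" Om "T f'" h c]
  by (simp add: dom_D dom_lin L2_lin)

lemma semi_inner_dom: "semi_inner dom fun_lin ipT"
proof
  show "dom \<noteq> {}" using dom_I[OF L2_zero L2_zero R_zero] by blast
  show "ipT f g = ipT g f" for f g by (simp add: ipT_def ip2_commute[of Om f g] ip2_commute[of Om "T f"])
  show "0 \<le> ipT f f" for f by (simp add: ipT_def flip: norm_L2_sq)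
  show "ipT (fun_lin c f g) h = ipT f h + c * ipT g h" if "f \<in> dom" "g \<in> dom" "h \<in> dom" for f g h c
    using that by (simp add: ipT_def ip2_lin_left ipT_lin dom_D distrib_left)
qed (rule dom_lin)

lemma ipT_null_iff:
  assumes "f \<in> dom" shows "ipT f f = 0 \<longleftrightarrow> (AE x in lebesgue_on Om. f x = 0)"
proof
  assume "ipT f f = 0"
  then have "(norm_L2 Om f)\<^sup>2 = 0" unfolding ipT_def norm_L2_sq[symmetric]
    by (smt (verit) zero_le_power2)
  then show "AE x in lebesgue_on Om. f x = 0" using norm_L2_null_iff dom_D(1)[OF assms] by auto
next
  assume "AE x in lebesgue_on Om. f x = 0"
  then have "norm_L2 Om f = 0" "norm_L2 Om (T f) = 0"
    using T_null[OF assms] norm_L2_null_iff dom_D[OF assms] by auto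
  then show "ipT f f = 0" by (simp add: ipT_def flip: norm_L2_sq)
qed

end

lemma integral_L2_test_lin:
  fixes f g :: "real ^ 'n \<Rightarrow> real"
  assumes "f \<in> L2 Om" "g \<in> L2 Om" "h \<in> L2 Om"
  shows "(LINT x|lebesgue_on Om. (f x + c * g x) * h x) =
    (LINT x|lebesgue_on Om. f x * h x) + c * (LINT x|lebesgue_on Om. g x * h x)"
  using ip2_lin_left[OF assms, of c] by (simp add: ip2_def fun_lin_def)

lemma AE_vec_eq:
  fixes f g :: "'a \<Rightarrow> 'b ^ 'm::finite"
  shows "(\<And>i. AE x in M. f x $ i = g x $ i) \<Longrightarrow> AE x in M. f x = g x"
  unfolding vec_eq_iff by (rule eventually_all_finite)

lemma AE_eq_if_test_integrals_eq:
  fixes f g :: "real ^ 'n \<Rightarrow> real"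
  assumes Om: "open Om" "bounded Om" and f: "f \<in> L2 Om" and g: "g \<in> L2 Om"
    and eq: "\<And>\<phi>. test_fun Om \<phi> \<Longrightarrow>
      (LINT x|lebesgue_on Om. f x * \<phi> x) = (LINT x|lebesgue_on Om. g x * \<phi> x)"
  shows "AE x in lebesgue_on Om. f x = g x"
proof -
  have "AE x in lebesgue_on Om. f x + (-1) * g x = 0"
  proof (rule AE_zero_if_test_integrals_zero[OF Om])
    have "fun_lin (-1) f g \<in> L2 Om" by (rule L2_lin[OF f g])
    then show "integrable (lebesgue_on Om) (\<lambda>x. f x + (-1) * g x)"
      using L2_integrable[OF Om] by (simp add: fun_lin_def)
    show "(LINT x|lebesgue_on Om. (f x + (-1) * g x) * \<phi> x) = 0" if "test_fun Om \<phi>" for \<phi>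
      using integral_L2_test_lin[OF f g test_fun_L2(1)[OF Om that], of "-1"] eq[OF that] by simp
  qed
  then show ?thesis by simp
qed

lemma integral_mult_cong_AE:
  fixes f f' h :: "real ^ 'n \<Rightarrow> real"
  assumes "f \<in> L2 Om" "f' \<in> L2 Om" "h \<in> L2 Om" "AE x in lebesgue_on Om. f x = f' x"
  shows "(LINT x|lebesgue_on Om. f x * h x) = (LINT x|lebesgue_on Om. f' x * h x)"
  using ip2_cong_AE[OF assms(4), of h h] assms by (simp add: ip2_def)

lemma weak_operator_grad:
  assumes Om: "open Om" "bounded Om"
  shows "weak_operator Om (is_weak_grad Om) (wgrad Om)"
proof
  show "is_weak_grad Om (\<lambda>x. 0) (\<lambda>x. 0)" by (simp add: is_weak_grad_def)
  show "is_weak_grad Om (fun_lin c f f') (fun_lin c g g')"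
    if "f \<in> L2 Om" "f' \<in> L2 Om" "g \<in> L2 Om" "g' \<in> L2 Om" "is_weak_grad Om f g" "is_weak_grad Om f' g'"
    for f f' g g' c
    unfolding is_weak_grad_def
  proof (intro allI impI)
    fix \<phi> i assume t: "test_fun Om \<phi>"
    have "(LINT x|lebesgue_on Om. (f x + c * f' x) * pd i \<phi> x) =
      - (LINT x|lebesgue_on Om. (g x $ i + c * g' x $ i) * \<phi> x)"
      using that t test_fun_L2[OF Om t] by (simp add: integral_L2_test_lin L2_nth is_weak_grad_def)
    then show "(LINT x|lebesgue_on Om. fun_lin c f f' x * pd i \<phi> x) =
      - (LINT x|lebesgue_on Om. fun_lin c g g' x $ i * \<phi> x)" by (simp add: fun_lin_def)
  qed
  show "AE x in lebesgue_on Om. g x = g' x"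
    if "f \<in> L2 Om" "f' \<in> L2 Om" "AE x in lebesgue_on Om. f x = f' x" "g \<in> L2 Om" "g' \<in> L2 Om"
      "is_weak_grad Om f g" "is_weak_grad Om f' g'" for f f' g g'
  proof (rule AE_vec_eq, rule AE_eq_if_test_integrals_eq[OF Om])
    show "(LINT x|lebesgue_on Om. g x $ i * \<phi> x) = (LINT x|lebesgue_on Om. g' x $ i * \<phi> x)"
      if t: "test_fun Om \<phi>" for i \<phi>
      using integral_mult_cong_AE[of f Om f' "pd i \<phi>"] test_fun_L2[OF Om t] t
        \<open>f \<in> L2 Om\<close> \<open>f' \<in> L2 Om\<close> \<open>AE x in lebesgue_on Om. f x = f' x\<close>
        \<open>is_weak_grad Om f g\<close> \<open>is_weak_grad Om f' g'\<close> by (simp add: is_weak_grad_def)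
  qed (use that in \<open>simp_all add: L2_nth\<close>)
  show "wgrad Om f \<in> L2 Om \<and> is_weak_grad Om f (wgrad Om f)"
    if "g \<in> L2 Om" "is_weak_grad Om f g" for f g
    unfolding wgrad_def by (rule someI[of _ g]) (use that in simp)
qed

definition is_weak_tdiv :: "(real ^ 'n) set \<Rightarrow> 'n tens \<Rightarrow> 'n vect \<Rightarrow> bool" where
  "is_weak_tdiv Om \<tau> g \<longleftrightarrow> (\<forall>i. is_weak_div Om (trow \<tau> i) (\<lambda>x. g x $ i))"

lemma integral_sum_L2_test_lin:
  fixes s t :: "real ^ 'n \<Rightarrow> real ^ 'm" and h :: "'m \<Rightarrow> real ^ 'n \<Rightarrow> real"
  assumes "s \<in> L2 Om" "t \<in> L2 Om" "\<And>j. h j \<in> L2 Om"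
  shows "(LINT x|lebesgue_on Om. (\<Sum>j\<in>UNIV. (s x $ j + c * t x $ j) * h j x)) =
    (LINT x|lebesgue_on Om. (\<Sum>j\<in>UNIV. s x $ j * h j x)) +
    c * (LINT x|lebesgue_on Om. (\<Sum>j\<in>UNIV. t x $ j * h j x))"
proof -
  have "(LINT x|lebesgue_on Om. (\<Sum>j\<in>UNIV. s x $ j * h j x)) =
      (\<Sum>j\<in>UNIV. LINT x|lebesgue_on Om. s x $ j * h j x)" if "s \<in> L2 Om" for s :: "real ^ 'n \<Rightarrow> real ^ 'm"
    using that assms(3) by (intro Bochner_Integration.integral_sum L2_integrable_mult L2_nth)
  from this[OF assms(1)] this[OF assms(2)] this[OF L2_lin[OF assms(1,2), of c]]
  show ?thesis
    using assms by (simp add: fun_lin_def integral_L2_test_lin L2_nth sum.distrib sum_distrib_left)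
qed

lemma weak_operator_tdiv:
  assumes Om: "open Om" "bounded Om"
  shows "weak_operator Om (is_weak_tdiv Om) (tdiv Om)"
proof
  show "is_weak_tdiv Om (\<lambda>x. 0) (\<lambda>x. 0)" by (simp add: is_weak_tdiv_def is_weak_div_def)
  show "is_weak_tdiv Om (fun_lin c f f') (fun_lin c g g')"
    if "f \<in> L2 Om" "f' \<in> L2 Om" "g \<in> L2 Om" "g' \<in> L2 Om" "is_weak_tdiv Om f g" "is_weak_tdiv Om f' g'"
    for f f' g g' c
    unfolding is_weak_tdiv_def is_weak_div_def
  proof (intro allI impI)
    fix \<phi> i assume t: "test_fun Om \<phi>"
    have "(LINT x|lebesgue_on Om. (\<Sum>j\<in>UNIV. (f x $ i $ j + c * f' x $ i $ j) * pd j \<phi> x)) =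
      - (LINT x|lebesgue_on Om. (g x $ i + c * g' x $ i) * \<phi> x)"
      using that t test_fun_L2[OF Om t] integral_sum_L2_test_lin[of "trow f i" Om "trow f' i" "\<lambda>j. pd j \<phi>" c]
      by (simp add: integral_L2_test_lin L2_nth is_weak_tdiv_def is_weak_div_def)
    then show "(LINT x|lebesgue_on Om. (\<Sum>j\<in>UNIV. fun_lin c f f' x $ i $ j * pd j \<phi> x)) =
      - (LINT x|lebesgue_on Om. fun_lin c g g' x $ i * \<phi> x)" by (simp add: fun_lin_def)
  qed
  show "AE x in lebesgue_on Om. g x = g' x"
    if "f \<in> L2 Om" "f' \<in> L2 Om" "AE x in lebesgue_on Om. f x = f' x" "g \<in> L2 Om" "g' \<in> L2 Om"
      "is_weak_tdiv Om f g" "is_weak_tdiv Om f' g'" for f f' g g'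
  proof (rule AE_vec_eq, rule AE_eq_if_test_integrals_eq[OF Om])
    fix i \<phi> assume t: "test_fun Om \<phi>"
    have "(LINT x|lebesgue_on Om. (\<Sum>j\<in>UNIV. f x $ i $ j * pd j \<phi> x)) =
        (LINT x|lebesgue_on Om. (\<Sum>j\<in>UNIV. f' x $ i $ j * pd j \<phi> x))"
    proof (rule integral_cong_AE)
      show "AE x in lebesgue_on Om. (\<Sum>j\<in>UNIV. f x $ i $ j * pd j \<phi> x) = (\<Sum>j\<in>UNIV. f' x $ i $ j * pd j \<phi> x)"
        using that(3) by eventually_elim simp
      have "(\<lambda>x. \<Sum>j\<in>UNIV. f x $ i $ j * pd j \<phi> x) \<in> borel_measurable (lebesgue_on Om)"
        if "f \<in> L2 Om" for f
        using L2_measurable[OF L2_nth[OF L2_nth[OF that]]] L2_measurable[OF test_fun_L2(2)[OF Om t]]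
        by (intro borel_measurable_sum borel_measurable_times) auto
      then show "(\<lambda>x. \<Sum>j\<in>UNIV. f x $ i $ j * pd j \<phi> x) \<in> borel_measurable (lebesgue_on Om)"
        "(\<lambda>x. \<Sum>j\<in>UNIV. f' x $ i $ j * pd j \<phi> x) \<in> borel_measurable (lebesgue_on Om)"
        using that(1,2) by blast+
    qed
    then show "(LINT x|lebesgue_on Om. g x $ i * \<phi> x) = (LINT x|lebesgue_on Om. g' x $ i * \<phi> x)"
      using that(6,7) t by (simp add: is_weak_tdiv_def is_weak_div_def)
  qed (use that in \<open>simp_all add: L2_nth\<close>)
  show "tdiv Om f \<in> L2 Om \<and> is_weak_tdiv Om f (tdiv Om f)"
    if "g \<in> L2 Om" "is_weak_tdiv Om f g" for f g
  proof -
    have "wdiv Om (trow f i) \<in> L2 Om \<and> is_weak_div Om (trow f i) (wdiv Om (trow f i))" for i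
      unfolding wdiv_def
      by (rule someI[of _ "\<lambda>x. g x $ i"]) (use that in \<open>simp add: is_weak_tdiv_def L2_nth\<close>)
    then show ?thesis by (auto simp: is_weak_tdiv_def tdiv_def intro!: L2_vec)
  qed
qed

locale bounded_open =
  fixes Om :: "(real ^ 'n) set"
  assumes Om_open: "open Om" and Om_bounded: "bounded Om"
begin

sublocale G: weak_operator Om "is_weak_grad Om" "wgrad Om"
  by (rule weak_operator_grad[OF Om_open Om_bounded])

sublocale D: weak_operator Om "is_weak_tdiv Om" "tdiv Om"
  by (rule weak_operator_tdiv[OF Om_open Om_bounded])

lemma H1_dom: "H1 Om = G.dom"
  by (simp add: H1_def G.dom_def)

lemma Hdiv_dom: "Hdiv Om = D.dom"
proof -
  have "(\<forall>i. \<exists>D\<in>L2 Om. is_weak_div Om (trow \<tau> i) D) \<longleftrightarrow> (\<exists>g\<in>L2 Om. is_weak_tdiv Om \<tau> g)" for \<tau>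
  proof
    assume "\<forall>i. \<exists>D\<in>L2 Om. is_weak_div Om (trow \<tau> i) D"
    then obtain D where D: "\<And>i. D i \<in> L2 Om" "\<And>i. is_weak_div Om (trow \<tau> i) (D i)" by metis
    then show "\<exists>g\<in>L2 Om. is_weak_tdiv Om \<tau> g"
      by (intro bexI[of _ "\<lambda>x. \<chi> i. D i x"] L2_vec) (simp_all add: is_weak_tdiv_def)
  qed (auto simp: is_weak_tdiv_def intro: L2_nth)
  then show ?thesis by (simp add: Hdiv_def D.dom_def)
qed

sublocale H1: semi_inner "H1 Om" fun_lin G.ipT
  unfolding H1_dom by (rule G.semi_inner_dom)

sublocale Hdiv: semi_inner "Hdiv Om" fun_lin D.ipT
  unfolding Hdiv_dom by (rule D.semi_inner_dom)

lemma norm_H1_nrm: "H1.nrm p = norm_H1 Om p"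
  by (simp add: H1.nrm_def norm_H1_def G.ipT_def norm_L2_sq)

lemma norm_Y_nrm: "Hdiv.nrm t = norm_Y Om t"
  by (simp add: Hdiv.nrm_def norm_Y_def D.ipT_def norm_L2_sq)

lemma norm_H1_nonneg [simp]: "0 \<le> norm_H1 Om p"
  by (simp add: norm_H1_def)

end

section \<open>Completeness\<close>

lemma L2_complete:
  fixes s :: "nat \<Rightarrow> real ^ 'n \<Rightarrow> 'b::euclidean_space"
  assumes Om: "open Om" "bounded Om" and s: "\<And>m. s m \<in> L2 Om"
    and cauchy: "\<And>e. 0 < e \<Longrightarrow> \<exists>M. \<forall>m\<ge>M. \<forall>l\<ge>M. norm_L2 Om (\<lambda>x. s m x - s l x) < e"
  shows "\<exists>f\<in>L2 Om. (\<lambda>m. norm_L2 Om (\<lambda>x. s m x - f x)) \<longlonglongrightarrow> 0"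
proof -
  let ?M = "lebesgue_on Om"
  have diff: "(\<lambda>x. f x - g x) \<in> L2 Om" if "f \<in> L2 Om" "g \<in> L2 Om" for f g :: "real ^ 'n \<Rightarrow> 'b"
    using L2_lin[OF that, of "-1"] by (simp add: fun_lin_def)
  have "\<exists>M. \<forall>m\<ge>M. \<forall>l\<ge>M. norm_L2 Om (\<lambda>x. s m x - s l x) < (1/2) ^ j" for j
    by (rule cauchy) simp
  then obtain N where N: "\<And>j m l. m \<ge> N j \<Longrightarrow> l \<ge> N j \<Longrightarrow> norm_L2 Om (\<lambda>x. s m x - s l x) < (1/2) ^ j"
    by metis
  define r where "r = rec_nat (N 0) (\<lambda>j k. max k (N (Suc j)))"
  have r: "r (Suc j) \<ge> r j" "r j \<ge> N j" for j
    by (simp add: r_def, cases j) (simp_all add: r_def)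
  have r_mono: "r i \<le> r j" if "i \<le> j" for i j using lift_Suc_mono_le[of r i j] r(1) that by simp
  define g where "g j = s (r j)" for j
  have g: "g j \<in> L2 Om" for j by (simp add: g_def s)
  note meas = L2_measurable[OF g] L2_measurable[OF s]
  define C where "C = norm_L2 Om (\<lambda>x. 1 :: real)"
  have one: "(\<lambda>x. 1 :: real) \<in> L2 Om" using Om by (intro L2_bounded[of _ _ 1]) auto
  have nn: "(\<integral>\<^sup>+x. ennreal (norm (g (Suc j) x - g j x)) \<partial>?M) \<le> ennreal (C * (1/2) ^ j)" for j
  proof -
    have n: "(\<lambda>x. norm (g (Suc j) x - g j x)) \<in> L2 Om"
      using diff[OF g g, of "Suc j" j] measurable_compose[OF L2_measurable[OF diff[OF g g]] borel_measurable_norm, of "Suc j" j]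
      by (simp add: L2_def)
    have "(\<integral>\<^sup>+x. ennreal (norm (g (Suc j) x - g j x)) \<partial>?M) =
        ennreal (LINT x|?M. norm (g (Suc j) x - g j x))"
      by (rule nn_integral_eq_integral[OF L2_integrable[OF Om n]]) simp
    also have "(LINT x|?M. norm (g (Suc j) x - g j x)) \<le>
        norm_L2 Om (\<lambda>x. norm (g (Suc j) x - g j x)) * C"
      using ip2_le[OF n one] by (simp add: ip2_def C_def)
    also have "norm_L2 Om (\<lambda>x. norm (g (Suc j) x - g j x)) = norm_L2 Om (\<lambda>x. g (Suc j) x - g j x)"
      by (simp add: norm_L2_def)
    also have "\<dots> * C \<le> (1/2) ^ j * C"
      using N[of j "r (Suc j)" "r j"] r[of j] by (intro mult_right_mono) (auto simp: g_def C_def)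
    finally show ?thesis by (simp add: mult.commute ennreal_leI)
  qed
  have "(\<integral>\<^sup>+x. (\<Sum>j. ennreal (norm (g (Suc j) x - g j x))) \<partial>?M) =
      (\<Sum>j. \<integral>\<^sup>+x. ennreal (norm (g (Suc j) x - g j x)) \<partial>?M)"
    by (rule nn_integral_suminf) (use meas in measurable)
  also have "\<dots> \<le> (\<Sum>j. ennreal (C * (1/2) ^ j))" by (intro suminf_le nn summableI)
  also have "\<dots> = ennreal (\<Sum>j. C * (1/2) ^ j)"
    by (rule suminf_ennreal2) (auto simp: C_def intro!: summable_mult summable_geometric)
  finally have "(\<integral>\<^sup>+x. (\<Sum>j. ennreal (norm (g (Suc j) x - g j x))) \<partial>?M) \<noteq> \<infinity>"
    by (auto simp: top_unique)
  then have "AE x in ?M. (\<Sum>j. ennreal (norm (g (Suc j) x - g j x))) \<noteq> \<infinity>"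
    by (intro nn_integral_PInf_AE) (use meas in measurable)
  then have conv: "AE x in ?M. convergent (\<lambda>j. g j x)"
  proof eventually_elim
    case (elim x)
    then have "summable (\<lambda>j. norm (g (Suc j) x - g j x))"
      by (intro summable_suminf_not_top) auto
    then have "summable (\<lambda>j. g (Suc j) x - g j x)" by (rule summable_norm_cancel)
    then have "convergent (\<lambda>n. \<Sum>j<n. g (Suc j) x - g j x)" by (simp add: summable_iff_convergent)
    then have "convergent (\<lambda>n. g n x - g 0 x)"
      by (simp only: sum_lessThan_telescope[of "\<lambda>j. g j x"])
    from convergent_add[OF this convergent_const[of "g 0 x"]] show ?case by simp
  qed
  define f where "f x = lim (\<lambda>j. g j x)" for x
  have f_meas: "f \<in> borel_measurable ?M"
    unfolding f_def by (rule borel_measurable_lim_metric) (rule meas)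
  have gf: "AE x in ?M. (\<lambda>j. g j x) \<longlonglongrightarrow> f x"
    using conv by eventually_elim (simp add: f_def convergent_LIMSEQ_iff)
  have fatou: "(\<integral>\<^sup>+x. ennreal ((norm (s m x - f x))\<^sup>2) \<partial>?M) \<le> ennreal (((1/2) ^ j)\<^sup>2)" if m: "m \<ge> N j" for m j
  proof -
    have "(\<integral>\<^sup>+x. ennreal ((norm (s m x - f x))\<^sup>2) \<partial>?M) =
        (\<integral>\<^sup>+x. liminf (\<lambda>l. ennreal ((norm (s m x - g l x))\<^sup>2)) \<partial>?M)"
    proof (rule nn_integral_cong_AE)
      show "AE x in ?M. ennreal ((norm (s m x - f x))\<^sup>2) = liminf (\<lambda>l. ennreal ((norm (s m x - g l x))\<^sup>2))"
        using gf
      proof eventually_elim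
        case (elim x)
        then have "(\<lambda>l. ennreal ((norm (s m x - g l x))\<^sup>2)) \<longlonglongrightarrow> ennreal ((norm (s m x - f x))\<^sup>2)"
          by (intro tendsto_intros)
        from lim_imp_Liminf[OF sequentially_bot this] show ?case by (rule sym)
      qed
    qed
    also have "\<dots> \<le> liminf (\<lambda>l. \<integral>\<^sup>+x. ennreal ((norm (s m x - g l x))\<^sup>2) \<partial>?M)"
      by (rule nn_integral_liminf) (use meas in measurable)
    also have "\<dots> \<le> ennreal (((1/2) ^ j)\<^sup>2)"
    proof (rule Liminf_le)
      show "\<forall>\<^sub>F l in sequentially. (\<integral>\<^sup>+x. ennreal ((norm (s m x - g l x))\<^sup>2) \<partial>?M) \<le> ennreal (((1/2) ^ j)\<^sup>2)"
      proof (rule eventually_sequentiallyI[of j])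
        fix l assume "j \<le> l"
        then have "r l \<ge> N j" using r_mono r(2) order_trans by blast
        then have "norm_L2 Om (\<lambda>x. s m x - g l x) \<le> (1/2) ^ j"
          using N[OF m] unfolding g_def by (simp add: less_imp_le)
        then have "(norm_L2 Om (\<lambda>x. s m x - g l x))\<^sup>2 \<le> ((1/2) ^ j)\<^sup>2" by (intro power_mono) auto
        moreover have "(\<integral>\<^sup>+x. ennreal ((norm (s m x - g l x))\<^sup>2) \<partial>?M) =
            ennreal ((norm_L2 Om (\<lambda>x. s m x - g l x))\<^sup>2)"
          using nn_integral_eq_integral[of ?M "\<lambda>x. (norm (s m x - g l x))\<^sup>2"] diff[OF s g, of m l]
          by (simp add: L2_def norm_L2_def)
        ultimately show "(\<integral>\<^sup>+x. ennreal ((norm (s m x - g l x))\<^sup>2) \<partial>?M) \<le> ennreal (((1/2) ^ j)\<^sup>2)"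
          by (simp add: ennreal_leI)
      qed
    qed simp
    finally show ?thesis .
  qed
  have sf: "(\<lambda>x. s m x - f x) \<in> L2 Om" if "m \<ge> N j" for m j
  proof -
    have ms: "(\<lambda>x. s m x - f x) \<in> borel_measurable ?M" using meas f_meas by measurable
    moreover have "integrable ?M (\<lambda>x. (norm (s m x - f x))\<^sup>2)"
    proof (rule integrableI_bounded)
      show "(\<lambda>x. (norm (s m x - f x))\<^sup>2) \<in> borel_measurable ?M" using ms by measurable
      show "(\<integral>\<^sup>+x. ennreal (norm ((norm (s m x - f x))\<^sup>2)) \<partial>?M) < \<infinity>"
        using le_less_trans[OF fatou[OF that] ennreal_less_top] by simp
    qed
    ultimately show ?thesis by (simp add: L2_def)
  qed
  have f_L2: "f \<in> L2 Om"
    using diff[OF s[of "N 0"] sf[where m="N 0" and j=0]] by simp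
  have "norm_L2 Om (\<lambda>x. s m x - f x) \<le> (1/2) ^ j" if m: "m \<ge> N j" for m j
  proof -
    have "ennreal ((norm_L2 Om (\<lambda>x. s m x - f x))\<^sup>2) \<le> ennreal (((1/2) ^ j)\<^sup>2)"
      using fatou[OF m] nn_integral_eq_integral[of ?M "\<lambda>x. (norm (s m x - f x))\<^sup>2"] sf[OF m]
      by (simp add: L2_def norm_L2_def)
    then have "(norm_L2 Om (\<lambda>x. s m x - f x))\<^sup>2 \<le> ((1/2) ^ j)\<^sup>2"
      by (subst (asm) ennreal_le_iff) auto
    then show ?thesis by (rule power2_le_imp_le) simp
  qed
  then have bound: "\<exists>M. \<forall>m\<ge>M. norm_L2 Om (\<lambda>x. s m x - f x) \<le> (1/2) ^ j" for j by blast
  have "(\<lambda>m. norm_L2 Om (\<lambda>x. s m x - f x)) \<longlonglongrightarrow> 0"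
  proof (rule LIMSEQ_I)
    fix e :: real assume "0 < e"
    then obtain j where j: "(1/2) ^ j < e" using real_arch_pow_inv[of e "1/2"] by auto
    obtain M where "\<forall>m\<ge>M. norm_L2 Om (\<lambda>x. s m x - f x) \<le> (1/2) ^ j" using bound by blast
    with j show "\<exists>M. \<forall>m\<ge>M. norm (norm_L2 Om (\<lambda>x. s m x - f x) - 0) < e"
      by (intro exI[of _ M] allI impI) (auto intro: le_less_trans)
  qed
  with f_L2 show ?thesis by blast
qed

context bounded_open
begin

lemma L2_converges_integral:
  assumes s: "\<And>m. s m \<in> L2 Om" and f: "f \<in> L2 Om" "(\<lambda>m. norm_L2 Om (\<lambda>x. s m x - f x)) \<longlonglongrightarrow> 0" and h: "h \<in> L2 Om"
  shows "(\<lambda>m. ip2 Om (s m) h) \<longlonglongrightarrow> ip2 Om f h"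
proof -
  have d: "fun_lin (-1) (s m) f = (\<lambda>x. s m x - f x)" for m by (simp add: fun_lin_def)
  have "(\<lambda>m. ip2 Om (s m) h - ip2 Om f h) \<longlonglongrightarrow> 0"
  proof (rule Lim_null_comparison)
    show "\<forall>\<^sub>F m in sequentially. norm (ip2 Om (s m) h - ip2 Om f h) \<le> norm_L2 Om (\<lambda>x. s m x - f x) * norm_L2 Om h"
      using ip2_le[OF L2_lin[OF s f(1), of "-1"] h] ip2_lin_left[OF s f(1) h, of "-1"]
      by (intro always_eventually allI) (simp add: d)
    show "(\<lambda>m. norm_L2 Om (\<lambda>x. s m x - f x) * norm_L2 Om h) \<longlonglongrightarrow> 0"
      by (rule tendsto_mult_left_zero[OF f(2)])
  qed
  then show ?thesis by (rule LIM_zero_cancel)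
qed

text \<open>Weak gradients pass to the limit because they are defined by integrals against test functions.
  Completeness yields the lifting of least norm of a boundary function.\<close>

lemma H1_complete:
  assumes s: "\<And>m. s m \<in> H1 Om"
    and cauchy: "\<And>e. 0 < e \<Longrightarrow> \<exists>M. \<forall>m\<ge>M. \<forall>l\<ge>M. H1.dst (s m) (s l) < e"
  shows "\<exists>p\<in>H1 Om. (\<lambda>m. H1.dst (s m) p) \<longlonglongrightarrow> 0"
proof -
  have sG: "s m \<in> G.dom" for m using s by (simp add: H1_dom)
  have d: "fun_lin (-1) f g = (\<lambda>x. f x - g x)" for f g :: "real ^ 'n \<Rightarrow> 'b::euclidean_space"
    by (simp add: fun_lin_def)
  have gr: "norm_L2 Om (wgrad Om (fun_lin (-1) p q)) = norm_L2 Om (\<lambda>x. wgrad Om p x - g x)"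
    if "p \<in> H1 Om" "q \<in> L2 Om" "g \<in> L2 Om" "is_weak_grad Om q g" for p q g
  proof -
    have q: "q \<in> H1 Om" using that by (auto simp: H1_def)
    have "AE x in lebesgue_on Om. wgrad Om (fun_lin (-1) p q) x = wgrad Om p x - g x"
      using G.T_lin[of p q "-1"] G.T_eq[OF that(2-4)] that(1) q unfolding H1_dom
      by (auto simp: fun_lin_def elim!: eventually_elim2)
    moreover have "wgrad Om (fun_lin (-1) p q) \<in> L2 Om"
      using G.dom_D(2) H1.closed[OF that(1) q] by (simp add: H1_dom)
    moreover have "(\<lambda>x. wgrad Om p x - g x) \<in> L2 Om"
      using L2_lin[OF G.dom_D(2) that(3), of p "-1"] that(1) by (simp add: H1_dom d)
    ultimately have "ip2 Om (wgrad Om (fun_lin (-1) p q)) (wgrad Om (fun_lin (-1) p q)) =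
        ip2 Om (\<lambda>x. wgrad Om p x - g x) (\<lambda>x. wgrad Om p x - g x)"
      by (intro ip2_cong_AE)
    then show ?thesis by (simp only: norm_L2_eq)
  qed
  have dst: "H1.dst p q = sqrt ((norm_L2 Om (\<lambda>x. p x - q x))\<^sup>2 + (norm_L2 Om (\<lambda>x. wgrad Om p x - g x))\<^sup>2)"
    if "p \<in> H1 Om" "q \<in> L2 Om" "g \<in> L2 Om" "is_weak_grad Om q g" for p q g
    using gr[OF that] by (simp add: norm_H1_nrm norm_H1_def d)
  have s_dst: "H1.dst (s m) (s l) =
      sqrt ((norm_L2 Om (\<lambda>x. s m x - s l x))\<^sup>2 + (norm_L2 Om (\<lambda>x. wgrad Om (s m) x - wgrad Om (s l) x))\<^sup>2)" for m l
    by (rule dst[OF s]) (use sG in \<open>auto dest: G.dom_D\<close>)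
  have le: "norm_L2 Om (\<lambda>x. s m x - s l x) \<le> H1.dst (s m) (s l)"
    "norm_L2 Om (\<lambda>x. wgrad Om (s m) x - wgrad Om (s l) x) \<le> H1.dst (s m) (s l)" for m l
    unfolding s_dst by (auto intro!: real_le_rsqrt)
  have c: "\<exists>M. \<forall>m\<ge>M. \<forall>l\<ge>M. F m l < e" if e: "0 < e" and F: "\<And>m l. F m l \<le> H1.dst (s m) (s l)" for e F
  proof -
    obtain M where M: "\<forall>m\<ge>M. \<forall>l\<ge>M. H1.dst (s m) (s l) < e" using cauchy[OF e] by (elim exE)
    then have "F m l < e" if "m \<ge> M" "l \<ge> M" for m l
      using that le_less_trans[OF F, of m l e] by simp
    then show ?thesis by (intro exI[of _ M] allI impI)
  qed
  have "\<exists>f\<in>L2 Om. (\<lambda>m. norm_L2 Om (\<lambda>x. s m x - f x)) \<longlonglongrightarrow> 0"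
    by (rule L2_complete[OF Om_open Om_bounded G.dom_D(1)[OF sG] c[OF _ le(1)]])
  then obtain p where p: "p \<in> L2 Om" "(\<lambda>m. norm_L2 Om (\<lambda>x. s m x - p x)) \<longlonglongrightarrow> 0" by (elim bexE)
  have "\<exists>f\<in>L2 Om. (\<lambda>m. norm_L2 Om (\<lambda>x. wgrad Om (s m) x - f x)) \<longlonglongrightarrow> 0"
    by (rule L2_complete[OF Om_open Om_bounded G.dom_D(2)[OF sG] c[OF _ le(2)]])
  then obtain g where g: "g \<in> L2 Om" "(\<lambda>m. norm_L2 Om (\<lambda>x. wgrad Om (s m) x - g x)) \<longlonglongrightarrow> 0" by (elim bexE)
  have "is_weak_grad Om p g"
    unfolding is_weak_grad_def
  proof (intro allI impI)
    fix \<phi> i assume t: "test_fun Om \<phi>"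
    note tL = test_fun_L2[OF Om_open Om_bounded t]
    have ai: "(\<lambda>x. axis i (\<phi> x) :: real ^ 'n) \<in> L2 Om"
    proof (rule L2_vec)
      show "(\<lambda>x. (axis i (\<phi> x) :: real ^ 'n) $ j) \<in> L2 Om" for j
        by (cases "j = i") (simp_all add: axis_def tL(1) L2_zero)
    qed
    have "(\<lambda>m. ip2 Om (s m) (pd i \<phi>)) \<longlonglongrightarrow> ip2 Om p (pd i \<phi>)"
      by (rule L2_converges_integral[OF G.dom_D(1)[OF sG] p tL(2)])
    moreover have "(\<lambda>m. - ip2 Om (wgrad Om (s m)) (\<lambda>x. axis i (\<phi> x))) \<longlonglongrightarrow> - ip2 Om g (\<lambda>x. axis i (\<phi> x))"
      by (intro tendsto_minus L2_converges_integral[OF G.dom_D(2)[OF sG] g ai])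
    moreover have "ip2 Om (s m) (pd i \<phi>) = - ip2 Om (wgrad Om (s m)) (\<lambda>x. axis i (\<phi> x))" for m
      using G.dom_D(3)[OF sG, of m] t by (simp add: is_weak_grad_def ip2_def inner_axis)
    ultimately have "ip2 Om p (pd i \<phi>) = - ip2 Om g (\<lambda>x. axis i (\<phi> x))"
      using LIMSEQ_unique by simp
    then show "(LINT x|lebesgue_on Om. p x * pd i \<phi> x) = - (LINT x|lebesgue_on Om. g x $ i * \<phi> x)"
      by (simp add: ip2_def inner_axis)
  qed
  then have eq: "H1.dst (s m) p = sqrt ((norm_L2 Om (\<lambda>x. s m x - p x))\<^sup>2 + (norm_L2 Om (\<lambda>x. wgrad Om (s m) x - g x))\<^sup>2)"
    and pH: "p \<in> H1 Om" for m
    using dst[OF s p(1) g(1)] p(1) g(1) by (auto simp: H1_def)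
  have "(\<lambda>m. sqrt ((norm_L2 Om (\<lambda>x. s m x - p x))\<^sup>2 + (norm_L2 Om (\<lambda>x. wgrad Om (s m) x - g x))\<^sup>2))
      \<longlonglongrightarrow> sqrt (0\<^sup>2 + 0\<^sup>2)"
    by (intro tendsto_intros p(2) g(2))
  then have "(\<lambda>m. H1.dst (s m) p) \<longlonglongrightarrow> 0" unfolding eq by simp
  then show ?thesis by (rule bexI[where x = p, OF _ pH])
qed

end

section \<open>Traces and the data functionals\<close>

lemma continuous_measurable_surface:
  fixes \<phi> :: "real ^ 'n \<Rightarrow> real"
  assumes "continuous_on (closure Om) \<phi>" shows "\<phi> \<in> borel_measurable (surface Om)"
proof -
  have "continuous_on (frontier Om) \<phi>"
    using assms by (rule continuous_on_subset) (simp add: frontier_def)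
  then have "\<phi> \<in> borel_measurable (restrict_space borel (frontier Om))"
    by (rule borel_measurable_continuous_on_restrict)
  moreover have "sets (surface Om) = sets (restrict_space borel (frontier Om))"
    unfolding surface_def by (rule sets_restrict_space_cong) (use sets.sets_measure_of_eq[of borel] in simp)
  ultimately show ?thesis by (simp cong: measurable_cong_sets)
qed

context bounded_open
begin

lemma fun_lin_minus: "fun_lin (-1) f g = (\<lambda>x. f x - g x)" for f g :: "'a \<Rightarrow> 'b::real_vector"
  by (simp add: fun_lin_def)

lemma dst_H1: "H1.dst p q = norm_H1 Om (\<lambda>x. p x - q x)"
  by (simp add: norm_H1_nrm fun_lin_minus)

lemma trace_lin:
  assumes "is_trace Om v g" "is_trace Om v' g'"
  shows "is_trace Om (fun_lin c v v') (fun_lin c g g')"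
proof -
  let ?S = "surface Om"
  obtain \<phi> where v: "v \<in> H1 Om" "g \<in> borel_measurable ?S" and
    \<phi>: "\<And>m. \<phi> m \<in> H1 Om" "\<And>m. continuous_on (closure Om) (\<phi> m)" "(\<lambda>m. H1.dst (\<phi> m) v) \<longlonglongrightarrow> 0"
      "(\<lambda>m. \<integral>\<^sup>+x. ennreal ((\<phi> m x - g x)\<^sup>2) \<partial>?S) \<longlonglongrightarrow> 0"
    using assms(1) unfolding is_trace_def dst_H1 by auto
  obtain \<phi>' where v': "v' \<in> H1 Om" "g' \<in> borel_measurable ?S" and
    \<phi>': "\<And>m. \<phi>' m \<in> H1 Om" "\<And>m. continuous_on (closure Om) (\<phi>' m)" "(\<lambda>m. H1.dst (\<phi>' m) v') \<longlonglongrightarrow> 0"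
      "(\<lambda>m. \<integral>\<^sup>+x. ennreal ((\<phi>' m x - g' x)\<^sup>2) \<partial>?S) \<longlonglongrightarrow> 0"
    using assms(2) unfolding is_trace_def dst_H1 by auto
  let ?\<phi> = "\<lambda>m. fun_lin c (\<phi> m) (\<phi>' m)"
  have "(\<lambda>m. norm_H1 Om (\<lambda>x. ?\<phi> m x - fun_lin c v v' x)) \<longlonglongrightarrow> 0"
  proof (rule Lim_null_comparison)
    have eq: "(\<lambda>x. ?\<phi> m x - fun_lin c v v' x) = fun_lin c (fun_lin (-1) (\<phi> m) v) (fun_lin (-1) (\<phi>' m) v')" for m
      by (simp add: fun_lin_def algebra_simps)
    show "\<forall>\<^sub>F m in sequentially. norm (norm_H1 Om (\<lambda>x. ?\<phi> m x - fun_lin c v v' x)) \<le>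
        H1.dst (\<phi> m) v + \<bar>c\<bar> * H1.dst (\<phi>' m) v'"
      unfolding eq using H1.nrm_lin[OF H1.closed[OF \<phi>(1) v(1)] H1.closed[OF \<phi>'(1) v'(1)]]
      by (intro always_eventually allI) (simp flip: norm_H1_nrm add: H1.closed \<phi> \<phi>' v v')
    have "(\<lambda>m. H1.dst (\<phi> m) v + \<bar>c\<bar> * H1.dst (\<phi>' m) v') \<longlonglongrightarrow> 0 + \<bar>c\<bar> * 0"
      by (intro tendsto_intros \<phi> \<phi>')
    then show "(\<lambda>m. H1.dst (\<phi> m) v + \<bar>c\<bar> * H1.dst (\<phi>' m) v') \<longlonglongrightarrow> 0" by simp
  qed
  moreover have "(\<lambda>m. \<integral>\<^sup>+x. ennreal ((?\<phi> m x - fun_lin c g g' x)\<^sup>2) \<partial>?S) \<longlonglongrightarrow> 0"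
  proof (rule tendsto_sandwich[OF _ _ tendsto_const])
    let ?b = "\<lambda>m. 2 * (\<integral>\<^sup>+x. ennreal ((\<phi> m x - g x)\<^sup>2) \<partial>?S) +
        ennreal (2 * c\<^sup>2) * (\<integral>\<^sup>+x. ennreal ((\<phi>' m x - g' x)\<^sup>2) \<partial>?S)"
    have le: "(a + c * b)\<^sup>2 \<le> 2 * a\<^sup>2 + 2 * c\<^sup>2 * b\<^sup>2" for a b :: real
    proof -
      have "0 \<le> (a - c * b)\<^sup>2" by simp
      then show ?thesis by (simp add: power2_diff power2_sum power_mult_distrib algebra_simps)
    qed
    show "\<forall>\<^sub>F m in sequentially. (\<integral>\<^sup>+x. ennreal ((?\<phi> m x - fun_lin c g g' x)\<^sup>2) \<partial>?S) \<le> ?b m"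
    proof (intro always_eventually allI)
      fix m
      have [measurable]: "\<phi> m \<in> borel_measurable ?S" "\<phi>' m \<in> borel_measurable ?S"
        "g \<in> borel_measurable ?S" "g' \<in> borel_measurable ?S"
        using continuous_measurable_surface \<phi>(2) \<phi>'(2) v v' by blast+
      have "(?\<phi> m x - fun_lin c g g' x)\<^sup>2 \<le> 2 * (\<phi> m x - g x)\<^sup>2 + 2 * c\<^sup>2 * (\<phi>' m x - g' x)\<^sup>2" for x
        using le[of "\<phi> m x - g x" "\<phi>' m x - g' x"] by (simp add: fun_lin_def algebra_simps)
      then have "(\<integral>\<^sup>+x. ennreal ((?\<phi> m x - fun_lin c g g' x)\<^sup>2) \<partial>?S) \<le>
          (\<integral>\<^sup>+x. 2 * ennreal ((\<phi> m x - g x)\<^sup>2) + ennreal (2 * c\<^sup>2) * ennreal ((\<phi>' m x - g' x)\<^sup>2) \<partial>?S)"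
        by (intro nn_integral_mono)
          (simp add: ennreal_plus[symmetric] ennreal_mult'[symmetric] ennreal_leI
            del: ennreal_plus flip: ennreal_numeral)
      also have "\<dots> = ?b m"
        by (subst nn_integral_add) (simp_all add: nn_integral_cmult)
      finally show "(\<integral>\<^sup>+x. ennreal ((?\<phi> m x - fun_lin c g g' x)\<^sup>2) \<partial>?S) \<le> ?b m" .
    qed
    have "?b \<longlonglongrightarrow> 2 * 0 + ennreal (2 * c\<^sup>2) * 0"
      by (intro tendsto_add ennreal_tendsto_cmult \<phi> \<phi>') (simp_all add: ennreal_numeral[symmetric] del: ennreal_numeral)
    then show "?b \<longlonglongrightarrow> 0" by simp
  qed simp
  moreover have "fun_lin c g g' \<in> borel_measurable ?S"
    using v v' unfolding fun_lin_def by measurable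
  moreover have "continuous_on (closure Om) (?\<phi> m)" for m
    unfolding fun_lin_def using \<phi> \<phi>' by (intro continuous_intros)
  ultimately show ?thesis
    unfolding is_trace_def using H1.closed \<phi>(1) \<phi>'(1) v v' by (intro conjI exI[of _ ?\<phi>]) auto
qed

lemma zero_H1: "(\<lambda>x. 0) \<in> H1 Om"
  unfolding H1_dom by (rule G.dom_I[OF L2_zero L2_zero G.R_zero])

lemma norm_H1_null_iff: "p \<in> H1 Om \<Longrightarrow> norm_H1 Om p = 0 \<longleftrightarrow> (AE x in lebesgue_on Om. p x = 0)"
  using G.ipT_null_iff by (simp add: norm_H1_nrm[symmetric] H1.nrm_def H1_dom)

lemma norm_H1_zero: "norm_H1 Om (\<lambda>x. 0) = 0"
  using norm_H1_null_iff[OF zero_H1] by simp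

lemma trace_continuous:
  assumes "q \<in> H1 Om" "continuous_on (closure Om) q" shows "is_trace Om q q"
  unfolding is_trace_def using assms continuous_measurable_surface[OF assms(2)]
  by (intro conjI exI[of _ "\<lambda>m. q"]) (simp_all add: norm_H1_zero)

lemma trace_zero: "is_trace Om (\<lambda>x. 0) (\<lambda>x. 0)"
  by (rule trace_continuous[OF zero_H1]) simp

lemma norm_H12_le: "is_trace Om v g \<Longrightarrow> norm_H12 Om g \<le> norm_H1 Om v"
  unfolding norm_H12_def by (rule cInf_lower) (auto intro!: bdd_belowI[of _ 0])

lemma norm_H12_ge: "g \<in> H12 Om \<Longrightarrow> (\<And>v. is_trace Om v g \<Longrightarrow> c \<le> norm_H1 Om v) \<Longrightarrow> c \<le> norm_H12 Om g"
  unfolding norm_H12_def by (rule cInf_greatest) (auto simp: H12_def)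

lemma norm_H12_nonneg: "g \<in> H12 Om \<Longrightarrow> 0 \<le> norm_H12 Om g"
  by (rule norm_H12_ge) auto

lemma H12_lin: "g \<in> H12 Om \<Longrightarrow> h \<in> H12 Om \<Longrightarrow> fun_lin c g h \<in> H12 Om"
  using trace_lin unfolding H12_def by blast

lemma Hm12_lin:
  assumes r: "r \<in> Hm12 Om" and g: "g \<in> H12 Om" "h \<in> H12 Om"
  shows "r (fun_lin c g h) = r g + c * r h"
proof -
  have z: "(\<lambda>x. 0) \<in> H12 Om" using trace_zero by (auto simp: H12_def)
  have "(\<lambda>x. c * h x) = fun_lin c (\<lambda>x. 0) h" by (simp add: fun_lin_def)
  then have "(\<lambda>x. c * h x) \<in> H12 Om" using H12_lin[OF z g(2)] by simp
  then show ?thesis using r g by (simp add: Hm12_def fun_lin_def)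
qed

lemma Hm12_bound:
  assumes r: "r \<in> Hm12 Om" and g: "g \<in> H12 Om"
  shows "\<bar>r g\<bar> \<le> norm_Hm12 Om r * norm_H12 Om g" "0 \<le> norm_Hm12 Om r"
proof -
  let ?C = "{C. 0 \<le> C \<and> (\<forall>g\<in>H12 Om. \<bar>r g\<bar> \<le> C * norm_H12 Om g)}"
  obtain C where C: "\<forall>g\<in>H12 Om. \<bar>r g\<bar> \<le> C * norm_H12 Om g" using r by (auto simp: Hm12_def)
  have "\<bar>r g\<bar> \<le> \<bar>C\<bar> * norm_H12 Om g" if "g \<in> H12 Om" for g
    using C that mult_right_mono[OF abs_ge_self norm_H12_nonneg[OF that], of C] by force
  then have "\<bar>C\<bar> \<in> ?C" by simp
  then have ne: "?C \<noteq> {}" by blast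
  show "0 \<le> norm_Hm12 Om r" unfolding norm_Hm12_def by (rule cInf_greatest[OF ne]) simp
  show "\<bar>r g\<bar> \<le> norm_Hm12 Om r * norm_H12 Om g"
  proof (cases "norm_H12 Om g = 0")
    case True
    then show ?thesis using C g by fastforce
  next
    case False
    then have p: "0 < norm_H12 Om g" using norm_H12_nonneg[OF g] by simp
    have "\<bar>r g\<bar> / norm_H12 Om g \<le> norm_Hm12 Om r"
      unfolding norm_Hm12_def by (rule cInf_greatest[OF ne]) (use p g in \<open>auto simp: field_simps\<close>)
    then show ?thesis using p by (simp add: field_simps)
  qed
qed

lemma btrace_trace: "is_trace Om v g \<Longrightarrow> is_trace Om v (btrace Om v)"
  unfolding btrace_def by (rule someI[where P = "is_trace Om v"])

text \<open>Two traces of one function differ by a trace of the zero function, which has norm zero in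
  \<open>H12\<close>; so the chosen representative of the trace does not matter to a bounded functional.\<close>

lemma btrace_functional_lin:
  assumes r: "r \<in> Hm12 Om" and p: "is_trace Om p gp" and q: "is_trace Om q gq"
  shows "r (btrace Om (fun_lin c p q)) = r (btrace Om p) + c * r (btrace Om q)"
proof -
  note tp = btrace_trace[OF p] and tq = btrace_trace[OF q]
  note tl = trace_lin[OF tp tq, of c]
  note ts = btrace_trace[OF tl]
  have H: "btrace Om p \<in> H12 Om" "btrace Om q \<in> H12 Om"
    "fun_lin c (btrace Om p) (btrace Om q) \<in> H12 Om" "btrace Om (fun_lin c p q) \<in> H12 Om"
    using tp tq tl ts by (auto simp: H12_def)
  let ?d = "fun_lin (-1) (btrace Om (fun_lin c p q)) (fun_lin c (btrace Om p) (btrace Om q))"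
  have d: "?d \<in> H12 Om" by (rule H12_lin) (use H in auto)
  have "is_trace Om (fun_lin (-1) (fun_lin c p q) (fun_lin c p q)) ?d" by (rule trace_lin[OF ts tl])
  moreover have "fun_lin (-1) (fun_lin c p q) (fun_lin c p q) = (\<lambda>x. 0)" by (simp add: fun_lin_def)
  ultimately have "norm_H12 Om ?d \<le> 0" using norm_H12_le norm_H1_zero by metis
  then have "norm_H12 Om ?d = 0" using norm_H12_nonneg[OF d] by simp
  then have "r ?d = 0" using Hm12_bound(1)[OF r d] by simp
  then show ?thesis using Hm12_lin[OF r H(4,3), of "-1"] Hm12_lin[OF r H(1,2), of c] by simp
qed

lemma btrace_functional_bound:
  assumes r: "r \<in> Hm12 Om" and p: "is_trace Om p gp"
  shows "\<bar>r (btrace Om p)\<bar> \<le> norm_Hm12 Om r * norm_H1 Om p"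
proof -
  note t = btrace_trace[OF p]
  have H: "btrace Om p \<in> H12 Om" using t by (auto simp: H12_def)
  show ?thesis
    using Hm12_bound[OF r H] norm_H12_le[OF t] by (meson mult_left_mono order_trans)
qed

lemma trace_closed:
  assumes v: "\<And>m. is_trace Om (v m) g" and w: "w \<in> H1 Om" "(\<lambda>m. H1.dst (v m) w) \<longlonglongrightarrow> 0"
  shows "is_trace Om w g"
proof -
  let ?S = "surface Om"
  have vH: "v m \<in> H1 Om" for m using v by (simp add: is_trace_def)
  have "\<exists>\<psi>. \<psi> \<in> H1 Om \<and> continuous_on (closure Om) \<psi> \<and> H1.dst \<psi> (v m) < inverse (real (Suc m)) \<and>
      (\<integral>\<^sup>+x. ennreal ((\<psi> x - g x)\<^sup>2) \<partial>?S) < ennreal (inverse (real (Suc m)))" for m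
  proof -
    obtain \<phi> where \<phi>: "\<And>j. \<phi> j \<in> H1 Om" "\<And>j. continuous_on (closure Om) (\<phi> j)" "(\<lambda>j. H1.dst (\<phi> j) (v m)) \<longlonglongrightarrow> 0"
      "(\<lambda>j. \<integral>\<^sup>+x. ennreal ((\<phi> j x - g x)\<^sup>2) \<partial>?S) \<longlonglongrightarrow> 0"
      using v[of m] unfolding is_trace_def dst_H1 by auto
    have pos: "0 < inverse (real (Suc m))" by simp
    have "\<forall>\<^sub>F j in sequentially. H1.dst (\<phi> j) (v m) < inverse (real (Suc m))"
      by (rule order_tendstoD(2)[OF \<phi>(3) pos])
    moreover have "\<forall>\<^sub>F j in sequentially. (\<integral>\<^sup>+x. ennreal ((\<phi> j x - g x)\<^sup>2) \<partial>?S) < ennreal (inverse (real (Suc m)))"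
      by (rule order_tendstoD(2)[OF \<phi>(4)]) (use pos in simp)
    ultimately have "\<forall>\<^sub>F j in sequentially. H1.dst (\<phi> j) (v m) < inverse (real (Suc m)) \<and>
        (\<integral>\<^sup>+x. ennreal ((\<phi> j x - g x)\<^sup>2) \<partial>?S) < ennreal (inverse (real (Suc m)))"
      by (rule eventually_conj)
    then obtain j where "H1.dst (\<phi> j) (v m) < inverse (real (Suc m))"
        "(\<integral>\<^sup>+x. ennreal ((\<phi> j x - g x)\<^sup>2) \<partial>?S) < ennreal (inverse (real (Suc m)))"
      using eventually_happens'[OF sequentially_bot] by blast
    then show ?thesis using \<phi>(1,2) by (intro exI[of _ "\<phi> j"]) simp
  qed
  then obtain \<psi> where \<psi>: "\<And>m. \<psi> m \<in> H1 Om" "\<And>m. continuous_on (closure Om) (\<psi> m)"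
    "\<And>m. H1.dst (\<psi> m) (v m) < inverse (real (Suc m))"
    "\<And>m. (\<integral>\<^sup>+x. ennreal ((\<psi> m x - g x)\<^sup>2) \<partial>?S) < ennreal (inverse (real (Suc m)))"
    using choice[of "\<lambda>m \<psi>. \<psi> \<in> H1 Om \<and> continuous_on (closure Om) \<psi> \<and> H1.dst \<psi> (v m) < inverse (real (Suc m)) \<and>
      (\<integral>\<^sup>+x. ennreal ((\<psi> x - g x)\<^sup>2) \<partial>?S) < ennreal (inverse (real (Suc m)))"] by auto
  have "(\<lambda>m. H1.dst (\<psi> m) w) \<longlonglongrightarrow> 0"
  proof (rule Lim_null_comparison)
    show "\<forall>\<^sub>F m in sequentially. norm (H1.dst (\<psi> m) w) \<le> inverse (real (Suc m)) + H1.dst (v m) w"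
    proof (intro always_eventually allI)
      fix m
      show "norm (H1.dst (\<psi> m) w) \<le> inverse (real (Suc m)) + H1.dst (v m) w"
        using H1.dst_triangle[OF \<psi>(1)[of m] vH[of m] w(1)] \<psi>(3)[of m] H1.nrm_nonneg[OF H1.closed[OF \<psi>(1)[of m] w(1)], of "-1"]
        by simp
    qed
    show "(\<lambda>m. inverse (real (Suc m)) + H1.dst (v m) w) \<longlonglongrightarrow> 0"
      using tendsto_add[OF LIMSEQ_inverse_real_of_nat w(2)] by simp
  qed
  moreover have "(\<lambda>m. \<integral>\<^sup>+x. ennreal ((\<psi> m x - g x)\<^sup>2) \<partial>?S) \<longlonglongrightarrow> 0"
  proof (rule tendsto_sandwich[OF _ _ tendsto_const])
    show "\<forall>\<^sub>F m in sequentially. (\<integral>\<^sup>+x. ennreal ((\<psi> m x - g x)\<^sup>2) \<partial>?S) \<le> ennreal (inverse (real (Suc m)))"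
      using \<psi>(4) by (intro always_eventually allI less_imp_le)
    show "(\<lambda>m. ennreal (inverse (real (Suc m)))) \<longlonglongrightarrow> 0"
      using tendsto_ennrealI[OF LIMSEQ_inverse_real_of_nat] by simp
  qed simp
  moreover have "g \<in> borel_measurable ?S" using v[of 0] by (simp add: is_trace_def)
  ultimately show ?thesis
    unfolding is_trace_def dst_H1[symmetric] using w(1) \<psi>(1,2) by (intro conjI exI[of _ \<psi>]) auto
qed

text \<open>Functions with a given trace form a closed affine subspace of a complete space, and a
  minimising sequence is Cauchy by the parallelogram law.\<close>

lemma ex_minimal_lifting:
  assumes g: "g \<in> H12 Om"
  shows "\<exists>v. is_trace Om v g \<and> norm_H1 Om v \<le> norm_H12 Om g"
proof -
  define I where "I = norm_H12 Om g"
  have I: "0 \<le> I" using norm_H12_nonneg[OF g] by (simp add: I_def)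
  have "\<exists>v. is_trace Om v g \<and> norm_H1 Om v < I + inverse (real (Suc m))" for m
  proof -
    have "Inf {norm_H1 Om v | v. is_trace Om v g} < I + inverse (real (Suc m))"
      by (simp add: I_def norm_H12_def)
    from cInf_lessD[OF _ this] show ?thesis using g by (auto simp: H12_def)
  qed
  then obtain v where v: "\<And>m. is_trace Om (v m) g" "\<And>m. norm_H1 Om (v m) < I + inverse (real (Suc m))" by metis
  have vH: "v m \<in> H1 Om" for m using v(1) by (simp add: is_trace_def)
  have par: "(H1.dst (v m) (v l))\<^sup>2 \<le> 8 * I * e + 4 * e\<^sup>2"
    if e: "inverse (real (Suc m)) \<le> e" "inverse (real (Suc l)) \<le> e" for m l e
  proof -
    let ?u = "fun_lin (1/2) (fun_lin (-1/2) (v m) (v m)) (v l)"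
    have "is_trace Om ?u (fun_lin (1/2) (fun_lin (-1/2) g g) g)" by (intro trace_lin v(1))
    moreover have "fun_lin (1/2) (fun_lin (-1/2) g g) g = g" by (simp add: fun_lin_def)
    ultimately have "I \<le> norm_H1 Om ?u" using norm_H12_le by (simp add: I_def)
    then have "I\<^sup>2 \<le> (H1.nrm ?u)\<^sup>2" using I by (simp add: norm_H1_nrm power_mono)
    also have "\<dots> = G.ipT (v m) (v m) / 4 + G.ipT (v m) (v l) / 2 + G.ipT (v l) (v l) / 4"
      using H1.ip_sym[OF vH[of l] vH[of m]]
      by (simp add: H1.nrm_sq H1.closed vH H1.ip_lin H1.ip_lin_right field_simps)
    finally have "(H1.dst (v m) (v l))\<^sup>2 \<le> 2 * (H1.nrm (v m))\<^sup>2 + 2 * (H1.nrm (v l))\<^sup>2 - 4 * I\<^sup>2"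
      by (simp add: H1.dst_sq vH H1.nrm_sq)
    moreover have "(H1.nrm (v j))\<^sup>2 \<le> (I + e)\<^sup>2" if "inverse (real (Suc j)) \<le> e" for j
      using v(2)[of j] that by (intro power_mono) (auto simp: norm_H1_nrm)
    from this[OF e(1)] this[OF e(2)] have "2 * (H1.nrm (v m))\<^sup>2 + 2 * (H1.nrm (v l))\<^sup>2 \<le> 4 * (I + e)\<^sup>2" by simp
    moreover have "4 * (I + e)\<^sup>2 - 4 * I\<^sup>2 = 8 * I * e + 4 * e\<^sup>2" by (simp add: power2_sum)
    ultimately show ?thesis by linarith
  qed
  have "\<exists>M. \<forall>m\<ge>M. \<forall>l\<ge>M. H1.dst (v m) (v l) < e" if e: "0 < e" for e
  proof -
    have "(\<lambda>M. 8 * I * inverse (real (Suc M)) + 4 * (inverse (real (Suc M)))\<^sup>2) \<longlonglongrightarrow> 8 * I * 0 + 4 * 0\<^sup>2"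
      by (intro tendsto_intros LIMSEQ_inverse_real_of_nat)
    then have lim: "(\<lambda>M. 8 * I * inverse (real (Suc M)) + 4 * (inverse (real (Suc M)))\<^sup>2) \<longlonglongrightarrow> 0" by simp
    have "0 < e\<^sup>2" using e by simp
    from order_tendstoD(2)[OF lim this]
    obtain M where M: "8 * I * inverse (real (Suc M)) + 4 * (inverse (real (Suc M)))\<^sup>2 < e\<^sup>2"
      using eventually_happens'[OF sequentially_bot] by blast
    have "H1.dst (v m) (v l) < e" if "m \<ge> M" "l \<ge> M" for m l
    proof -
      have "inverse (real (Suc m)) \<le> inverse (real (Suc M))" "inverse (real (Suc l)) \<le> inverse (real (Suc M))"
        using that by (auto intro!: le_imp_inverse_le)
      from par[OF this] M have "(H1.dst (v m) (v l))\<^sup>2 < e\<^sup>2" by linarith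
      then show ?thesis using e by (simp add: power_less_imp_less_base)
    qed
    then show ?thesis by blast
  qed
  from H1_complete[OF vH this] obtain w where w: "w \<in> H1 Om" "(\<lambda>m. H1.dst (v m) w) \<longlonglongrightarrow> 0" by blast
  have "is_trace Om w g" by (rule trace_closed[OF v(1) w])
  moreover have "norm_H1 Om w \<le> I"
  proof (rule LIMSEQ_le_const)
    show "(\<lambda>m. I + inverse (real (Suc m)) + H1.dst (v m) w) \<longlonglongrightarrow> I"
      using tendsto_add[OF tendsto_add[OF tendsto_const LIMSEQ_inverse_real_of_nat] w(2)] by simp
    have "norm_H1 Om w \<le> I + inverse (real (Suc m)) + H1.dst (v m) w" for m
      using H1.nrm_le_dst[OF w(1) vH[of m]] H1.dst_commute[OF w(1) vH[of m]] v(2)[of m]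
      by (simp add: norm_H1_nrm)
    then show "\<exists>N. \<forall>m\<ge>N. norm_H1 Om w \<le> I + inverse (real (Suc m)) + H1.dst (v m) w" by blast
  qed
  ultimately show ?thesis by (auto simp: I_def)
qed

lemma lifting:
  assumes g: "g \<in> H12 Om"
  shows "lifting Om g \<in> H1 Om" "norm_H1 Om (lifting Om g) \<le> norm_H12 Om g"
proof -
  obtain v where v: "is_trace Om v g" "norm_H1 Om v \<le> norm_H12 Om g" using ex_minimal_lifting[OF g] by blast
  have "is_arg_min (norm_H1 Om) (\<lambda>v. is_trace Om v g) v"
    using v norm_H12_le by (auto simp: is_arg_min_def not_less intro: order_trans)
  then have "is_arg_min (norm_H1 Om) (\<lambda>v. is_trace Om v g) (lifting Om g)"
    unfolding lifting_def arg_min_def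
    by (rule someI[where P = "is_arg_min (norm_H1 Om) (\<lambda>v. is_trace Om v g)"])
  then have l: "is_trace Om (lifting Om g) g" "\<not> norm_H1 Om v < norm_H1 Om (lifting Om g)"
    using v(1) by (auto simp: is_arg_min_def)
  from l(1) show "lifting Om g \<in> H1 Om" by (simp add: is_trace_def)
  from l(2) v(2) show "norm_H1 Om (lifting Om g) \<le> norm_H12 Om g" by simp
qed

lemma ip2_rows:
  fixes s t :: "real ^ 'n \<Rightarrow> 'b::euclidean_space ^ 'm"
  assumes "s \<in> L2 Om" "t \<in> L2 Om"
  shows "ip2 Om s t = (\<Sum>i\<in>UNIV. ip2 Om (\<lambda>x. s x $ i) (\<lambda>x. t x $ i))"
  unfolding ip2_def inner_vec_def
  by (rule Bochner_Integration.integral_sum) (intro L2_integrable_inner L2_nth assms)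

lemma normal_dual_row:
  "normal_dual Om (trow \<tau> i) g =
    ip2 Om (trow \<tau> i) (wgrad Om (lifting Om g)) + ip2 Om (lifting Om g) (\<lambda>x. tdiv Om \<tau> x $ i)"
  by (simp add: normal_dual_def ip2_def tdiv_def)

text \<open>The lifting of the boundary datum is one fixed function of \<open>H1\<close>, so that the normal trace is
  linear in the tensor, and Green's formula is a sum of two inner products.\<close>

lemma H_fun_lin:
  assumes u: "uG \<in> H12v Om" and t: "\<tau> \<in> Hdiv Om" "\<tau>' \<in> Hdiv Om"
  shows "H_fun Om uG (fun_lin c \<tau> \<tau>') = H_fun Om uG \<tau> + c * H_fun Om uG \<tau>'"
proof -
  have tD: "\<tau> \<in> D.dom" "\<tau>' \<in> D.dom" using t by (simp_all add: Hdiv_dom)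
  have "normal_dual Om (trow (fun_lin c \<tau> \<tau>') i) (\<lambda>x. uG x $ i) =
      normal_dual Om (trow \<tau> i) (\<lambda>x. uG x $ i) + c * normal_dual Om (trow \<tau>' i) (\<lambda>x. uG x $ i)" for i
  proof -
    let ?L = "lifting Om (\<lambda>x. uG x $ i)"
    have L: "?L \<in> L2 Om" "wgrad Om ?L \<in> L2 Om"
      using lifting(1)[of "\<lambda>x. uG x $ i"] u G.dom_D by (auto simp: H12v_def H1_dom)
    have r: "trow (fun_lin c \<tau> \<tau>') i = fun_lin c (trow \<tau> i) (trow \<tau>' i)" by (simp add: fun_lin_def)
    note tL = L2_nth[OF D.dom_D(1)[OF tD(1)], of i] L2_nth[OF D.dom_D(1)[OF tD(2)], of i]
      L2_nth[OF D.dom_D(2)[OF tD(1)], of i] L2_nth[OF D.dom_D(2)[OF tD(2)], of i]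
    have "ip2 Om ?L (\<lambda>x. tdiv Om (fun_lin c \<tau> \<tau>') x $ i) =
        ip2 Om ?L (fun_lin c (\<lambda>x. tdiv Om \<tau> x $ i) (\<lambda>x. tdiv Om \<tau>' x $ i))"
    proof (rule ip2_cong_AE)
      show "AE x in lebesgue_on Om. tdiv Om (fun_lin c \<tau> \<tau>') x $ i =
          fun_lin c (\<lambda>x. tdiv Om \<tau> x $ i) (\<lambda>x. tdiv Om \<tau>' x $ i) x"
        using D.T_lin[OF tD, of c] by eventually_elim (simp add: fun_lin_def)
      show "(\<lambda>x. tdiv Om (fun_lin c \<tau> \<tau>') x $ i) \<in> L2 Om" by (intro L2_nth D.dom_D(2) D.dom_lin tD)
    qed (simp_all add: L L2_lin tL)
    moreover have "normal_dual Om (trow (fun_lin c \<tau> \<tau>') i) (\<lambda>x. uG x $ i) =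
        ip2 Om (fun_lin c (trow \<tau> i) (trow \<tau>' i)) (wgrad Om ?L) + ip2 Om ?L (\<lambda>x. tdiv Om (fun_lin c \<tau> \<tau>') x $ i)"
      by (subst normal_dual_row) (simp only: r)
    ultimately show ?thesis
      unfolding normal_dual_row using L tL
      by (simp add: ip2_lin_left L2.ip_lin_right algebra_simps)
  qed
  then show ?thesis
    by (simp add: H_fun_def normal_dualv_def sum.distrib sum_distrib_left algebra_simps)
qed

lemma H_fun_bound:
  assumes u: "uG \<in> H12v Om" and t: "\<tau> \<in> Hdiv Om"
  shows "\<bar>H_fun Om uG \<tau>\<bar> \<le> norm_H12v Om uG * norm_Y Om \<tau>"
proof -
  have tL: "\<tau> \<in> L2 Om" "tdiv Om \<tau> \<in> L2 Om" using t D.dom_D by (simp_all add: Hdiv_dom)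
  define a where "a i = sqrt ((norm_L2 Om (trow \<tau> i))\<^sup>2 + (norm_L2 Om (\<lambda>x. tdiv Om \<tau> x $ i))\<^sup>2)" for i
  define b where "b i = norm_H12 Om (\<lambda>x. uG x $ i)" for i
  have one: "\<bar>normal_dual Om (trow \<tau> i) (\<lambda>x. uG x $ i)\<bar> \<le> b i * a i" for i
  proof -
    let ?L = "lifting Om (\<lambda>x. uG x $ i)"
    have g: "(\<lambda>x. uG x $ i) \<in> H12 Om" using u by (simp add: H12v_def)
    have L: "?L \<in> L2 Om" "wgrad Om ?L \<in> L2 Om" using lifting(1)[OF g] G.dom_D by (auto simp: H1_dom)
    have cs: "x * y + z * w \<le> sqrt (x\<^sup>2 + w\<^sup>2) * sqrt (z\<^sup>2 + y\<^sup>2)" for x y z w :: real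
    proof -
      have "(x * y + z * w)\<^sup>2 + (x * z - y * w)\<^sup>2 = (x\<^sup>2 + w\<^sup>2) * (z\<^sup>2 + y\<^sup>2)"
        by (simp add: power2_eq_square algebra_simps)
      then have "(x * y + z * w)\<^sup>2 \<le> (x\<^sup>2 + w\<^sup>2) * (z\<^sup>2 + y\<^sup>2)"
        using zero_le_power2[of "x * z - y * w"] by linarith
      then have "sqrt ((x * y + z * w)\<^sup>2) \<le> sqrt ((x\<^sup>2 + w\<^sup>2) * (z\<^sup>2 + y\<^sup>2))" by (rule real_sqrt_le_mono)
      then show ?thesis by (simp add: real_sqrt_mult)
    qed
    have "\<bar>normal_dual Om (trow \<tau> i) (\<lambda>x. uG x $ i)\<bar> \<le>
        norm_L2 Om (trow \<tau> i) * norm_L2 Om (wgrad Om ?L) + norm_L2 Om ?L * norm_L2 Om (\<lambda>x. tdiv Om \<tau> x $ i)"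
      unfolding normal_dual_row
      using ip2_le[OF L2_nth[OF tL(1), of i] L(2)] ip2_le[OF L(1) L2_nth[OF tL(2), of i]] by linarith
    also have "\<dots> \<le> a i * norm_H1 Om ?L"
      unfolding a_def norm_H1_def by (rule cs)
    also have "\<dots> \<le> a i * b i"
      using lifting(2)[OF g] by (intro mult_left_mono) (auto simp: a_def b_def)
    finally show ?thesis by (simp add: mult.commute)
  qed
  have "\<bar>H_fun Om uG \<tau>\<bar> \<le> (\<Sum>i\<in>UNIV. \<bar>normal_dual Om (trow \<tau> i) (\<lambda>x. uG x $ i)\<bar>)"
    by (simp add: H_fun_def normal_dualv_def)
  also have "\<dots> \<le> (\<Sum>i\<in>UNIV. \<bar>b i\<bar> * \<bar>a i\<bar>)"
    by (intro sum_mono order_trans[OF one]) (metis abs_ge_self abs_mult)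
  also have "\<dots> \<le> L2_set b UNIV * L2_set a UNIV" by (rule L2_set_mult_ineq)
  also have "L2_set b UNIV = norm_H12v Om uG" by (simp add: L2_set_def norm_H12v_def b_def)
  also have "L2_set a UNIV = norm_Y Om \<tau>"
    using ip2_rows[OF tL(1) tL(1)] ip2_rows[OF tL(2) tL(2)]
    by (simp add: L2_set_def a_def norm_Y_def norm_L2_sq sum.distrib ip2_def)
  finally show ?thesis .
qed

end

section \<open>Integration by parts from difference quotients\<close>

lemma integral_lebesgue_on_eq_lborel:
  fixes f :: "real ^ 'n \<Rightarrow> real"
  assumes "open S" "(\<lambda>x. indicator S x * f x) \<in> borel_measurable borel"
  shows "(LINT x|lebesgue_on S. f x) = (LINT x|lborel. indicator S x * f x)"
proof -
  have "(LINT x|lebesgue_on S. f x) = (LINT x|lebesgue. indicator S x *\<^sub>R f x)"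
    using assms(1) by (intro integral_restrict_space) simp
  also have "\<dots> = (LINT x|lborel. indicator S x *\<^sub>R f x)"
    using assms(2) by (intro integral_completion) simp
  finally show ?thesis by simp
qed

lemma lborel_integral_translate:
  fixes f :: "real ^ 'n \<Rightarrow> real"
  assumes "f \<in> borel_measurable borel"
  shows "(LINT x|lborel. f (a + x)) = (LINT x|lborel. f x)"
proof -
  have "(LINT x|distr lborel borel ((+) a). f x) = (LINT x|lborel. f (a + x))"
    using assms by (intro integral_distr) auto
  then show ?thesis by (simp add: lborel_distr_plus)
qed

lemma pd_line:
  assumes "\<phi> differentiable (at (x + t *\<^sub>R axis i 1))"
  shows "((\<lambda>t. \<phi> (x + t *\<^sub>R axis i 1)) has_real_derivative pd i \<phi> (x + t *\<^sub>R axis i 1)) (at t)"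
proof -
  have d: "(\<phi> has_derivative frechet_derivative \<phi> (at (x + t *\<^sub>R axis i 1))) (at (x + t *\<^sub>R axis i 1))"
    using assms by (simp add: frechet_derivative_works)
  have "((\<lambda>t. x + t *\<^sub>R axis i 1) has_derivative (\<lambda>h. h *\<^sub>R axis i 1)) (at t)"
    by (auto intro!: derivative_eq_intros)
  from has_derivative_compose[OF this d]
  have "((\<lambda>t. \<phi> (x + t *\<^sub>R axis i 1)) has_derivative
      (\<lambda>h. frechet_derivative \<phi> (at (x + t *\<^sub>R axis i 1)) (h *\<^sub>R axis i 1))) (at t)" .
  moreover have "frechet_derivative \<phi> (at (x + t *\<^sub>R axis i 1)) (h *\<^sub>R axis i 1) =
      pd i \<phi> (x + t *\<^sub>R axis i 1) * h" for h
    using linear_scale[OF linear_frechet_derivative[OF assms]] by (simp add: pd_def mult.commute)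
  ultimately show ?thesis by (simp add: has_field_derivative_def)
qed

lemma pd_line_bound:
  assumes d: "\<And>t. t \<in> {0..h} \<Longrightarrow> \<phi> differentiable (at (x + (s * t) *\<^sub>R axis i 1))"
    and B: "\<And>t. t \<in> {0..h} \<Longrightarrow> \<bar>pd i \<phi> (x + (s * t) *\<^sub>R axis i 1)\<bar> \<le> B"
    and h: "0 \<le> h" and s: "\<bar>s\<bar> = 1"
  shows "\<bar>\<phi> (x + (s * h) *\<^sub>R axis i 1) - \<phi> x\<bar> \<le> B * h"
proof (cases "h = 0")
  case False
  with h have h: "0 < h" by simp
  have "((\<lambda>t. \<phi> (x + (s * t) *\<^sub>R axis i 1)) has_real_derivative
      pd i \<phi> (x + (s * t) *\<^sub>R axis i 1) * s) (at t)" if "0 \<le> t" "t \<le> h" for t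
  proof -
    have "((\<lambda>t. \<phi> (x + t *\<^sub>R axis i 1)) has_real_derivative pd i \<phi> (x + (s * t) *\<^sub>R axis i 1)) (at (s * t))"
      by (rule pd_line[OF d]) (use that in simp)
    moreover have "((*) s has_real_derivative s) (at t)"
      by (auto intro!: derivative_eq_intros)
    ultimately show ?thesis
      by (rule DERIV_chain2[where f = "\<lambda>t. \<phi> (x + t *\<^sub>R axis i 1)" and g = "(*) s"])
  qed
  from MVT2[OF h, of "\<lambda>t. \<phi> (x + (s * t) *\<^sub>R axis i 1)" "\<lambda>t. pd i \<phi> (x + (s * t) *\<^sub>R axis i 1) * s", OF this]
  obtain z where z: "0 < z" "z < h"
    "\<phi> (x + (s * h) *\<^sub>R axis i 1) - \<phi> x = h * (pd i \<phi> (x + (s * z) *\<^sub>R axis i 1) * s)" by auto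
  have "\<bar>h * (pd i \<phi> (x + (s * z) *\<^sub>R axis i 1) * s)\<bar> = h * \<bar>pd i \<phi> (x + (s * z) *\<^sub>R axis i 1)\<bar>"
    using h s by (simp add: abs_mult)
  also have "\<dots> \<le> h * B" using B[of z] z h by (intro mult_left_mono) auto
  finally show ?thesis using z(3) by (simp add: mult.commute)
qed simp

lemma test_fun_pd_outside:
  assumes "test_fun O' \<phi>" "x \<notin> closure {x. \<phi> x \<noteq> 0}"
  shows "\<phi> x = 0" "pd i \<phi> x = 0"
proof -
  show "\<phi> x = 0" using assms(2) closure_subset[of "{x. \<phi> x \<noteq> 0}"] by auto
  have "((\<lambda>x. 0) has_derivative (\<lambda>h. 0)) (at x)" by (rule has_derivative_const)
  then have "(\<phi> has_derivative (\<lambda>h. 0)) (at x)"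
  proof (rule has_derivative_transform_within_open[where s = "- closure {x. \<phi> x \<noteq> 0}"])
    show "0 = \<phi> y" if "y \<in> - closure {x. \<phi> x \<noteq> 0}" for y
      using that closure_subset[of "{x. \<phi> x \<noteq> 0}"] by auto
  qed (use assms(2) in auto)
  then show "pd i \<phi> x = 0" by (simp add: pd_eq)
qed

lemma test_fun_bounds:
  assumes "test_fun O' \<phi>"
  obtains B where "0 \<le> B" "\<And>x. \<bar>\<phi> x\<bar> \<le> B" "\<And>x. \<bar>pd i \<phi> x\<bar> \<le> B"
proof -
  let ?S = "closure {x. \<phi> x \<noteq> 0}"
  have S: "compact ?S" using test_fun_D(4)[OF assms] .
  have "bounded (\<phi> ` ?S)" "bounded (pd i \<phi> ` ?S)"
    using test_fun_D(1,3)[OF assms] S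
    by (auto intro!: compact_imp_bounded compact_continuous_image intro: continuous_on_subset)
  then obtain B1 B2 where B: "\<And>x. x \<in> ?S \<Longrightarrow> \<bar>\<phi> x\<bar> \<le> B1" "\<And>x. x \<in> ?S \<Longrightarrow> \<bar>pd i \<phi> x\<bar> \<le> B2"
    unfolding bounded_iff by (metis imageI real_norm_def)
  show ?thesis
  proof (rule that[of "max 0 (max B1 B2)"])
    show "\<bar>\<phi> x\<bar> \<le> max 0 (max B1 B2)" for x
      using B(1)[of x] test_fun_pd_outside(1)[OF assms, of x] by (cases "x \<in> ?S") auto
    show "\<bar>pd i \<phi> x\<bar> \<le> max 0 (max B1 B2)" for x
      using B(2)[of x] test_fun_pd_outside(2)[OF assms, of x] by (cases "x \<in> ?S") auto
  qed simp
qed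

text \<open>Integration by parts in a form that needs no regularity beyond difference quotients: if they are
  bounded along the axis and converge almost everywhere, translation invariance moves them from
  the test function to \<open>u\<close>, and dominated convergence gives the weak derivative.\<close>

lemma weak_partial:
  fixes u g :: "real ^ 'n \<Rightarrow> real"
  assumes S: "open S" "bounded S" and u: "continuous_on S u" "\<And>x. x \<in> S \<Longrightarrow> \<bar>u x\<bar> \<le> B"
    and L: "\<And>x h. 0 \<le> h \<Longrightarrow> (\<And>t. t \<in> {0..h} \<Longrightarrow> x + (- t) *\<^sub>R axis i 1 \<in> S) \<Longrightarrow>
              \<bar>u (x + (- h) *\<^sub>R axis i 1) - u x\<bar> \<le> L * h"
    and g: "g \<in> borel_measurable borel"
    and ug: "AE x in lborel. x \<in> S \<longrightarrow> ((\<lambda>t. u (x + t *\<^sub>R axis i 1)) has_real_derivative g x) (at 0)"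
    and \<phi>: "test_fun S \<phi>"
  shows "(LINT x|lebesgue_on S. u x * pd i \<phi> x) = - (LINT x|lebesgue_on S. g x * \<phi> x)"
proof -
  define e :: "real ^ 'n" where "e = axis i 1"
  define U where "U x = indicator S x * u x" for x
  let ?K = "closure {x. \<phi> x \<noteq> 0}"
  have K: "compact ?K" "?K \<subseteq> S" using test_fun_D(4,5)[OF \<phi>] .
  have U_meas [measurable]: "U \<in> borel_measurable borel"
    using borel_measurable_continuous_on_indicator[OF _ u(1)] S(1) by (simp add: U_def[abs_def])
  have \<phi>_meas [measurable]: "\<phi> \<in> borel_measurable borel" "pd i \<phi> \<in> borel_measurable borel"
    using test_fun_D(1,3)[OF \<phi>] by (auto intro: borel_measurable_continuous_onI)
  obtain C where C: "0 \<le> C" "\<And>x. \<bar>\<phi> x\<bar> \<le> C" "\<And>x. \<bar>pd i \<phi> x\<bar> \<le> C"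
    using test_fun_bounds[OF \<phi>, of i] by metis
  have UB: "\<bar>U x\<bar> \<le> indicator S x * \<bar>B\<bar>" for x using u(2)[of x] by (auto simp: U_def indicator_def)
  have S_int: "integrable lborel (\<lambda>x. indicator S x * c :: real)" for c
    using S emeasure_bounded_finite[OF S(2)]
    by (intro integrable_mult_left integrable_real_indicator) auto
  have U_int: "integrable lborel U"
    by (rule Bochner_Integration.integrable_bound[OF S_int[of "\<bar>B\<bar>"]]) (use UB in \<open>auto simp: abs_mult indicator_def\<close>)
  have mult_int: "integrable lborel (\<lambda>x. f x * h x)"
    if "integrable lborel f" "h \<in> borel_measurable borel" "\<And>x. \<bar>h x\<bar> \<le> C" for f h :: "real ^ 'n \<Rightarrow> real"
  proof (rule Bochner_Integration.integrable_bound)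
    show "integrable lborel (\<lambda>x. f x * C)" using that(1) by simp
    show "(\<lambda>x. f x * h x) \<in> borel_measurable lborel" using that(1,2) by (simp add: borel_measurable_integrable)
    show "AE x in lborel. norm (f x * h x) \<le> norm (f x * C)"
      using that(3) C(1) by (intro AE_I2) (simp add: abs_mult mult_left_mono)
  qed
  obtain \<delta> where \<delta>: "0 < \<delta>" "(\<Union>x\<in>?K. cball x \<delta>) \<subseteq> S"
    using compact_subset_open_imp_cball_epsilon_subset[OF K(1) S(1) K(2)] by metis
  define h where "h m = \<delta> * inverse (real (Suc m))" for m
  have h: "0 < h m" "h m \<le> \<delta>" for m
    using \<delta>(1) by (auto simp: h_def field_simps)
  have h0: "h \<longlonglongrightarrow> 0"
    unfolding h_def using tendsto_mult[OF tendsto_const LIMSEQ_inverse_real_of_nat, of \<delta>] by simp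
  \<comment> \<open>move the difference quotient from the test function to \<open>U\<close>\<close>
  have shift: "(LINT x|lborel. U x * ((\<phi> (x + h m *\<^sub>R e) - \<phi> x) / h m)) =
      (LINT x|lborel. \<phi> x * ((U (x + (- h m) *\<^sub>R e) - U x) / h m))" for m
  proof -
    have tr: "(LINT x|lborel. U x * \<phi> (x + h m *\<^sub>R e)) = (LINT x|lborel. \<phi> x * U (x + (- h m) *\<^sub>R e))"
      using lborel_integral_translate[of "\<lambda>x. \<phi> x * U (x + (- h m) *\<^sub>R e)" "h m *\<^sub>R e"]
      by (simp add: algebra_simps)
    have i1: "integrable lborel (\<lambda>x. U x * \<phi> (x + h m *\<^sub>R e))"
      by (rule mult_int[OF U_int]) (use C in measurable)
    have i2: "integrable lborel (\<lambda>x. \<phi> x * U x)"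
      using mult_int[OF U_int \<phi>_meas(1) C(2)] by (simp add: mult.commute)
    have "integrable lborel (\<lambda>x. U (- h m *\<^sub>R e + x))"
    proof (rule integrable_distr[where M' = borel and T = "(+) (- h m *\<^sub>R e)" and f = U])
      show "integrable (distr lborel borel ((+) (- h m *\<^sub>R e))) U" using U_int by (simp only: lborel_distr_plus)
    qed simp
    then have i3: "integrable lborel (\<lambda>x. \<phi> x * U (x + (- h m) *\<^sub>R e))"
      using mult_int[of "\<lambda>x. U (- h m *\<^sub>R e + x)", OF _ \<phi>_meas(1) C(2)] by (simp add: mult.commute add.commute)
    have "(LINT x|lborel. U x * ((\<phi> (x + h m *\<^sub>R e) - \<phi> x) / h m)) =
        ((LINT x|lborel. U x * \<phi> (x + h m *\<^sub>R e)) - (LINT x|lborel. \<phi> x * U x)) / h m"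
      by (subst Bochner_Integration.integral_diff[OF i1 i2, symmetric], subst integral_divide_zero[symmetric])
        (simp add: field_simps)
    also have "\<dots> = (LINT x|lborel. \<phi> x * ((U (x + (- h m) *\<^sub>R e) - U x) / h m))"
      unfolding tr
      by (subst Bochner_Integration.integral_diff[OF i3 i2, symmetric], subst integral_divide_zero[symmetric])
        (simp add: field_simps)
    finally show ?thesis .
  qed
  have diffble: "\<phi> differentiable (at x)" for x by (rule test_fun_D(2)[OF \<phi>])
  have lim1: "(\<lambda>m. LINT x|lborel. U x * ((\<phi> (x + h m *\<^sub>R e) - \<phi> x) / h m)) \<longlonglongrightarrow> (LINT x|lborel. U x * pd i \<phi> x)"
  proof (rule integral_dominated_convergence[where w = "\<lambda>x. \<bar>U x\<bar> * C"])
    show "integrable lborel (\<lambda>x. \<bar>U x\<bar> * C)" using U_int by simp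
    show "AE x in lborel. (\<lambda>m. U x * ((\<phi> (x + h m *\<^sub>R e) - \<phi> x) / h m)) \<longlonglongrightarrow> U x * pd i \<phi> x"
    proof (intro AE_I2 tendsto_mult tendsto_const)
      fix x
      have "((\<lambda>t. \<phi> (x + t *\<^sub>R e)) has_real_derivative pd i \<phi> x) (at 0)"
        using pd_line[OF diffble, of x i 0] by (simp add: e_def)
      then have "((\<lambda>t. (\<phi> (x + t *\<^sub>R e) - \<phi> x) / t) \<longlongrightarrow> pd i \<phi> x) (at 0)"
        by (simp add: has_field_derivative_iff)
      moreover have "filterlim h (at 0) sequentially"
        using h0 h(1) by (auto simp: filterlim_at intro!: always_eventually less_imp_neq[symmetric])
      ultimately show "(\<lambda>m. (\<phi> (x + h m *\<^sub>R e) - \<phi> x) / h m) \<longlonglongrightarrow> pd i \<phi> x"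
        by (rule filterlim_compose)
    qed
    show "AE x in lborel. norm (U x * ((\<phi> (x + h m *\<^sub>R e) - \<phi> x) / h m)) \<le> \<bar>U x\<bar> * C" for m
    proof (intro AE_I2)
      fix x
      have "\<bar>\<phi> (x + (1 * h m) *\<^sub>R axis i 1) - \<phi> x\<bar> \<le> C * h m"
        by (rule pd_line_bound) (use C(3) diffble h(1)[of m] in auto)
      then have "\<bar>(\<phi> (x + h m *\<^sub>R e) - \<phi> x) / h m\<bar> \<le> C"
        using h(1)[of m] by (simp add: e_def field_simps)
      then show "norm (U x * ((\<phi> (x + h m *\<^sub>R e) - \<phi> x) / h m)) \<le> \<bar>U x\<bar> * C"
        by (simp only: real_norm_def abs_mult) (intro mult_left_mono, auto)
    qed
  qed measurable
  have lim2: "(\<lambda>m. LINT x|lborel. \<phi> x * ((U (x + (- h m) *\<^sub>R e) - U x) / h m)) \<longlonglongrightarrow> (LINT x|lborel. \<phi> x * - g x)"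
  proof (rule integral_dominated_convergence[where w = "\<lambda>x. indicator S x * (C * \<bar>L\<bar>)"])
    show "integrable lborel (\<lambda>x. indicator S x * (C * \<bar>L\<bar>))" by (rule S_int)
    have inS: "x + (- t) *\<^sub>R e \<in> S" if "x \<in> ?K" "0 \<le> t" "t \<le> \<delta>" for x t
    proof -
      have "x + (- t) *\<^sub>R e \<in> cball x \<delta>" using that by (simp add: dist_norm e_def)
      then show ?thesis using \<delta>(2) that(1) by blast
    qed
    have quot: "(U (x + (- h m) *\<^sub>R e) - U x) / h m = (u (x + (- h m) *\<^sub>R e) - u x) / h m" if "x \<in> ?K" for x m
      using inS[OF that, of "h m"] inS[OF that, of 0] h[of m] \<delta>(1) by (simp add: U_def)
    show "AE x in lborel. (\<lambda>m. \<phi> x * ((U (x + (- h m) *\<^sub>R e) - U x) / h m)) \<longlonglongrightarrow> \<phi> x * - g x"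
      using ug
    proof eventually_elim
      case (elim x)
      show ?case
      proof (cases "x \<in> ?K")
        case True
        with K(2) have "x \<in> S" by blast
        with elim have "((\<lambda>t. u (x + t *\<^sub>R e)) has_real_derivative g x) (at 0)" by (simp add: e_def)
        then have "((\<lambda>t. (u (x + t *\<^sub>R e) - u x) / t) \<longlongrightarrow> g x) (at 0)"
          by (simp add: has_field_derivative_iff)
        moreover have "filterlim (\<lambda>m. - h m) (at 0) sequentially"
          unfolding filterlim_at using tendsto_minus[OF h0] h(1) by (simp add: less_imp_neq[symmetric])
        ultimately have "(\<lambda>m. (u (x + (- h m) *\<^sub>R e) - u x) / - h m) \<longlonglongrightarrow> g x"
          by (rule filterlim_compose[where g = "\<lambda>t. (u (x + t *\<^sub>R e) - u x) / t" and f = "\<lambda>m. - h m"])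
        from tendsto_mult[OF tendsto_const[of "\<phi> x"] tendsto_minus[OF this]]
        show ?thesis unfolding quot[OF True] by (simp only: divide_minus_right minus_minus)
      next
        case False
        have "\<phi> x = 0" by (rule test_fun_pd_outside(1)[OF \<phi> False])
        then show ?thesis by simp
      qed
    qed
    show "AE x in lborel. norm (\<phi> x * ((U (x + (- h m) *\<^sub>R e) - U x) / h m)) \<le> indicator S x * (C * \<bar>L\<bar>)" for m
    proof (intro AE_I2)
      fix x
      show "norm (\<phi> x * ((U (x + (- h m) *\<^sub>R e) - U x) / h m)) \<le> indicator S x * (C * \<bar>L\<bar>)"
      proof (cases "x \<in> ?K")
        case True
        have "\<bar>u (x + (- h m) *\<^sub>R e) - u x\<bar> \<le> L * h m"
          unfolding e_def
        proof (rule L)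
          show "x + (- t) *\<^sub>R axis i 1 \<in> S" if "t \<in> {0..h m}" for t
            using inS[OF True, of t] that h(2)[of m] by (simp add: e_def)
        qed (use h(1)[of m] in simp)
        also have "\<dots> \<le> \<bar>L\<bar> * h m" using h(1)[of m] by (intro mult_right_mono) auto
        finally have "\<bar>(u (x + (- h m) *\<^sub>R e) - u x) / h m\<bar> \<le> \<bar>L\<bar>"
          using h(1)[of m] by (simp add: field_simps)
        then have "\<bar>\<phi> x\<bar> * \<bar>(u (x + (- h m) *\<^sub>R e) - u x) / h m\<bar> \<le> C * \<bar>L\<bar>"
          using C by (intro mult_mono) auto
        moreover have "x \<in> S" using True K(2) by blast
        ultimately show ?thesis unfolding quot[OF True] by (simp add: abs_mult)
      next
        case False
        have "\<phi> x = 0" by (rule test_fun_pd_outside(1)[OF \<phi> False])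
        then show ?thesis using C(1) by simp
      qed
    qed
  qed (use g in measurable)
  have "(LINT x|lborel. U x * pd i \<phi> x) = (LINT x|lborel. \<phi> x * - g x)"
    by (rule LIMSEQ_unique[OF lim1 lim2[folded shift]])
  moreover have "(LINT x|lebesgue_on S. u x * pd i \<phi> x) = (LINT x|lborel. U x * pd i \<phi> x)"
  proof -
    have eq: "(\<lambda>x. indicator S x * (u x * pd i \<phi> x)) = (\<lambda>x. U x * pd i \<phi> x)" by (simp add: U_def mult.assoc)
    have "(\<lambda>x. indicator S x * (u x * pd i \<phi> x)) \<in> borel_measurable borel" unfolding eq by measurable
    from integral_lebesgue_on_eq_lborel[OF S(1) this] show ?thesis by (simp only: eq)
  qed
  moreover have "(LINT x|lebesgue_on S. g x * \<phi> x) = (LINT x|lborel. \<phi> x * g x)"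
  proof -
    have "\<phi> x = 0" if "x \<notin> S" for x by (rule test_fun_pd_outside(1)[OF \<phi>]) (use that K(2) in blast)
    then have eq: "(\<lambda>x. indicator S x * (g x * \<phi> x)) = (\<lambda>x. \<phi> x * g x)"
      by (auto simp: fun_eq_iff indicator_def)
    have "(\<lambda>x. indicator S x * (g x * \<phi> x)) \<in> borel_measurable borel" unfolding eq using g by measurable
    from integral_lebesgue_on_eq_lborel[OF S(1) this] show ?thesis by (simp only: eq)
  qed
  ultimately show ?thesis by simp
qed

section \<open>Polynomials\<close>

definition mon :: "('n::finite \<Rightarrow> nat) \<Rightarrow> real ^ 'n \<Rightarrow> real" where
  "mon m x = (\<Prod>i\<in>UNIV. (x $ i) ^ m i)"

definition mdeg :: "('n::finite \<Rightarrow> nat) \<Rightarrow> nat" where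
  "mdeg m = (\<Sum>i\<in>UNIV. m i)"

text \<open>The polynomials of degree less than \<open>k\<close>; the strict bound lets differentiation lower the
  degree of constants as well.\<close>

definition polys_less :: "nat \<Rightarrow> 'n::finite scal set" where
  "polys_less k = {p. \<exists>c. p = (\<lambda>x. \<Sum>m | mdeg m < k. c m * mon m x)}"

lemma finite_mdeg_less: "finite {m :: 'n::finite \<Rightarrow> nat. mdeg m < k}"
proof (rule finite_subset)
  show "{m :: 'n \<Rightarrow> nat. mdeg m < k} \<subseteq> (UNIV :: 'n set) \<rightarrow>\<^sub>E {..<k}"
  proof
    fix m :: "'n \<Rightarrow> nat" assume "m \<in> {m. mdeg m < k}"
    moreover have "m i \<le> mdeg m" for i unfolding mdeg_def by (rule member_le_sum) auto
    ultimately show "m \<in> (UNIV :: 'n set) \<rightarrow>\<^sub>E {..<k}" by (auto intro: le_less_trans)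
  qed
  show "finite ((UNIV :: 'n set) \<rightarrow>\<^sub>E {..<k})" by (intro finite_PiE) auto
qed

lemma polys_eq: "polys k = polys_less (Suc k)"
  by (auto simp: polys_def polys_less_def mon_def mdeg_def less_Suc_eq_le fun_eq_iff)

lemma polys_less_mon: "mdeg m < k \<Longrightarrow> mon m \<in> polys_less k"
proof -
  assume m: "mdeg m < k"
  have "mon m x = (\<Sum>m' | mdeg m' < k. (if m' = m then 1 else 0) * mon m' x)" for x
    using m by (simp add: sum.delta[OF finite_mdeg_less] if_distrib[of "\<lambda>c. c * _"] cong: if_cong)
  then show ?thesis by (auto simp: polys_less_def fun_eq_iff)
qed

lemma polys_less_add:
  assumes "p \<in> polys_less k" "q \<in> polys_less k" shows "(\<lambda>x. p x + q x) \<in> polys_less k"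
proof -
  obtain c d where "p = (\<lambda>x. \<Sum>m | mdeg m < k. c m * mon m x)" "q = (\<lambda>x. \<Sum>m | mdeg m < k. d m * mon m x)"
    using assms by (auto simp: polys_less_def)
  then have "(\<lambda>x. p x + q x) = (\<lambda>x. \<Sum>m | mdeg m < k. (c m + d m) * mon m x)"
    by (simp add: sum.distrib distrib_right)
  then show ?thesis unfolding polys_less_def by (intro CollectI exI[of _ "\<lambda>m. c m + d m"])
qed

lemma polys_less_scale:
  assumes "p \<in> polys_less k" shows "(\<lambda>x. a * p x) \<in> polys_less k"
proof -
  obtain c where "p = (\<lambda>x. \<Sum>m | mdeg m < k. c m * mon m x)"
    using assms by (auto simp: polys_less_def)
  then have "(\<lambda>x. a * p x) = (\<lambda>x. \<Sum>m | mdeg m < k. (a * c m) * mon m x)"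
    by (simp add: sum_distrib_left mult.assoc)
  then show ?thesis unfolding polys_less_def by (intro CollectI exI[of _ "\<lambda>m. a * c m"])
qed

lemma polys_less_zero: "(\<lambda>x. 0) \<in> polys_less k"
  unfolding polys_less_def by (intro CollectI exI[of _ "\<lambda>m. 0"]) simp

lemma polys_less_sum: "(\<And>j. j \<in> J \<Longrightarrow> p j \<in> polys_less k) \<Longrightarrow> (\<lambda>x. \<Sum>j\<in>J. p j x) \<in> polys_less k"
  by (induction J rule: infinite_finite_induct) (auto intro: polys_less_zero polys_less_add)

lemma polys_less_induct [consumes 1, case_names mon lin]:
  fixes p :: "'n::finite scal"
  assumes "p \<in> polys_less k"
    and mon: "\<And>m. mdeg m < k \<Longrightarrow> P (mon m)"
    and lin: "\<And>(J :: ('n \<Rightarrow> nat) set) c f. finite J \<Longrightarrow> (\<And>j. j \<in> J \<Longrightarrow> P (f j)) \<Longrightarrow> P (\<lambda>x. \<Sum>j\<in>J. c j * f j x)"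
  shows "P p"
proof -
  obtain c where p: "p = (\<lambda>x. \<Sum>m | mdeg m < k. c m * mon m x)" using assms(1) by (auto simp: polys_less_def)
  show ?thesis unfolding p by (rule lin[OF finite_mdeg_less]) (use mon in simp)
qed

lemma polys_less_mono:
  assumes "p \<in> polys_less k" "k \<le> l" shows "p \<in> polys_less l"
  using assms(1)
proof (induction rule: polys_less_induct)
  case (mon m)
  then show ?case using assms(2) by (intro polys_less_mon) simp
next
  case (lin J c f)
  then show ?case by (intro polys_less_sum polys_less_scale)
qed

lemma mon_mult: "mon m x * mon m' x = mon (\<lambda>i. m i + m' i) x"
  by (simp add: mon_def power_add prod.distrib)

lemma polys_mult:
  assumes "p \<in> polys j" "q \<in> polys k" shows "(\<lambda>x. p x * q x) \<in> polys (j + k)"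
proof -
  have "(\<lambda>x. mon m x * q x) \<in> polys (j + k)" if m: "mdeg m < Suc j" for m
    using assms(2) unfolding polys_eq
  proof (induction rule: polys_less_induct)
    case (mon m')
    then show ?case unfolding mon_mult using m
      by (intro polys_less_mon) (simp add: mdeg_def sum.distrib)
  next
    case (lin J c f)
    have "(\<lambda>x. mon m x * (\<Sum>i\<in>J. c i * f i x)) = (\<lambda>x. \<Sum>i\<in>J. c i * (mon m x * f i x))"
      by (simp add: sum_distrib_left mult_ac)
    with lin show ?case by (auto intro!: polys_less_sum polys_less_scale)
  qed
  with assms(1) show ?thesis unfolding polys_eq
  proof (induction rule: polys_less_induct)
    case (lin J c f)
    have "(\<lambda>x. (\<Sum>i\<in>J. c i * f i x) * q x) = (\<lambda>x. \<Sum>i\<in>J. c i * (f i x * q x))"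
      by (simp add: sum_distrib_right sum_distrib_left mult_ac)
    with lin show ?case by (auto intro!: polys_less_sum polys_less_scale)
  qed simp
qed

lemma polys_const: "(\<lambda>x :: real ^ 'n. a) \<in> polys k"
proof -
  have "mon (\<lambda>i. 0) = (\<lambda>x :: real ^ 'n. 1)" by (simp add: mon_def fun_eq_iff)
  moreover have "mon (\<lambda>i :: 'n. 0) \<in> polys_less (Suc k)" by (rule polys_less_mon) (simp add: mdeg_def)
  ultimately show ?thesis using polys_less_scale[of "\<lambda>x :: real ^ 'n. 1" "Suc k" a] by (simp add: polys_eq)
qed

lemma polys_coord: "(\<lambda>x. x $ i) \<in> polys 1"
proof -
  have "mon (\<lambda>j. if j = i then 1 else 0) = (\<lambda>x. x $ i)"
    by (simp add: mon_def fun_eq_iff if_distrib[of "\<lambda>n. _ ^ n"] cong: if_cong)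
  moreover have "mon (\<lambda>j. if j = i then 1 else 0) \<in> polys_less (Suc 1)"
    by (rule polys_less_mon) (simp add: mdeg_def)
  ultimately show ?thesis by (simp add: polys_eq)
qed

lemmas polys_add = polys_less_add[of _ "Suc k" for k, folded polys_eq]
  and polys_scale = polys_less_scale[of _ "Suc k" for k, folded polys_eq]
  and polys_sum = polys_less_sum[of _ _ "Suc k" for k, folded polys_eq]

lemma polys_mono: "p \<in> polys k \<Longrightarrow> k \<le> l \<Longrightarrow> p \<in> polys l"
  unfolding polys_eq by (rule polys_less_mono) auto

lemma polys_affine: "(\<lambda>x. a \<bullet> x + c) \<in> polys 1"
  unfolding inner_vec_def inner_real_def
  by (intro polys_add polys_sum polys_scale polys_coord polys_const)

lemma polys_prod: "(\<And>j. j \<in> J \<Longrightarrow> p j \<in> polys 1) \<Longrightarrow> (\<lambda>x. \<Prod>j\<in>J. p j x) \<in> polys (card J)"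
proof (induction J rule: infinite_finite_induct)
  case (insert a J)
  then show ?case using polys_mult[of "p a" 1 "\<lambda>x. \<Prod>j\<in>J. p j x" "card J"] by auto
qed (auto intro: polys_const)

lemma has_derivative_coord_power:
  "((\<lambda>x. (x $ j) ^ k) has_derivative (\<lambda>h. real k * (x $ j) ^ (k - 1) * h $ j)) (at (x :: real ^ 'n))"
  using has_derivative_power[OF bounded_linear_imp_has_derivative[OF bounded_linear_vec_nth[of j]], where n = k]
  by (simp add: mult_ac)

lemma mon_prod_differentiable:
  "(\<lambda>x. \<Prod>j\<in>J. (x $ j) ^ m j) differentiable (at (x :: real ^ 'n))"
  by (induction J rule: infinite_finite_induct)
    (auto intro!: differentiable_mult has_derivative_coord_power simp: differentiable_def[of "\<lambda>x. (x $ _) ^ _"])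

lemma pd_mon_prod:
  assumes "finite J"
  shows "pd i (\<lambda>x. \<Prod>j\<in>J. (x $ j) ^ m j) x =
    (if i \<in> J then real (m i) * (\<Prod>j\<in>J. (x $ j) ^ (m(i := m i - 1)) j) else 0)"
  using assms
proof (induction J rule: finite_induct)
  case (insert a J)
  have d: "(\<lambda>x. (x $ a) ^ m a) differentiable (at x)"
    using has_derivative_coord_power[of a "m a" x] by (auto simp: differentiable_def)
  have "pd i (\<lambda>x. (x $ a) ^ m a * (\<Prod>j\<in>J. (x $ j) ^ m j)) x =
      (x $ a) ^ m a * pd i (\<lambda>x. \<Prod>j\<in>J. (x $ j) ^ m j) x + pd i (\<lambda>x. (x $ a) ^ m a) x * (\<Prod>j\<in>J. (x $ j) ^ m j)"
    by (rule pd_mult[OF d mon_prod_differentiable])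
  moreover have "pd i (\<lambda>x. (x $ a) ^ m a) x = (if i = a then real (m a) * (x $ a) ^ (m a - 1) else 0)"
    using pd_eq[OF has_derivative_coord_power[of a "m a" x], of i] by (simp add: axis_def)
  moreover have "(\<Prod>j\<in>J. (x $ j) ^ (m(i := m i - 1)) j) = (\<Prod>j\<in>J. (x $ j) ^ m j)" if "i \<notin> J"
    using that by (intro prod.cong) auto
  ultimately show ?case using insert by (auto simp: mult_ac)
qed simp

lemma pd_mon: "pd i (mon m) x = real (m i) * mon (m(i := m i - 1)) x"
  using pd_mon_prod[of UNIV i m x] by (simp add: mon_def[abs_def])

lemma mon_differentiable: "mon m differentiable (at x)"
  unfolding mon_def[abs_def] by (rule mon_prod_differentiable)

lemma pd_sum_scale:
  assumes "finite J" "\<And>j. j \<in> J \<Longrightarrow> f j differentiable (at x)"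
  shows "pd i (\<lambda>x. \<Sum>j\<in>J. c j * f j x) x = (\<Sum>j\<in>J. c j * pd i (f j) x)"
proof -
  have "((\<lambda>x. \<Sum>j\<in>J. c j * f j x) has_derivative (\<lambda>h. \<Sum>j\<in>J. c j * frechet_derivative (f j) (at x) h)) (at x)"
    using assms(2) by (intro has_derivative_sum has_derivative_mult_right) (simp flip: frechet_derivative_works)
  from pd_eq[OF this] show ?thesis by (simp add: pd_def)
qed

lemma polys_less_differentiable: "p \<in> polys_less k \<Longrightarrow> p differentiable (at x)"
proof (induction rule: polys_less_induct)
  case (mon m)
  show ?case by (rule mon_differentiable)
next
  case (lin J c f)
  then show ?case by (intro differentiable_sum) auto
qed

lemmas polys_differentiable = polys_less_differentiable[of _ "Suc k" for k, folded polys_eq]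

lemma polys_continuous: "p \<in> polys k \<Longrightarrow> continuous_on S p"
  by (intro continuous_at_imp_continuous_on ballI differentiable_imp_continuous_within polys_differentiable)

lemma polys_less_pd: "p \<in> polys_less (Suc k) \<Longrightarrow> pd i p \<in> polys_less k \<and> (\<forall>x. p differentiable (at x))"
proof (induction rule: polys_less_induct)
  case (mon m)
  have "pd i (mon m) \<in> polys_less k"
  proof (cases "m i = 0")
    case True
    then have "pd i (mon m) = (\<lambda>x. 0)" by (simp add: fun_eq_iff pd_mon)
    then show ?thesis by (simp add: polys_less_zero)
  next
    case False
    have "mdeg (m(i := m i - 1)) + 1 = mdeg m"
      using False by (simp add: mdeg_def sum.remove[of UNIV i])
    then have "mon (m(i := m i - 1)) \<in> polys_less k" using mon by (intro polys_less_mon) simp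
    from polys_less_scale[OF this, of "real (m i)"]
    show ?thesis by (simp only: pd_mon[abs_def, of i m])
  qed
  then show ?case using mon_differentiable by blast
next
  case (lin J c f)
  then have "pd i (\<lambda>x. \<Sum>j\<in>J. c j * f j x) = (\<lambda>x. \<Sum>j\<in>J. c j * pd i (f j) x)"
    by (intro ext pd_sum_scale) auto
  moreover have "(\<lambda>x. \<Sum>j\<in>J. c j * pd i (f j) x) \<in> polys_less k"
    using lin by (intro polys_less_sum polys_less_scale) auto
  moreover have "(\<lambda>x. \<Sum>j\<in>J. c j * f j x) differentiable (at x)" for x
    using lin by (intro differentiable_sum) auto
  ultimately show ?case by simp
qed

lemma polys_pd_less: "p \<in> polys k \<Longrightarrow> pd i p \<in> polys_less k"
  using polys_less_pd[of p k i] by (simp add: polys_eq)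

lemma polys_pd: "p \<in> polys k \<Longrightarrow> pd i p \<in> polys k"
  using polys_less_mono[OF polys_pd_less, of p k "Suc k" i] by (simp add: polys_eq)

lemma pd_commute: "p \<in> polys k \<Longrightarrow> pd i (pd j p) x = pd j (pd i p) x"
proof -
  assume "p \<in> polys k"
  then obtain c where p: "p = (\<lambda>x. \<Sum>m | mdeg m < Suc k. c m * mon m x)"
    unfolding polys_eq by (auto simp: polys_less_def)
  have 1: "pd i p = (\<lambda>x. \<Sum>m | mdeg m < Suc k. (c m * real (m i)) * mon (m(i := m i - 1)) x)" for i
    unfolding p by (rule ext, subst pd_sum_scale)
      (auto simp: finite_mdeg_less mon_differentiable pd_mon mult.assoc simp del: fun_upd_apply)
  have 2: "pd j (pd i p) x = (\<Sum>m | mdeg m < Suc k. c m * (real (m i) * real ((m(i := m i - 1)) j)) *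
      mon ((m(i := m i - 1))(j := (m(i := m i - 1)) j - 1)) x)" for i j
    unfolding 1 by (subst pd_sum_scale)
      (auto simp: finite_mdeg_less mon_differentiable pd_mon mult.assoc simp del: fun_upd_apply)
  show ?thesis
  proof (cases "i = j")
    case False
    then show ?thesis unfolding 2 by (intro sum.cong) (simp_all add: fun_upd_twist mult_ac)
  qed simp
qed

lemma polys_on_line: "p \<in> polys k \<Longrightarrow> \<exists>P. \<forall>t. p (y + t *\<^sub>R v) = poly P t"
  unfolding polys_eq
proof (induction rule: polys_less_induct)
  case (mon m)
  have "mon m (y + t *\<^sub>R v) = poly (\<Prod>i\<in>UNIV. [:y $ i, v $ i:] ^ m i) t" for t
    by (simp add: mon_def poly_prod)
  then show ?case by blast
next
  case (lin J c f)
  then obtain P where "\<And>j t. j \<in> J \<Longrightarrow> f j (y + t *\<^sub>R v) = poly (P j) t" by metis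
  then have "(\<Sum>j\<in>J. c j * f j (y + t *\<^sub>R v)) = poly (\<Sum>j\<in>J. smult (c j) (P j)) t" for t
    by (simp add: poly_sum)
  then show ?case by blast
qed

text \<open>On lines through a point of the open set, a polynomial function is a polynomial in one variable
  with infinitely many zeros.\<close>

lemma polys_zero_on_open:
  assumes p: "p \<in> polys k" and S: "open S" "y \<in> S" "\<And>x. x \<in> S \<Longrightarrow> p x = 0"
  shows "p x = 0"
proof -
  obtain P where P: "\<And>t. p (y + t *\<^sub>R (x - y)) = poly P t" using polys_on_line[OF p] by metis
  have "open ((\<lambda>t. y + t *\<^sub>R (x - y)) -` S)"
    by (intro open_vimage[OF S(1)]) (auto intro!: continuous_intros)
  then obtain e where e: "0 < e" "ball 0 e \<subseteq> (\<lambda>t. y + t *\<^sub>R (x - y)) -` S"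
    using S(2) openE[of _ 0] by force
  have "poly P t = 0" if "t \<in> {0<..<e}" for t
    using e(2) that S(3) P[of t, symmetric] by (auto simp: subset_iff dist_real_def)
  then have "{0<..<e} \<subseteq> {t. poly P t = 0}" by blast
  moreover have "infinite {0<..<e}" using e(1) by (rule infinite_Ioo)
  ultimately have "infinite {t. poly P t = 0}" using finite_subset by metis
  then have "P = 0" using poly_roots_finite by metis
  then show ?thesis using P[of 1] by simp
qed

text \<open>Euler's operator \<open>q \<mapsto> n q + x \<bullet> \<nabla> q\<close> is the divergence of \<open>q x\<close>. It multiplies
  each monomial by a positive number, and it is injective because it turns \<open>t ^ n q (t x)\<close> into a
  constant on rays.\<close>

lemma euler_operator_injective:
  fixes w :: "'n::finite scal"
  assumes w: "\<And>x. w differentiable (at x)"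
    and 0: "\<And>x. real CARD('n) * w x + (\<Sum>i\<in>UNIV. x $ i * pd i w x) = 0"
  shows "w x = 0"
proof -
  let ?n = "CARD('n)"
  have fd: "frechet_derivative w (at y) x = (\<Sum>i\<in>UNIV. x $ i * pd i w y)" for y
  proof -
    have lin: "linear (frechet_derivative w (at y))" by (rule linear_frechet_derivative[OF w])
    have "x = (\<Sum>i\<in>UNIV. x $ i *\<^sub>R axis i 1)" using basis_expansion[of x] by (simp add: scalar_mult_eq_scaleR)
    then have "frechet_derivative w (at y) x = frechet_derivative w (at y) (\<Sum>i\<in>UNIV. x $ i *\<^sub>R axis i 1)" by simp
    also have "\<dots> = (\<Sum>i\<in>UNIV. frechet_derivative w (at y) (x $ i *\<^sub>R axis i 1))" by (rule linear_sum[OF lin])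
    also have "\<dots> = (\<Sum>i\<in>UNIV. x $ i * pd i w y)" by (simp add: linear_scale[OF lin] pd_def)
    finally show ?thesis .
  qed
  have d: "((\<lambda>t. w (t *\<^sub>R x)) has_real_derivative (\<Sum>i\<in>UNIV. x $ i * pd i w (t *\<^sub>R x))) (at t)" for t
  proof -
    have "((\<lambda>t. t *\<^sub>R x) has_derivative (\<lambda>h. h *\<^sub>R x)) (at t)" by (auto intro!: derivative_eq_intros)
    from has_derivative_compose[OF this frechet_derivative_works[THEN iffD1, OF w]]
    have "((\<lambda>t. w (t *\<^sub>R x)) has_derivative (\<lambda>h. frechet_derivative w (at (t *\<^sub>R x)) (h *\<^sub>R x))) (at t)" .
    moreover have "frechet_derivative w (at (t *\<^sub>R x)) (h *\<^sub>R x) = (\<Sum>i\<in>UNIV. x $ i * pd i w (t *\<^sub>R x)) * h" for h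
      using linear_scale[OF linear_frechet_derivative[OF w]] by (simp add: fd mult.commute)
    ultimately show ?thesis by (simp add: has_field_derivative_def)
  qed
  have "((\<lambda>t. t ^ ?n * w (t *\<^sub>R x)) has_real_derivative 0) (at t)" for t
  proof -
    have "((\<lambda>t. t ^ ?n * w (t *\<^sub>R x)) has_real_derivative
        (real ?n * t ^ (?n - 1)) * w (t *\<^sub>R x) + (\<Sum>i\<in>UNIV. x $ i * pd i w (t *\<^sub>R x)) * t ^ ?n) (at t)"
      by (rule DERIV_mult[OF _ d]) (auto intro!: derivative_eq_intros)
    moreover have "t ^ ?n = t ^ (?n - 1) * t" by (simp add: power_eq_if)
    moreover have "real ?n * w (t *\<^sub>R x) + t * (\<Sum>i\<in>UNIV. x $ i * pd i w (t *\<^sub>R x)) = 0"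
      using 0[of "t *\<^sub>R x"] by (simp add: sum_distrib_left mult_ac)
    moreover have "(real ?n * t ^ (?n - 1)) * a + b * (t ^ (?n - 1) * t) = t ^ (?n - 1) * (real ?n * a + t * b)" for a b
      by (simp add: algebra_simps)
    ultimately show ?thesis by simp
  qed
  then have "\<forall>t. ((\<lambda>t. t ^ ?n * w (t *\<^sub>R x)) has_real_derivative 0) (at t)" by blast
  from DERIV_isconst_all[OF this, of 1 0] show ?thesis by (simp add: power_0_left)
qed

lemma euler_operator_degree:
  fixes q :: "'n::finite scal"
  assumes q: "q \<in> polys k" and s: "s \<in> polys_less k"
    and eq: "\<And>x. real CARD('n) * q x + (\<Sum>i\<in>UNIV. x $ i * pd i q x) = s x"
  shows "q \<in> polys_less k"
proof -
  let ?n = "real CARD('n)"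
  obtain c where c: "s = (\<lambda>x. \<Sum>m | mdeg m < k. c m * mon m x)" using s by (auto simp: polys_less_def)
  define d where "d m = c m / (?n + real (mdeg m))" for m :: "'n \<Rightarrow> nat"
  define q' where "q' x = (\<Sum>m | mdeg m < k. d m * mon m x)" for x
  have q': "q' \<in> polys_less k" by (auto simp: polys_less_def q'_def[abs_def])
  have dd: "q differentiable (at x)" "q' differentiable (at x)" for x
    using polys_differentiable[OF q] polys_less_differentiable[OF q'] by auto
  have euler_mon: "(\<Sum>i\<in>UNIV. x $ i * pd i (mon m) x) = real (mdeg m) * mon m x" for m and x :: "real ^ 'n"
  proof -
    have "x $ i * pd i (mon m) x = real (m i) * mon m x" for i
    proof (cases "m i = 0")
      case False
      then obtain l where l: "m i = Suc l" using not0_implies_Suc by blast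
      have "x $ i * mon (m(i := m i - 1)) x = mon m x"
        unfolding mon_def by (simp add: prod.remove[of UNIV i] l)
      then show ?thesis by (simp add: pd_mon mult_ac)
    qed (simp add: pd_mon)
    then show ?thesis by (simp add: mdeg_def sum_distrib_right)
  qed
  have pd_q': "pd i q' x = (\<Sum>m | mdeg m < k. d m * pd i (mon m) x)" for i x
    unfolding q'_def[abs_def] by (rule pd_sum_scale) (auto simp: finite_mdeg_less mon_differentiable)
  have eq': "?n * q' x + (\<Sum>i\<in>UNIV. x $ i * pd i q' x) = s x" for x
  proof -
    have "(\<Sum>i\<in>UNIV. x $ i * pd i q' x) = (\<Sum>m | mdeg m < k. d m * (\<Sum>i\<in>UNIV. x $ i * pd i (mon m) x))"
      unfolding pd_q' sum_distrib_left by (subst sum.swap) (simp add: mult_ac)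
    then have "?n * q' x + (\<Sum>i\<in>UNIV. x $ i * pd i q' x) =
        (\<Sum>m | mdeg m < k. d m * (?n + real (mdeg m)) * mon m x)"
      unfolding euler_mon q'_def by (simp add: sum_distrib_left sum.distrib algebra_simps)
    moreover have "d m * (?n + real (mdeg m)) = c m" for m
    proof -
      have "0 < ?n + real (mdeg m)" by (rule add_pos_nonneg) simp_all
      then show ?thesis by (simp add: d_def)
    qed
    ultimately show ?thesis by (simp add: c)
  qed
  have "q x + (-1) * q' x = 0" for x
  proof (rule euler_operator_injective)
    show "(\<lambda>x. q x + (-1) * q' x) differentiable (at x)" for x
      using dd by (intro differentiable_add differentiable_mult) auto
    have pd: "pd i (\<lambda>x. q x + (-1) * q' x) x = pd i q x - pd i q' x" for i x
      using pd_add[OF dd(1)[of x], of "\<lambda>x. (-1) * q' x" i] pd_mult[of "\<lambda>x. -1" x q' i] dd(2)[of x]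
      by simp
    show "?n * (q x + (-1) * q' x) + (\<Sum>i\<in>UNIV. x $ i * pd i (\<lambda>x. q x + (-1) * q' x) x) = 0" for x
      using eq[of x] eq'[of x] unfolding pd by (simp add: algebra_simps sum_subtractf)
  qed
  then have "q = q'" by (simp add: fun_eq_iff)
  with q' show ?thesis by simp
qed

section \<open>Simplices and barycentric coordinates\<close>

text \<open>The vertices of a simplex are affinely independent, so an affine function with prescribed
  vertex values exists and is unique; the description of \<open>bary\<close> is therefore meaningful.\<close>

lemma bary_affine:
  fixes K :: "(real ^ 'n) set"
  assumes K: "int CARD('n) simplex K" and v: "v \<in> vertices K"
  shows "bary K v \<in> polys 1"
proof -
  obtain C where C: "\<not> affine_dependent C" "int (card C) = int CARD('n) + 1" "K = convex hull C"
    using K by (auto simp: simplex_def)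
  have vC: "vertices K = C"
    using extreme_point_of_convex_hull_affine_independent[OF C(1)] by (auto simp: vertices_def C(3))
  have hull: "affine hull C = UNIV"
    using C(1,2) by (intro affine_independent_span_eq) simp_all
  have "\<exists>v0\<in>C. v0 \<noteq> v"
  proof (rule ccontr)
    assume "\<not> (\<exists>v0\<in>C. v0 \<noteq> v)"
    then have "card C \<le> card {v}" by (intro card_mono) auto
    moreover have "0 < CARD('n)" by simp
    ultimately show False using C(2) by simp
  qed
  then obtain v0 where v0: "v0 \<in> C" "v0 \<noteq> v" by blast
  have ind: "independent ((\<lambda>x. - v0 + x) ` (C - {v0}))"
    using affine_dependent_iff_dependent2[OF v0(1)] C(1) by simp
  obtain f :: "real ^ 'n \<Rightarrow> real" where f: "linear f"
      "\<forall>y\<in>(\<lambda>x. - v0 + x) ` (C - {v0}). f y = (if y = v - v0 then 1 else 0)"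
    using linear_independent_extend[OF ind, of "\<lambda>y. if y = v - v0 then 1 else 0"] by blast
  define a where "a = adjoint f 1"
  have fa: "f y = a \<bullet> y" for y using adjoint_works[OF f(1), of y 1] by (simp add: a_def inner_commute)
  define l where "l x = a \<bullet> x + (- (a \<bullet> v0))" for x
  have lv: "l w = (if w = v then 1 else 0)" if w: "w \<in> C" for w
  proof (cases "w = v0")
    case True
    then show ?thesis using v0(2) by (simp add: l_def)
  next
    case False
    have "f (- v0 + w) = (if - v0 + w = v - v0 then 1 else 0)" using f(2) False w by blast
    then have "f (- v0 + w) = (if w = v then 1 else 0)" by (simp add: algebra_simps)
    then show ?thesis unfolding fa l_def by (simp add: inner_diff_right split: if_splits)
  qed
  have "bary K v = l"
    unfolding bary_def vC
  proof (rule the_equality)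
    show "(\<exists>a c. l = (\<lambda>x. a \<bullet> x + c)) \<and> (\<forall>w\<in>C. l w = (if w = v then 1 else 0))"
      using lv by (intro conjI exI[of _ a] exI[of _ "- (a \<bullet> v0)"]) (auto simp: l_def[abs_def])
    fix l' assume l': "(\<exists>a c. l' = (\<lambda>x. a \<bullet> x + c)) \<and> (\<forall>w\<in>C. l' w = (if w = v then 1 else 0))"
    then obtain a' c' where a': "l' = (\<lambda>x. a' \<bullet> x + c')" by blast
    have "a' \<bullet> w + c' = a \<bullet> w - a \<bullet> v0" if "w \<in> C" for w
      using l' lv[OF that] that by (simp add: a' l_def)
    then have "C \<subseteq> {x. (a' - a) \<bullet> x = - (c' + a \<bullet> v0)}" by (force simp: inner_diff_left)
    then have "affine hull C \<subseteq> {x. (a' - a) \<bullet> x = - (c' + a \<bullet> v0)}"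
      by (intro hull_minimal affine_hyperplane)
    then have "(a' - a) \<bullet> x = - (c' + a \<bullet> v0)" for x unfolding hull by blast
    then show "l' = l" by (auto simp: fun_eq_iff a' l_def inner_diff_left algebra_simps)
  qed
  then show ?thesis using polys_affine[of a "- (a \<bullet> v0)"] by (simp add: l_def[abs_def])
qed

lemma bubble_poly:
  fixes K :: "(real ^ 'n) set"
  assumes "int CARD('n) simplex K" shows "bubble K \<in> polys (card (vertices K))"
  unfolding bubble_def[abs_def] by (rule polys_prod) (rule bary_affine[OF assms])

definition is_poly :: "'n::finite scal \<Rightarrow> bool" where
  "is_poly p \<longleftrightarrow> (\<exists>k. p \<in> polys k)"

definition is_vpoly :: "'n::finite vect \<Rightarrow> bool" where
  "is_vpoly s \<longleftrightarrow> (\<forall>j. is_poly (\<lambda>x. s x $ j))"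

lemma is_poly_lin:
  assumes "is_poly p" "is_poly q" shows "is_poly (fun_lin c p q)"
proof -
  obtain j k where "p \<in> polys j" "q \<in> polys k" using assms by (auto simp: is_poly_def)
  then have "p \<in> polys (max j k)" "q \<in> polys (max j k)" by (auto intro: polys_mono)
  then have "(\<lambda>x. p x + c * q x) \<in> polys (max j k)" by (intro polys_add polys_scale)
  then show ?thesis by (auto simp: is_poly_def fun_lin_def)
qed

lemma is_poly_zero: "is_poly (\<lambda>x. 0)" using polys_const by (auto simp: is_poly_def)

lemma is_poly_mult: "is_poly p \<Longrightarrow> is_poly q \<Longrightarrow> is_poly (\<lambda>x. p x * q x)"
  using polys_mult by (fastforce simp: is_poly_def)

lemma is_poly_pd: "is_poly p \<Longrightarrow> is_poly (pd i p)"
  using polys_pd by (auto simp: is_poly_def)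

lemma is_poly_differentiable: "is_poly p \<Longrightarrow> p differentiable (at x)"
  using polys_differentiable by (auto simp: is_poly_def)

lemma is_poly_continuous: "is_poly p \<Longrightarrow> continuous_on S p"
  using polys_continuous by (auto simp: is_poly_def)

lemma is_poly_pd_commute: "is_poly p \<Longrightarrow> pd i (pd j p) x = pd j (pd i p) x"
  using pd_commute by (auto simp: is_poly_def)

lemma is_poly_add: "is_poly p \<Longrightarrow> is_poly q \<Longrightarrow> is_poly (\<lambda>x. p x + q x)"
  using is_poly_lin[of p q 1] by (simp add: fun_lin_def)

lemma is_poly_minus: "is_poly p \<Longrightarrow> is_poly (\<lambda>x. - p x)"
  using is_poly_lin[OF is_poly_zero, of p "-1"] by (simp add: fun_lin_def)

lemma is_poly_diff: "is_poly p \<Longrightarrow> is_poly q \<Longrightarrow> is_poly (\<lambda>x. p x - q x)"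
  using is_poly_lin[of p q "-1"] by (simp add: fun_lin_def)

lemma is_poly_sum: "(\<And>j. j \<in> J \<Longrightarrow> is_poly (p j)) \<Longrightarrow> is_poly (\<lambda>x. \<Sum>j\<in>J. p j x)"
  by (induction J rule: infinite_finite_induct) (auto intro: is_poly_zero is_poly_add)

lemma is_poly_coord: "is_poly (\<lambda>x. x $ i)"
  using polys_coord by (auto simp: is_poly_def)

lemma pd_lin:
  "p differentiable (at x) \<Longrightarrow> q differentiable (at x) \<Longrightarrow>
    pd i (\<lambda>x. p x + c * q x) x = pd i p x + c * pd i q x"
  using pd_add[of p x "\<lambda>x. c * q x" i] pd_mult[of "\<lambda>x. c" x q i] by simp

lemma pd_minus: "p differentiable (at x) \<Longrightarrow> pd i (\<lambda>x. - p x) x = - pd i p x"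
  using pd_lin[of "\<lambda>x. 0" x p i "-1"] by simp

lemma pd_diff:
  "p differentiable (at x) \<Longrightarrow> q differentiable (at x) \<Longrightarrow> pd i (\<lambda>x. p x - q x) x = pd i p x - pd i q x"
  using pd_lin[of p x q i "-1"] by simp

section \<open>The local spaces\<close>

definition lin_closed :: "('a \<Rightarrow> 'b::real_vector) set \<Rightarrow> bool" where
  "lin_closed S \<longleftrightarrow> (\<lambda>x. 0) \<in> S \<and> (\<forall>f\<in>S. \<forall>g\<in>S. \<forall>c. fun_lin c f g \<in> S)"

lemma lin_closed_polys: "lin_closed (polys k)"
  unfolding lin_closed_def using polys_const[of 0 k]
  by (auto simp: fun_lin_def intro!: polys_add polys_scale)

lemma lin_closed_vpolys: "lin_closed (vpolys k :: 'n::finite vect set)"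
proof -
  have "lin_closed (polys k :: 'n scal set)" by (rule lin_closed_polys)
  then show ?thesis unfolding lin_closed_def vpolys_def fun_lin_def by simp
qed

lemma lin_closed_rows_in: "lin_closed V \<Longrightarrow> lin_closed (rows_in V)"
  unfolding lin_closed_def rows_in_def fun_lin_def by simp

lemma lin_closed_fsum:
  fixes A B :: "(real ^ 'n \<Rightarrow> 'b::real_vector) set"
  assumes A: "lin_closed A" and B: "lin_closed B" shows "lin_closed (fsum A B)"
  unfolding lin_closed_def
proof (intro conjI ballI allI)
  show "(\<lambda>x. 0) \<in> fsum A B"
    unfolding fsum_def
    by (intro CollectI exI[of _ "\<lambda>x. 0"]) (use A B in \<open>simp add: lin_closed_def\<close>)
  fix f g c assume "f \<in> fsum A B" "g \<in> fsum A B"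
  then obtain a b a' b' where f: "f = (\<lambda>x. a x + b x)" "a \<in> A" "b \<in> B" and g: "g = (\<lambda>x. a' x + b' x)" "a' \<in> A" "b' \<in> B"
    by (auto simp: fsum_def)
  have "fun_lin c f g = (\<lambda>x. fun_lin c a a' x + fun_lin c b b' x)"
    by (simp add: f(1) g(1) fun_lin_def scaleR_add_right add_ac)
  moreover have "fun_lin c a a' \<in> A" "fun_lin c b b' \<in> B" using A B f g by (auto simp: lin_closed_def)
  ultimately show "fun_lin c f g \<in> fsum A B" unfolding fsum_def by blast
qed

lemma lin_closed_radial: "lin_closed {\<lambda>x :: real ^ 'n. q x *\<^sub>R x | q. q \<in> polys k}" (is "lin_closed ?R")
  unfolding lin_closed_def
proof (intro conjI ballI allI)
  show "(\<lambda>x. 0) \<in> ?R"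
    by (intro CollectI exI[of _ "\<lambda>x. 0"]) (simp add: polys_const)
  fix f g c assume "f \<in> ?R" "g \<in> ?R"
  then obtain p q where "f = (\<lambda>x. p x *\<^sub>R x)" "p \<in> polys k" "g = (\<lambda>x. q x *\<^sub>R x)" "q \<in> polys k" by auto
  then show "fun_lin c f g \<in> ?R"
    by (intro CollectI exI[of _ "\<lambda>x. p x + c * q x"])
      (simp add: fun_lin_def scaleR_add_left polys_add polys_scale)
qed

lemma lin_closed_RT: "lin_closed (RT k)"
  unfolding RT_def by (intro lin_closed_fsum lin_closed_vpolys lin_closed_radial)

definition cdiv :: "'n::finite vect \<Rightarrow> 'n scal" where
  "cdiv s x = (\<Sum>j\<in>UNIV. pd j (\<lambda>x. s x $ j) x)"

lemma is_poly_cdiv: "is_vpoly s \<Longrightarrow> is_poly (cdiv s)"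
  unfolding cdiv_def[abs_def] is_vpoly_def by (intro is_poly_sum is_poly_pd) blast

lemma cdiv_add:
  assumes "is_vpoly s" "is_vpoly t" shows "cdiv (\<lambda>x. s x + t x) x = cdiv s x + cdiv t x"
proof -
  have "pd j (\<lambda>x. s x $ j + t x $ j) x = pd j (\<lambda>x. s x $ j) x + pd j (\<lambda>x. t x $ j) x" for j
    by (rule pd_add) (use assms in \<open>auto simp: is_vpoly_def intro: is_poly_differentiable\<close>)
  then show ?thesis by (simp add: cdiv_def sum.distrib)
qed

lemma is_vpoly_add: "is_vpoly s \<Longrightarrow> is_vpoly t \<Longrightarrow> is_vpoly (\<lambda>x. s x + t x)"
  by (auto simp: is_vpoly_def intro: is_poly_add)

lemma is_vpoly_vpolys: "s \<in> vpolys k \<Longrightarrow> is_vpoly s"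
  by (auto simp: is_vpoly_def vpolys_def is_poly_def)

lemma cdiv_vpolys: "s \<in> vpolys k \<Longrightarrow> cdiv s \<in> polys_less k"
  unfolding cdiv_def[abs_def] by (intro polys_less_sum polys_pd_less) (simp add: vpolys_def)

lemma cdiv_radial:
  fixes q :: "'n::finite scal"
  assumes "is_poly q"
  shows "cdiv (\<lambda>x. q x *\<^sub>R x) x = real CARD('n) * q x + (\<Sum>j\<in>UNIV. x $ j * pd j q x)"
proof -
  have "pd j (\<lambda>x. q x * x $ j) x = q x + x $ j * pd j q x" for j
  proof -
    have "pd j (\<lambda>x. x $ j) x = 1"
      by (subst pd_eq[OF bounded_linear_imp_has_derivative[OF bounded_linear_vec_nth]]) (simp add: axis_def)
    moreover have "pd j (\<lambda>x. q x * x $ j) x = q x * pd j (\<lambda>x. x $ j) x + pd j q x * x $ j"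
      by (rule pd_mult) (auto intro: is_poly_differentiable assms is_poly_coord)
    ultimately show ?thesis by (simp add: mult.commute)
  qed
  then show ?thesis by (simp add: cdiv_def sum.distrib)
qed

lemma is_vpoly_radial: "is_poly q \<Longrightarrow> is_vpoly (\<lambda>x. q x *\<^sub>R x)"
  by (auto simp: is_vpoly_def intro: is_poly_mult is_poly_coord)

lemma RT_cases:
  assumes "s \<in> RT k"
  obtains p q where "s = (\<lambda>x. p x + q x *\<^sub>R x)" "p \<in> vpolys k" "q \<in> polys k"
  using assms by (auto simp: RT_def fsum_def)

lemma is_vpoly_RT: "s \<in> RT k \<Longrightarrow> is_vpoly s"
proof (erule RT_cases)
  fix p q assume s: "s = (\<lambda>x. p x + q x *\<^sub>R x)" and p: "p \<in> vpolys k" and q: "q \<in> polys k"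
  have "is_poly q" using q by (auto simp: is_poly_def)
  then show "is_vpoly s" unfolding s by (intro is_vpoly_add is_vpoly_radial is_vpoly_vpolys[OF p])
qed

lemma euler_polys:
  fixes q :: "'n::finite scal"
  assumes q: "q \<in> polys k" shows "(\<lambda>x. real CARD('n) * q x + (\<Sum>j\<in>UNIV. x $ j * pd j q x)) \<in> polys k"
proof -
  have "(\<lambda>x. x $ j * pd j q x) \<in> polys k" for j
  proof (cases k)
    case 0
    then have "pd j q = (\<lambda>x. 0)" using polys_pd_less[OF q, of j] by (simp add: polys_less_def)
    then show ?thesis by (simp add: polys_const)
  next
    case (Suc l)
    then have "pd j q \<in> polys l" using polys_pd_less[OF q, of j] by (simp add: polys_eq)
    from polys_mult[OF polys_coord this, of j] Suc show ?thesis by simp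
  qed
  then show ?thesis by (intro polys_add polys_scale q polys_sum)
qed

lemma cdiv_RT: "s \<in> RT k \<Longrightarrow> cdiv s \<in> polys k"
proof (erule RT_cases)
  fix p q assume s: "s = (\<lambda>x. p x + q x *\<^sub>R x)" and p: "p \<in> vpolys k" and q: "q \<in> polys k"
  have qp: "is_poly q" using q by (auto simp: is_poly_def)
  have "cdiv s = (\<lambda>x. cdiv p x + (real CARD('a) * q x + (\<Sum>j\<in>UNIV. x $ j * pd j q x)))"
    unfolding s by (rule ext) (simp add: cdiv_add is_vpoly_vpolys[OF p] is_vpoly_radial[OF qp] cdiv_radial[OF qp])
  moreover have "cdiv p \<in> polys k"
    using polys_less_mono[OF cdiv_vpolys[OF p], of "Suc k"] by (simp add: polys_eq)
  ultimately show "cdiv s \<in> polys k" by (simp add: polys_add euler_polys[OF q])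
qed

text \<open>If \<open>p + q x\<close> is divergence free, then Euler's operator maps \<open>q\<close> to \<open>- div p\<close>, of degree less
  than \<open>k\<close>. Hence \<open>q\<close> has degree less than \<open>k\<close> as well, and \<open>q x\<close> is a polynomial field of
  degree at most \<open>k\<close>.\<close>

lemma RT_divergence_free:
  assumes s: "s \<in> RT k" and 0: "\<And>x. cdiv s x = 0" shows "s \<in> vpolys k"
  using s
proof (rule RT_cases)
  fix p q assume s: "s = (\<lambda>x. p x + q x *\<^sub>R x)" and p: "p \<in> vpolys k" and q: "q \<in> polys k"
  have qp: "is_poly q" using q by (auto simp: is_poly_def)
  have ql: "q \<in> polys_less k"
  proof (rule euler_operator_degree[OF q])
    show "(\<lambda>x. - 1 * cdiv p x) \<in> polys_less k" by (intro polys_less_scale cdiv_vpolys p)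
    show "real CARD('a) * q x + (\<Sum>i\<in>UNIV. x $ i * pd i q x) = - 1 * cdiv p x" for x
      using 0[of x] cdiv_add[OF is_vpoly_vpolys[OF p] is_vpoly_radial[OF qp], of x] cdiv_radial[OF qp, of x]
      by (simp add: s)
  qed
  have "(\<lambda>x. q x * x $ j) \<in> polys k" for j
  proof (cases k)
    case 0
    then have "q = (\<lambda>x. 0)" using ql by (simp add: polys_less_def)
    then show ?thesis by (simp add: polys_const)
  next
    case (Suc l)
    then have "q \<in> polys l" using ql by (simp add: polys_eq)
    from polys_mult[OF this polys_coord, of j] Suc show ?thesis by simp
  qed
  then show "s \<in> vpolys k" using p unfolding s by (simp add: vpolys_def polys_add)
qed

lemma ax_cases:
  assumes "CARD('n::{finite,linorder}) = m"
  shows "(UNIV :: 'n set) = ax ` {..<m}" "inj_on (ax :: nat \<Rightarrow> 'n) {..<m}"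
proof -
  let ?l = "sorted_list_of_set (UNIV :: 'n set)"
  have l: "length ?l = m" "distinct ?l" "set ?l = UNIV" using assms by simp_all
  have "set ?l = (!) ?l ` {..<length ?l}" by (auto simp: set_conv_nth)
  then have "(UNIV :: 'n set) = (!) ?l ` {..<m}" by (simp only: l)
  then show "(UNIV :: 'n set) = ax ` {..<m}" by (simp add: ax_def[abs_def])
  show "inj_on (ax :: nat \<Rightarrow> 'n) {..<m}"
    unfolding ax_def inj_on_def using l by (auto simp: nth_eq_iff_index_eq)
qed

lemma is_poly_bubble:
  fixes K :: "(real ^ 'n::{finite,linorder}) set"
  assumes "int CARD('n) simplex K" shows "is_poly (bubble K)"
  using bubble_poly[OF assms] by (auto simp: is_poly_def)

lemma curl2_poly:
  fixes \<phi> :: "'n::{finite,linorder} scal"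
  assumes n: "CARD('n) = 2" and p: "is_poly \<phi>"
  shows "is_vpoly (curl2 \<phi>)" "cdiv (curl2 \<phi>) x = 0"
proof -
  have u: "(UNIV :: 'n set) = {ax 0, ax 1}" "ax 0 \<noteq> (ax 1 :: 'n)"
    using ax_cases[OF n] by (auto simp: inj_on_def lessThan_Suc numeral_2_eq_2)
  have c: "(\<lambda>x. curl2 \<phi> x $ ax 0) = pd (ax 1) \<phi>" "(\<lambda>x. curl2 \<phi> x $ ax 1) = (\<lambda>x. - pd (ax 0) \<phi> x)"
    using u(2) by (auto simp: curl2_def fun_eq_iff)
  show "is_vpoly (curl2 \<phi>)"
    unfolding is_vpoly_def
  proof
    fix j :: 'n
    have "j = ax 0 \<or> j = ax 1" using u(1) by blast
    then show "is_poly (\<lambda>x. curl2 \<phi> x $ j)" using c is_poly_pd[OF p] is_poly_minus by metis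
  qed
  show "cdiv (curl2 \<phi>) x = 0"
    unfolding cdiv_def u(1) using u(2)
    by (simp add: c pd_minus is_poly_differentiable is_poly_pd p is_poly_pd_commute[OF p, of "ax 0" "ax 1"]
        del: One_nat_def)
qed

lemma curl3_poly:
  fixes w :: "'n::{finite,linorder} vect"
  assumes n: "CARD('n) = 3" and p: "is_vpoly w"
  shows "is_vpoly (curl3 w)" "cdiv (curl3 w) x = 0"
proof -
  have u: "(UNIV :: 'n set) = {ax 0, ax 1, ax 2}" "ax 0 \<noteq> (ax 1 :: 'n)" "ax 0 \<noteq> (ax 2 :: 'n)" "ax 1 \<noteq> (ax 2 :: 'n)"
    using ax_cases[OF n] by (auto simp: inj_on_def lessThan_Suc numeral_3_eq_3 numeral_2_eq_2)
  have wp: "is_poly (\<lambda>x. w x $ j)" for j using p by (simp add: is_vpoly_def)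
  have c: "(\<lambda>x. curl3 w x $ ax 0) = (\<lambda>x. pd (ax 1) (\<lambda>y. w y $ ax 2) x - pd (ax 2) (\<lambda>y. w y $ ax 1) x)"
    "(\<lambda>x. curl3 w x $ ax 1) = (\<lambda>x. pd (ax 2) (\<lambda>y. w y $ ax 0) x - pd (ax 0) (\<lambda>y. w y $ ax 2) x)"
    "(\<lambda>x. curl3 w x $ ax 2) = (\<lambda>x. pd (ax 0) (\<lambda>y. w y $ ax 1) x - pd (ax 1) (\<lambda>y. w y $ ax 0) x)"
    using u(2-4) by (auto simp: curl3_def fun_eq_iff)
  show "is_vpoly (curl3 w)"
    unfolding is_vpoly_def
  proof
    fix j :: 'n
    have "j = ax 0 \<or> j = ax 1 \<or> j = ax 2" using u(1) by blast
    then show "is_poly (\<lambda>x. curl3 w x $ j)" by (elim disjE) (simp_all only: c is_poly_diff is_poly_pd wp)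
  qed
  have d: "pd i (\<lambda>x. pd j (\<lambda>y. w y $ a) x - pd k (\<lambda>y. w y $ b) x) x =
      pd i (pd j (\<lambda>y. w y $ a)) x - pd i (pd k (\<lambda>y. w y $ b)) x" for i j k a b
    by (intro pd_diff is_poly_differentiable is_poly_pd wp)
  show "cdiv (curl3 w) x = 0"
    unfolding cdiv_def u(1) using u(2-4)
    by (simp add: c d is_poly_pd_commute[OF wp, of "ax 1" "ax 0"] is_poly_pd_commute[OF wp, of "ax 2" "ax 0"]
        is_poly_pd_commute[OF wp, of "ax 2" "ax 1"] del: One_nat_def)
qed

text \<open>Curls are divergence free because mixed partial derivatives of polynomials commute.\<close>

lemma Bub_poly:
  fixes K :: "(real ^ 'n::{finite,linorder}) set"
  assumes n: "CARD('n) \<in> {2, 3}" and K: "int CARD('n) simplex K" and s: "s \<in> Bub k K"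
  shows "is_vpoly s" "cdiv s x = 0"
proof -
  note b = is_poly_bubble[OF K]
  have "is_vpoly s \<and> cdiv s x = 0"
  proof (cases "CARD('n) = 2")
    case True
    then obtain q where q: "s = curl2 (\<lambda>x. bubble K x * q x)" "q \<in> polys k" using s by (auto simp: Bub_def)
    then have "is_poly (\<lambda>x. bubble K x * q x)" by (intro is_poly_mult b) (auto simp: is_poly_def)
    from curl2_poly[OF True this] show ?thesis by (simp add: q(1))
  next
    case False
    then have n3: "CARD('n) = 3" using n by simp
    obtain w where w: "s = curl3 (\<lambda>x. bubble K x *\<^sub>R w x)" "w \<in> vpolys k" using s False by (auto simp: Bub_def)
    then have "is_vpoly (\<lambda>x. bubble K x *\<^sub>R w x)"
      by (auto simp: is_vpoly_def vpolys_def is_poly_def[of "\<lambda>x. w x $ _"] intro!: is_poly_mult b)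
        (auto simp: is_poly_def)
    from curl3_poly[OF n3 this] show ?thesis by (simp add: w(1))
  qed
  then show "is_vpoly s" "cdiv s x = 0" by auto
qed

lemma lin_closed_Bub:
  fixes K :: "(real ^ 'n::{finite,linorder}) set"
  assumes n: "CARD('n) \<in> {2, 3}" and K: "int CARD('n) simplex K"
  shows "lin_closed (Bub k K)"
proof -
  note b = is_poly_bubble[OF K]
  have zero: "(\<lambda>x. 0) \<in> polys k" by (rule polys_const)
  have diff: "(\<lambda>x. bubble K x * q x) differentiable (at x)" if "q \<in> polys k" for q and x :: "(real, 'n) vec"
    using that by (intro is_poly_differentiable is_poly_mult b) (auto simp: is_poly_def)
  have e: "pd i (\<lambda>x. bubble K x * (p x + c * q x)) x =
      pd i (\<lambda>x. bubble K x * p x) x + c * pd i (\<lambda>x. bubble K x * q x) x" if "p \<in> polys k" "q \<in> polys k" for i c p q and x :: "(real, 'n) vec"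
    using pd_lin[OF diff[OF that(1), of x] diff[OF that(2), of x], of i c] by (simp add: algebra_simps)
  show ?thesis
  proof (cases "CARD('n) = 2")
    case True
    have B: "Bub k K = {curl2 (\<lambda>x. bubble K x * q x) | q. q \<in> polys k}" using True by (simp add: Bub_def)
    show ?thesis
      unfolding lin_closed_def B
    proof (intro conjI ballI allI)
      show "(\<lambda>x. 0) \<in> {curl2 (\<lambda>x. bubble K x * q x) | q. q \<in> polys k}"
        by (intro CollectI exI[of _ "\<lambda>x. 0"]) (simp add: zero curl2_def fun_eq_iff vec_eq_iff)
      fix f g c assume "f \<in> {curl2 (\<lambda>x. bubble K x * q x) | q. q \<in> polys k}" "g \<in> {curl2 (\<lambda>x. bubble K x * q x) | q. q \<in> polys k}"
      then obtain p q where pq: "f = curl2 (\<lambda>x. bubble K x * p x)" "p \<in> polys k" "g = curl2 (\<lambda>x. bubble K x * q x)" "q \<in> polys k"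
        by auto
      have "fun_lin c f g = curl2 (\<lambda>x. bubble K x * (p x + c * q x))"
        unfolding pq(1,3) fun_lin_def curl2_def by (simp add: fun_eq_iff vec_eq_iff e[OF pq(2,4)])
      then show "fun_lin c f g \<in> {curl2 (\<lambda>x. bubble K x * q x) | q. q \<in> polys k}"
        using pq(2,4) by (intro CollectI exI[of _ "\<lambda>x. p x + c * q x"]) (simp add: polys_add polys_scale)
    qed
  next
    case False
    have B: "Bub k K = {curl3 (\<lambda>x. bubble K x *\<^sub>R w x) | w. w \<in> vpolys k}" using False by (simp add: Bub_def)
    show ?thesis
      unfolding lin_closed_def B
    proof (intro conjI ballI allI)
      show "(\<lambda>x. 0) \<in> {curl3 (\<lambda>x. bubble K x *\<^sub>R w x) | w. w \<in> vpolys k}"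
        by (intro CollectI exI[of _ "\<lambda>x. 0"]) (simp add: zero vpolys_def curl3_def fun_eq_iff vec_eq_iff)
      fix f g c assume "f \<in> {curl3 (\<lambda>x. bubble K x *\<^sub>R w x) | w. w \<in> vpolys k}" "g \<in> {curl3 (\<lambda>x. bubble K x *\<^sub>R w x) | w. w \<in> vpolys k}"
      then obtain p q where pq: "f = curl3 (\<lambda>x. bubble K x *\<^sub>R p x)" "p \<in> vpolys k" "g = curl3 (\<lambda>x. bubble K x *\<^sub>R q x)" "q \<in> vpolys k"
        by auto
      have c: "(\<lambda>x. p x $ j) \<in> polys k" "(\<lambda>x. q x $ j) \<in> polys k" for j using pq by (auto simp: vpolys_def)
      have "fun_lin c f g = curl3 (\<lambda>x. bubble K x *\<^sub>R (p x + c *\<^sub>R q x))"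
        unfolding pq(1,3) fun_lin_def curl3_def
        by (simp add: fun_eq_iff vec_eq_iff e[OF c], (simp add: algebra_simps)?)
      moreover have "(\<lambda>x. p x + c *\<^sub>R q x) \<in> vpolys k"
        using c by (simp add: vpolys_def polys_add polys_scale)
      ultimately show "fun_lin c f g \<in> {curl3 (\<lambda>x. bubble K x *\<^sub>R w x) | w. w \<in> vpolys k}"
        by (intro CollectI exI[of _ "\<lambda>x. p x + c *\<^sub>R q x"] conjI)
    qed
  qed
qed

section \<open>Simplicial meshes\<close>

locale mesh =
  fixes Om :: "(real ^ 'n::{finite,linorder}) set" and T :: "(real ^ 'n::{finite,linorder}) set set"
  assumes open_Om: "open Om" and bounded_Om: "bounded Om" and Om_nonempty: "Om \<noteq> {}"
    and is_mesh: "is_mesh Om T" and card_n: "CARD('n) \<in> {2, 3}"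
begin

sublocale bounded_open Om
  by unfold_locales (rule open_Om bounded_Om)+

lemma T_finite: "finite T" and T_cover: "\<Union>T = closure Om"
  using is_mesh by (auto simp: is_mesh_def triangulation_def)

lemma T_simplex: "K \<in> T \<Longrightarrow> int CARD('n) simplex K"
  using is_mesh by (simp add: is_mesh_def)

lemma T_convex: "K \<in> T \<Longrightarrow> convex K" and T_closed: "K \<in> T \<Longrightarrow> closed K"
  using T_simplex[of K] by (auto simp: simplex_def intro!: compact_imp_closed finite_imp_compact_convex_hull aff_independent_finite)

lemma T_interior: assumes "K \<in> T" shows "interior K \<noteq> {}"
proof -
  have "aff_dim K = int DIM((real, 'n) vec)" using aff_dim_simplex[OF T_simplex[OF assms]] by simp
  then have "rel_interior K = interior K" by (rule interior_rel_interior)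
  moreover have "K \<noteq> {}" using T_simplex[OF assms] aff_dim_simplex[OF T_simplex[OF assms]] by auto
  ultimately show ?thesis using rel_interior_eq_empty[OF T_convex[OF assms]] by simp
qed

lemma T_closure_interior: "K \<in> T \<Longrightarrow> closure (interior K) = K"
  using convex_closure_interior[OF T_convex T_interior] T_closed by simp

lemma T_disjoint: assumes "K \<in> T" "K' \<in> T" "K \<noteq> K'" shows "interior K \<inter> interior K' = {}"
proof (rule ccontr)
  assume ne: "interior K \<inter> interior K' \<noteq> {}"
  have "K \<inter> K' face_of K" "K' \<inter> K face_of K'"
    using is_mesh assms by (auto simp: is_mesh_def triangulation_def)
  moreover have "K \<inter> K' \<inter> interior K \<noteq> {}" "K' \<inter> K \<inter> interior K' \<noteq> {}"
    using ne interior_subset[of K] interior_subset[of K'] by auto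
  ultimately have "K \<inter> K' = K" "K' \<inter> K = K'" using face_of_disjoint_interior by blast+
  then show False using assms(3) by blast
qed

definition cell where "cell K = interior K \<inter> Om"

lemma cell_open: "open (cell K)" and cell_bounded: "bounded (cell K)" and cell_sub: "cell K \<subseteq> Om"
  using Om_open Om_bounded by (auto simp: cell_def intro: bounded_subset)

lemma cell_nonempty: assumes "K \<in> T" shows "cell K \<noteq> {}"
proof -
  have "interior K \<subseteq> closure Om" using interior_subset T_cover assms by blast
  then obtain x where x: "x \<in> interior K" "x \<in> closure Om" using T_interior[OF assms] by blast
  then have "interior K \<inter> closure Om \<noteq> {}" by blast
  then show ?thesis using open_Int_closure_eq_empty[of "interior K" Om] by (simp add: cell_def)
qed

text \<open>The elements are convex, so their frontiers are null sets.\<close>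

lemma AE_in_cells: "AE x in lborel. x \<in> Om \<longrightarrow> (\<exists>K\<in>T. x \<in> cell K)"
proof -
  have "(\<Union>K\<in>T. frontier K) \<in> null_sets lborel"
  proof (rule null_sets_UN')
    show "countable T" using T_finite by (rule countable_finite)
    show "frontier K \<in> null_sets lborel" if "K \<in> T" for K
    proof -
      have "frontier K \<in> null_sets (completion lborel)"
        using negligible_convex_frontier[OF T_convex[OF that]] by (simp add: negligible_iff_null_sets)
      then show ?thesis by (subst (asm) null_sets_completion_iff) auto
    qed
  qed
  then have "AE x in lborel. x \<notin> (\<Union>K\<in>T. frontier K)" by (rule AE_not_in)
  then show ?thesis
  proof eventually_elim
    case (elim x)
    show ?case
    proof
      assume x: "x \<in> Om"
      then obtain K where "K \<in> T" "x \<in> K" using T_cover closure_subset by blast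
      then show "\<exists>K\<in>T. x \<in> cell K" using elim x T_closed by (auto simp: cell_def frontier_def)
    qed
  qed
qed

lemma AE_Om_iff: "(AE x in lebesgue_on Om. P x) \<longleftrightarrow> (AE x in lebesgue. x \<in> Om \<longrightarrow> P x)"
  using Om_open by (simp add: AE_restrict_space_iff)

lemma AE_cell_iff: "(AE x in lebesgue_on (cell K). P x) \<longleftrightarrow> (AE x in lebesgue. x \<in> cell K \<longrightarrow> P x)"
  using cell_open[of K] by (simp add: AE_restrict_space_iff)

lemma AE_cells:
  assumes "\<And>K. K \<in> T \<Longrightarrow> AE x in lebesgue. x \<in> cell K \<longrightarrow> P x"
  shows "AE x in lebesgue_on Om. P x"
proof -
  have "AE x in lebesgue. \<forall>K\<in>T. x \<in> cell K \<longrightarrow> P x" using T_finite assms by (intro AE_finite_allI)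
  moreover have "AE x in lebesgue. x \<in> Om \<longrightarrow> (\<exists>K\<in>T. x \<in> cell K)" using AE_in_cells by (rule AE_completion)
  ultimately have "AE x in lebesgue. x \<in> Om \<longrightarrow> P x" by eventually_elim blast
  then show ?thesis by (simp add: AE_Om_iff)
qed

lemma restr_in_iff:
  "K \<in> T \<Longrightarrow> restr_in K S f \<longleftrightarrow> (\<exists>s\<in>S. AE x in lebesgue. x \<in> K \<longrightarrow> f x = s x)"
  unfolding restr_in_def using T_closed by (simp add: AE_restrict_space_iff)

lemma restr_in_I: "s \<in> S \<Longrightarrow> (\<And>x. f x = s x) \<Longrightarrow> restr_in K S f"
  unfolding restr_in_def by (intro bexI[of _ s]) auto

lemma restr_in_lin:
  assumes K: "K \<in> T" and S: "lin_closed S" and f: "restr_in K S f" "restr_in K S g"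
  shows "restr_in K S (fun_lin c f g)"
proof -
  obtain s t where s: "s \<in> S" "AE x in lebesgue. x \<in> K \<longrightarrow> f x = s x"
    and t: "t \<in> S" "AE x in lebesgue. x \<in> K \<longrightarrow> g x = t x"
    using f by (auto simp: restr_in_iff[OF K])
  have "AE x in lebesgue. x \<in> K \<longrightarrow> fun_lin c f g x = fun_lin c s t x"
    using s(2) t(2) by eventually_elim (simp add: fun_lin_def)
  moreover have "fun_lin c s t \<in> S" using S s(1) t(1) by (simp add: lin_closed_def)
  ultimately show ?thesis unfolding restr_in_iff[OF K] by blast
qed

end

lemma polys_diff: "p \<in> polys k \<Longrightarrow> q \<in> polys k \<Longrightarrow> (\<lambda>x. p x - q x) \<in> polys k"
  using polys_add[OF _ polys_scale[of q k "-1"], of p] by simp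

lemma Bub_degree:
  fixes K :: "(real ^ 'n::{finite,linorder}) set"
  assumes K: "int CARD('n) simplex K" and s: "s \<in> Bub k K"
  shows "s \<in> vpolys (card (vertices K) + k)"
proof (cases "CARD('n) = 2")
  case True
  then obtain q where q: "s = curl2 (\<lambda>x. bubble K x * q x)" "q \<in> polys k" using s by (auto simp: Bub_def)
  have "(\<lambda>x. bubble K x * q x) \<in> polys (card (vertices K) + k)" by (rule polys_mult[OF bubble_poly[OF K] q(2)])
  note d = polys_pd[OF this]
  have "(\<lambda>x. curl2 (\<lambda>x. bubble K x * q x) x $ j) \<in> polys (card (vertices K) + k)" for j
  proof (cases "j = ax 0")
    case True
    then show ?thesis using d[of "ax 1"] by (simp add: curl2_def)
  next
    case False
    then show ?thesis using polys_scale[OF d[of "ax 0"], of "-1"] by (simp add: curl2_def)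
  qed
  then show ?thesis by (simp add: vpolys_def q(1))
next
  case False
  then obtain w where w: "s = curl3 (\<lambda>x. bubble K x *\<^sub>R w x)" "w \<in> vpolys k" using s by (auto simp: Bub_def)
  have "(\<lambda>x. (bubble K x *\<^sub>R w x) $ j) \<in> polys (card (vertices K) + k)" for j
    using polys_mult[OF bubble_poly[OF K], of "\<lambda>x. w x $ j" k] w(2) by (simp add: vpolys_def)
  note d = polys_diff[OF polys_pd[OF this] polys_pd[OF this]]
  have "(\<lambda>x. curl3 (\<lambda>x. bubble K x *\<^sub>R w x) x $ j) \<in> polys (card (vertices K) + k)" for j
    unfolding curl3_def using d by (cases "j = ax 0"; cases "j = ax 1") (simp_all del: vector_scaleR_component)
  then show ?thesis by (simp add: vpolys_def w(1))
qed

lemma RT_degree: "s \<in> RT k \<Longrightarrow> s \<in> vpolys (Suc k)"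
proof (erule RT_cases)
  fix p q assume s: "s = (\<lambda>x. p x + q x *\<^sub>R x)" and p: "p \<in> vpolys k" and q: "q \<in> polys k"
  have "(\<lambda>x. p x $ j + q x * x $ j) \<in> polys (Suc k)" for j
    using polys_mult[OF q polys_coord[of j]] polys_mono[of "\<lambda>x. p x $ j" k "Suc k"] p
    by (intro polys_add) (simp_all add: vpolys_def)
  then show "s \<in> vpolys (Suc k)" by (simp add: s vpolys_def)
qed

lemma vpolys_mono: "s \<in> vpolys k \<Longrightarrow> k \<le> l \<Longrightarrow> s \<in> vpolys l"
  by (auto simp: vpolys_def intro: polys_mono)

lemma vpolys_add: "s \<in> vpolys k \<Longrightarrow> t \<in> vpolys k \<Longrightarrow> (\<lambda>x. s x + t x) \<in> vpolys k"
  by (simp add: vpolys_def polys_add)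

lemma fsum_rows_cases:
  assumes "s \<in> fsum (rows_in V) (rows_in B)"
  obtains a b where "s = (\<lambda>x. a x + b x)" "\<And>i. trow a i \<in> V" "\<And>i. trow b i \<in> B"
  using assms by (auto simp: fsum_def rows_in_def)

lemma AE_eq_continuous:
  fixes f g :: "real ^ 'n \<Rightarrow> real"
  assumes S: "open S" and fg: "continuous_on S f" "continuous_on S g"
    and ae: "AE x in lebesgue. x \<in> S \<longrightarrow> f x = g x" and x: "x \<in> S"
  shows "f x = g x"
proof (rule ccontr)
  assume ne: "f x \<noteq> g x"
  let ?N = "S \<inter> (\<lambda>x. f x - g x) -` (- {0})"
  have "open ?N" using S fg by (intro continuous_open_preimage continuous_intros) auto
  moreover have "?N \<noteq> {}" using x ne by auto
  moreover have "negligible ?N"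
  proof -
    have "AE x in lebesgue. x \<notin> ?N" using ae by eventually_elim auto
    then have "?N \<in> null_sets lebesgue" using \<open>open ?N\<close> by (subst AE_iff_null_sets) auto
    then show ?thesis by (simp add: negligible_iff_null_sets)
  qed
  ultimately show False using open_not_negligible by blast
qed

lemma is_poly_bounded:
  assumes "is_poly p" "bounded S" obtains B where "0 \<le> B" "\<And>x. x \<in> S \<Longrightarrow> \<bar>p x\<bar> \<le> B"
proof -
  have "compact (p ` closure S)"
    using assms by (intro compact_continuous_image is_poly_continuous) auto
  from compact_imp_bounded[OF this] obtain B where "\<forall>y\<in>p ` closure S. norm y \<le> B"
    unfolding bounded_iff by blast
  then have "\<And>x. x \<in> closure S \<Longrightarrow> \<bar>p x\<bar> \<le> B" by simp
  then show ?thesis using closure_subset[of S] by (intro that[of "\<bar>B\<bar>"]) force+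
qed

lemma poly_weak_partial:
  assumes S: "open S" "bounded S" and p: "is_poly p" and \<phi>: "test_fun S \<phi>"
  shows "(LINT x|lebesgue_on S. p x * pd i \<phi> x) = - (LINT x|lebesgue_on S. pd i p x * \<phi> x)"
proof -
  obtain B where B: "\<And>x. x \<in> S \<Longrightarrow> \<bar>p x\<bar> \<le> B" using is_poly_bounded[OF p S(2)] by metis
  obtain L where L: "\<And>x. x \<in> S \<Longrightarrow> \<bar>pd i p x\<bar> \<le> L" using is_poly_bounded[OF is_poly_pd[OF p] S(2)] by metis
  show ?thesis
  proof (rule weak_partial[OF S is_poly_continuous[OF p] B _ _ _ \<phi>])
    fix x h assume h: "0 \<le> h" "\<And>t. t \<in> {0..h} \<Longrightarrow> x + (- t) *\<^sub>R axis i 1 \<in> S"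
    have "\<bar>p (x + (-1 * h) *\<^sub>R axis i 1) - p x\<bar> \<le> L * h"
      by (rule pd_line_bound) (use h L is_poly_differentiable[OF p] in auto)
    then show "\<bar>p (x + (- h) *\<^sub>R axis i 1) - p x\<bar> \<le> L * h" by simp
  next
    show "pd i p \<in> borel_measurable borel"
      by (intro borel_measurable_continuous_onI is_poly_continuous is_poly_pd p)
    show "AE x in lborel. x \<in> S \<longrightarrow> ((\<lambda>t. p (x + t *\<^sub>R axis i 1)) has_real_derivative pd i p x) (at 0)"
      using pd_line[OF is_poly_differentiable[OF p], of _ i 0] by (intro AE_I2 impI) simp
  qed
qed

lemma integral_lebesgue_on_subset:
  fixes f :: "real ^ 'n \<Rightarrow> real"
  assumes "open S" "open S'" "S \<subseteq> S'" "\<And>x. x \<notin> S \<Longrightarrow> f x = 0"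
  shows "(LINT x|lebesgue_on S'. f x) = (LINT x|lebesgue_on S. f x)"
proof -
  have "(LINT x|lebesgue_on S'. f x) = (LINT x|lebesgue. indicator S' x *\<^sub>R f x)"
    using assms(2) by (intro integral_restrict_space) simp
  also have "\<dots> = (LINT x|lebesgue. indicator S x *\<^sub>R f x)"
    using assms(3,4) by (intro Bochner_Integration.integral_cong) (auto simp: indicator_def)
  also have "\<dots> = (LINT x|lebesgue_on S. f x)"
    using assms(1) by (intro integral_restrict_space[symmetric]) simp
  finally show ?thesis .
qed

lemma L2_subset:
  assumes "open S" "open S'" "S \<subseteq> S'" "f \<in> L2 S'" shows "f \<in> L2 S"
proof -
  have "f \<in> borel_measurable (lebesgue_on S)"
    using measurable_restrict_mono[OF L2_measurable[OF assms(4)] assms(3)] .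
  moreover have "integrable (lebesgue_on S) (\<lambda>x. (norm (f x))\<^sup>2)"
  proof -
    have "set_integrable lebesgue S' (\<lambda>x. (norm (f x))\<^sup>2)"
      using assms(2,4) by (simp add: L2_def set_integrable_def integrable_restrict_space)
    then have "set_integrable lebesgue S (\<lambda>x. (norm (f x))\<^sup>2)"
      by (rule set_integrable_subset) (use assms in auto)
    then show ?thesis using assms(1) by (simp add: set_integrable_def integrable_restrict_space)
  qed
  ultimately show ?thesis by (simp add: L2_def)
qed

lemma test_fun_subset: "test_fun S \<phi> \<Longrightarrow> S \<subseteq> S' \<Longrightarrow> test_fun S' \<phi>"
  by (auto simp: test_fun_def)

lemma test_fun_zero_outside:
  assumes "test_fun S \<phi>" "x \<notin> S" shows "\<phi> x = 0" "pd i \<phi> x = 0"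
proof -
  have "x \<notin> closure {x. \<phi> x \<noteq> 0}" using assms test_fun_D(5)[OF assms(1)] by blast
  then show "\<phi> x = 0" "pd i \<phi> x = 0" by (rule test_fun_pd_outside[OF assms(1)])+
qed

lemma is_poly_L2: "open S \<Longrightarrow> bounded S \<Longrightarrow> is_poly p \<Longrightarrow> p \<in> L2 S"
  by (intro continuous_L2 is_poly_continuous)

context mesh
begin

text \<open>Test functions supported in one element only see the polynomial on that element, for which the
  classical divergence is the weak one.\<close>

lemma tdiv_on_cell:
  assumes \<tau>: "\<tau> \<in> Hdiv Om" and K: "K \<in> T" and s: "AE x in lebesgue. x \<in> K \<longrightarrow> \<tau> x = s x"
    and sp: "is_vpoly (trow s i)"
  shows "AE x in lebesgue. x \<in> cell K \<longrightarrow> tdiv Om \<tau> x $ i = cdiv (trow s i) x"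
proof -
  let ?C = "cell K"
  note C = cell_open[of K] cell_bounded[of K] cell_sub[of K]
  have \<tau>D: "\<tau> \<in> L2 Om" "tdiv Om \<tau> \<in> L2 Om" "is_weak_tdiv Om \<tau> (tdiv Om \<tau>)"
    using \<tau> D.dom_D unfolding Hdiv_dom by auto
  have "AE x in lebesgue_on ?C. tdiv Om \<tau> x $ i = cdiv (trow s i) x"
  proof (rule AE_eq_if_test_integrals_eq[OF C(1,2)])
    show "(\<lambda>x. tdiv Om \<tau> x $ i) \<in> L2 ?C" by (intro L2_subset[OF C(1) Om_open C(3)] L2_nth \<tau>D)
    show "cdiv (trow s i) \<in> L2 ?C" by (intro is_poly_L2 C is_poly_cdiv sp)
    fix \<phi> assume t: "test_fun ?C \<phi>"
    note tO = test_fun_subset[OF t C(3)]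
    note tL = test_fun_L2[OF C(1,2) t]
    have p: "is_poly (\<lambda>x. s x $ i $ j)" for j using sp by (simp add: is_vpoly_def)
    have sC: "AE x in lebesgue_on ?C. \<tau> x = s x"
      unfolding AE_cell_iff using s by eventually_elim (use interior_subset[of K] in \<open>auto simp: cell_def\<close>)
    have \<tau>C: "\<tau> \<in> L2 ?C" by (rule L2_subset[OF C(1) Om_open C(3) \<tau>D(1)])
    have "(LINT x|lebesgue_on ?C. tdiv Om \<tau> x $ i * \<phi> x) = (LINT x|lebesgue_on Om. tdiv Om \<tau> x $ i * \<phi> x)"
      by (rule integral_lebesgue_on_subset[symmetric, OF C(1) Om_open C(3)]) (simp add: test_fun_zero_outside[OF t])
    also have "\<dots> = - (LINT x|lebesgue_on Om. (\<Sum>j\<in>UNIV. \<tau> x $ i $ j * pd j \<phi> x))"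
      using \<tau>D(3) tO by (simp add: is_weak_tdiv_def is_weak_div_def)
    also have "(LINT x|lebesgue_on Om. (\<Sum>j\<in>UNIV. \<tau> x $ i $ j * pd j \<phi> x)) =
        (LINT x|lebesgue_on ?C. (\<Sum>j\<in>UNIV. \<tau> x $ i $ j * pd j \<phi> x))"
      by (rule integral_lebesgue_on_subset[OF C(1) Om_open C(3)]) (simp add: test_fun_zero_outside[OF t])
    also have "\<dots> = (\<Sum>j\<in>UNIV. LINT x|lebesgue_on ?C. \<tau> x $ i $ j * pd j \<phi> x)"
      by (intro Bochner_Integration.integral_sum L2_integrable_mult L2_nth \<tau>C tL)
    also have "\<dots> = (\<Sum>j\<in>UNIV. - (LINT x|lebesgue_on ?C. pd j (\<lambda>x. s x $ i $ j) x * \<phi> x))"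
    proof (rule sum.cong[OF refl])
      fix j
      have "AE x in lebesgue_on ?C. \<tau> x $ i $ j = s x $ i $ j" using sC by eventually_elim simp
      then have "(LINT x|lebesgue_on ?C. \<tau> x $ i $ j * pd j \<phi> x) = (LINT x|lebesgue_on ?C. s x $ i $ j * pd j \<phi> x)"
        by (intro integral_mult_cong_AE L2_nth \<tau>C tL is_poly_L2 C p)
      then show "(LINT x|lebesgue_on ?C. \<tau> x $ i $ j * pd j \<phi> x) = - (LINT x|lebesgue_on ?C. pd j (\<lambda>x. s x $ i $ j) x * \<phi> x)"
        using poly_weak_partial[OF C(1,2) p t] by simp
    qed
    also have "\<dots> = - (LINT x|lebesgue_on ?C. (\<Sum>j\<in>UNIV. pd j (\<lambda>x. s x $ i $ j) x * \<phi> x))"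
      unfolding sum_negf
      by (subst Bochner_Integration.integral_sum) (intro L2_integrable_mult is_poly_L2 C is_poly_pd p tL, simp)
    finally show "(LINT x|lebesgue_on ?C. tdiv Om \<tau> x $ i * \<phi> x) = (LINT x|lebesgue_on ?C. cdiv (trow s i) x * \<phi> x)"
      by (simp add: cdiv_def sum_distrib_right)
  qed
  then show ?thesis by (simp add: AE_cell_iff)
qed

text \<open>Moments against the monomials on the elements separate piecewise polynomials.\<close>

lemma fin_dim_piecewise:
  fixes V :: "((real, 'n) vec \<Rightarrow> 'b::euclidean_space) set"
  assumes V: "V \<subseteq> L2 Om"
    and pw: "\<And>f K. f \<in> V \<Longrightarrow> K \<in> T \<Longrightarrow> \<exists>s. (\<forall>b\<in>Basis. (\<lambda>x. s x \<bullet> b) \<in> polys D) \<and> (AE x in lebesgue. x \<in> K \<longrightarrow> f x = s x)"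
    and null: "\<And>f. f \<in> V \<Longrightarrow> AE x in lebesgue_on Om. f x = 0 \<Longrightarrow> ip f f = 0"
  shows "fin_dim V fun_lin ip"
proof -
  define w :: "(real, 'n) vec set \<Rightarrow> ('n \<Rightarrow> nat) \<Rightarrow> 'b \<Rightarrow> (real, 'n) vec \<Rightarrow> 'b"
    where "w K m b x = (indicator (cell K) x * mon m x) *\<^sub>R b" for K m b x
  have wL: "w K m b \<in> L2 Om" for K m b
  proof -
    have "is_poly (mon m :: (real, 'n) vec \<Rightarrow> real)"
      using polys_less_mon[of m "Suc (mdeg m)"] by (auto simp: is_poly_def polys_eq)
    note p = this is_poly_continuous[OF this, of UNIV]
    obtain B where B: "0 \<le> B" "\<And>x. x \<in> Om \<Longrightarrow> \<bar>mon m x :: real\<bar> \<le> B" using is_poly_bounded[OF p(1) Om_bounded] by metis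
    have "(\<lambda>x. indicator (cell K) x * mon m x :: real) \<in> borel_measurable borel"
      using cell_open[of K] borel_measurable_continuous_onI[OF p(2)] by (intro borel_measurable_times borel_measurable_indicator) auto
    then have "(\<lambda>x. indicator (cell K) x * mon m x :: real) \<in> borel_measurable (lebesgue_on Om)"
      by (intro measurable_restrict_space1 measurable_completion) simp
    moreover have "norm (indicator (cell K) x * mon m x :: real) \<le> B" if "x \<in> Om" for x
      using B(2)[OF that] B(1) by (simp add: indicator_def)
    ultimately have "(\<lambda>x. indicator (cell K) x * mon m x :: real) \<in> L2 Om"
      by (rule L2_bounded[OF Om_open Om_bounded])
    then show ?thesis
      unfolding w_def[abs_def] by (rule L2_bounded_linear[OF _ bounded_linear_scaleR_left])
  qed
  let ?I = "T \<times> {m. mdeg m < Suc D} \<times> (Basis :: 'b set)"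
  let ?F = "(\<lambda>(K, m, b) f. ip2 Om f (w K m b)) ` ?I"
  have "separating V fun_lin ip ?F"
    unfolding separating_def
  proof (intro conjI ballI impI)
    show "finite ?F" using T_finite finite_mdeg_less by (intro finite_imageI finite_cartesian_product) auto
    show "linear_on V fun_lin l" if "l \<in> ?F" for l
      using that V wL by (auto simp: linear_on_def ip2_lin_left subset_iff)
    fix f assume f: "f \<in> V" and 0: "\<forall>l\<in>?F. l f = 0"
    have fL: "f \<in> L2 Om" using f V by blast
    have "AE x in lebesgue_on Om. f x = 0"
    proof (rule AE_cells)
      fix K assume K: "K \<in> T"
      obtain s where s: "\<forall>b\<in>Basis. (\<lambda>x. s x \<bullet> b) \<in> polys D" "AE x in lebesgue. x \<in> K \<longrightarrow> f x = s x"
        using pw[OF f K] by blast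
      have "\<forall>b\<in>Basis. \<exists>c. (\<lambda>x. s x \<bullet> b) = (\<lambda>x. \<Sum>m | mdeg m < Suc D. c m * mon m x)"
        using s(1) unfolding polys_eq by (auto simp: polys_less_def)
      then obtain c where c: "\<And>b. b \<in> Basis \<Longrightarrow> (\<lambda>x. s x \<bullet> b) = (\<lambda>x. \<Sum>m | mdeg m < Suc D. c b m * mon m x)" by metis
      have fs: "AE x in lebesgue_on Om. indicator (cell K) x * (f x \<bullet> f x) =
          (\<Sum>b\<in>Basis. \<Sum>m | mdeg m < Suc D. c b m * (f x \<bullet> w K m b x))"
        unfolding AE_Om_iff using s(2)
      proof eventually_elim
        case (elim x)
        have "(\<Sum>b\<in>Basis. \<Sum>m | mdeg m < Suc D. c b m * (f x \<bullet> w K m b x)) =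
            indicator (cell K) x * (\<Sum>b\<in>Basis. (f x \<bullet> b) * (\<Sum>m | mdeg m < Suc D. c b m * mon m x))"
          unfolding w_def by (simp add: sum_distrib_left mult_ac)
        also have "\<dots> = indicator (cell K) x * (\<Sum>b\<in>Basis. (f x \<bullet> b) * (s x \<bullet> b))"
        proof -
          have "(\<Sum>m | mdeg m < Suc D. c b m * mon m x) = s x \<bullet> b" if "b \<in> Basis" for b
            using fun_cong[OF c[OF that], of x] by simp
          then show ?thesis by simp
        qed
        also have "\<dots> = indicator (cell K) x * (f x \<bullet> f x)"
        proof (cases "x \<in> cell K")
          case True
          then have "f x = s x" using elim interior_subset[of K] by (auto simp: cell_def)
          then show ?thesis by (simp add: euclidean_inner[of "s x" "s x"])
        qed simp
        finally show ?case by simp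
      qed
      have sum_int: "integrable (lebesgue_on Om) (\<lambda>x. \<Sum>b\<in>Basis. \<Sum>m | mdeg m < Suc D. c b m * (f x \<bullet> w K m b x))"
        by (intro Bochner_Integration.integrable_sum integrable_mult_right L2_integrable_inner fL wL)
      have meas: "(\<lambda>x. indicator (cell K) x * (f x \<bullet> f x) :: real) \<in> borel_measurable (lebesgue_on Om)"
        using L2_measurable[OF fL] cell_open[of K] cell_sub[of K]
        by (intro borel_measurable_times borel_measurable_inner borel_measurable_indicator)
          (auto simp: sets_restrict_space)
      have "(LINT x|lebesgue_on Om. indicator (cell K) x * (f x \<bullet> f x)) =
          (LINT x|lebesgue_on Om. (\<Sum>b\<in>Basis. \<Sum>m | mdeg m < Suc D. c b m * (f x \<bullet> w K m b x)))"
        by (rule integral_cong_AE[OF meas _ fs]) (use sum_int in simp)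
      also have "\<dots> = (\<Sum>b\<in>Basis. \<Sum>m | mdeg m < Suc D. c b m * ip2 Om f (w K m b))"
        unfolding ip2_def
        by (simp add: L2_integrable_inner fL wL)
      also have "\<dots> = 0"
      proof (intro sum.neutral ballI)
        fix b :: 'b and m :: "'n \<Rightarrow> nat" assume bm: "b \<in> Basis" "m \<in> {m. mdeg m < Suc D}"
        have "ip2 Om f (w K m b) = 0" using 0 K bm by force
        then show "c b m * ip2 Om f (w K m b) = 0" by simp
      qed
      finally have int0: "(LINT x|lebesgue_on Om. indicator (cell K) x * (f x \<bullet> f x)) = 0" .
      have "integrable (lebesgue_on Om) (\<lambda>x. indicator (cell K) x * (f x \<bullet> f x) :: real)"
        by (rule Bochner_Integration.integrable_bound[OF L2_integrable_inner[OF fL fL] meas]) (simp add: indicator_def)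
      from integral_nonneg_eq_0_iff_AE[OF this] int0
      have "AE x in lebesgue_on Om. indicator (cell K) x * (f x \<bullet> f x) = (0::real)" by simp
      then have "AE x in lebesgue. x \<in> Om \<longrightarrow> indicator (cell K) x * (f x \<bullet> f x) = (0::real)" by (simp add: AE_Om_iff)
      then show "AE x in lebesgue. x \<in> cell K \<longrightarrow> f x = 0"
        by eventually_elim (use cell_sub[of K] in \<open>auto simp: indicator_def\<close>)
    qed
    then show "ip f f = 0" by (rule null[OF f])
  qed
  then show ?thesis unfolding fin_dim_def by blast
qed

lemma polys_inner_vec: "s \<in> vpolys k \<Longrightarrow> b \<in> Basis \<Longrightarrow> (\<lambda>x. s x \<bullet> b) \<in> polys k"
  by (auto simp: Basis_vec_def vpolys_def inner_axis)

lemma polys_inner_tens: "(\<And>i. trow s i \<in> vpolys k) \<Longrightarrow> b \<in> Basis \<Longrightarrow> (\<lambda>x. s x \<bullet> b) \<in> polys k"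
  by (auto simp: Basis_vec_def vpolys_def inner_axis)

text \<open>A continuous piecewise polynomial is Lipschitz along every segment in the domain: the segment is
  covered by its finitely many closed pieces in the elements, and on each of them the derivative
  is bounded. Difference quotients are thus bounded, and they converge inside the elements.\<close>

lemma X2h_H1:
  assumes "q \<in> X2h Om T k" shows "q \<in> H1 Om"
proof -
  have qc: "continuous_on (closure Om) q" using assms by (simp add: X2h_def)
  have "\<exists>s. is_poly s \<and> (AE x in lebesgue. x \<in> K \<longrightarrow> q x = s x)" if "K \<in> T" for K
  proof -
    have "restr_in K (polys (k + 1)) q" using assms that by (simp add: X2h_def)
    then obtain s where "s \<in> polys (k + 1)" "AE x in lebesgue. x \<in> K \<longrightarrow> q x = s x"
      unfolding restr_in_iff[OF \<open>K \<in> T\<close>] by (elim bexE)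
    then show ?thesis by (intro exI[of _ s]) (auto simp: is_poly_def)
  qed
  then have "\<forall>K\<in>T. \<exists>s. is_poly s \<and> (AE x in lebesgue. x \<in> K \<longrightarrow> q x = s x)" by blast
  from bchoice[OF this] obtain s
    where "\<forall>K\<in>T. is_poly (s K) \<and> (AE x in lebesgue. x \<in> K \<longrightarrow> q x = s K x)" by (elim exE)
  then have sp: "\<And>K. K \<in> T \<Longrightarrow> is_poly (s K)" and s: "\<And>K. K \<in> T \<Longrightarrow> AE x in lebesgue. x \<in> K \<longrightarrow> q x = s K x"
    by auto
  have KO: "K \<subseteq> closure Om" if "K \<in> T" for K using Union_upper[OF that] by (simp only: T_cover)
  have qs: "q x = s K x" if K: "K \<in> T" and x: "x \<in> K" for K x
  proof -
    have "q y - s K y = 0" if "y \<in> interior K" for y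
    proof -
      have ae: "AE x in lebesgue. x \<in> interior K \<longrightarrow> q x = s K x"
        using s[OF K] by eventually_elim (use interior_subset[of K] in auto)
      have "interior K \<subseteq> closure Om" using KO[OF K] interior_subset[of K] by (rule subset_trans[rotated])
      then have "continuous_on (interior K) q" by (rule continuous_on_subset[OF qc])
      from AE_eq_continuous[OF open_interior this is_poly_continuous[OF sp[OF K]] ae that]
      show ?thesis by simp
    qed
    moreover have "continuous_on (closure (interior K)) (\<lambda>x. q x - s K x)"
      unfolding T_closure_interior[OF K]
      by (intro continuous_on_diff is_poly_continuous sp K continuous_on_subset[OF qc KO])
    moreover have "x \<in> closure (interior K)" unfolding T_closure_interior[OF K] by (rule x)
    ultimately have "q x - s K x = 0"
      using continuous_constant_on_closure[of "interior K" "\<lambda>x. q x - s K x" 0 x] by simp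
    then show ?thesis by simp
  qed
  have bd: "bounded (closure Om)" using Om_bounded by (rule bounded_closure)
  have Kb: "bounded K" if "K \<in> T" for K using bounded_subset[OF bd KO[OF that]] .
  define G where "G x = (\<chi> i. \<Sum>K\<in>T. indicator (cell K) x * pd i (s K) x)" for x
  have G_cell: "G x $ i = pd i (s K) x" if "K \<in> T" "x \<in> cell K" for K x i
  proof -
    have "indicator (cell K') x * pd i (s K') x = (if K' = K then pd i (s K) x else 0)" if "K' \<in> T" for K'
      using T_disjoint[OF \<open>K \<in> T\<close> \<open>K' \<in> T\<close>] \<open>x \<in> cell K\<close> by (auto simp: cell_def indicator_def)
    then have "G x $ i = (\<Sum>K'\<in>T. if K' = K then pd i (s K) x else 0)"
      unfolding G_def vec_lambda_beta by (intro sum.cong refl)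
    then show ?thesis using T_finite \<open>K \<in> T\<close> by simp
  qed
  have G_meas: "(\<lambda>x. G x $ i) \<in> borel_measurable borel" for i
    unfolding G_def vec_lambda_beta
    using cell_open sp
    by (intro borel_measurable_sum borel_measurable_times borel_measurable_indicator borel_measurable_continuous_onI
        is_poly_continuous is_poly_pd) auto
  define L where "L K i = (SOME L. 0 \<le> L \<and> (\<forall>x\<in>closure Om. \<bar>pd i (s K) x\<bar> \<le> L))" for K i
  have L': "0 \<le> L K i \<and> (\<forall>x\<in>closure Om. \<bar>pd i (s K) x\<bar> \<le> L K i)" if "K \<in> T" for K i
    unfolding L_def
  proof (rule someI_ex)
    obtain B where "0 \<le> B" "\<And>x. x \<in> closure Om \<Longrightarrow> \<bar>pd i (s K) x\<bar> \<le> B"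
      using is_poly_bounded[OF is_poly_pd[OF sp[OF \<open>K \<in> T\<close>]] bd] by metis
    then show "\<exists>L\<ge>0. \<forall>x\<in>closure Om. \<bar>pd i (s K) x\<bar> \<le> L" by blast
  qed
  then have L: "\<And>K i. K \<in> T \<Longrightarrow> 0 \<le> L K i" "\<And>K i x. K \<in> T \<Longrightarrow> x \<in> closure Om \<Longrightarrow> \<bar>pd i (s K) x\<bar> \<le> L K i"
    by auto
  define M where "M i = (\<Sum>K\<in>T. L K i)" for i
  have LM: "L K i \<le> M i" if "K \<in> T" for K i
    unfolding M_def using T_finite that L(1) by (intro member_le_sum) auto
  have M0: "0 \<le> M i" for i unfolding M_def using L(1) by (intro sum_nonneg) auto
  have qL: "q \<in> L2 Om" using qc by (rule continuous_L2[OF Om_open Om_bounded])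
  have GL: "G \<in> L2 Om"
  proof (rule L2_vec, rule L2_bounded[OF Om_open Om_bounded])
    fix i
    show "(\<lambda>x. G x $ i) \<in> borel_measurable (lebesgue_on Om)"
      using G_meas[of i] by (intro measurable_restrict_space1 measurable_completion) simp
    show "norm (G x $ i) \<le> M i" if x: "x \<in> Om" for x
    proof (cases "\<exists>K\<in>T. x \<in> cell K")
      case True
      then obtain K where K: "K \<in> T" "x \<in> cell K" by blast
      then show ?thesis
        using G_cell[OF K] L(2)[OF K(1), of x i] LM[OF K(1), of i] x closure_subset[of Om] by (auto intro: order_trans)
    next
      case False
      then show ?thesis using M0 by (simp add: G_def)
    qed
  qed
  have "compact (q ` closure Om)" using qc bd by (intro compact_continuous_image) (simp_all only: compact_eq_bounded_closed closed_closure simp_thms)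
  from compact_imp_bounded[OF this] obtain B where "\<forall>y\<in>q ` closure Om. norm y \<le> B"
    unfolding bounded_iff by blast
  then have B: "\<And>x. x \<in> closure Om \<Longrightarrow> \<bar>q x\<bar> \<le> B" by simp
  have "is_weak_grad Om q G"
    unfolding is_weak_grad_def
  proof (intro allI impI)
    fix \<phi> i assume t: "test_fun Om \<phi>"
    define e :: "(real, 'n) vec" where "e = axis i 1"
    show "(LINT x|lebesgue_on Om. q x * pd i \<phi> x) = - (LINT x|lebesgue_on Om. G x $ i * \<phi> x)"
    proof (rule weak_partial[OF Om_open Om_bounded _ _ _ G_meas _ t])
      show "continuous_on Om q" using qc closure_subset by (rule continuous_on_subset)
      show "\<bar>q x\<bar> \<le> B" if "x \<in> Om" for x using B that closure_subset by blast
    next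
      fix x h assume h: "0 \<le> h" "\<And>t. t \<in> {0..h} \<Longrightarrow> x + (- t) *\<^sub>R axis i 1 \<in> Om"
      let ?f = "\<lambda>t. q (x + (- t) *\<^sub>R e)"
      define U where "U K = {0..h} \<inter> (\<lambda>t. x + (- t) *\<^sub>R e) -` K" for K
      have "lipschitz_on (M i) {0..h} ?f"
      proof (rule lipschitz_on_closed_Union[where I = T and U = U])
        fix K assume K: "K \<in> T"
        show "closed (U K)"
          unfolding U_def by (intro continuous_closed_preimage T_closed K continuous_intros)
        have le: "\<bar>?f b - ?f a\<bar> \<le> M i * (b - a)" if ab: "a \<in> U K" "b \<in> U K" "a \<le> b" for a b
        proof -
          let ?y = "x + (- a) *\<^sub>R e"
          have yr: "?y + (-1 * r) *\<^sub>R e = x + (- (a + r)) *\<^sub>R e" for r by (simp add: algebra_simps)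
          have inK: "x + (- (a + r)) *\<^sub>R e \<in> K" if r: "r \<in> {0..b - a}" for r
          proof (cases "a = b")
            case True
            then show ?thesis using ab r by (simp add: U_def)
          next
            case False
            then have ab': "0 < b - a" using ab(3) by simp
            define c where "c = r / (b - a)"
            have c: "0 \<le> c" "c \<le> 1" "c * (b - a) = r" using r ab' by (auto simp: c_def field_simps)
            have "(1 - c) *\<^sub>R (x + (- a) *\<^sub>R e) + c *\<^sub>R (x + (- b) *\<^sub>R e) \<in> K"
              using T_convex[OF K] ab c unfolding convex_alt U_def by auto
            moreover have "(1 - c) *\<^sub>R (x + (- a) *\<^sub>R e) + c *\<^sub>R (x + (- b) *\<^sub>R e) = x + (- (a + c * (b - a))) *\<^sub>R e"
              by (simp add: algebra_simps)
            ultimately show ?thesis using c(3) by simp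
          qed
          have "\<bar>s K (?y + (-1 * (b - a)) *\<^sub>R axis i 1) - s K ?y\<bar> \<le> M i * (b - a)"
          proof (rule pd_line_bound)
            fix r assume r: "r \<in> {0..b - a}"
            have "?y + (-1 * r) *\<^sub>R axis i 1 \<in> K"
              using inK[OF r] unfolding yr[of r, symmetric] by (simp only: e_def)
            then show "\<bar>pd i (s K) (?y + (-1 * r) *\<^sub>R axis i 1)\<bar> \<le> M i"
              using L(2)[OF K, of _ i] KO[OF K] LM[OF K, of i] by (meson order_trans subsetD)
            show "s K differentiable (at (?y + (-1 * r) *\<^sub>R axis i 1))" by (rule is_poly_differentiable[OF sp[OF K]])
          qed (use ab in auto)
          note bound = this[folded e_def]
          have yb: "?y + (-1 * (b - a)) *\<^sub>R e = x + (- b) *\<^sub>R e" unfolding yr by simp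
          have "?f b = s K (x + (- b) *\<^sub>R e)" "?f a = s K ?y"
            by (rule qs[OF K]; use ab in \<open>simp add: U_def\<close>)+
          then show ?thesis using bound unfolding yb by simp
        qed
        show "lipschitz_on (M i) (U K) ?f"
        proof (rule lipschitz_onI[OF _ M0])
          fix a b assume ab: "a \<in> U K" "b \<in> U K"
          show "dist (?f a) (?f b) \<le> M i * dist a b"
            using le[OF ab] le[OF ab(2,1)] by (cases "a \<le> b") (auto simp: dist_real_def abs_minus_commute)
        qed
      next
        show "{0..h} \<subseteq> (\<Union>K\<in>T. U K)"
        proof
          fix t assume t: "t \<in> {0..h}"
          then have "x + (- t) *\<^sub>R e \<in> Om" using h(2) by (simp add: e_def)
          then have "x + (- t) *\<^sub>R e \<in> \<Union>T" unfolding T_cover using closure_subset by blast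
          then obtain K where "K \<in> T" "x + (- t) *\<^sub>R e \<in> K" by blast
          then show "t \<in> (\<Union>K\<in>T. U K)" using t by (auto simp: U_def)
        qed
      qed (use T_finite M0 in auto)
      from lipschitz_onD[OF this, of h 0] h(1)
      show "\<bar>q (x + (- h) *\<^sub>R axis i 1) - q x\<bar> \<le> M i * h" by (simp add: dist_real_def e_def)
    next
      show "AE x in lborel. x \<in> Om \<longrightarrow> ((\<lambda>t. q (x + t *\<^sub>R axis i 1)) has_real_derivative G x $ i) (at 0)"
        using AE_in_cells
      proof eventually_elim
        case (elim x)
        show ?case
        proof
          assume "x \<in> Om"
          then obtain K where K: "K \<in> T" "x \<in> cell K" using elim by blast
          have "((\<lambda>t. s K (x + t *\<^sub>R axis i 1)) has_real_derivative pd i (s K) x) (at 0)"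
            using pd_line[OF is_poly_differentiable[OF sp[OF K(1)]], of x i 0] by simp
          moreover have "open ((\<lambda>t. x + t *\<^sub>R axis i 1 :: (real, 'n) vec) -` interior K)"
            by (intro open_vimage continuous_intros) auto
          ultimately have "((\<lambda>t. q (x + t *\<^sub>R axis i 1)) has_real_derivative pd i (s K) x) (at 0)"
          proof (rule has_field_derivative_transform_within_open)
            show "s K (x + t *\<^sub>R axis i 1) = q (x + t *\<^sub>R axis i 1)"
              if "t \<in> (\<lambda>t. x + t *\<^sub>R axis i 1) -` interior K" for t
              using qs[OF K(1)] interior_subset[of K] that by force
          qed (use K in \<open>auto simp: cell_def\<close>)
          then show "((\<lambda>t. q (x + t *\<^sub>R axis i 1)) has_real_derivative G x $ i) (at 0)"
            by (simp add: G_cell[OF K])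
        qed
      qed
    qed
  qed
  then show ?thesis unfolding H1_def using qL GL by blast
qed

end

section \<open>The finite element spaces\<close>

lemma sqrt_cauchy_schwarz:
  "x * y + z * w \<le> sqrt (x\<^sup>2 + z\<^sup>2) * sqrt (y\<^sup>2 + w\<^sup>2)" for x y z w :: real
proof -
  have "(x * y + z * w)\<^sup>2 + (x * w - z * y)\<^sup>2 = (x\<^sup>2 + z\<^sup>2) * (y\<^sup>2 + w\<^sup>2)"
    by (simp add: power2_eq_square algebra_simps)
  then have "(x * y + z * w)\<^sup>2 \<le> (x\<^sup>2 + z\<^sup>2) * (y\<^sup>2 + w\<^sup>2)"
    using zero_le_power2[of "x * w - z * y"] by linarith
  then have "sqrt ((x * y + z * w)\<^sup>2) \<le> sqrt ((x\<^sup>2 + z\<^sup>2) * (y\<^sup>2 + w\<^sup>2))" by (rule real_sqrt_le_mono)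
  then show ?thesis by (simp add: real_sqrt_mult)
qed

context mesh
begin

lemma restr_in_zero: "lin_closed S \<Longrightarrow> restr_in K S (\<lambda>x. 0)"
  by (rule restr_in_I[of "\<lambda>x. 0"]) (simp_all add: lin_closed_def)

lemmas lin_closed_X = lin_closed_fsum[OF lin_closed_rows_in[OF lin_closed_vpolys]
    lin_closed_rows_in[OF lin_closed_Bub[OF card_n T_simplex]]]
lemmas lin_closed_Y = lin_closed_fsum[OF lin_closed_rows_in[OF lin_closed_RT]
    lin_closed_rows_in[OF lin_closed_Bub[OF card_n T_simplex]]]

lemma X1h_lin: "e \<in> X1h Om T k \<Longrightarrow> e' \<in> X1h Om T k \<Longrightarrow> fun_lin c e e' \<in> X1h Om T k"
  unfolding X1h_def using L2_lin restr_in_lin lin_closed_X by blast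

lemma X1h_zero: "(\<lambda>x. 0) \<in> X1h Om T k"
  unfolding X1h_def using L2_zero restr_in_zero lin_closed_X by blast

lemma X2h_lin: "q \<in> X2h Om T k \<Longrightarrow> q' \<in> X2h Om T k \<Longrightarrow> fun_lin c q q' \<in> X2h Om T k"
proof -
  assume q: "q \<in> X2h Om T k" "q' \<in> X2h Om T k"
  have "restr_in K (polys (k + 1)) (fun_lin c q q')" if "K \<in> T" for K
    using restr_in_lin[OF that lin_closed_polys] q that by (simp add: X2h_def)
  moreover have "continuous_on (closure Om) (fun_lin c q q')"
    using q unfolding X2h_def fun_lin_def by (auto intro!: continuous_intros)
  ultimately show ?thesis by (simp add: X2h_def)
qed

lemma X2h_zero: "(\<lambda>x. 0) \<in> X2h Om T k"
  unfolding X2h_def by (intro CollectI conjI ballI restr_in_zero lin_closed_polys continuous_on_const)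

lemma Yh_lin: "t \<in> Yh Om T k \<Longrightarrow> t' \<in> Yh Om T k \<Longrightarrow> fun_lin c t t' \<in> Yh Om T k"
  unfolding Yh_def using Hdiv.closed restr_in_lin lin_closed_Y by blast

lemma zero_Hdiv: "(\<lambda>x. 0) \<in> Hdiv Om"
  unfolding Hdiv_dom by (rule D.dom_I[OF L2_zero L2_zero D.R_zero])

lemma Yh_zero: "(\<lambda>x. 0) \<in> Yh Om T k"
  unfolding Yh_def using zero_Hdiv restr_in_zero lin_closed_Y by blast

definition Z1h where "Z1h k = {v \<in> L2 Om. \<forall>K\<in>T. restr_in K (vpolys k) v}"

definition Z2h where "Z2h k = {\<eta> \<in> L2skew Om. continuous_on (closure Om) \<eta> \<and>
                     (\<forall>K\<in>T. restr_in K (rows_in (vpolys (k + 1))) \<eta>)}"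

lemma Zh_eq: "Zh Om T k = Z1h k \<times> Z2h k"
  by (simp add: Zh_def Z1h_def Z2h_def)

lemma Z1h_lin: "v \<in> Z1h k \<Longrightarrow> v' \<in> Z1h k \<Longrightarrow> fun_lin c v v' \<in> Z1h k"
  unfolding Z1h_def using L2_lin restr_in_lin lin_closed_vpolys by blast

lemma Z1h_zero: "(\<lambda>x. 0) \<in> Z1h k"
  unfolding Z1h_def using L2_zero restr_in_zero lin_closed_vpolys by blast

lemma Z2h_lin: "v \<in> Z2h k \<Longrightarrow> v' \<in> Z2h k \<Longrightarrow> fun_lin c v v' \<in> Z2h k"
proof -
  assume v: "v \<in> Z2h k" "v' \<in> Z2h k"
  have "restr_in K (rows_in (vpolys (k + 1))) (fun_lin c v v')" if "K \<in> T" for K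
    using restr_in_lin[OF that lin_closed_rows_in[OF lin_closed_vpolys]] v that by (simp add: Z2h_def)
  moreover have "continuous_on (closure Om) (fun_lin c v v')"
    using v unfolding Z2h_def fun_lin_def by (auto intro!: continuous_intros)
  moreover have "fun_lin c v v' \<in> L2skew Om"
  proof -
    have "AE x in lebesgue_on Om. transpose (v x) = - v x" "AE x in lebesgue_on Om. transpose (v' x) = - v' x"
      using v by (auto simp: Z2h_def L2skew_def)
    then have "AE x in lebesgue_on Om. transpose (fun_lin c v v' x) = - fun_lin c v v' x"
    proof eventually_elim
      case (elim x)
      have "transpose (fun_lin c v v' x) = transpose (v x) + c *\<^sub>R transpose (v' x)"
        by (simp add: fun_lin_def transpose_def vec_eq_iff)
      then show ?case unfolding elim by (simp add: fun_lin_def)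
    qed
    then show ?thesis using v L2_lin[of v Om v' c] by (simp add: Z2h_def L2skew_def)
  qed
  ultimately show ?thesis by (simp add: Z2h_def)
qed

lemma Z2h_zero: "(\<lambda>x. 0) \<in> Z2h k"
  unfolding Z2h_def L2skew_def
  by (intro CollectI conjI ballI restr_in_zero lin_closed_rows_in lin_closed_vpolys continuous_on_const L2_zero)
    (simp add: transpose_def vec_eq_iff)

lemma X1h_L2: "e \<in> X1h Om T k \<Longrightarrow> e \<in> L2 Om" and Yh_Hdiv: "t \<in> Yh Om T k \<Longrightarrow> t \<in> Hdiv Om"
  and Z1h_L2: "v \<in> Z1h k \<Longrightarrow> v \<in> L2 Om" and Z2h_L2: "\<eta> \<in> Z2h k \<Longrightarrow> \<eta> \<in> L2 Om"
  by (auto simp: X1h_def Yh_def Z1h_def Z2h_def L2skew_def)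

lemma semi_inner_X1h: "semi_inner (X1h Om T k) fun_lin (ip2 Om)"
  by (rule semi_inner_subspace[OF semi_inner_L2]) ((use X1h_L2 X1h_zero X1h_lin in blast)+)

lemma semi_inner_X2h: "semi_inner (X2h Om T k) fun_lin G.ipT"
  by (rule semi_inner_subspace[OF H1.semi_inner_axioms]) ((use X2h_H1 X2h_zero X2h_lin in blast)+)

lemma semi_inner_Yh: "semi_inner (Yh Om T k) fun_lin D.ipT"
  by (rule semi_inner_subspace[OF Hdiv.semi_inner_axioms]) ((use Yh_Hdiv Yh_zero Yh_lin in blast)+)

lemma semi_inner_Z1h: "semi_inner (Z1h k) fun_lin (ip2 Om)"
  by (rule semi_inner_subspace[OF semi_inner_L2]) ((use Z1h_L2 Z1h_zero Z1h_lin in blast)+)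

lemma semi_inner_Z2h: "semi_inner (Z2h k) fun_lin (ip2 Om)"
  by (rule semi_inner_subspace[OF semi_inner_L2]) ((use Z2h_L2 Z2h_zero Z2h_lin in blast)+)

definition max_degree :: "nat \<Rightarrow> nat" where
  "max_degree k = (\<Sum>K\<in>T. card (vertices K)) + k + 1"

lemma Bub_max_degree: "K \<in> T \<Longrightarrow> s \<in> Bub k K \<Longrightarrow> s \<in> vpolys (max_degree k)"
proof -
  assume K: "K \<in> T" and s: "s \<in> Bub k K"
  have "card (vertices K) \<le> (\<Sum>K\<in>T. card (vertices K))" using T_finite K by (intro member_le_sum) auto
  then show ?thesis by (intro vpolys_mono[OF Bub_degree[OF T_simplex[OF K] s]]) (simp add: max_degree_def)
qed

lemma fin_dim_X1h: "fin_dim (X1h Om T k) fun_lin (ip2 Om)"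
proof (rule fin_dim_piecewise)
  show "X1h Om T k \<subseteq> L2 Om" using X1h_L2 by blast
  show "ip2 Om f f = 0" if "f \<in> X1h Om T k" "AE x in lebesgue_on Om. f x = 0" for f
    using ip2_null_iff[OF X1h_L2[OF that(1)]] that(2) by simp
  fix f K assume f: "f \<in> X1h Om T k" and K: "K \<in> T"
  then have "restr_in K (fsum (rows_in (vpolys k)) (rows_in (Bub k K))) f" by (simp add: X1h_def)
  then obtain s where s: "s \<in> fsum (rows_in (vpolys k)) (rows_in (Bub k K))" "AE x in lebesgue. x \<in> K \<longrightarrow> f x = s x"
    unfolding restr_in_iff[OF K] by (elim bexE)
  obtain a b where ab: "s = (\<lambda>x. a x + b x)" "\<And>i. trow a i \<in> vpolys k" "\<And>i. trow b i \<in> Bub k K"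
    by (rule fsum_rows_cases[OF s(1)]) (rule that)
  have "trow s i \<in> vpolys (max_degree k)" for i
    using vpolys_add[OF vpolys_mono[OF ab(2)[of i]] Bub_max_degree[OF K ab(3)[of i]]] by (simp add: ab(1) max_degree_def)
  then show "\<exists>s. (\<forall>b\<in>Basis. (\<lambda>x. s x \<bullet> b) \<in> polys (max_degree k)) \<and> (AE x in lebesgue. x \<in> K \<longrightarrow> f x = s x)"
    using s(2) polys_inner_tens[of s "max_degree k"] by (intro exI[of _ s] conjI ballI) auto
qed

lemma fin_dim_Yh: "fin_dim (Yh Om T k) fun_lin D.ipT"
proof (rule fin_dim_piecewise)
  show "Yh Om T k \<subseteq> L2 Om" using Yh_Hdiv D.dom_D(1) unfolding Hdiv_dom by blast
  show "D.ipT f f = 0" if "f \<in> Yh Om T k" "AE x in lebesgue_on Om. f x = 0" for f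
    using D.ipT_null_iff[of f] Yh_Hdiv[OF that(1)] that(2) unfolding Hdiv_dom by simp
  fix f K assume f: "f \<in> Yh Om T k" and K: "K \<in> T"
  then have "restr_in K (fsum (rows_in (RT k)) (rows_in (Bub k K))) f" by (simp add: Yh_def)
  then obtain s where s: "s \<in> fsum (rows_in (RT k)) (rows_in (Bub k K))" "AE x in lebesgue. x \<in> K \<longrightarrow> f x = s x"
    unfolding restr_in_iff[OF K] by (elim bexE)
  obtain a b where ab: "s = (\<lambda>x. a x + b x)" "\<And>i. trow a i \<in> RT k" "\<And>i. trow b i \<in> Bub k K"
    by (rule fsum_rows_cases[OF s(1)]) (rule that)
  have "trow s i \<in> vpolys (max_degree k)" for i
    using vpolys_add[OF vpolys_mono[OF RT_degree[OF ab(2)[of i]]] Bub_max_degree[OF K ab(3)[of i]]]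
    by (simp add: ab(1) max_degree_def)
  then show "\<exists>s. (\<forall>b\<in>Basis. (\<lambda>x. s x \<bullet> b) \<in> polys (max_degree k)) \<and> (AE x in lebesgue. x \<in> K \<longrightarrow> f x = s x)"
    using s(2) polys_inner_tens[of s "max_degree k"] by (intro exI[of _ s] conjI ballI) auto
qed

lemma fin_dim_X2h: "fin_dim (X2h Om T k) fun_lin G.ipT"
proof (rule fin_dim_piecewise)
  show "X2h Om T k \<subseteq> L2 Om" using X2h_H1 G.dom_D(1) unfolding H1_dom by blast
  show "G.ipT f f = 0" if "f \<in> X2h Om T k" "AE x in lebesgue_on Om. f x = 0" for f
    using G.ipT_null_iff[of f] X2h_H1[OF that(1)] that(2) unfolding H1_dom by simp
  fix f K assume f: "f \<in> X2h Om T k" and K: "K \<in> T"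
  then have "restr_in K (polys (k + 1)) f" by (simp add: X2h_def)
  then show "\<exists>s. (\<forall>b\<in>Basis. (\<lambda>x. s x \<bullet> b) \<in> polys (k + 1)) \<and> (AE x in lebesgue. x \<in> K \<longrightarrow> f x = s x)"
    unfolding restr_in_iff[OF K] by auto
qed

lemma fin_dim_Z1h: "fin_dim (Z1h k) fun_lin (ip2 Om)"
proof (rule fin_dim_piecewise)
  show "Z1h k \<subseteq> L2 Om" using Z1h_L2 by blast
  show "ip2 Om f f = 0" if "f \<in> Z1h k" "AE x in lebesgue_on Om. f x = 0" for f
    using ip2_null_iff[OF Z1h_L2[OF that(1)]] that(2) by simp
  fix f K assume f: "f \<in> Z1h k" and K: "K \<in> T"
  then have "restr_in K (vpolys k) f" by (simp add: Z1h_def)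
  then show "\<exists>s. (\<forall>b\<in>Basis. (\<lambda>x. s x \<bullet> b) \<in> polys k) \<and> (AE x in lebesgue. x \<in> K \<longrightarrow> f x = s x)"
    unfolding restr_in_iff[OF K] using polys_inner_vec by blast
qed

lemma fin_dim_Z2h: "fin_dim (Z2h k) fun_lin (ip2 Om)"
proof (rule fin_dim_piecewise)
  show "Z2h k \<subseteq> L2 Om" using Z2h_L2 by blast
  show "ip2 Om f f = 0" if "f \<in> Z2h k" "AE x in lebesgue_on Om. f x = 0" for f
    using ip2_null_iff[OF Z2h_L2[OF that(1)]] that(2) by simp
  fix f K assume f: "f \<in> Z2h k" and K: "K \<in> T"
  then have "restr_in K (rows_in (vpolys (k + 1))) f" by (simp add: Z2h_def)
  then obtain s where s: "s \<in> rows_in (vpolys (k + 1))" "AE x in lebesgue. x \<in> K \<longrightarrow> f x = s x"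
    unfolding restr_in_iff[OF K] by (elim bexE)
  then show "\<exists>s. (\<forall>b\<in>Basis. (\<lambda>x. s x \<bullet> b) \<in> polys (k + 1)) \<and> (AE x in lebesgue. x \<in> K \<longrightarrow> f x = s x)"
    using polys_inner_tens[of s "k + 1"] by (intro exI[of _ s] conjI ballI) (auto simp: rows_in_def)
qed

abbreviation "lin2 \<equiv> prod_lin fun_lin fun_lin"
abbreviation "ipX \<equiv> prod_ip (ip2 Om) G.ipT"
abbreviation "ipZ \<equiv> prod_ip (ip2 Om) (ip2 Om)"

lemma semi_inner_Xh: "semi_inner (Xh Om T k) lin2 ipX"
  unfolding Xh_def by (rule semi_inner_prod[OF semi_inner_X1h semi_inner_X2h])

lemma fin_dim_Xh: "fin_dim (Xh Om T k) lin2 ipX"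
  unfolding Xh_def by (rule fin_dim_prod[OF semi_inner_X1h semi_inner_X2h fin_dim_X1h fin_dim_X2h])

lemma semi_inner_Zh: "semi_inner (Zh Om T k) lin2 ipZ"
  unfolding Zh_eq by (rule semi_inner_prod[OF semi_inner_Z1h semi_inner_Z2h])

lemma fin_dim_Zh: "fin_dim (Zh Om T k) lin2 ipZ"
  unfolding Zh_eq by (rule fin_dim_prod[OF semi_inner_Z1h semi_inner_Z2h fin_dim_Z1h fin_dim_Z2h])

lemma norm_H1_sq: "(norm_H1 Om q)\<^sup>2 = G.ipT q q"
  unfolding norm_H1_def G.ipT_def by (simp add: norm_L2_sq[symmetric])

lemma norm_X_nrm: "semi_inner.nrm ipX x = norm_X Om x" if "x \<in> Xh Om T k"
  unfolding semi_inner.nrm_def[OF semi_inner_Xh]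
  by (simp add: norm_X_def prod_ip_def norm_L2_sq norm_H1_sq split: prod.split)

lemma norm_Z_nrm: "semi_inner.nrm ipZ x = norm_Z Om x" if "x \<in> Zh Om T k"
  unfolding semi_inner.nrm_def[OF semi_inner_Zh]
  by (simp add: norm_Z_def prod_ip_def norm_L2_sq split: prod.split)

section \<open>The divergence of the stress space\<close>

lemma Yh_local:
  assumes t: "t \<in> Yh Om T k"
  obtains a b where
    "\<And>K i. K \<in> T \<Longrightarrow> trow (a K) i \<in> RT k" "\<And>K i. K \<in> T \<Longrightarrow> trow (b K) i \<in> Bub k K"
    "\<And>K. K \<in> T \<Longrightarrow> AE x in lebesgue. x \<in> K \<longrightarrow> t x = a K x + b K x"
    "\<And>K i. K \<in> T \<Longrightarrow> AE x in lebesgue. x \<in> cell K \<longrightarrow> tdiv Om t x $ i = cdiv (trow (a K) i) x"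
proof -
  have "\<exists>ab. (\<forall>i. trow (fst ab) i \<in> RT k) \<and> (\<forall>i. trow (snd ab) i \<in> Bub k K) \<and>
      (AE x in lebesgue. x \<in> K \<longrightarrow> t x = fst ab x + snd ab x)" if K: "K \<in> T" for K
  proof -
    have "restr_in K (fsum (rows_in (RT k)) (rows_in (Bub k K))) t" using t K by (simp add: Yh_def)
    then obtain s where s: "s \<in> fsum (rows_in (RT k)) (rows_in (Bub k K))" "AE x in lebesgue. x \<in> K \<longrightarrow> t x = s x"
      unfolding restr_in_iff[OF K] by (elim bexE)
    obtain a b where "s = (\<lambda>x. a x + b x)" "\<And>i. trow a i \<in> RT k" "\<And>i. trow b i \<in> Bub k K"
      by (rule fsum_rows_cases[OF s(1)]) (rule that)
    then show ?thesis using s(2) by (intro exI[of _ "(a, b)"]) simp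
  qed
  then have "\<forall>K\<in>T. \<exists>ab. (\<forall>i. trow (fst ab) i \<in> RT k) \<and> (\<forall>i. trow (snd ab) i \<in> Bub k K) \<and>
      (AE x in lebesgue. x \<in> K \<longrightarrow> t x = fst ab x + snd ab x)" by blast
  from bchoice[OF this] obtain ab where ab: "\<forall>K\<in>T. (\<forall>i. trow (fst (ab K)) i \<in> RT k) \<and> (\<forall>i. trow (snd (ab K)) i \<in> Bub k K) \<and>
      (AE x in lebesgue. x \<in> K \<longrightarrow> t x = fst (ab K) x + snd (ab K) x)" by (elim exE)
  show ?thesis
  proof (rule that[of "\<lambda>K. fst (ab K)" "\<lambda>K. snd (ab K)"])
    fix K i assume K: "K \<in> T"
    show a: "trow (fst (ab K)) i \<in> RT k" and b: "trow (snd (ab K)) i \<in> Bub k K" using ab K by auto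
    show s: "AE x in lebesgue. x \<in> K \<longrightarrow> t x = fst (ab K) x + snd (ab K) x" using ab K by auto
    note bp = Bub_poly[OF card_n T_simplex[OF K] b]
    have "is_vpoly (trow (\<lambda>x. fst (ab K) x + snd (ab K) x) i)"
      using is_vpoly_add[OF is_vpoly_RT[OF a] bp(1)] by simp
    from tdiv_on_cell[OF Yh_Hdiv[OF t] K s this]
    show "AE x in lebesgue. x \<in> cell K \<longrightarrow> tdiv Om t x $ i = cdiv (trow (fst (ab K)) i) x"
      using cdiv_add[OF is_vpoly_RT[OF a] bp(1)] bp(2) by simp
  qed
qed

text \<open>The bubbles are divergence free, and the divergence of a Raviart--Thomas field of order \<open>k\<close> has
  degree at most \<open>k\<close>. The divergence of the stress space is thus tested by itself.\<close>

lemma tdiv_Yh_in_Z1h: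
  assumes t: "t \<in> Yh Om T k"
  shows "\<exists>v\<in>Z1h k. AE x in lebesgue_on Om. v x = tdiv Om t x"
proof -
  obtain a b where a: "\<And>K i. K \<in> T \<Longrightarrow> trow (a K) i \<in> RT k"
    and d: "\<And>K i. K \<in> T \<Longrightarrow> AE x in lebesgue. x \<in> cell K \<longrightarrow> tdiv Om t x $ i = cdiv (trow (a K) i) x"
    by (rule Yh_local[OF t]) (rule that)
  define v :: "(real, 'n) vec \<Rightarrow> (real, 'n) vec"
    where "v x = (\<chi> i. \<Sum>K\<in>T. indicator (interior K) x * cdiv (trow (a K) i) x)" for x
  have vK: "v x $ i = cdiv (trow (a K) i) x" if "K \<in> T" "x \<in> interior K" for K x i
  proof -
    have "indicator (interior K') x * cdiv (trow (a K') i) x = (if K' = K then cdiv (trow (a K) i) x else 0)"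
      if "K' \<in> T" for K'
      using T_disjoint[OF \<open>K \<in> T\<close> \<open>K' \<in> T\<close>] \<open>x \<in> interior K\<close> by (auto simp: indicator_def)
    then have "v x $ i = (\<Sum>K'\<in>T. if K' = K then cdiv (trow (a K) i) x else 0)"
      unfolding v_def vec_lambda_beta by (intro sum.cong refl)
    then show ?thesis using T_finite \<open>K \<in> T\<close> by simp
  qed
  have ae: "AE x in lebesgue_on Om. v x = tdiv Om t x"
  proof (rule AE_vec_eq, rule AE_cells)
    show "AE x in lebesgue. x \<in> cell K \<longrightarrow> v x $ i = tdiv Om t x $ i" if "K \<in> T" for K i
      using d[OF that, of i] by eventually_elim (use vK[OF that] in \<open>auto simp: cell_def\<close>)
  qed
  have "v \<in> Z1h k"
    unfolding Z1h_def
  proof (intro CollectI conjI ballI)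
    have p: "is_poly (cdiv (trow (a K) i))" if "K \<in> T" for K i
      by (rule is_poly_cdiv[OF is_vpoly_RT[OF a[OF that]]])
    have comp: "(\<lambda>x. indicator (interior K) x * cdiv (trow (a K) i) x) \<in> L2 Om" if K: "K \<in> T" for K i
    proof -
      obtain B where B: "0 \<le> B" "\<And>x. x \<in> Om \<Longrightarrow> \<bar>cdiv (trow (a K) i) x\<bar> \<le> B"
        using is_poly_bounded[OF p[OF K] Om_bounded] by metis
      have "(\<lambda>x. indicator (interior K) x * cdiv (trow (a K) i) x) \<in> borel_measurable borel"
        by (intro borel_measurable_times borel_measurable_indicator borel_measurable_continuous_onI is_poly_continuous p K) auto
      then have "(\<lambda>x. indicator (interior K) x * cdiv (trow (a K) i) x) \<in> borel_measurable (lebesgue_on Om)"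
        by (intro measurable_restrict_space1 measurable_completion) simp
      moreover have "norm (indicator (interior K) x * cdiv (trow (a K) i) x) \<le> B" if "x \<in> Om" for x
        using B(2)[OF that] B(1) by (simp add: indicator_def)
      ultimately show ?thesis by (rule L2_bounded[OF Om_open Om_bounded])
    qed
    have "(\<lambda>x. \<Sum>K\<in>S. indicator (interior K) x * cdiv (trow (a K) i) x) \<in> L2 Om" if "finite S" "S \<subseteq> T" for S i
      using that
    proof (induction S rule: finite_induct)
      case (insert K S)
      have "(\<lambda>x. \<Sum>K\<in>insert K S. indicator (interior K) x * cdiv (trow (a K) i) x)
          = fun_lin 1 (\<lambda>x. indicator (interior K) x * cdiv (trow (a K) i) x)
              (\<lambda>x. \<Sum>K\<in>S. indicator (interior K) x * cdiv (trow (a K) i) x)"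
        by (simp only: fun_lin_def sum.insert[OF insert.hyps] scaleR_one)
      then show ?case using L2_lin[OF comp[of K i] insert.IH, of 1] insert.prems by simp
    qed (simp add: L2_zero)
    then show "v \<in> L2 Om" using T_finite unfolding v_def by (intro L2_vec) simp
    fix K assume K: "K \<in> T"
    have "AE x in lebesgue. x \<notin> frontier K"
      using negligible_convex_frontier[OF T_convex[OF K]] by (intro AE_not_in) (simp add: negligible_iff_null_sets)
    then have on_K: "AE x in lebesgue. x \<in> K \<longrightarrow> v x = (\<chi> i. cdiv (trow (a K) i) x)"
    proof eventually_elim
      case (elim x)
      show ?case
      proof
        assume "x \<in> K"
        then have "x \<in> interior K" using elim T_closed[OF K] by (simp add: frontier_def)
        then show "v x = (\<chi> i. cdiv (trow (a K) i) x)" by (simp add: vec_eq_iff vK[OF K])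
      qed
    qed
    have p: "(\<lambda>x. \<chi> i. cdiv (trow (a K) i) x) \<in> vpolys k"
      using cdiv_RT[OF a[OF K]] by (simp add: vpolys_def)
    show "restr_in K (vpolys k) v" unfolding restr_in_iff[OF K] by (rule bexI[OF _ p]) (rule on_K)
  qed
  show ?thesis by (rule bexI[OF _ \<open>v \<in> Z1h k\<close>]) (rule ae)
qed

lemma fsum_I: "a \<in> A \<Longrightarrow> b \<in> B \<Longrightarrow> (\<lambda>x. a x + b x) \<in> fsum A B"
  unfolding fsum_def by (rule CollectI, rule exI[of _ a], rule exI[of _ b]) simp

lemma constant_null:
  fixes c :: "'b::euclidean_space"
  assumes "norm_L2 Om (\<lambda>x. c) = 0" shows "c = 0"
proof (rule ccontr)
  assume "c \<noteq> 0"
  have cL: "(\<lambda>x. c) \<in> L2 Om"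
    by (rule continuous_L2[OF Om_open Om_bounded]) (rule continuous_on_const)
  have "AE x in lebesgue. x \<in> Om \<longrightarrow> c = 0"
    using norm_L2_null_iff[OF cL] assms unfolding AE_Om_iff by simp
  then have ae: "AE x in lebesgue. x \<in> Om \<longrightarrow> (0::real) = 1"
    by (rule eventually_mono) (use \<open>c \<noteq> 0\<close> in simp)
  obtain y where "y \<in> Om" using Om_nonempty by blast
  have "(0::real) = 1"
    by (rule AE_eq_continuous[OF Om_open continuous_on_const continuous_on_const ae \<open>y \<in> Om\<close>])
  then show False by simp
qed

text \<open>The reason for the choice of \<open>X1h\<close>: a divergence free stress lies in the strain space, bubbles
  included, because the Raviart--Thomas part loses its top degree.\<close>

lemma divergence_free_Yh_in_X1h:
  assumes t: "t \<in> Yh Om T k" and 0: "AE x in lebesgue_on Om. tdiv Om t x = 0"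
  shows "t \<in> X1h Om T k"
proof -
  obtain a b where a: "\<And>K i. K \<in> T \<Longrightarrow> trow (a K) i \<in> RT k" and b: "\<And>K i. K \<in> T \<Longrightarrow> trow (b K) i \<in> Bub k K"
    and s: "\<And>K. K \<in> T \<Longrightarrow> AE x in lebesgue. x \<in> K \<longrightarrow> t x = a K x + b K x"
    and d: "\<And>K i. K \<in> T \<Longrightarrow> AE x in lebesgue. x \<in> cell K \<longrightarrow> tdiv Om t x $ i = cdiv (trow (a K) i) x"
    by (rule Yh_local[OF t]) (rule that)
  have "trow (a K) i \<in> vpolys k" if K: "K \<in> T" for K i
  proof (rule RT_divergence_free[OF a[OF K]])
    fix x
    obtain y where y: "y \<in> cell K" using cell_nonempty[OF K] unfolding ex_in_conv[symmetric] by (elim exE)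
    have "cdiv (trow (a K) i) z = 0" if "z \<in> cell K" for z
    proof (rule AE_eq_continuous[OF cell_open _ _ _ that])
      show "continuous_on (cell K) (cdiv (trow (a K) i))"
        by (rule is_poly_continuous[OF is_poly_cdiv[OF is_vpoly_RT[OF a[OF K]]]])
      have "AE x in lebesgue. x \<in> Om \<longrightarrow> tdiv Om t x = 0" using 0 by (simp only: AE_Om_iff)
      with d[OF K, of i] show "AE x in lebesgue. x \<in> cell K \<longrightarrow> cdiv (trow (a K) i) x = 0"
      proof eventually_elim
        case (elim x)
        then show ?case using cell_sub[of K] by (metis subsetD zero_index)
      qed
    qed (rule continuous_on_const)
    then show "cdiv (trow (a K) i) x = 0" by (rule polys_zero_on_open[OF cdiv_RT[OF a[OF K]] cell_open y])
  qed
  then have "restr_in K (fsum (rows_in (vpolys k)) (rows_in (Bub k K))) t" if K: "K \<in> T" for K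
    unfolding restr_in_iff[OF K] using s[OF K] b[OF K] K
    by (intro bexI[of _ "\<lambda>x. a K x + b K x"] fsum_I) (simp_all add: rows_in_def)
  moreover have "t \<in> L2 Om" using Yh_Hdiv[OF t] D.dom_D(1) by (simp add: Hdiv_dom)
  ultimately show ?thesis by (simp add: X1h_def)
qed

section \<open>The discrete saddle point structure\<close>

definition b2h :: "'n tens \<Rightarrow> 'n zel \<Rightarrow> real" where
  "b2h t v = - ip2 Om (fst v) (tdiv Om t) - ip2 Om t (snd v)"

lemma b2_form_eq: "b2_form Om y v = b2h (snd y) v"
  by (simp add: b2_form_def b2h_def ip2_def split: prod.split)

lemma b1_form_eq: "b1_form Om e t = - ip2 Om t (fst e)"
  by (simp add: b1_form_def ip2_def split: prod.split)

lemma Yh_L2: assumes "t \<in> Yh Om T k" shows "t \<in> L2 Om" "tdiv Om t \<in> L2 Om" "t \<in> D.dom"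
  using Yh_Hdiv[OF assms] D.dom_D by (auto simp: Hdiv_dom)

lemma X2h_L2: assumes "q \<in> X2h Om T k" shows "q \<in> L2 Om" "wgrad Om q \<in> L2 Om" "q \<in> G.dom"
  using X2h_H1[OF assms] G.dom_D by (auto simp: H1_dom)

lemma kernel_divergence_free:
  assumes t: "t \<in> Yh Om T k" and ker: "\<And>v. v \<in> Zh Om T k \<Longrightarrow> b2h t v = 0"
  shows "AE x in lebesgue_on Om. tdiv Om t x = 0"
proof -
  obtain v where v: "v \<in> Z1h k" "AE x in lebesgue_on Om. v x = tdiv Om t x" using tdiv_Yh_in_Z1h[OF t] by blast
  have "b2h t (v, \<lambda>x. 0) = 0" using v(1) Z2h_zero by (intro ker) (simp add: Zh_eq)
  moreover have "ip2 Om t (\<lambda>x. 0) = 0" by (simp add: ip2_def)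
  moreover have "ip2 Om v (tdiv Om t) = ip2 Om (tdiv Om t) (tdiv Om t)"
    by (rule ip2_cong_AE[OF v(2)]) (use Yh_L2[OF t] Z1h_L2[OF v(1)] in auto)
  ultimately have "ip2 Om (tdiv Om t) (tdiv Om t) = 0" by (simp add: b2h_def)
  then show ?thesis using ip2_null_iff[OF Yh_L2(2)[OF t]] by simp
qed

lemma ip2_AE_zero:
  assumes "AE x in lebesgue_on Om. f x = 0" "f \<in> L2 Om" "g \<in> L2 Om" shows "ip2 Om f g = 0"
proof -
  have "ip2 Om f g = ip2 Om (\<lambda>x. 0) g"
    by (rule ip2_cong_AE[OF assms(1)]) (use assms L2_zero in auto)
  then show ?thesis by (simp add: ip2_def)
qed

lemma ipT_zero: "q \<in> G.dom \<Longrightarrow> G.ipT q (\<lambda>x. 0) = 0"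
proof -
  assume q: "q \<in> G.dom"
  have z: "(\<lambda>x. 0) \<in> G.dom" using zero_H1 by (simp add: H1_dom)
  have "AE x in lebesgue_on Om. wgrad Om (\<lambda>x. 0) x = 0" by (rule G.T_null[OF z]) simp
  then have "ip2 Om (wgrad Om (\<lambda>x. 0)) (wgrad Om q) = 0" using G.dom_D(2)[OF z] G.dom_D(2)[OF q] by (rule ip2_AE_zero)
  then show ?thesis by (simp add: G.ipT_def ip2_commute[of Om "wgrad Om q"]) (simp add: ip2_def)
qed

text \<open>The kernel of \<open>b2h\<close> consists of divergence free stresses, on which the norm of \<open>Hdiv\<close> is
  the \<open>L2\<close> norm. Therefore \<open>\<tau> \<mapsto> (\<tau>, 0)\<close> is the embedding required by the abstract theory.\<close>

lemma saddle_axioms: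
  assumes b: "0 < beta" and isup: "inf_sup_b2 Om T k beta"
  shows "saddle (Xh Om T k) lin2 ipX (Yh Om T k) fun_lin D.ipT (Zh Om T k) lin2 ipZ
    (b1_form Om) b2h (\<lambda>t. (t, \<lambda>x. 0)) beta"
proof -
  interpret X: semi_inner "Xh Om T k" lin2 ipX by (rule semi_inner_Xh)
  interpret Y: semi_inner "Yh Om T k" fun_lin D.ipT by (rule semi_inner_Yh)
  interpret Z: semi_inner "Zh Om T k" lin2 ipZ by (rule semi_inner_Zh)
  have nY: "Y.nrm t = sqrt ((norm_L2 Om t)\<^sup>2 + (norm_L2 Om (tdiv Om t))\<^sup>2)" for t
    by (simp add: Y.nrm_def D.ipT_def norm_L2_sq)
  have nX: "X.nrm x = sqrt ((norm_L2 Om (fst x))\<^sup>2 + (norm_H1 Om (snd x))\<^sup>2)" for x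
    by (simp add: X.nrm_def prod_ip_def norm_L2_sq norm_H1_sq)
  have nZ: "Z.nrm x = sqrt ((norm_L2 Om (fst x))\<^sup>2 + (norm_L2 Om (snd x))\<^sup>2)" for x
    by (simp add: Z.nrm_def prod_ip_def norm_L2_sq)
  have b2_bound: "\<bar>b2h t v\<bar> \<le> Y.nrm t * Z.nrm v" if t: "t \<in> Yh Om T k" and v: "v \<in> Zh Om T k" for t v
  proof -
    obtain v1 v2 where [simp]: "v = (v1, v2)" and m: "v1 \<in> L2 Om" "v2 \<in> L2 Om"
      using v Z1h_L2 Z2h_L2 by (auto simp: Zh_eq)
    have "\<bar>b2h t v\<bar> \<le> norm_L2 Om t * norm_L2 Om v2 + norm_L2 Om (tdiv Om t) * norm_L2 Om v1"
      using ip2_le[OF m(1) Yh_L2(2)[OF t]] ip2_le[OF Yh_L2(1)[OF t] m(2)] by (simp add: b2h_def mult.commute)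
    also have "\<dots> \<le> Y.nrm t * sqrt ((norm_L2 Om v2)\<^sup>2 + (norm_L2 Om v1)\<^sup>2)"
      unfolding nY by (rule sqrt_cauchy_schwarz)
    finally show ?thesis unfolding nZ by (simp add: add.commute)
  qed
  show ?thesis
  proof
    show "fin_dim (Xh Om T k) lin2 ipX" by (rule fin_dim_Xh)
    show "fin_dim (Yh Om T k) fun_lin D.ipT" by (rule fin_dim_Yh)
    show "fin_dim (Zh Om T k) lin2 ipZ" by (rule fin_dim_Zh)
    show "0 < beta" by fact
  next
    fix t assume t: "t \<in> Yh Om T k"
    show "linear_on (Xh Om T k) lin2 (\<lambda>e. b1_form Om e t)"
      unfolding linear_on_def b1_form_eq
    proof (intro ballI allI)
      fix x y c assume "x \<in> Xh Om T k" "y \<in> Xh Om T k"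
      then have "fst x \<in> L2 Om" "fst y \<in> L2 Om" using X1h_L2 by (auto simp: Xh_def)
      from L2.ip_lin_right[OF this Yh_L2(1)[OF t], of c]
      show "- ip2 Om t (fst (lin2 c x y)) = - ip2 Om t (fst x) + c * - ip2 Om t (fst y)"
        by (simp add: prod_lin_def)
    qed
    show "linear_on (Zh Om T k) lin2 (b2h t)"
      unfolding linear_on_def b2h_def
    proof (intro ballI allI)
      fix x y c assume "x \<in> Zh Om T k" "y \<in> Zh Om T k"
      then have *: "fst x \<in> L2 Om" "fst y \<in> L2 Om" "snd x \<in> L2 Om" "snd y \<in> L2 Om"
        using Z1h_L2 Z2h_L2 by (auto simp: Zh_eq)
      show "- ip2 Om (fst (lin2 c x y)) (tdiv Om t) - ip2 Om t (snd (lin2 c x y)) =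
        - ip2 Om (fst x) (tdiv Om t) - ip2 Om t (snd x) + c * (- ip2 Om (fst y) (tdiv Om t) - ip2 Om t (snd y))"
        using ip2_lin_left[OF *(1,2) Yh_L2(2)[OF t], of c] L2.ip_lin_right[OF *(3,4) Yh_L2(1)[OF t], of c]
        by (simp add: prod_lin_def algebra_simps)
    qed
  next
    fix e assume e: "e \<in> Xh Om T k"
    then have eL: "fst e \<in> L2 Om" using X1h_L2 by (auto simp: Xh_def)
    show "linear_on (Yh Om T k) fun_lin (b1_form Om e)"
      unfolding linear_on_def b1_form_eq
    proof (intro ballI allI)
      fix x y c assume "x \<in> Yh Om T k" "y \<in> Yh Om T k"
      from ip2_lin_left[OF this[THEN Yh_L2(1)] eL, of c]
      show "- ip2 Om (fun_lin c x y) (fst e) = - ip2 Om x (fst e) + c * - ip2 Om y (fst e)" by simp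
    qed
    fix t assume t: "t \<in> Yh Om T k"
    have "\<bar>b1_form Om e t\<bar> \<le> norm_L2 Om t * norm_L2 Om (fst e)"
      using ip2_le[OF Yh_L2(1)[OF t] eL] by (simp add: b1_form_eq)
    also have "\<dots> \<le> Y.nrm t * X.nrm e"
      unfolding nX nY by (intro mult_mono real_sqrt_sum_squares_ge1) (simp_all add: norm_L2_def)
    finally show "\<bar>b1_form Om e t\<bar> \<le> X.nrm e * Y.nrm t" by (simp add: mult.commute)
  next
    fix v assume v: "v \<in> Zh Om T k"
    then have vL: "fst v \<in> L2 Om" "snd v \<in> L2 Om" using Z1h_L2 Z2h_L2 by (auto simp: Zh_eq)
    show "linear_on (Yh Om T k) fun_lin (\<lambda>t. b2h t v)"
      unfolding linear_on_def
    proof (intro ballI allI)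
      fix s t c assume st: "s \<in> Yh Om T k" "t \<in> Yh Om T k"
      have "ip2 Om (fst v) (tdiv Om (fun_lin c s t)) = ip2 Om (fst v) (tdiv Om s) + c * ip2 Om (fst v) (tdiv Om t)"
        using D.ipT_lin[OF Yh_L2(3)[OF st(1)] Yh_L2(3)[OF st(2)] vL(1), of c]
        by (simp add: ip2_commute[of Om "fst v"])
      then show "b2h (fun_lin c s t) v = b2h s v + c * b2h t v"
        using st[THEN Yh_L2(1)] vL by (simp add: b2h_def ip2_lin_left algebra_simps)
    qed
  next
    fix t v assume "t \<in> Yh Om T k" "v \<in> Zh Om T k"
    then show "\<bar>b2h t v\<bar> \<le> Y.nrm t * Z.nrm v" by (rule b2_bound)
  next
    fix v m assume v: "v \<in> Zh Om T k" and m: "0 \<le> m" and le: "\<And>t. t \<in> Yh Om T k \<Longrightarrow> b2h t v \<le> m * Y.nrm t"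
    let ?A = "{y \<in> Xh Om T k \<times> Yh Om T k. norm_XY Om y \<noteq> 0}"
    have "?A \<noteq> {}"
    proof -
      define c :: "(real, 'n) vec \<Rightarrow> ((real, 'n) vec, 'n) vec" where "c x = (\<chi> i. \<chi> j. 1)" for x
      have cL: "c \<in> L2 Om"
        unfolding c_def by (rule continuous_L2[OF Om_open Om_bounded]) (rule continuous_on_const)
      have "c \<in> X1h Om T k"
        unfolding X1h_def
      proof (intro CollectI conjI ballI cL)
        fix K assume K: "K \<in> T"
        have z: "(\<lambda>x. 0 :: (real, 'n) vec) \<in> Bub k K"
          using lin_closed_Bub[OF card_n T_simplex[OF K], of k] by (simp add: lin_closed_def)
        have "c \<in> fsum (rows_in (vpolys k)) (rows_in (Bub k K))"
          unfolding fsum_def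
          by (rule CollectI, rule exI[of _ c], rule exI[of _ "\<lambda>x. 0"]) (simp add: z rows_in_def vpolys_def c_def[abs_def] polys_const)
        then show "restr_in K (fsum (rows_in (vpolys k)) (rows_in (Bub k K))) c" by (rule restr_in_I) simp
      qed
      moreover have "norm_L2 Om c \<noteq> 0"
      proof
        assume "norm_L2 Om c = 0"
        then have "(\<chi> i. \<chi> j. (1::real)) = (0 :: ((real, 'n) vec, 'n) vec)"
          unfolding c_def[abs_def] by (rule constant_null)
        then show False by (simp add: vec_eq_iff)
      qed
      ultimately have mem: "((c, \<lambda>x. 0), \<lambda>x. 0) \<in> ?A"
        using X2h_zero Yh_zero by (simp add: Xh_def norm_XY_def norm_X_def add_nonneg_eq_0_iff)
      show ?thesis
      proof
        assume "?A = {}"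
        with mem show False by (simp only: empty_iff)
      qed
    qed
    moreover have "b2_form Om y v / norm_XY Om y \<le> m" if y: "y \<in> ?A" for y
    proof -
      have yY: "snd y \<in> Yh Om T k" using y by (simp add: mem_Times_iff)
      have ny: "Y.nrm (snd y) \<le> norm_XY Om y"
        unfolding nY norm_XY_def by (auto simp: norm_Y_def split: prod.split intro!: real_sqrt_le_mono)
      have "0 \<le> norm_XY Om y" by (simp add: norm_XY_def split: prod.split)
      then have p: "0 < norm_XY Om y" using y by simp
      have "b2_form Om y v \<le> m * Y.nrm (snd y)" unfolding b2_form_eq by (rule le[OF yY])
      also have "\<dots> \<le> m * norm_XY Om y" using ny m by (rule mult_left_mono)
      finally show ?thesis using p by (simp add: field_simps)
    qed
    ultimately have "(SUP y\<in>?A. b2_form Om y v / norm_XY Om y) \<le> m" by (rule cSUP_least)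
    moreover have "beta * norm_Z Om v \<le> (SUP y\<in>?A. b2_form Om y v / norm_XY Om y)"
      using isup v unfolding inf_sup_b2_def by (rule bspec)
    ultimately show "beta * Z.nrm v \<le> m" using norm_Z_nrm[OF v] by simp
  next
    fix t assume t: "t \<in> Yh Om T k" and ker: "\<And>v. v \<in> Zh Om T k \<Longrightarrow> b2h t v = 0"
    note d0 = kernel_divergence_free[OF t ker]
    show "(t, \<lambda>x. 0) \<in> Xh Om T k" using divergence_free_Yh_in_X1h[OF t d0] X2h_zero by (simp add: Xh_def)
    show "b1_form Om (t, \<lambda>x. 0) t' = - D.ipT t t'" if "t' \<in> Yh Om T k" for t'
      using ip2_AE_zero[OF d0 Yh_L2(2)[OF t] Yh_L2(2)[OF that]] ip2_commute[of Om t t']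
      by (simp add: b1_form_eq D.ipT_def)
    show "b1_form Om e t = - ipX e (t, \<lambda>x. 0)" if "e \<in> Xh Om T k" for e
    proof -
      have "snd e \<in> G.dom" using that X2h_L2(3) by (auto simp: Xh_def)
      from ipT_zero[OF this] show ?thesis by (simp add: b1_form_eq prod_ip_def ip2_commute[of Om t])
    qed
  qed
qed

end

section \<open>The bilinear form of the elasticity and flow problem\<close>

lemma L2_dominated:
  fixes f :: "real ^ 'n \<Rightarrow> 'b::euclidean_space" and h :: "real ^ 'n \<Rightarrow> 'c::euclidean_space"
  assumes f: "f \<in> L2 Om" and h: "h \<in> borel_measurable (lebesgue_on Om)"
    and K: "0 \<le> K" "AE x in lebesgue_on Om. norm (h x) \<le> K * norm (f x)"
  shows "h \<in> L2 Om" "norm_L2 Om h \<le> K * norm_L2 Om f"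
proof -
  have fi: "integrable (lebesgue_on Om) (\<lambda>x. K\<^sup>2 * (norm (f x))\<^sup>2)" using f by (simp add: L2_def)
  have le: "AE x in lebesgue_on Om. (norm (h x))\<^sup>2 \<le> K\<^sup>2 * (norm (f x))\<^sup>2"
    using K(2)
  proof eventually_elim
    case (elim x)
    then have "(norm (h x))\<^sup>2 \<le> (K * norm (f x))\<^sup>2" by (intro power_mono) auto
    then show ?case by (simp add: power_mult_distrib)
  qed
  have hi: "integrable (lebesgue_on Om) (\<lambda>x. (norm (h x))\<^sup>2)"
    by (rule Bochner_Integration.integrable_bound[OF fi]) (use h le in auto)
  then show "h \<in> L2 Om" using h by (simp add: L2_def)
  have "(LINT x|lebesgue_on Om. (norm (h x))\<^sup>2) \<le> (LINT x|lebesgue_on Om. K\<^sup>2 * (norm (f x))\<^sup>2)"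
    by (rule integral_mono_AE[OF hi fi le])
  then have "(norm_L2 Om h)\<^sup>2 \<le> (K * norm_L2 Om f)\<^sup>2"
    by (simp add: norm_L2_def power_mult_distrib)
  then show "norm_L2 Om h \<le> K * norm_L2 Om f"
    by (rule power2_le_imp_le) (simp add: K(1) norm_L2_def)
qed

lemma norm_matrix_vector_le: "norm (A *v x) \<le> norm A * norm x" for A :: "real ^ 'n ^ 'm"
proof -
  have c: "\<bar>A $ i \<bullet> x\<bar> \<le> norm x * norm (A $ i)" for i
    using Cauchy_Schwarz_ineq2[of "A $ i" x] by (simp only: mult.commute)
  have "norm (A *v x) = L2_set (\<lambda>i. norm ((A *v x) $ i)) UNIV" by (rule norm_vec_def)
  also have "\<dots> \<le> L2_set (\<lambda>i. norm x * norm (A $ i)) UNIV"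
    by (rule L2_set_mono) (simp_all add: matrix_vector_mul_component c)
  also have "\<dots> = norm x * norm A" by (simp add: norm_vec_def[of A] L2_set_right_distrib)
  finally show ?thesis by (simp add: mult.commute)
qed

lemma matrix_vector_L2:
  fixes A :: "real ^ 'n \<Rightarrow> real ^ 'm ^ 'l"
  assumes A: "A \<in> borel_measurable (lebesgue_on Om)" and f: "f \<in> L2 Om"
    and K: "0 \<le> K" "AE x in lebesgue_on Om. norm (A x) \<le> K"
  shows "(\<lambda>x. A x *v f x) \<in> L2 Om" "norm_L2 Om (\<lambda>x. A x *v f x) \<le> K * norm_L2 Om f"
proof -
  have K': "AE x in lebesgue_on Om. norm (A x *v f x) \<le> K * norm (f x)"
    using K(2)
  proof eventually_elim
    case (elim x)
    have "norm (A x *v f x) \<le> norm (A x) * norm (f x)" by (rule norm_matrix_vector_le)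
    also have "\<dots> \<le> K * norm (f x)" using elim by (rule mult_right_mono) simp
    finally show ?case .
  qed
  show L: "(\<lambda>x. A x *v f x) \<in> L2 Om"
  proof (rule L2_vec, rule L2_dominated(1)[OF f _ K(1)])
    fix i
    have "(\<lambda>x. A x $ i) \<in> borel_measurable (lebesgue_on Om)"
      by (rule measurable_compose[OF A borel_measurable_continuous_onI[OF linear_continuous_on[OF bounded_linear_vec_nth]]])
    then show "(\<lambda>x. (A x *v f x) $ i) \<in> borel_measurable (lebesgue_on Om)"
      unfolding matrix_vector_mul_component using L2_measurable[OF f] by (rule borel_measurable_inner)
    show "AE x in lebesgue_on Om. norm ((A x *v f x) $ i) \<le> K * norm (f x)"
      using K'
    proof eventually_elim
      case (elim x)
      show ?case using Finite_Cartesian_Product.norm_nth_le[of "A x *v f x" i] elim by (rule order_trans)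
    qed
  qed
  show "norm_L2 Om (\<lambda>x. A x *v f x) \<le> K * norm_L2 Om f"
    by (rule L2_dominated(2)[OF f L2_measurable[OF L] K(1) K'])
qed

lemma inner_mat_one: "mat 1 \<bullet> (A :: real ^ 'n ^ 'n) = trace A"
proof -
  have "mat 1 \<bullet> A = (\<Sum>i\<in>UNIV. \<Sum>j\<in>UNIV. if i = j then A $ i $ j else 0)"
    unfolding inner_vec_def mat_def by (intro sum.cong refl) simp
  then show ?thesis by (simp add: trace_def)
qed

lemma bounded_linear_trace: "bounded_linear (trace :: real ^ 'n ^ 'n \<Rightarrow> real)"
  unfolding inner_mat_one[symmetric, abs_def] by (rule bounded_linear_inner_right)

lemma abs_trace_le: "\<bar>trace (A :: real ^ 'n ^ 'n)\<bar> \<le> sqrt (real CARD('n)) * norm A"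
proof -
  have "norm (mat 1 :: real ^ 'n ^ 'n) = sqrt (real CARD('n))"
    unfolding norm_eq_sqrt_inner inner_mat_one by (simp add: trace_def mat_def)
  then show ?thesis unfolding inner_mat_one[symmetric] by (metis Cauchy_Schwarz_ineq2)
qed

lemma trace_L2:
  fixes d :: "real ^ 'n \<Rightarrow> real ^ 'n ^ 'n"
  assumes d: "d \<in> L2 Om"
  shows "(\<lambda>x. trace (d x)) \<in> L2 Om" "norm_L2 Om (\<lambda>x. trace (d x)) \<le> sqrt (real CARD('n)) * norm_L2 Om d"
proof -
  show *: "(\<lambda>x. trace (d x)) \<in> L2 Om" by (rule L2_bounded_linear[OF d bounded_linear_trace])
  show "norm_L2 Om (\<lambda>x. trace (d x)) \<le> sqrt (real CARD('n)) * norm_L2 Om d"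
    by (rule L2_dominated(2)[OF d L2_measurable[OF *]]) (simp_all add: abs_trace_le)
qed

text \<open>As \<open>gam1\<close> is at least \<open>gam2 / b\<^sup>2\<close> and \<open>gam2\<close> at least \<open>2 + 2 / ca + 2 Ca / ca\<close>, the
  constant \<open>gam1\<close> dominates the three coefficients of the a priori bound for \<open>M = 2 Ca\<close>,
  provided that \<open>b \<le> 1\<close>.\<close>

lemma gam1_bounds:
  assumes ca: "0 < ca" and Ca: "0 \<le> Ca" and b: "0 < b" "b \<le> 1"
  shows "1 / ca \<le> gam1 Ca ca b" "1 / (b * ca) \<le> gam1 Ca ca b" "2 * Ca / ca + 1 \<le> gam1 Ca ca b"
proof -
  let ?g = "gam2 Ca ca"
  have "2 * (ca + 1 + Ca) / ca \<le> ?g"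
    unfolding gam2_def using ca Ca by (intro divide_right_mono mult_right_mono) auto
  then have g: "2 + 2 * (1 / ca) + 2 * Ca / ca \<le> ?g" using ca by (simp add: field_simps)
  have p: "0 \<le> 1 / ca" "0 \<le> 2 * Ca / ca" using ca Ca by auto
  have "0 < G \<and> a \<le> G \<and> c + 1 \<le> G" if "2 + 2 * a + c \<le> G" "0 \<le> a" "0 \<le> c" for a c G :: real
    using that by linarith
  from this[OF g p] have g0: "0 < ?g" "1 / ca \<le> ?g" "2 * Ca / ca + 1 \<le> ?g" by blast+
  have "?g\<^sup>2 \<le> (Ca + 1 + b + ?g)\<^sup>2" using g0 Ca b by (intro power_mono) auto
  then have "?g\<^sup>2 / (b\<^sup>2 * ?g) \<le> gam1 Ca ca b"
    unfolding gam1_def using g0 by (intro divide_right_mono) auto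
  then have *: "?g / b\<^sup>2 \<le> gam1 Ca ca b" using g0 by (simp add: power2_eq_square field_simps)
  have "b\<^sup>2 \<le> b" using b by (simp add: power2_eq_square mult_left_le)
  then have "?g / b \<le> ?g / b\<^sup>2" using g0 b by (intro divide_left_mono) auto
  with * have 1: "?g / b \<le> gam1 Ca ca b" by simp
  have 2: "?g \<le> ?g / b" using g0 b by (simp add: field_simps mult_left_le)
  have "(1 / ca) / b \<le> ?g / b" using g0(2) b by (intro divide_right_mono) auto
  then show "1 / (b * ca) \<le> gam1 Ca ca b" using 1 by (simp add: mult.commute)
  show "1 / ca \<le> gam1 Ca ca b" "2 * Ca / ca + 1 \<le> gam1 Ca ca b" using 1 2 g0 by simp_all
qed

text \<open>Solutions may be changed by null vectors; this passes from a fixed point of the solution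
  operator up to null sets to a solution of the nonlinear problem.\<close>

lemma (in saddle) sol_replace:
  assumes a: "form a ca M" and s: "sol a G H F d s u" and d': "d' \<in> X" "X.dst d d' = 0"
  shows "sol a G H F d' s u"
proof -
  have d: "d \<in> X" using s by (simp add: sol_def)
  obtain B where B: "\<And>d e. d \<in> X \<Longrightarrow> e \<in> X \<Longrightarrow> \<bar>a d e\<bar> \<le> B * X.nrm d * X.nrm e"
    using a unfolding form_def by metis
  have "a d e = a d' e" if "e \<in> X" for e
    by (rule X.linear_on_dst_null[where f = "\<lambda>x. a x e", OF _ _ d d'])
      (use a B[OF _ that] that in \<open>force simp: form_def\<close>)+
  moreover have "b1 d t = b1 d' t" if "t \<in> Y" for t
    by (rule X.linear_on_dst_null[where f = "\<lambda>x. b1 x t", OF b1_left[OF that] _ d d'])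
      (use b1_bound[OF _ that] in force)
  ultimately show ?thesis using s d' by (simp add: sol_def)
qed

locale biot_mesh = mesh Om T
  for Om :: "((real, 'n::{finite,linorder}) vec) set" and T :: "((real, 'n) vec) set set" +
  fixes kap :: "'n xel \<Rightarrow> 'n tens" and lam mu alpha c0 k1 k2 beta :: real and k :: nat
  assumes lam: "0 < lam" and mu: "0 < mu" and alpha: "0 \<le> alpha" and c0: "0 < c0" and k1: "0 < k1" and k2: "0 < k2"
    and perm: "permeability Om kap k1 k2" and beta: "0 < beta" and isup: "inf_sup_b2 Om T k beta"
begin

sublocale S: saddle "Xh Om T k" "prod_lin fun_lin fun_lin" "prod_ip (ip2 Om) G.ipT" "Yh Om T k" fun_lin D.ipT
    "Zh Om T k" "prod_lin fun_lin fun_lin" "prod_ip (ip2 Om) (ip2 Om)" "b1_form Om" b2h "\<lambda>t. (t, \<lambda>x. 0)" beta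
  by (rule saddle_axioms[OF beta isup])

text \<open>The form \<open>b2h\<close> is bounded by one, so that its inf-sup constant cannot exceed one on a space
  with an element of positive norm, such as a constant field.\<close>

lemma beta_le_1: "beta \<le> 1"
proof -
  define c :: "(real, 'n) vec" where "c = (\<chi> i. 1)"
  have cL: "(\<lambda>x. c) \<in> L2 Om" by (rule continuous_L2[OF Om_open Om_bounded]) (rule continuous_on_const)
  have "(\<lambda>x :: (real, 'n) vec. c) \<in> vpolys k" by (simp add: vpolys_def c_def polys_const)
  then have "restr_in K (vpolys k) (\<lambda>x. c)" for K by (rule restr_in_I) simp
  then have v: "(\<lambda>x. c, \<lambda>x. 0) \<in> Zh Om T k" (is "?v \<in> _") using cL Z2h_zero by (simp add: Zh_eq Z1h_def)
  have "norm_Z Om ?v \<noteq> 0"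
  proof
    assume "norm_Z Om ?v = 0"
    then have "norm_L2 Om (\<lambda>x. c) = 0" by (simp add: norm_Z_def sum_power2_eq_zero_iff)
    then have "c = 0" by (rule constant_null)
    then show False by (simp add: c_def vec_eq_iff)
  qed
  then have p: "0 < S.Z.nrm ?v" using norm_Z_nrm[OF v] S.Z.nrm_nonneg[OF v] by simp
  have "beta * S.Z.nrm ?v \<le> S.Z.nrm ?v"
    using S.inf_sup[OF v S.Z.nrm_nonneg[OF v]] S.b2_bound[OF _ v] by (force simp: mult.commute)
  then show ?thesis using p by simp
qed

lemma X_parts:
  assumes "x \<in> Xh Om T k"
  shows "norm_L2 Om (fst x) \<le> S.X.nrm x" "norm_H1 Om (snd x) \<le> S.X.nrm x"
    "norm_L2 Om (snd x) \<le> S.X.nrm x" "norm_L2 Om (wgrad Om (snd x)) \<le> S.X.nrm x"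
proof -
  have n: "S.X.nrm x = sqrt ((norm_L2 Om (fst x))\<^sup>2 + (norm_H1 Om (snd x))\<^sup>2)"
    unfolding norm_X_nrm[OF assms] by (simp add: norm_X_def split: prod.split)
  show "norm_L2 Om (fst x) \<le> S.X.nrm x" and H: "norm_H1 Om (snd x) \<le> S.X.nrm x"
    unfolding n by simp_all
  have "norm_L2 Om (snd x) \<le> norm_H1 Om (snd x)" "norm_L2 Om (wgrad Om (snd x)) \<le> norm_H1 Om (snd x)"
    unfolding norm_H1_def by simp_all
  then show "norm_L2 Om (snd x) \<le> S.X.nrm x" "norm_L2 Om (wgrad Om (snd x)) \<le> S.X.nrm x" using H by auto
qed

lemma Xh_L2:
  assumes "x \<in> Xh Om T k"
  shows "fst x \<in> L2 Om" "snd x \<in> L2 Om" "wgrad Om (snd x) \<in> L2 Om" "snd x \<in> G.dom" "snd x \<in> H1 Om"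
    "x \<in> Xsp Om" "(\<lambda>y. trace (fst x y)) \<in> L2 Om"
  using assms X1h_L2 X2h_L2 X2h_H1 trace_L2(1)[of "fst x" Om] by (auto simp: Xh_def Xsp_def)

lemma Y_parts: "norm_L2 Om t \<le> S.Y.nrm t"
  unfolding S.Y.nrm_def D.ipT_def norm_L2_sq[symmetric] by simp

definition flux :: "'n xel \<Rightarrow> 'n scal \<Rightarrow> 'n vect" where
  "flux w p = (\<lambda>x. kap w x *v wgrad Om p x)"

lemma permeability_bound:
  assumes "w \<in> Xsp Om" obtains K where "0 \<le> K" "AE x in lebesgue_on Om. norm (kap w x) \<le> K"
    "kap w \<in> borel_measurable (lebesgue_on Om)"
proof -
  have L: "kap w \<in> borel_measurable (lebesgue_on Om)" "norm_Linf Om (kap w) < \<infinity>"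
    using perm assms by (auto simp: permeability_def Linf_def)
  obtain m where m: "norm_Linf Om (kap w) < ereal (real m)" using L(2) less_PInf_Ex_of_nat by auto
  have "AE x in lebesgue_on Om. ereal (norm (kap w x)) \<le> norm_Linf Om (kap w)"
    unfolding norm_Linf_def by (rule esssup_AE)
  then have "AE x in lebesgue_on Om. norm (kap w x) \<le> real m"
  proof eventually_elim
    case (elim x)
    then have "ereal (norm (kap w x)) \<le> ereal (real m)" using m by (meson less_imp_le order_trans)
    then show ?case by simp
  qed
  then show ?thesis using L(1) by (intro that[of "real m"]) auto
qed

lemma flux_bound:
  assumes "w \<in> Xsp Om"
  obtains K where "0 \<le> K" "\<And>p. p \<in> G.dom \<Longrightarrow> flux w p \<in> L2 Om"
    "\<And>p. p \<in> G.dom \<Longrightarrow> norm_L2 Om (flux w p) \<le> K * norm_L2 Om (wgrad Om p)"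
proof -
  obtain K where K: "0 \<le> K" "AE x in lebesgue_on Om. norm (kap w x) \<le> K" "kap w \<in> borel_measurable (lebesgue_on Om)"
    by (rule permeability_bound[OF assms])
  show ?thesis
    using matrix_vector_L2[OF K(3) G.dom_D(2) K(1,2)] K(1) by (intro that[of K]) (auto simp: flux_def)
qed

lemma flux_L2: "w \<in> Xsp Om \<Longrightarrow> p \<in> G.dom \<Longrightarrow> flux w p \<in> L2 Om"
  by (rule flux_bound) auto

lemma flux_lin:
  assumes w: "w \<in> Xsp Om" and p: "p \<in> G.dom" "p' \<in> G.dom" and h: "h \<in> L2 Om"
  shows "ip2 Om (flux w (fun_lin c p p')) h = ip2 Om (flux w p) h + c * ip2 Om (flux w p') h"
proof -
  have "ip2 Om (flux w (fun_lin c p p')) h = ip2 Om (fun_lin c (flux w p) (flux w p')) h"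
  proof (rule ip2_cong_AE)
    show "AE x in lebesgue_on Om. flux w (fun_lin c p p') x = fun_lin c (flux w p) (flux w p') x"
      using G.T_lin[OF p, of c]
      by eventually_elim (simp add: flux_def fun_lin_def matrix_vector_right_distrib matrix_vector_mult_scaleR)
  qed (use flux_L2[OF w] G.dom_lin[OF p, of c] p h in \<open>auto intro!: L2_lin\<close>)
  then show ?thesis using flux_L2[OF w] p h by (simp add: ip2_lin_left)
qed

lemma flux_coercive:
  assumes w: "w \<in> Xsp Om" and p: "p \<in> G.dom"
  shows "k1 * (norm_L2 Om (wgrad Om p))\<^sup>2 \<le> ip2 Om (flux w p) (wgrad Om p)"
proof -
  have "(LINT x|lebesgue_on Om. k1 * (wgrad Om p x \<bullet> wgrad Om p x)) \<le> (LINT x|lebesgue_on Om. flux w p x \<bullet> wgrad Om p x)"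
  proof (rule integral_mono_AE)
    have "AE x in lebesgue_on Om. \<forall>v. v \<noteq> 0 \<longrightarrow> k1 * (norm v)\<^sup>2 \<le> v \<bullet> (kap w x *v v)"
      using perm w by (simp add: permeability_def)
    then show "AE x in lebesgue_on Om. k1 * (wgrad Om p x \<bullet> wgrad Om p x) \<le> flux w p x \<bullet> wgrad Om p x"
    proof eventually_elim
      case (elim x)
      then show ?case
        by (cases "wgrad Om p x = 0") (auto simp: flux_def power2_norm_eq_inner inner_commute)
    qed
  qed (use L2_integrable_inner[OF G.dom_D(2)[OF p] G.dom_D(2)[OF p]] L2_integrable_inner[OF flux_L2[OF w p] G.dom_D(2)[OF p]] in auto)
  then show ?thesis by (simp add: norm_L2_sq ip2_def)
qed

lemma flux_lipschitz:
  assumes w: "w \<in> Xsp Om" "w' \<in> Xsp Om" and p: "p \<in> G.dom" and h: "h \<in> L2 Om"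
  shows "\<bar>ip2 Om (flux w p) h - ip2 Om (flux w' p) h\<bar>
    \<le> k2 * norm_H1 Om (\<lambda>x. snd w x - snd w' x) * norm_L2 Om (wgrad Om p) * norm_L2 Om h"
proof -
  let ?K = "k2 * norm_H1 Om (\<lambda>x. snd w x - snd w' x)"
  let ?A = "\<lambda>x. kap w x - kap w' x"
  have K0: "0 \<le> ?K" using k2 by simp
  have "kap w \<in> borel_measurable (lebesgue_on Om)" "kap w' \<in> borel_measurable (lebesgue_on Om)"
    using perm w by (auto simp: permeability_def Linf_def)
  then have A: "?A \<in> borel_measurable (lebesgue_on Om)" by (rule borel_measurable_diff)
  have le: "norm_Linf Om ?A \<le> ereal ?K"
  proof -
    have "norm_Linf Om (\<lambda>x. kap (fst w, snd w) x - kap (fst w', snd w') x) \<le> ereal ?K"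
      using perm w unfolding permeability_def Xsp_def mem_Times_iff by blast
    then show ?thesis by simp
  qed
  have "AE x in lebesgue_on Om. ereal (norm (?A x)) \<le> norm_Linf Om ?A"
    unfolding norm_Linf_def by (rule esssup_AE)
  then have AK: "AE x in lebesgue_on Om. norm (?A x) \<le> ?K"
  proof eventually_elim
    case (elim x)
    then have "ereal (norm (?A x)) \<le> ereal ?K" using le by (rule order_trans)
    then show ?case by simp
  qed
  note m = matrix_vector_L2[OF A G.dom_D(2)[OF p] K0 AK]
  have "(\<lambda>x. ?A x *v wgrad Om p x) = fun_lin (-1) (flux w p) (flux w' p)"
    by (simp add: flux_def fun_lin_def matrix_vector_mult_diff_rdistrib)
  then have "ip2 Om (flux w p) h - ip2 Om (flux w' p) h = ip2 Om (\<lambda>x. ?A x *v wgrad Om p x) h"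
    using ip2_lin_left[OF flux_L2[OF w(1) p] flux_L2[OF w(2) p] h, of "-1"] by simp
  also have "\<bar>\<dots>\<bar> \<le> norm_L2 Om (\<lambda>x. ?A x *v wgrad Om p x) * norm_L2 Om h" by (rule ip2_le[OF m(1) h])
  also have "\<dots> \<le> (?K * norm_L2 Om (wgrad Om p)) * norm_L2 Om h"
    using m(2) by (rule mult_right_mono) (simp add: norm_L2_def)
  finally show ?thesis by simp
qed

abbreviation "a_w \<equiv> a_form Om lam mu alpha c0 kap"

lemma a_form_eq:
  assumes d: "d \<in> Xh Om T k" and e: "e \<in> Xh Om T k"
  shows "a_w w d e = lam * ip2 Om (\<lambda>x. trace (fst d x)) (\<lambda>x. trace (fst e x)) + 2 * mu * ip2 Om (fst d) (fst e)
    + ip2 Om (flux w (snd d)) (wgrad Om (snd e)) + c0 * ip2 Om (snd d) (snd e)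
    + alpha * ip2 Om (snd e) (\<lambda>x. trace (fst d x)) - alpha * ip2 Om (snd d) (\<lambda>x. trace (fst e x))"
proof -
  have "(LINT x|lebesgue_on Om. hooke lam mu (fst d x) \<bullet> fst e x) =
      (LINT x|lebesgue_on Om. lam * (trace (fst d x) \<bullet> trace (fst e x)) + 2 * mu * (fst d x \<bullet> fst e x))"
    by (intro Bochner_Integration.integral_cong refl)
      (simp add: hooke_def inner_add_left inner_mat_one)
  also have "\<dots> = lam * ip2 Om (\<lambda>x. trace (fst d x)) (\<lambda>x. trace (fst e x)) + 2 * mu * ip2 Om (fst d) (fst e)"
    unfolding ip2_def
    using L2_integrable_inner[OF Xh_L2(7)[OF d] Xh_L2(7)[OF e]] L2_integrable_inner[OF Xh_L2(1)[OF d] Xh_L2(1)[OF e]]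
    by (subst Bochner_Integration.integral_add) auto
  finally show ?thesis
    by (simp add: a_form_def split_beta ip2_def flux_def)
qed

lemma norm_L2_nonneg [simp]: "0 \<le> norm_L2 S f" for f :: "real ^ 'm \<Rightarrow> 'b::euclidean_space"
  by (simp add: norm_L2_def)

lemma elastic_bound:
  fixes d e :: "(real, 'n) vec \<Rightarrow> ((real, 'n) vec, 'n) vec"
  assumes d: "d \<in> L2 Om" and e: "e \<in> L2 Om"
  shows "\<bar>lam * ip2 Om (\<lambda>x. trace (d x)) (\<lambda>x. trace (e x)) + 2 * mu * ip2 Om d e\<bar>
    \<le> (2 * mu + real CARD('n) * lam) * (norm_L2 Om d * norm_L2 Om e)"
proof -
  let ?n = "real CARD('n)"
  have "\<bar>ip2 Om (\<lambda>x. trace (d x)) (\<lambda>x. trace (e x))\<bar> \<le> norm_L2 Om (\<lambda>x. trace (d x)) * norm_L2 Om (\<lambda>x. trace (e x))"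
    by (rule ip2_le[OF trace_L2(1)[OF d] trace_L2(1)[OF e]])
  also have "\<dots> \<le> (sqrt ?n * norm_L2 Om d) * (sqrt ?n * norm_L2 Om e)"
    by (intro mult_mono trace_L2(2) d e) simp_all
  also have "\<dots> = (sqrt ?n * sqrt ?n) * (norm_L2 Om d * norm_L2 Om e)" by (simp only: mult_ac)
  also have "\<dots> = ?n * (norm_L2 Om d * norm_L2 Om e)" by simp
  finally have "lam * \<bar>ip2 Om (\<lambda>x. trace (d x)) (\<lambda>x. trace (e x))\<bar> \<le> lam * (?n * (norm_L2 Om d * norm_L2 Om e))"
    using lam by (intro mult_left_mono) auto
  moreover have "2 * mu * \<bar>ip2 Om d e\<bar> \<le> 2 * mu * (norm_L2 Om d * norm_L2 Om e)"
    using ip2_le[OF d e] mu by (intro mult_left_mono) auto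
  moreover have "\<bar>lam * ip2 Om (\<lambda>x. trace (d x)) (\<lambda>x. trace (e x)) + 2 * mu * ip2 Om d e\<bar>
      \<le> lam * \<bar>ip2 Om (\<lambda>x. trace (d x)) (\<lambda>x. trace (e x))\<bar> + 2 * mu * \<bar>ip2 Om d e\<bar>"
    using lam mu by (intro order_trans[OF abs_triangle_ineq]) (simp add: abs_mult)
  ultimately show ?thesis by (simp add: algebra_simps)
qed

lemma coupling_bound:
  fixes d :: "(real, 'n) vec \<Rightarrow> ((real, 'n) vec, 'n) vec"
  assumes q: "q \<in> L2 Om" and d: "d \<in> L2 Om"
  shows "\<bar>alpha * ip2 Om q (\<lambda>x. trace (d x))\<bar> \<le> real CARD('n) * alpha * (norm_L2 Om q * norm_L2 Om d)"
proof -
  let ?n = "real CARD('n)"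
  have n: "sqrt ?n \<le> ?n"
    by (rule real_le_lsqrt) (use card_n in \<open>auto simp: power2_eq_square\<close>)
  have "\<bar>ip2 Om q (\<lambda>x. trace (d x))\<bar> \<le> norm_L2 Om q * norm_L2 Om (\<lambda>x. trace (d x))"
    by (rule ip2_le[OF q trace_L2(1)[OF d]])
  also have "\<dots> \<le> norm_L2 Om q * (?n * norm_L2 Om d)"
    by (rule mult_left_mono[OF order_trans[OF trace_L2(2)[OF d] mult_right_mono[OF n]]]) simp_all
  finally show ?thesis using mult_left_mono[OF _ alpha] by (fastforce simp: abs_mult alpha mult_ac)
qed

lemma norm_wgrad_zero: "norm_L2 Om (wgrad Om (\<lambda>x. 0)) = 0"
  using norm_H1_zero by (simp add: norm_H1_def sum_power2_eq_zero_iff)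

lemma lin2_parts:
  "fst (lin2 c x y) = fun_lin c (fst x) (fst y)" "snd (lin2 c x y) = fun_lin c (snd x) (snd y)"
  by (simp_all add: prod_lin_def)

lemma trace_lin2:
  fixes d e :: "'z \<Rightarrow> ((real, 'n) vec, 'n) vec"
  shows
  "(\<lambda>z. trace (fun_lin c d e z)) = fun_lin c (\<lambda>z. trace (d z)) (\<lambda>z. trace (e z))"
  by (simp add: fun_lin_def inner_mat_one[symmetric] inner_add_right)

lemma a_linear_left:
  assumes w: "w \<in> Xsp Om" and e: "e \<in> Xh Om T k"
  shows "linear_on (Xh Om T k) lin2 (\<lambda>d. a_w w d e)"
  unfolding linear_on_def
proof (intro ballI allI)
  fix x y c assume x: "x \<in> Xh Om T k" and y: "y \<in> Xh Om T k"
  note X = Xh_L2[OF x] and Y = Xh_L2[OF y] and E = Xh_L2[OF e]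
  note eqs = ip2_lin_left[OF X(7) Y(7) E(7), of c] ip2_lin_left[OF X(1) Y(1) E(1), of c]
    flux_lin[OF w X(4) Y(4) E(3), of c] ip2_lin_left[OF X(2) Y(2) E(2), of c]
    L2.ip_lin_right[OF X(7) Y(7) E(2), of c] ip2_lin_left[OF X(2) Y(2) E(7), of c]
  show "a_w w (lin2 c x y) e = a_w w x e + c * a_w w y e"
    unfolding a_form_eq[OF S.X.closed[OF x y] e] a_form_eq[OF x e] a_form_eq[OF y e] lin2_parts trace_lin2 eqs
    by (simp add: algebra_simps)
qed

lemma a_linear_right:
  assumes w: "w \<in> Xsp Om" and d: "d \<in> Xh Om T k"
  shows "linear_on (Xh Om T k) lin2 (a_w w d)"
  unfolding linear_on_def
proof (intro ballI allI)
  fix x y c assume x: "x \<in> Xh Om T k" and y: "y \<in> Xh Om T k"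
  note X = Xh_L2[OF x] and Y = Xh_L2[OF y] and E = Xh_L2[OF d]
  have fl: "ip2 Om (flux w (snd d)) (wgrad Om (fun_lin c (snd x) (snd y))) =
      ip2 Om (flux w (snd d)) (wgrad Om (snd x)) + c * ip2 Om (flux w (snd d)) (wgrad Om (snd y))"
    using G.ipT_lin[OF X(4) Y(4) flux_L2[OF w E(4)], of c] by (simp only: ip2_commute[of Om "flux w (snd d)"])
  note eqs = L2.ip_lin_right[OF X(7) Y(7) E(7), of c] L2.ip_lin_right[OF X(1) Y(1) E(1), of c]
    fl L2.ip_lin_right[OF X(2) Y(2) E(2), of c]
    ip2_lin_left[OF X(2) Y(2) E(7), of c] L2.ip_lin_right[OF X(7) Y(7) E(2), of c]
  show "a_w w d (lin2 c x y) = a_w w d x + c * a_w w d y"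
    unfolding a_form_eq[OF d S.X.closed[OF x y]] a_form_eq[OF d x] a_form_eq[OF d y] lin2_parts trace_lin2 eqs
    by (simp add: algebra_simps)
qed

lemma a_coercive:
  assumes w: "w \<in> Xsp Om" and e: "e \<in> Xh Om T k" and ca: "0 < ca" "ca \<le> k1" "ca \<le> 2 * mu" "ca \<le> c0"
  shows "ca * ipX e e \<le> a_w w e e"
proof -
  note E = Xh_L2[OF e]
  have "a_w w e e = lam * (norm_L2 Om (\<lambda>x. trace (fst e x)))\<^sup>2 + 2 * mu * (norm_L2 Om (fst e))\<^sup>2
      + ip2 Om (flux w (snd e)) (wgrad Om (snd e)) + c0 * (norm_L2 Om (snd e))\<^sup>2"
    unfolding a_form_eq[OF e e] norm_L2_sq by simp
  moreover have "ca * (norm_L2 Om (fst e))\<^sup>2 \<le> 2 * mu * (norm_L2 Om (fst e))\<^sup>2"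
      "ca * (norm_L2 Om (snd e))\<^sup>2 \<le> c0 * (norm_L2 Om (snd e))\<^sup>2"
      "ca * (norm_L2 Om (wgrad Om (snd e)))\<^sup>2 \<le> k1 * (norm_L2 Om (wgrad Om (snd e)))\<^sup>2"
    using ca by (intro mult_right_mono; simp)+
  moreover have "0 \<le> lam * (norm_L2 Om (\<lambda>x. trace (fst e x)))\<^sup>2" using lam by simp
  moreover note flux_coercive[OF w E(4)]
  ultimately have "ca * (norm_L2 Om (fst e))\<^sup>2 + ca * (norm_L2 Om (snd e))\<^sup>2 + ca * (norm_L2 Om (wgrad Om (snd e)))\<^sup>2
      \<le> a_w w e e" by linarith
  then show ?thesis by (simp add: prod_ip_def G.ipT_def norm_L2_sq algebra_simps)
qed

lemma a_bounded:
  assumes w: "w \<in> Xsp Om"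
  shows "\<exists>B. \<forall>d\<in>Xh Om T k. \<forall>e\<in>Xh Om T k. \<bar>a_w w d e\<bar> \<le> B * S.X.nrm d * S.X.nrm e"
proof -
  obtain K where K: "0 \<le> K" "\<And>p. p \<in> G.dom \<Longrightarrow> flux w p \<in> L2 Om"
    "\<And>p. p \<in> G.dom \<Longrightarrow> norm_L2 Om (flux w p) \<le> K * norm_L2 Om (wgrad Om p)"
    by (rule flux_bound[OF w]) (rule that)
  let ?c = "2 * mu + real CARD('n) * lam" and ?m = "real CARD('n) * alpha"
  have "\<bar>a_w w d e\<bar> \<le> (?c + K + c0 + 2 * ?m) * S.X.nrm d * S.X.nrm e"
    if d: "d \<in> Xh Om T k" and e: "e \<in> Xh Om T k" for d e
  proof -
    note D = Xh_L2[OF d] and E = Xh_L2[OF e] and dn = X_parts[OF d] and en = X_parts[OF e]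
    let ?P = "S.X.nrm d * S.X.nrm e"
    have P: "x * y \<le> ?P" if "x \<le> S.X.nrm d" "y \<le> S.X.nrm e" "0 \<le> x" "0 \<le> y" for x y
      using that by (intro mult_mono) auto
    have 1: "\<bar>lam * ip2 Om (\<lambda>x. trace (fst d x)) (\<lambda>x. trace (fst e x)) + 2 * mu * ip2 Om (fst d) (fst e)\<bar> \<le> ?c * ?P"
      by (rule order_trans[OF elastic_bound[OF D(1) E(1)] mult_left_mono[OF P]]) (use dn en lam mu in auto)
    have "\<bar>ip2 Om (flux w (snd d)) (wgrad Om (snd e))\<bar> \<le> norm_L2 Om (flux w (snd d)) * norm_L2 Om (wgrad Om (snd e))"
      by (rule ip2_le[OF flux_L2[OF w D(4)] E(3)])
    also have "\<dots> \<le> (K * norm_L2 Om (wgrad Om (snd d))) * norm_L2 Om (wgrad Om (snd e))"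
      using K(3)[OF D(4)] by (rule mult_right_mono) simp
    also have "\<dots> = K * (norm_L2 Om (wgrad Om (snd d)) * norm_L2 Om (wgrad Om (snd e)))" by (simp only: mult_ac)
    also have "\<dots> \<le> K * ?P" by (rule mult_left_mono[OF P]) (use dn en K in auto)
    finally have 2: "\<bar>ip2 Om (flux w (snd d)) (wgrad Om (snd e))\<bar> \<le> K * ?P" .
    have "\<bar>ip2 Om (snd d) (snd e)\<bar> \<le> ?P"
      by (rule order_trans[OF ip2_le[OF D(2) E(2)] P]) (use dn en in auto)
    then have 3: "\<bar>c0 * ip2 Om (snd d) (snd e)\<bar> \<le> c0 * ?P" using c0 by (simp add: abs_mult mult_left_mono)
    have "norm_L2 Om (snd e) * norm_L2 Om (fst d) \<le> ?P"
      using P[of "norm_L2 Om (fst d)" "norm_L2 Om (snd e)"] dn en by (simp add: mult.commute)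
    then have 4: "\<bar>alpha * ip2 Om (snd e) (\<lambda>x. trace (fst d x))\<bar> \<le> ?m * ?P"
      by (intro order_trans[OF coupling_bound[OF E(2) D(1)] mult_left_mono]) (use alpha in auto)
    have 5: "\<bar>alpha * ip2 Om (snd d) (\<lambda>x. trace (fst e x))\<bar> \<le> ?m * ?P"
      by (rule order_trans[OF coupling_bound[OF D(2) E(1)] mult_left_mono[OF P]]) (use dn en alpha in auto)
    have "\<bar>a_w w d e\<bar> \<le> ?c * ?P + K * ?P + c0 * ?P + ?m * ?P + ?m * ?P"
      unfolding a_form_eq[OF d e] using 1 2 3 4 5 by linarith
    then show ?thesis by (simp add: algebra_simps)
  qed
  then show ?thesis by blast
qed

text \<open>An embedded stress has no pressure component, so neither the permeability nor \<open>c0\<close> occurs. The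
  elastic and the coupling term are bounded by \<open>Ca\<close> each, whence the factor two.\<close>

lemma a_kernel_bound:
  assumes w: "w \<in> Xsp Om" and t: "t \<in> S.ker" and e: "e \<in> Xh Om T k"
    and Ca: "2 * mu + real CARD('n) * lam \<le> Ca" "real CARD('n) * alpha \<le> Ca"
  shows "\<bar>a_w w (t, \<lambda>x. 0) e\<bar> \<le> 2 * Ca * S.Y.nrm t * S.X.nrm e"
    "\<bar>a_w w e (t, \<lambda>x. 0)\<bar> \<le> 2 * Ca * S.Y.nrm t * S.X.nrm e"
proof -
  have d: "(t, \<lambda>x. 0) \<in> Xh Om T k" by (rule S.ker_emb(1)[OF t])
  note D = Xh_L2[OF d, simplified fst_conv snd_conv] and E = Xh_L2[OF e] and en = X_parts[OF e]
  let ?P = "S.Y.nrm t * S.X.nrm e"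
  have P: "norm_L2 Om t * y \<le> ?P" if "y \<le> S.X.nrm e" "0 \<le> y" for y
    using that Y_parts[of t] by (intro mult_mono) (auto intro: order_trans[OF norm_L2_nonneg])
  have P0: "0 \<le> ?P" using P[of 0] en(1) order_trans[OF norm_L2_nonneg en(1)] by simp
  have "0 \<le> real CARD('n) * alpha" using alpha by simp
  then have Ca0: "0 \<le> Ca" using Ca(2) by linarith
  have 1: "\<bar>lam * ip2 Om (\<lambda>x. trace (t x)) (\<lambda>x. trace (fst e x)) + 2 * mu * ip2 Om t (fst e)\<bar> \<le> Ca * ?P"
    by (rule order_trans[OF elastic_bound[OF D(1) E(1)] mult_mono[OF Ca(1) P]])
      (use en Ca0 in auto)
  have 2: "\<bar>alpha * ip2 Om (snd e) (\<lambda>x. trace (t x))\<bar> \<le> Ca * ?P"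
  proof -
    have le: "norm_L2 Om (snd e) * norm_L2 Om t \<le> ?P" using P[OF en(3)] by (simp add: mult.commute)
    have "real CARD('n) * alpha * (norm_L2 Om (snd e) * norm_L2 Om t) \<le> Ca * ?P"
      by (rule mult_mono[OF Ca(2) le Ca0]) simp
    with coupling_bound[OF E(2) D(1)] show ?thesis by (rule order_trans)
  qed
  obtain K where "0 \<le> K" "\<And>p. p \<in> G.dom \<Longrightarrow> flux w p \<in> L2 Om"
    and K: "\<And>p. p \<in> G.dom \<Longrightarrow> norm_L2 Om (flux w p) \<le> K * norm_L2 Om (wgrad Om p)"
    by (rule flux_bound[OF w]) (rule that)
  have 3: "ip2 Om (flux w (\<lambda>x. 0)) (wgrad Om (snd e)) = 0"
  proof -
    have "norm_L2 Om (flux w (\<lambda>x. 0)) = 0"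
      using K[OF D(4)] norm_L2_nonneg[of Om "flux w (\<lambda>x. 0)"] by (simp add: norm_wgrad_zero)
    then show ?thesis using ip2_le[OF flux_L2[OF w D(4)] E(3)] by simp
  qed
  have 4: "ip2 Om (flux w (snd e)) (wgrad Om (\<lambda>x. 0)) = 0"
    using ip2_le[OF flux_L2[OF w E(4)] D(3)] by (simp add: norm_wgrad_zero)
  have z: "ip2 Om (\<lambda>x. 0) h = 0" "ip2 Om h (\<lambda>x. 0) = 0" for h :: "(real, 'n) vec \<Rightarrow> real"
    by (simp_all add: ip2_def)
  have "a_w w (t, \<lambda>x. 0) e = lam * ip2 Om (\<lambda>x. trace (t x)) (\<lambda>x. trace (fst e x)) + 2 * mu * ip2 Om t (fst e)
      + alpha * ip2 Om (snd e) (\<lambda>x. trace (t x))"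
    using a_form_eq[OF d e, of w] by (simp add: 3 z)
  with 1 2 show "\<bar>a_w w (t, \<lambda>x. 0) e\<bar> \<le> 2 * Ca * S.Y.nrm t * S.X.nrm e" by (simp add: mult.assoc)
  have "a_w w e (t, \<lambda>x. 0) = lam * ip2 Om (\<lambda>x. trace (t x)) (\<lambda>x. trace (fst e x)) + 2 * mu * ip2 Om t (fst e)
      - alpha * ip2 Om (snd e) (\<lambda>x. trace (t x))"
    using a_form_eq[OF e d, of w]
    by (simp add: 4 z ip2_commute[of Om "fst e" t] ip2_commute[of Om "\<lambda>x. trace (fst e x)" "\<lambda>x. trace (t x)"])
  with 1 2 show "\<bar>a_w w e (t, \<lambda>x. 0)\<bar> \<le> 2 * Ca * S.Y.nrm t * S.X.nrm e" by (simp add: mult.assoc)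
qed

text \<open>Only the flux depends on the linearisation point, and its Lipschitz condition involves only the
  pressures.\<close>

lemma a_lipschitz:
  assumes w: "w \<in> Xh Om T k" "w' \<in> Xh Om T k" and d: "d \<in> Xh Om T k" and e: "e \<in> Xh Om T k"
  shows "\<bar>a_w w d e - a_w w' d e\<bar> \<le> k2 * S.X.dst w w' * S.X.nrm d * S.X.nrm e"
proof -
  note D = Xh_L2[OF d] and E = Xh_L2[OF e]
  have ww: "lin2 (-1) w w' \<in> Xh Om T k" by (rule S.X.closed[OF w])
  have "\<bar>a_w w d e - a_w w' d e\<bar> = \<bar>ip2 Om (flux w (snd d)) (wgrad Om (snd e)) - ip2 Om (flux w' (snd d)) (wgrad Om (snd e))\<bar>"
    unfolding a_form_eq[OF d e] by simp
  also have "\<dots> \<le> k2 * norm_H1 Om (\<lambda>x. snd w x - snd w' x) * norm_L2 Om (wgrad Om (snd d)) * norm_L2 Om (wgrad Om (snd e))"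
    by (rule flux_lipschitz[OF Xh_L2(6)[OF w(1)] Xh_L2(6)[OF w(2)] D(4) E(3)])
  also have "\<dots> \<le> k2 * S.X.dst w w' * S.X.nrm d * S.X.nrm e"
  proof -
    have "norm_H1 Om (\<lambda>x. snd w x - snd w' x) \<le> S.X.dst w w'"
      using X_parts(2)[OF ww] by (simp add: lin2_parts fun_lin_minus)
    then show ?thesis
      using X_parts(4)[OF d] X_parts(4)[OF e] k2 S.X.nrm_nonneg[OF d] S.X.nrm_nonneg[OF ww]
      by (intro mult_mono) auto
  qed
  finally show ?thesis .
qed

lemma a_form_saddle:
  assumes w: "w \<in> Xh Om T k" and ca: "0 < ca" "ca \<le> k1" "ca \<le> 2 * mu" "ca \<le> c0"
    and Ca: "2 * mu + real CARD('n) * lam \<le> Ca" "real CARD('n) * alpha \<le> Ca"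
  shows "S.form (a_w w) ca (2 * Ca)"
  unfolding S.form_def
proof (intro conjI ballI)
  note w' = Xh_L2(6)[OF w]
  show "0 < ca" by fact
  have "0 \<le> real CARD('n) * alpha" using alpha by simp
  then show "0 \<le> 2 * Ca" using Ca(2) by linarith
  show "\<exists>B. \<forall>d\<in>Xh Om T k. \<forall>e\<in>Xh Om T k. \<bar>a_w w d e\<bar> \<le> B * S.X.nrm d * S.X.nrm e" by (rule a_bounded[OF w'])
  fix e assume e: "e \<in> Xh Om T k"
  show "linear_on (Xh Om T k) lin2 (\<lambda>d. a_w w d e)" by (rule a_linear_left[OF w' e])
  show "linear_on (Xh Om T k) lin2 (a_w w e)" by (rule a_linear_right[OF w' e])
  show "ca * ipX e e \<le> a_w w e e" by (rule a_coercive[OF w' e ca])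
  fix t assume t: "t \<in> S.ker"
  show "\<bar>a_w w (t, \<lambda>x. 0) e\<bar> \<le> 2 * Ca * S.Y.nrm t * S.X.nrm e" by (rule a_kernel_bound(1)[OF w' t e Ca])
  show "\<bar>a_w w e (t, \<lambda>x. 0)\<bar> \<le> 2 * Ca * S.Y.nrm t * S.X.nrm e" by (rule a_kernel_bound(2)[OF w' t e Ca])
qed

section \<open>The functionals and the identification of almost everywhere equal functions\<close>

lemma Xh_trace: "x \<in> Xh Om T k \<Longrightarrow> is_trace Om (snd x) (snd x)"
  using trace_continuous[OF Xh_L2(5)] by (auto simp: Xh_def X2h_def)

lemma G_fun_eq: "G_fun Om g rG x = ip2 Om g (snd x) + rG (btrace Om (snd x))"
  by (simp add: G_fun_def ip2_def split: prod.split)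

lemma F_fun_eq: "F_fun Om f v = ip2 Om f (fst v)"
  by (simp add: F_fun_def ip2_def split: prod.split)

lemma G_fun_saddle:
  assumes g: "g \<in> L2 Om" and rG: "rG \<in> Hm12 Om"
  shows "linear_on (Xh Om T k) lin2 (G_fun Om g rG)"
    and "x \<in> Xh Om T k \<Longrightarrow> \<bar>G_fun Om g rG x\<bar> \<le> (norm_L2 Om g + norm_Hm12 Om rG) * S.X.nrm x"
    and "0 \<le> norm_Hm12 Om rG"
proof -
  show "linear_on (Xh Om T k) lin2 (G_fun Om g rG)"
    unfolding linear_on_def
  proof (intro ballI allI)
    fix x y c assume x: "x \<in> Xh Om T k" and y: "y \<in> Xh Om T k"
    show "G_fun Om g rG (lin2 c x y) = G_fun Om g rG x + c * G_fun Om g rG y"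
      unfolding G_fun_eq lin2_parts btrace_functional_lin[OF rG Xh_trace[OF x] Xh_trace[OF y]]
        L2.ip_lin_right[OF Xh_L2(2)[OF x] Xh_L2(2)[OF y] g]
      by (simp add: algebra_simps)
  qed
  show nn: "0 \<le> norm_Hm12 Om rG"
    by (rule Hm12_bound(2)[OF rG, of "\<lambda>x. 0"]) (use trace_zero in \<open>auto simp: H12_def\<close>)
  assume x: "x \<in> Xh Om T k"
  have "\<bar>ip2 Om g (snd x)\<bar> \<le> norm_L2 Om g * S.X.nrm x"
    by (rule order_trans[OF ip2_le[OF g Xh_L2(2)[OF x]] mult_left_mono[OF X_parts(3)[OF x]]]) simp
  moreover have "\<bar>rG (btrace Om (snd x))\<bar> \<le> norm_Hm12 Om rG * S.X.nrm x"
    by (rule order_trans[OF btrace_functional_bound[OF rG Xh_trace[OF x]] mult_left_mono[OF X_parts(2)[OF x] nn]])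
  ultimately show "\<bar>G_fun Om g rG x\<bar> \<le> (norm_L2 Om g + norm_Hm12 Om rG) * S.X.nrm x"
    unfolding G_fun_eq distrib_right by linarith
qed

lemma H_fun_saddle:
  assumes u: "uG \<in> H12v Om"
  shows "linear_on (Yh Om T k) fun_lin (H_fun Om uG)"
    and "t \<in> Yh Om T k \<Longrightarrow> \<bar>H_fun Om uG t\<bar> \<le> norm_H12v Om uG * S.Y.nrm t"
  using H_fun_lin[OF u] H_fun_bound[OF u] Yh_Hdiv norm_Y_nrm by (auto simp: linear_on_def)

lemma F_fun_saddle:
  assumes f: "f \<in> L2 Om"
  shows "linear_on (Zh Om T k) lin2 (F_fun Om f)"
    and "v \<in> Zh Om T k \<Longrightarrow> \<bar>F_fun Om f v\<bar> \<le> norm_L2 Om f * S.Z.nrm v"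
proof -
  have L: "fst v \<in> L2 Om" if "v \<in> Zh Om T k" for v using that Z1h_L2 by (auto simp: Zh_eq)
  show "linear_on (Zh Om T k) lin2 (F_fun Om f)"
    unfolding linear_on_def F_fun_eq lin2_parts by (intro ballI allI L2.ip_lin_right L f)
  assume v: "v \<in> Zh Om T k"
  have "norm_L2 Om (fst v) \<le> S.Z.nrm v"
    unfolding norm_Z_nrm[OF v] by (simp add: norm_Z_def split: prod.split)
  then show "\<bar>F_fun Om f v\<bar> \<le> norm_L2 Om f * S.Z.nrm v"
    unfolding F_fun_eq by (intro order_trans[OF ip2_le[OF f L[OF v]] mult_left_mono]) simp_all
qed

lemma eq_on_fun_lin: "(AE x in lebesgue_on Om. fun_lin (- 1) f g x = 0) \<longleftrightarrow> eq_on Om f g"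
  by (simp add: fun_lin_minus eq_on_def)

lemma dst_Xh: "x \<in> Xh Om T k \<Longrightarrow> y \<in> Xh Om T k \<Longrightarrow> S.X.dst x y = 0 \<longleftrightarrow> eq_pair Om x y"
proof -
  assume x: "x \<in> Xh Om T k" and y: "y \<in> Xh Om T k"
  note D = Xh_L2[OF S.X.closed[OF x y, of "-1"]]
  have "S.X.dst x y = 0 \<longleftrightarrow> ip2 Om (fst (lin2 (-1) x y)) (fst (lin2 (-1) x y)) = 0 \<and>
      G.ipT (snd (lin2 (-1) x y)) (snd (lin2 (-1) x y)) = 0"
    using L2.ip_pos[OF D(1)] H1.ip_pos[OF D(5)]
    by (simp add: S.X.nrm_def prod_ip_def add_nonneg_eq_0_iff)
  also have "\<dots> \<longleftrightarrow> eq_pair Om x y"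
    unfolding ip2_null_iff[OF D(1)] G.ipT_null_iff[OF D(4)] unfolding lin2_parts eq_on_fun_lin eq_pair_def ..
  finally show ?thesis .
qed

lemma dst_Yh: "s \<in> Yh Om T k \<Longrightarrow> t \<in> Yh Om T k \<Longrightarrow> S.Y.dst s t = 0 \<longleftrightarrow> eq_on Om s t"
proof -
  assume s: "s \<in> Yh Om T k" and t: "t \<in> Yh Om T k"
  have "S.Y.dst s t = 0 \<longleftrightarrow> D.ipT (fun_lin (-1) s t) (fun_lin (-1) s t) = 0" by (simp add: S.Y.nrm_def)
  also have "\<dots> \<longleftrightarrow> eq_on Om s t"
    unfolding D.ipT_null_iff[OF Yh_L2(3)[OF Yh_lin[OF s t]]] eq_on_fun_lin ..
  finally show ?thesis .
qed

lemma dst_Zh: "x \<in> Zh Om T k \<Longrightarrow> y \<in> Zh Om T k \<Longrightarrow> S.Z.dst x y = 0 \<longleftrightarrow> eq_pair Om x y"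
proof -
  assume x: "x \<in> Zh Om T k" and y: "y \<in> Zh Om T k"
  have "lin2 (-1) x y \<in> Zh Om T k" by (rule S.Z.closed[OF x y])
  then have D: "fst (lin2 (-1) x y) \<in> L2 Om" "snd (lin2 (-1) x y) \<in> L2 Om"
    using Z1h_L2 Z2h_L2 unfolding Zh_eq mem_Times_iff by blast+
  have "S.Z.dst x y = 0 \<longleftrightarrow> ip2 Om (fst (lin2 (-1) x y)) (fst (lin2 (-1) x y)) = 0 \<and>
      ip2 Om (snd (lin2 (-1) x y)) (snd (lin2 (-1) x y)) = 0"
    using L2.ip_pos[OF D(1)] L2.ip_pos[OF D(2)]
    by (simp add: S.Z.nrm_def prod_ip_def add_nonneg_eq_0_iff)
  also have "\<dots> \<longleftrightarrow> eq_pair Om x y"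
    unfolding ip2_null_iff[OF D(1)] ip2_null_iff[OF D(2)] unfolding lin2_parts eq_on_fun_lin eq_pair_def ..
  finally show ?thesis .
qed

lemma ball3: "X \<noteq> {} \<Longrightarrow> Y \<noteq> {} \<Longrightarrow> Z \<noteq> {} \<Longrightarrow>
    (\<forall>e\<in>X. \<forall>t\<in>Y. \<forall>v\<in>Z. P e \<and> Q t \<and> R v) \<longleftrightarrow> (\<forall>e\<in>X. P e) \<and> (\<forall>t\<in>Y. Q t) \<and> (\<forall>v\<in>Z. R v)"
  by blast

lemma discr_sol_iff:
  "discr_sol Om T k A f g uG rG ((d, s), u) \<longleftrightarrow> S.sol A (G_fun Om g rG) (H_fun Om uG) (F_fun Om f) d s u"
  unfolding discr_sol_def S.sol_def prod.case b2_form_eq snd_conv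
    ball3[OF S.X.nonempty S.Y.nonempty S.Z.nonempty] ..

section \<open>Existence, uniqueness and stability\<close>

text \<open>The radius of the a priori bound is \<open>\<gamma>\<close> times the norm of the data. The smallness condition
  contains both requirements: with the entry one of the maximum this radius is at most \<open>r\<close>, and
  with the other entry the contraction factor is below one.\<close>

lemma discrete_solution:
  fixes r :: real
  defines "\<gamma> \<equiv> gam1 (Cbig CARD('n) lam mu alpha c0 k2 r) (Csmall mu c0 k1) beta"
  assumes r: "0 < r" and f: "f \<in> L2 Om" and g: "g \<in> L2 Om" and uG: "uG \<in> H12v Om" and rG: "rG \<in> Hm12 Om"
    and small: "\<gamma> / r * max (\<gamma> * k2 * r) 1 * data_norm Om f g uG rG < 1"
  defines "lin \<equiv> lin_sol Om T k lam mu alpha c0 kap f g uG rG"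
    and "nonlin \<equiv> nonlin_sol Om T k lam mu alpha c0 kap f g uG rG"
    and "J \<equiv> Jh Om T k lam mu alpha c0 kap f g uG rG"
  shows "\<forall>w\<in>Wh Om T k r. (\<exists>x. lin w x) \<and> (\<forall>x y. lin w x \<and> lin w y \<longrightarrow> eq_sol Om x y)"
    and "\<exists>d\<in>Wh Om T k r. eq_pair Om (J d) d \<and> (\<forall>d'\<in>Wh Om T k r. eq_pair Om (J d') d' \<longrightarrow> eq_pair Om d' d)"
    and "\<forall>d\<in>Wh Om T k r. eq_pair Om (J d) d \<longleftrightarrow> (\<exists>s u. nonlin ((d, s), u))"
    and "\<exists>d s u. d \<in> Wh Om T k r \<and> nonlin ((d, s), u) \<and>
          (\<forall>d' s' u'. d' \<in> Wh Om T k r \<and> nonlin ((d', s'), u') \<longrightarrow> eq_sol Om ((d', s'), u') ((d, s), u)) \<and>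
          norm_XYZ Om ((d, s), u) \<le>
            (\<gamma> + (2 * Cbig CARD('n) lam mu alpha c0 k2 r * \<gamma> + 1 + 1 / beta) + (1 + \<gamma>) / beta) * data_norm Om f g uG rG"
proof -
  define Ca where "Ca = Cbig CARD('n) lam mu alpha c0 k2 r"
  define ca where "ca = Csmall mu c0 k1"
  define S where "S = data_norm Om f g uG rG"
  let ?G = "G_fun Om g rG" and ?H = "H_fun Om uG" and ?F = "F_fun Om f"
  let ?g = "norm_L2 Om g + norm_Hm12 Om rG" and ?h = "norm_H12v Om uG" and ?f = "norm_L2 Om f"
  have ca: "0 < ca" "ca \<le> k1" "ca \<le> 2 * mu" "ca \<le> c0"
    using k1 mu c0 by (auto simp: ca_def Csmall_def)
  have Ca: "2 * mu + real CARD('n) * lam \<le> Ca" "real CARD('n) * alpha \<le> Ca" "k2 * r \<le> Ca"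
    unfolding Ca_def Cbig_def by (intro Max_ge; simp)+
  have Ca0: "0 \<le> Ca" using Ca(3) k2 r by (intro order_trans[OF _ Ca(3)]) simp
  have \<gamma>: "\<gamma> = gam1 Ca ca beta" by (simp add: \<gamma>_def Ca_def ca_def)
  note gb = gam1_bounds[OF ca(1) Ca0 beta beta_le_1, folded \<gamma>]
  have \<gamma>0: "1 / ca \<le> \<gamma>" "0 < \<gamma>" using gb(1) ca(1) by (auto intro: less_le_trans[OF divide_pos_pos[OF zero_less_one ca(1)]])
  have g0: "0 \<le> ?g" using G_fun_saddle(3)[OF g rG] by simp
  have h0: "0 \<le> ?h" by (simp add: norm_H12v_def sum_nonneg)
  have Ssum: "S = ?g + ?h + ?f" by (simp add: S_def data_norm_def)
  have S0: "0 \<le> S" using g0 h0 by (simp add: Ssum)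
  \<comment> \<open>both entries of the maximum in the smallness condition are needed\<close>
  have scale: "\<gamma> / r * m * S < 1" if "m \<le> max (\<gamma> * k2 * r) 1" for m
  proof -
    have "\<gamma> / r * m * S \<le> \<gamma> / r * max (\<gamma> * k2 * r) 1 * S"
      using that \<gamma>0(2) r S0 by (intro mult_right_mono mult_left_mono) auto
    then show ?thesis using small by (simp add: S_def)
  qed
  have Rr: "\<gamma> * S \<le> r" using scale[of 1] r by (simp add: field_simps)
  have contr: "\<gamma> * k2 * (\<gamma> * S) < 1" using scale[of "\<gamma> * k2 * r"] r by (simp add: field_simps)
  interpret N: nonlinear_saddle "Xh Om T k" lin2 ipX "Yh Om T k" fun_lin D.ipT "Zh Om T k" lin2 ipZ
    "b1_form Om" b2h "\<lambda>t. (t, \<lambda>x. 0)" beta a_w ca "2 * Ca" k2 ?g ?h ?f "\<gamma> * S" ?G ?H ?F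
  proof unfold_locales
    show "S.form (a_w w) ca (2 * Ca)" if "w \<in> Xh Om T k" for w by (rule a_form_saddle[OF that ca Ca(1,2)])
    show "0 \<le> k2" using k2 by simp
    show "\<bar>a_w w d e - a_w w' d e\<bar> \<le> k2 * S.X.dst w w' * S.X.nrm d * S.X.nrm e"
      if "w \<in> Xh Om T k" "w' \<in> Xh Om T k" "d \<in> Xh Om T k" "e \<in> Xh Om T k" for w w' d e
      by (rule a_lipschitz[OF that])
    show "linear_on (Xh Om T k) lin2 ?G" by (rule G_fun_saddle(1)[OF g rG])
    show "\<bar>?G e\<bar> \<le> ?g * S.X.nrm e" if "e \<in> Xh Om T k" for e by (rule G_fun_saddle(2)[OF g rG that])
    show "0 \<le> ?g" by (rule g0)
    show "linear_on (Yh Om T k) fun_lin ?H" by (rule H_fun_saddle(1)[OF uG])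
    show "0 \<le> ?h" by (rule h0)
    show "\<bar>?H t\<bar> \<le> ?h * S.Y.nrm t" if "t \<in> Yh Om T k" for t by (rule H_fun_saddle(2)[OF uG that])
    show "linear_on (Zh Om T k) lin2 ?F" by (rule F_fun_saddle(1)[OF f])
    show "0 \<le> ?f" by simp
    show "\<bar>?F v\<bar> \<le> ?f * S.Z.nrm v" if "v \<in> Zh Om T k" for v by (rule F_fun_saddle(2)[OF f that])
    show "0 \<le> \<gamma> * S" using \<gamma>0 S0 by simp
    have "(?g + ?f / beta + 2 * Ca * ?h) / ca + ?h = 1 / ca * ?g + 1 / (beta * ca) * ?f + (2 * Ca / ca + 1) * ?h"
      using ca(1) beta by (simp add: field_simps)
    also have "\<dots> \<le> \<gamma> * ?g + \<gamma> * ?f + \<gamma> * ?h"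
      using gb g0 h0 by (intro add_mono mult_right_mono) auto
    finally show "(?g + ?f / beta + 2 * Ca * ?h) / ca + ?h \<le> \<gamma> * S" by (simp add: Ssum algebra_simps)
    have "1 / ca * (k2 * (\<gamma> * S)) \<le> \<gamma> * (k2 * (\<gamma> * S))"
      using gb(1) k2 \<gamma>0 S0 by (intro mult_right_mono) auto
    then show "k2 / ca * (\<gamma> * S) < 1" using contr by (simp add: mult_ac)
  qed
  have lin_iff: "lin w ((d, s), u) \<longleftrightarrow> S.sol (a_w w) ?G ?H ?F d s u" for w d s u
    unfolding lin_def lin_sol_def by (rule discr_sol_iff)
  have nonlin_iff: "nonlin ((d, s), u) \<longleftrightarrow> S.sol (a_w d) ?G ?H ?F d s u" for d s u
    unfolding nonlin_def nonlin_sol_def discr_sol_iff by (simp add: S.sol_def)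
  have W: "w \<in> Xh Om T k" if "w \<in> Wh Om T k r" for w using that by (simp add: Wh_def)
  have eq_solI: "eq_sol Om ((d, s), u) ((d', s'), u')"
    if "S.sol A ?G ?H ?F d s u" "S.sol A' ?G ?H ?F d' s' u'"
      "S.X.dst d d' = 0" "S.Y.dst s s' = 0" "S.Z.dst u u' = 0" for A A' d s u d' s' u'
    using that dst_Xh[of d d'] dst_Yh[of s s'] dst_Zh[of u u'] by (simp add: eq_sol_def S.sol_def)
  have J_sol: "\<exists>s u. S.sol (a_w w) ?G ?H ?F (J w) s u" if "w \<in> Xh Om T k" for w
  proof -
    have "\<exists>d s u. lin_sol Om T k lam mu alpha c0 kap f g uG rG w ((d, s), u)"
      using N.lin_exists[OF that] lin_iff unfolding lin_def by blast
    then have "\<exists>s u. lin_sol Om T k lam mu alpha c0 kap f g uG rG w ((J w, s), u)"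
      unfolding J_def Jh_def by (rule someI_ex)
    then show ?thesis using lin_iff unfolding lin_def by blast
  qed
  have fixed_iff: "eq_pair Om (J d) d \<longleftrightarrow> (\<exists>s u. nonlin ((d, s), u))" if d: "d \<in> Xh Om T k" for d
  proof -
    obtain s u where su: "S.sol (a_w d) ?G ?H ?F (J d) s u" using J_sol[OF d] by blast
    then have Jd: "J d \<in> Xh Om T k" by (simp add: S.sol_def)
    show ?thesis
    proof
      assume "eq_pair Om (J d) d"
      then have "S.X.dst (J d) d = 0" using dst_Xh[OF Jd d] by simp
      from S.sol_replace[OF N.form[OF d] su d this] show "\<exists>s u. nonlin ((d, s), u)"
        unfolding nonlin_iff by blast
    next
      assume "\<exists>s u. nonlin ((d, s), u)"
      then obtain s' u' where "S.sol (a_w d) ?G ?H ?F d s' u'" unfolding nonlin_iff by blast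
      from S.sol_unique(1)[OF N.form[OF d] su this] show "eq_pair Om (J d) d" using dst_Xh[OF Jd d] by simp
    qed
  qed
  obtain d s u where sol: "S.sol (a_w d) ?G ?H ?F d s u" using N.nonlinear_exists by blast
  then have dX: "d \<in> Xh Om T k" and sY: "s \<in> Yh Om T k" and uZ: "u \<in> Zh Om T k" by (simp_all add: S.sol_def)
  have dn: "S.X.nrm d \<le> \<gamma> * S" by (rule N.lin_bound[OF dX sol])
  then have dW: "d \<in> Wh Om T k r" using dX Rr norm_X_nrm[OF dX] by (simp add: Wh_def)
  have uniq: "eq_sol Om ((d', s'), u') ((d, s), u)" if "nonlin ((d', s'), u')" for d' s' u'
    using eq_solI[OF that[unfolded nonlin_iff] sol] N.nonlinear_unique[OF that[unfolded nonlin_iff] sol] by blast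

  show "\<forall>w\<in>Wh Om T k r. (\<exists>x. lin w x) \<and> (\<forall>x y. lin w x \<and> lin w y \<longrightarrow> eq_sol Om x y)"
  proof (intro ballI conjI allI impI)
    fix w assume w: "w \<in> Wh Om T k r"
    obtain d s u where "S.sol (a_w w) ?G ?H ?F d s u" using N.lin_exists[OF W[OF w]] by blast
    then have "lin w ((d, s), u)" unfolding lin_iff .
    then show "\<exists>x. lin w x" by (rule exI)
    fix x y assume xy: "lin w x \<and> lin w y"
    obtain d s u d' s' u' where [simp]: "x = ((d, s), u)" "y = ((d', s'), u')" by (metis prod.exhaust)
    have "S.sol (a_w w) ?G ?H ?F d s u" "S.sol (a_w w) ?G ?H ?F d' s' u'" using xy by (simp_all add: lin_iff)
    from eq_solI[OF this] S.sol_unique[OF N.form[OF W[OF w]] this] show "eq_sol Om x y" by simp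
  qed
  show "\<forall>d\<in>Wh Om T k r. eq_pair Om (J d) d \<longleftrightarrow> (\<exists>s u. nonlin ((d, s), u))"
    using fixed_iff W by blast
  show "\<exists>d\<in>Wh Om T k r. eq_pair Om (J d) d \<and> (\<forall>d'\<in>Wh Om T k r. eq_pair Om (J d') d' \<longrightarrow> eq_pair Om d' d)"
  proof (intro bexI[OF _ dW] conjI ballI impI)
    show "eq_pair Om (J d) d" unfolding fixed_iff[OF dX] nonlin_iff using sol by blast
    fix d' assume "d' \<in> Wh Om T k r" "eq_pair Om (J d') d'"
    then obtain s' u' where "nonlin ((d', s'), u')" using fixed_iff[OF W] by blast
    from uniq[OF this] show "eq_pair Om d' d" by (simp add: eq_sol_def)
  qed
  have "norm_XYZ Om ((d, s), u) \<le> (\<gamma> + (2 * Ca * \<gamma> + 1 + 1 / beta) + (1 + \<gamma>) / beta) * S"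
  proof -
    have n0: "0 \<le> norm_X Om d" "0 \<le> norm_Y Om s" "0 \<le> norm_Z Om u"
      by (auto simp: norm_X_def norm_Y_def norm_Z_def split: prod.split)
    have "norm_XYZ Om ((d, s), u) \<le> norm_XY Om (d, s) + norm_Z Om u"
      unfolding norm_XYZ_def prod.case using n0 by (intro sqrt_sum_squares_le_sum) (auto simp: norm_XY_def)
    moreover have "norm_XY Om (d, s) \<le> norm_X Om d + norm_Y Om s"
      unfolding norm_XY_def prod.case using n0 by (intro sqrt_sum_squares_le_sum)
    ultimately have le: "norm_XYZ Om ((d, s), u) \<le> S.X.nrm d + S.Y.nrm s + S.Z.nrm u"
      unfolding norm_X_nrm[OF dX] norm_Z_nrm[OF uZ] norm_Y_nrm by linarith
    have ap: "S.Y.nrm s \<le> 2 * Ca * S.X.nrm d + ?g + ?f / beta" "S.Z.nrm u \<le> (?h + S.X.nrm d) / beta"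
      using S.a_priori(2,3)[OF N.form[OF dX] sol N.G(2) N.G(3) N.H(2) N.H(3) N.F(2) N.F(3) N.H(1)] by blast+
    have hS: "?h \<le> S" using g0 norm_L2_nonneg[of Om f] unfolding Ssum by linarith
    have fb: "?f / beta \<le> S / beta" using beta g0 h0 by (intro divide_right_mono) (auto simp: Ssum)
    have "2 * Ca * S.X.nrm d \<le> 2 * Ca * (\<gamma> * S)" using dn Ca0 by (intro mult_left_mono) auto
    then have "S.Y.nrm s \<le> 2 * Ca * (\<gamma> * S) + S + S / beta"
      using ap(1) fb h0 norm_L2_nonneg[of Om f] unfolding Ssum by linarith
    moreover have "S.Z.nrm u \<le> (S + \<gamma> * S) / beta"
      by (rule order_trans[OF ap(2)]) (intro divide_right_mono add_mono hS dn less_imp_le[OF beta])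
    ultimately have "norm_XYZ Om ((d, s), u) \<le> \<gamma> * S + (2 * Ca * (\<gamma> * S) + S + S / beta) + (S + \<gamma> * S) / beta"
      using le dn by linarith
    then show ?thesis by (simp add: algebra_simps add_divide_distrib)
  qed
  then show "\<exists>d s u. d \<in> Wh Om T k r \<and> nonlin ((d, s), u) \<and>
          (\<forall>d' s' u'. d' \<in> Wh Om T k r \<and> nonlin ((d', s'), u') \<longrightarrow> eq_sol Om ((d', s'), u') ((d, s), u)) \<and>
          norm_XYZ Om ((d, s), u) \<le>
            (\<gamma> + (2 * Cbig CARD('n) lam mu alpha c0 k2 r * \<gamma> + 1 + 1 / beta) + (1 + \<gamma>) / beta) * data_norm Om f g uG rG"
    using dW sol uniq unfolding Ca_def S_def by (intro exI[of _ d] exI[of _ s] exI[of _ u]) (simp add: nonlin_iff)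
qed

end

lemma gam1_pos:
  assumes "0 < ca" "0 \<le> Ca" "0 < b" shows "0 \<le> gam1 Ca ca b"
  unfolding gam1_def gam2_def using assms by (intro divide_nonneg_nonneg mult_nonneg_nonneg) auto

theorem theorem4p2:
  fixes Om :: "(real ^ 'n::{finite,linorder}) set"
    and kap :: "'n xel \<Rightarrow> 'n tens"
    and lam mu alpha c0 k1 k2 beta r :: real
    and k :: nat
  assumes "CARD('n) \<in> {2, 3}"
    and "lipschitz_domain Om"
    and "0 < lam" and "0 < mu" and "0 \<le> alpha" and "alpha \<le> 1" and "0 < c0"
    and "0 < k1" and "0 < k2" and "permeability Om kap k1 k2"
    and "0 < beta" and "0 < r"
  shows "let \<gamma>1 = gam1 (Cbig CARD('n) lam mu alpha c0 k2 r) (Csmall mu c0 k1) beta in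
   \<exists>C>0. \<forall>T f g uG rG.
    is_mesh Om T \<and> inf_sup_b2 Om T k beta \<and>
    f \<in> L2 Om \<and> g \<in> L2 Om \<and> uG \<in> H12v Om \<and> rG \<in> Hm12 Om \<and>
    \<gamma>1 / r * max (\<gamma>1 * k2 * r) 1 * data_norm Om f g uG rG < 1 \<longrightarrow>
    (let W = Wh Om T k r;
         lin = lin_sol Om T k lam mu alpha c0 kap f g uG rG;
         nonlin = nonlin_sol Om T k lam mu alpha c0 kap f g uG rG;
         J = Jh Om T k lam mu alpha c0 kap f g uG rG
     in
       \<comment> \<open>the operator is well defined\<close>
       (\<forall>w\<in>W. (\<exists>x. lin w x) \<and> (\<forall>x y. lin w x \<and> lin w y \<longrightarrow> eq_sol Om x y)) \<and>
       \<comment> \<open>unique fixed point\<close>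
       (\<exists>d\<in>W. eq_pair Om (J d) d \<and> (\<forall>d'\<in>W. eq_pair Om (J d') d' \<longrightarrow> eq_pair Om d' d)) \<and>
       \<comment> \<open>fixed points are the first components of solutions\<close>
       (\<forall>d\<in>W. eq_pair Om (J d) d \<longleftrightarrow> (\<exists>s u. nonlin ((d, s), u))) \<and>
       \<comment> \<open>unique solution, and its bound\<close>
       (\<exists>d s u. d \<in> W \<and> nonlin ((d, s), u) \<and>
          (\<forall>d' s' u'. d' \<in> W \<and> nonlin ((d', s'), u') \<longrightarrow> eq_sol Om ((d', s'), u') ((d, s), u)) \<and>
          norm_XYZ Om ((d, s), u) \<le> C * data_norm Om f g uG rG))"
proof -
  define Ca where "Ca = Cbig CARD('n) lam mu alpha c0 k2 r"
  define \<gamma> where "\<gamma> = gam1 Ca (Csmall mu c0 k1) beta"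
  \<comment> \<open>the bounds of the first component, of the stress and of the last component, in this order\<close>
  define C where "C = \<gamma> + (2 * Ca * \<gamma> + 1 + 1 / beta) + (1 + \<gamma>) / beta"
  have Ca0: "0 \<le> Ca"
  proof -
    have "k2 * r \<le> Ca" unfolding Ca_def Cbig_def by (intro Max_ge) simp_all
    then show ?thesis using assms by (intro order_trans[OF _ \<open>k2 * r \<le> Ca\<close>]) simp
  qed
  have "0 < Csmall mu c0 k1" using assms by (simp add: Csmall_def)
  from gam1_pos[OF this Ca0 \<open>0 < beta\<close>] have \<gamma>0: "0 \<le> \<gamma>" by (simp add: \<gamma>_def)
  have C0: "0 < C"
    unfolding C_def using \<gamma>0 Ca0 \<open>0 < beta\<close>
    by (intro add_pos_nonneg add_nonneg_pos add_pos_pos) (auto intro!: add_nonneg_pos)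
  have mesh: "biot_mesh Om T kap lam mu alpha c0 k1 k2 beta k" if "is_mesh Om T" "inf_sup_b2 Om T k beta" for T
    using assms that by unfold_locales (auto simp: lipschitz_domain_def)
  show ?thesis
    unfolding Let_def \<gamma>_def[unfolded Ca_def, symmetric]
  proof (intro exI[of _ C] conjI C0 allI impI)
    fix T :: "((real, 'n) vec) set set" and f uG :: "'n vect" and g :: "'n scal" and rG :: "'n scal \<Rightarrow> real"
    assume "is_mesh Om T \<and> inf_sup_b2 Om T k beta \<and> f \<in> L2 Om \<and> g \<in> L2 Om \<and> uG \<in> H12v Om \<and> rG \<in> Hm12 Om \<and>
      \<gamma> / r * max (\<gamma> * k2 * r) 1 * data_norm Om f g uG rG < 1"
    then have h: "is_mesh Om T" "inf_sup_b2 Om T k beta" "f \<in> L2 Om" "g \<in> L2 Om" "uG \<in> H12v Om" "rG \<in> Hm12 Om"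
      "\<gamma> / r * max (\<gamma> * k2 * r) 1 * data_norm Om f g uG rG < 1" by auto
    note sol = biot_mesh.discrete_solution[OF mesh[OF h(1,2)] \<open>0 < r\<close> h(3-6) h(7)[unfolded \<gamma>_def Ca_def],
        folded Ca_def, folded \<gamma>_def, folded C_def]
    show "\<forall>w\<in>Wh Om T k r. (\<exists>x. lin_sol Om T k lam mu alpha c0 kap f g uG rG w x) \<and>
        (\<forall>x y. lin_sol Om T k lam mu alpha c0 kap f g uG rG w x \<and> lin_sol Om T k lam mu alpha c0 kap f g uG rG w y
          \<longrightarrow> eq_sol Om x y)" by (rule sol(1))
    show "\<exists>d\<in>Wh Om T k r. eq_pair Om (Jh Om T k lam mu alpha c0 kap f g uG rG d) d \<and>
        (\<forall>d'\<in>Wh Om T k r. eq_pair Om (Jh Om T k lam mu alpha c0 kap f g uG rG d') d' \<longrightarrow> eq_pair Om d' d)"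
      by (rule sol(2))
    show "\<forall>d\<in>Wh Om T k r. eq_pair Om (Jh Om T k lam mu alpha c0 kap f g uG rG d) d \<longleftrightarrow>
        (\<exists>s u. nonlin_sol Om T k lam mu alpha c0 kap f g uG rG ((d, s), u))" by (rule sol(3))
    show "\<exists>d s u. d \<in> Wh Om T k r \<and> nonlin_sol Om T k lam mu alpha c0 kap f g uG rG ((d, s), u) \<and>
        (\<forall>d' s' u'. d' \<in> Wh Om T k r \<and> nonlin_sol Om T k lam mu alpha c0 kap f g uG rG ((d', s'), u') \<longrightarrow>
          eq_sol Om ((d', s'), u') ((d, s), u)) \<and>
        norm_XYZ Om ((d, s), u) \<le> C * data_norm Om f g uG rG" by (rule sol(4))
  qed
qed

end
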